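(* Let $G$ be a connected, locally finite graph, and suppose that $\mathrm{Aut}(G)$ has a quasi-transitive nonunimodular subgroup. Then the free and wired minimal spanning forests of $G$ are distinct.
   Context: A subgroup $\Gamma\subseteq\mathrm{Aut}(G)$ is quasi-transitive if its action on the vertex set $V$ has only finitely many orbits. It is unimodular if $|\mathrm{Stab}_v u|=|\mathrm{Stab}_u v|$ for all $u,v\in V$ in the same $\Gamma$-orbit, where $\mathrm{Stab}_x$ is the stabilizer of $x$ in $\Gamma$ and $\mathrm{Stab}_x y$ is the orbit of $y$ under $\mathrm{Stab}_x$; otherwise it is nonunimodular. Minimal spanning forests (standard definition): let $(\ell(e))_{e\in E}$ be i.i.d. uniform $[0,1]$ labels on the edges of $G$. An extended path joining vertices $x$ and $y$ is either a finite simple path from $x$ to $y$ or the union of two disjoint infinite simple paths, one starting at $x$ and one starting at $y$. The free minimal spanning forest (FMSF) is the set of edges $e$ such that every finite path joining the endpoints of $e$ contains an edge $e'$ with $\ell(e')\geq \ell(e)$. The wired minimal spanning forest (WMSF) is the set of edges $e$ such that every extended path joining the endpoints of $e$ contains an edge $e'$ with $\ell(e')\geq\ell(e)$. Always $\mathrm{WMSF}\subseteq\mathrm{FMSF}$. The two forests are distinct if it is not the case that $\mathrm{WMSF}=\mathrm{FMSF}$ almost surely (equivalently, if their laws as random subsets of $E$ differ). *)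

theory Defs
  imports "HOL-Probability.Probability" "HOL-Algebra.Group_Action"
begin

section \<open>Graphs and paths\<close>

text \<open>
  A graph is given by its vertex set \<open>V\<close> and its set \<open>E\<close> of undirected edges, each edge being
  the two-element set of its endpoints. No finiteness or countability is built in.
\<close>

definition simple_graph :: "'v set \<Rightarrow> 'v set set \<Rightarrow> bool" where
  "simple_graph V E \<longleftrightarrow> (\<forall>e\<in>E. \<exists>x\<in>V. \<exists>y\<in>V. x \<noteq> y \<and> e = {x, y})"

definition locally_finite_graph :: "'v set \<Rightarrow> 'v set set \<Rightarrow> bool" where
  "locally_finite_graph V E \<longleftrightarrow> (\<forall>v\<in>V. finite {e\<in>E. v \<in> e})"

text \<open>A finite path is the list of its vertices; repetitions are allowed unless it is simple.\<close>

definition finite_path :: "'v set \<Rightarrow> 'v set set \<Rightarrow> 'v \<Rightarrow> 'v \<Rightarrow> 'v list \<Rightarrow> bool" where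
  "finite_path V E x y p \<longleftrightarrow>
     p \<noteq> [] \<and> hd p = x \<and> last p = y \<and> set p \<subseteq> V \<and> successively (\<lambda>a b. {a, b} \<in> E) p"

definition finite_simple_path :: "'v set \<Rightarrow> 'v set set \<Rightarrow> 'v \<Rightarrow> 'v \<Rightarrow> 'v list \<Rightarrow> bool" where
  "finite_simple_path V E x y p \<longleftrightarrow> finite_path V E x y p \<and> distinct p"

definition path_edges :: "'v list \<Rightarrow> 'v set set" where
  "path_edges p = {{p ! i, p ! Suc i} | i. Suc i < length p}"

definition infinite_simple_path :: "'v set \<Rightarrow> 'v set set \<Rightarrow> 'v \<Rightarrow> (nat \<Rightarrow> 'v) \<Rightarrow> bool" where
  "infinite_simple_path V E x r \<longleftrightarrow>
     r 0 = x \<and> range r \<subseteq> V \<and> inj r \<and> (\<forall>i. {r i, r (Suc i)} \<in> E)"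

definition ray_edges :: "(nat \<Rightarrow> 'v) \<Rightarrow> 'v set set" where
  "ray_edges r = {{r i, r (Suc i)} | i. True}"

definition connected_graph :: "'v set \<Rightarrow> 'v set set \<Rightarrow> bool" where
  "connected_graph V E \<longleftrightarrow> (\<forall>x\<in>V. \<forall>y\<in>V. \<exists>p. finite_path V E x y p)"

text \<open>\<open>F\<close> is the set of edges of some extended path joining \<open>x\<close> and \<open>y\<close>.\<close>

definition extended_path_edges ::
    "'v set \<Rightarrow> 'v set set \<Rightarrow> 'v \<Rightarrow> 'v \<Rightarrow> 'v set set \<Rightarrow> bool" where
  "extended_path_edges V E x y F \<longleftrightarrow>
     (\<exists>p. finite_simple_path V E x y p \<and> F = path_edges p) \<or>
     (\<exists>r s. infinite_simple_path V E x r \<and> infinite_simple_path V E y s \<and>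
        range r \<inter> range s = {} \<and> F = ray_edges r \<union> ray_edges s)"


section \<open>Minimal spanning forests for a fixed labelling\<close>

definition FMSF :: "'v set \<Rightarrow> 'v set set \<Rightarrow> ('v set \<Rightarrow> real) \<Rightarrow> 'v set set" where
  "FMSF V E l = {e\<in>E. \<forall>x y p. e = {x, y} \<longrightarrow> finite_path V E x y p \<longrightarrow>
     (\<exists>e'\<in>path_edges p. l e' \<ge> l e)}"

definition WMSF :: "'v set \<Rightarrow> 'v set set \<Rightarrow> ('v set \<Rightarrow> real) \<Rightarrow> 'v set set" where
  "WMSF V E l = {e\<in>E. \<forall>x y F. e = {x, y} \<longrightarrow> extended_path_edges V E x y F \<longrightarrow>
     (\<exists>e'\<in>F. l e' \<ge> l e)}"


section \<open>Automorphisms\<close>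

text \<open>
  As for \<^const>\<open>BijGroup\<close>, automorphisms are extensional functions on \<open>V\<close>, so that distinct
  elements of the group act differently on \<open>V\<close>.
\<close>

definition graph_aut :: "'v set \<Rightarrow> 'v set set \<Rightarrow> ('v \<Rightarrow> 'v) set" where
  "graph_aut V E = {f \<in> Bij V. \<forall>x\<in>V. \<forall>y\<in>V. {f x, f y} \<in> E \<longleftrightarrow> {x, y} \<in> E}"

definition GraphAut :: "'v set \<Rightarrow> 'v set set \<Rightarrow> ('v \<Rightarrow> 'v) monoid" where
  "GraphAut V E = BijGroup V \<lparr>carrier := graph_aut V E\<rparr>"

lemma subgroup_graph_aut: "subgroup (graph_aut V E) (BijGroup V)"
proof (rule subgroup.intro)
  show "graph_aut V E \<subseteq> carrier (BijGroup V)"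
    by (auto simp: graph_aut_def BijGroup_def)
next
  fix f g assume "f \<in> graph_aut V E" "g \<in> graph_aut V E"
  then show "f \<otimes>\<^bsub>BijGroup V\<^esub> g \<in> graph_aut V E"
    using Bij_imp_funcset[of g V]
    by (auto simp: graph_aut_def BijGroup_def compose_Bij compose_eq Pi_iff)
next
  show "\<one>\<^bsub>BijGroup V\<^esub> \<in> graph_aut V E"
    by (auto simp: graph_aut_def BijGroup_def id_Bij)
next
  fix f assume f: "f \<in> graph_aut V E"
  then have fB: "f \<in> Bij V" and fV: "f ` V = V"
    by (auto simp: graph_aut_def Bij_def bij_betw_def)
  have "{inv_into V f x, inv_into V f y} \<in> E \<longleftrightarrow> {x, y} \<in> E" if "x \<in> V" "y \<in> V" for x y
    using f that fV inv_into_into[of x f V] inv_into_into[of y f V]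
      f_inv_into_f[of x f V] f_inv_into_f[of y f V]
    unfolding graph_aut_def by force
  then show "inv\<^bsub>BijGroup V\<^esub> f \<in> graph_aut V E"
    using fB by (simp add: inv_BijGroup graph_aut_def restrict_inv_into_Bij)
qed

lemma group_GraphAut: "group (GraphAut V E)"
  unfolding GraphAut_def
  by (rule subgroup.subgroup_is_group[OF subgroup_graph_aut group_BijGroup])

text \<open>A group of automorphisms acts on \<open>V\<close> by evaluation, whence the action \<^const>\<open>id\<close> below.\<close>

definition quasi_transitive :: "'v set \<Rightarrow> 'v set set \<Rightarrow> ('v \<Rightarrow> 'v) set \<Rightarrow> bool" where
  "quasi_transitive V E \<Gamma> \<longleftrightarrow> finite (orbits (GraphAut V E \<lparr>carrier := \<Gamma>\<rparr>) V id)"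

definition stab_orbit ::
    "'v set \<Rightarrow> 'v set set \<Rightarrow> ('v \<Rightarrow> 'v) set \<Rightarrow> 'v \<Rightarrow> 'v \<Rightarrow> 'v set" where
  "stab_orbit V E \<Gamma> x y =
     orbit (GraphAut V E \<lparr>carrier := stabilizer (GraphAut V E \<lparr>carrier := \<Gamma>\<rparr>) id x\<rparr>) id y"

text \<open>
  In a connected, locally finite graph all sets \<open>stab_orbit V E \<Gamma> x y\<close> are finite (they lie in
  a sphere around \<open>x\<close>), so the convention that \<^const>\<open>card\<close> is 0 on infinite sets plays no role.
\<close>

definition unimodular :: "'v set \<Rightarrow> 'v set set \<Rightarrow> ('v \<Rightarrow> 'v) set \<Rightarrow> bool" where
  "unimodular V E \<Gamma> \<longleftrightarrow>
     (\<forall>u\<in>V. \<forall>v\<in>V. u \<in> orbit (GraphAut V E \<lparr>carrier := \<Gamma>\<rparr>) id v \<longrightarrow>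
        card (stab_orbit V E \<Gamma> v u) = card (stab_orbit V E \<Gamma> u v))"


section \<open>Random labels\<close>

text \<open>I.i.d. uniform \<open>[0,1]\<close> edge labels, on an arbitrary probability space.\<close>

definition iid_uniform_labels :: "'w measure \<Rightarrow> 'v set set \<Rightarrow> ('v set \<Rightarrow> 'w \<Rightarrow> real) \<Rightarrow> bool" where
  "iid_uniform_labels M E l \<longleftrightarrow>
     prob_space M \<and>
     prob_space.indep_vars M (\<lambda>_. borel) l E \<and>
     (\<forall>e\<in>E. distr M borel (l e) = uniform_measure lborel {0..1})"

text \<open>
  For connected, locally finite graphs the event below is measurable and its probability depends
  only on the joint law of the labels, hence not on the choice of \<open>M\<close> and \<open>l\<close>.
\<close>

definition distinct_MSFs ::
    "'v set \<Rightarrow> 'v set set \<Rightarrow> 'w measure \<Rightarrow> ('v set \<Rightarrow> 'w \<Rightarrow> real) \<Rightarrow> bool" where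
  "distinct_MSFs V E M l \<longleftrightarrow>
     \<not> (AE \<omega> in M. WMSF V E (\<lambda>e. l e \<omega>) = FMSF V E (\<lambda>e. l e \<omega>))"

end

theory Submission
  imports Defs
begin

text \<open>
  Suppose that the two forests agree almost surely. Varying the label of a single edge shows that, for \<open>a < b\<close>,
  two vertices in infinite clusters at level \<open>a\<close> are almost surely connected at level \<open>b\<close>. By Harris' inequality
  the two-point function at level \<open>b\<close> is then bounded below on an orbit. This is impossible for some \<open>b\<close> above the
  critical point \<open>p\<close>, because there the two-point function, weighted by the square root of the modular
  function, is summable.

  The summability is first proved at \<open>p\<close>. Below \<open>p\<close> the susceptibility is finite, and mass transport gives
  \<open>P(reach height t) \<le> e\<^sup>-\<^sup>t\<close> inside the upper half-space. If the number of vertices reached at height \<open>t\<close> were often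
  large, a second moment argument along lineages would make the probability of going higher too large; hence its
  truncated first moment is at most about \<open>e\<^sup>-\<^sup>t\<close>. The tree-graph inequality bounds its second moment in terms
  of the weighted sum \<open>Y\<close>, so the first moment decays with a constant \<open>Y\<^sup>\<epsilon>\<close>. Cutting paths at their extremal
  vertices (van den Berg--Kesten) turns this into \<open>Y \<le> C Y\<^sup>1\<^sup>/\<^sup>2\<close>, a bound uniform below \<open>p\<close>. A Simon--Lieb argument
  extends summability beyond \<open>p\<close>, and by the Duminil-Copin--Tassion argument there are infinite clusters above \<open>p\<close>.
\<close>

section \<open>Bernoulli percolation on finite edge sets\<close>

text \<open>The second moment argument would need the exact exponential rate of the reaching
  probability, of which only the upper bound \<open>exp (- t)\<close> is known. The rate \<alpha> is
  therefore left undetermined: the threshold above which numbers of crossing points are excluded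
  grows like \<open>exp (\<alpha> * u)\<close> with an extra height \<open>u\<close>, the
  probability of gaining that height decays like \<open>exp (- \<alpha> * u)\<close>, and \<alpha>
  cancels up to errors as small as desired. What remains is an arbitrarily small power of the
  truncation level, hence of \<open>Y\<close>. This smallness closes the argument. Moving endpoints
  into one orbit and cutting paths costs a power of the moment constant; that power, though large,
  is fixed by a lower bound for the edge probability before \<epsilon> is chosen. The surviving
  decay \<open>exp (- (3 / 4) * t)\<close> beats the growth \<open>exp (t / 2)\<close> of the
  weight. Bounds such as \<open>chi\<close> and \<open>XX\<close> are predicates quantified over
  finite edge sets and finite sets of endpoints; infinite configurations appear only at the
  end.\<close>

definition Ex :: "real \<Rightarrow> 'e set \<Rightarrow> ('e set \<Rightarrow> real) \<Rightarrow> real" where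
  "Ex p F f = (\<Sum>\<xi>\<in>Pow F. p ^ card \<xi> * (1 - p) ^ card (F - \<xi>) * f \<xi>)"

abbreviation Pr :: "real \<Rightarrow> 'e set \<Rightarrow> ('e set \<Rightarrow> bool) \<Rightarrow> real" where
  "Pr p F A \<equiv> Ex p F (\<lambda>\<xi>. of_bool (A \<xi>))"

definition incr :: "('e set \<Rightarrow> bool) \<Rightarrow> bool" where
  "incr A \<longleftrightarrow> (\<forall>\<xi> \<xi>'. \<xi> \<subseteq> \<xi>' \<longrightarrow> A \<xi> \<longrightarrow> A \<xi>')"

lemma incrI [intro?]: "(\<And>\<xi> \<xi>'. \<xi> \<subseteq> \<xi>' \<Longrightarrow> A \<xi> \<Longrightarrow> A \<xi>') \<Longrightarrow> incr A" by (auto simp: incr_def)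

lemma incrD: "incr A \<Longrightarrow> \<xi> \<subseteq> \<xi>' \<Longrightarrow> A \<xi> \<Longrightarrow> A \<xi>'" by (auto simp: incr_def)

lemma mono_of_bool_incr: "incr A \<Longrightarrow> mono (\<lambda>\<xi>. of_bool (A \<xi>) :: real)" by (auto simp: incr_def mono_def)

lemma Ex_empty [simp]: "Ex p {} f = f {}" by (simp add: Ex_def)

text \<open>Conditioning on the state of a single edge. The inequalities of Harris and van den
  Berg--Kesten, monotonicity in p and Russo's formula are all inductions over the edge set through
  this identity.\<close>

lemma Ex_insert:
  assumes "finite F" "e \<notin> F"
  shows "Ex p (insert e F) f = p * Ex p F (\<lambda>\<xi>. f (insert e \<xi>)) + (1 - p) * Ex p F f"
proof -
  have inj: "inj_on (insert e) (Pow F)" using assms(2) by (auto simp: inj_on_def)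
  have fin: "finite \<xi>" if "\<xi> \<subseteq> F" for \<xi> using that assms(1) finite_subset by auto
  have 1: "(\<Sum>\<xi>\<in>insert e ` Pow F. p ^ card \<xi> * (1 - p) ^ card (insert e F - \<xi>) * f \<xi>)
    = p * Ex p F (\<lambda>\<xi>. f (insert e \<xi>))"
    unfolding Ex_def sum.reindex[OF inj] sum_distrib_left o_def
  proof (rule sum.cong[OF refl])
    fix \<xi> assume "\<xi> \<in> Pow F"
    then have "e \<notin> \<xi>" "insert e F - insert e \<xi> = F - \<xi>" using assms(2) by auto
    then show "p ^ card (insert e \<xi>) * (1 - p) ^ card (insert e F - insert e \<xi>) * f (insert e \<xi>)
      = p * (p ^ card \<xi> * (1 - p) ^ card (F - \<xi>) * f (insert e \<xi>))"
      using fin \<open>\<xi> \<in> Pow F\<close> by simp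
  qed
  have 2: "(\<Sum>\<xi>\<in>Pow F. p ^ card \<xi> * (1 - p) ^ card (insert e F - \<xi>) * f \<xi>) = (1 - p) * Ex p F f"
    unfolding Ex_def sum_distrib_left
  proof (rule sum.cong[OF refl])
    fix \<xi> assume "\<xi> \<in> Pow F"
    then have "insert e F - \<xi> = insert e (F - \<xi>)" "e \<notin> F - \<xi>" "finite (F - \<xi>)" using assms by auto
    then show "p ^ card \<xi> * (1 - p) ^ card (insert e F - \<xi>) * f \<xi>
      = (1 - p) * (p ^ card \<xi> * (1 - p) ^ card (F - \<xi>) * f \<xi>)"
      by simp
  qed
  have "Ex p (insert e F) f =
      (\<Sum>\<xi>\<in>Pow F \<union> insert e ` Pow F. p ^ card \<xi> * (1 - p) ^ card (insert e F - \<xi>) * f \<xi>)"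
    by (simp add: Ex_def Pow_insert)
  also have "\<dots> = p * Ex p F (\<lambda>\<xi>. f (insert e \<xi>)) + (1 - p) * Ex p F f"
    using assms 1 2 by (subst sum.union_disjoint) auto
  finally show ?thesis .
qed

lemma Ex_const [simp]: "finite F \<Longrightarrow> Ex p F (\<lambda>_. c) = c"
  by (induction F rule: finite_induct) (auto simp: Ex_insert algebra_simps)

lemma Ex_add: "Ex p F (\<lambda>\<xi>. f \<xi> + g \<xi>) = Ex p F f + Ex p F g" by (simp add: Ex_def algebra_simps sum.distrib)

lemma Ex_diff: "Ex p F (\<lambda>\<xi>. f \<xi> - g \<xi>) = Ex p F f - Ex p F g" by (simp add: Ex_def algebra_simps sum_subtractf)

lemma Ex_cmult: "Ex p F (\<lambda>\<xi>. c * f \<xi>) = c * Ex p F f" by (simp add: Ex_def algebra_simps sum_distrib_left)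

lemma Ex_cmult_right: "Ex p F (\<lambda>\<xi>. f \<xi> * c) = Ex p F f * c" by (simp add: Ex_def algebra_simps sum_distrib_left)

lemma Ex_sum: "Ex p F (\<lambda>\<xi>. \<Sum>i\<in>I. f i \<xi>) = (\<Sum>i\<in>I. Ex p F (f i))"
  unfolding Ex_def sum_distrib_left by (subst sum.swap) simp

lemma Ex_mono:
  assumes "0 \<le> p" "p \<le> 1" "\<And>\<xi>. \<xi> \<subseteq> F \<Longrightarrow> f \<xi> \<le> g \<xi>"
  shows "Ex p F f \<le> Ex p F g" unfolding Ex_def using assms by (intro sum_mono mult_left_mono) auto

lemma Ex_cong:
  assumes "\<And>\<xi>. \<xi> \<subseteq> F \<Longrightarrow> f \<xi> = g \<xi>"
  shows "Ex p F f = Ex p F g" unfolding Ex_def using assms by (intro sum.cong) auto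

lemma Ex_nonneg: "0 \<le> p \<Longrightarrow> p \<le> 1 \<Longrightarrow> (\<And>\<xi>. \<xi> \<subseteq> F \<Longrightarrow> 0 \<le> f \<xi>) \<Longrightarrow> 0 \<le> Ex p F f"
  unfolding Ex_def by (intro sum_nonneg mult_nonneg_nonneg) auto

lemma Pr_nonneg [simp]: "0 \<le> p \<Longrightarrow> p \<le> 1 \<Longrightarrow> 0 \<le> Pr p F A" by (rule Ex_nonneg) auto

lemma Pr_le_1 [simp]: "finite F \<Longrightarrow> 0 \<le> p \<Longrightarrow> p \<le> 1 \<Longrightarrow> Pr p F A \<le> 1"
  using Ex_mono[of p F "\<lambda>\<xi>. of_bool (A \<xi>)" "\<lambda>_. 1"] by simp

lemma Pr_mono:
  "0 \<le> p \<Longrightarrow> p \<le> 1 \<Longrightarrow> (\<And>\<xi>. \<xi> \<subseteq> F \<Longrightarrow> A \<xi> \<Longrightarrow> B \<xi>) \<Longrightarrow> Pr p F A \<le> Pr p F B" by (rule Ex_mono) auto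

lemma Pr_Bex_le:
  assumes "0 \<le> p" "p \<le> 1" "finite I" "\<And>\<xi>. \<xi> \<subseteq> F \<Longrightarrow> A \<xi> \<Longrightarrow> \<exists>i\<in>I. B i \<xi>"
  shows "Pr p F A \<le> (\<Sum>i\<in>I. Pr p F (B i))"
proof -
  have "of_bool (A \<xi>) \<le> (\<Sum>i\<in>I. of_bool (B i \<xi>) :: real)" if om: "\<xi> \<subseteq> F" for \<xi>
  proof (cases "A \<xi>")
    case True
    with assms(4) om obtain i where i: "i \<in> I" "B i \<xi>" by blast
    have "(of_bool (B i \<xi>) :: real) \<le> (\<Sum>i\<in>I. of_bool (B i \<xi>))" using i assms(3) by (intro member_le_sum) auto
    with True i show ?thesis by simp
  qed (simp add: sum_nonneg)
  then show ?thesis using assms by (simp add: Ex_sum[symmetric] Ex_mono)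
qed

lemma Ex_Un:
  assumes "finite A" "finite B" "A \<inter> B = {}"
  shows "Ex p (A \<union> B) k = Ex p A (\<lambda>a. Ex p B (\<lambda>b. k (a \<union> b)))" using assms
proof (induction A arbitrary: k rule: finite_induct)
  case (insert e A)
  then have "e \<notin> A \<union> B" "finite (A \<union> B)" by auto
  with insert show ?case by (simp add: Ex_insert insert_commute)
qed simp

lemma Ex_restrict:
  assumes "finite F" "A \<subseteq> F"
  shows "Ex p F (\<lambda>\<xi>. f (\<xi> \<inter> A)) = Ex p A f"
proof -
  have "Ex p (A \<union> (F - A)) (\<lambda>\<xi>. f (\<xi> \<inter> A)) = Ex p A (\<lambda>a. Ex p (F - A) (\<lambda>b. f ((a \<union> b) \<inter> A)))"
    using assms finite_subset by (intro Ex_Un) auto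
  also have "\<dots> = Ex p A (\<lambda>a. Ex p (F - A) (\<lambda>b. f a))" by (intro Ex_cong arg_cong[where f = f]) auto
  finally show ?thesis using assms by (simp add: Un_absorb1)
qed

lemma Ex_depends:
  assumes "finite F" "A \<subseteq> F" "\<And>\<xi>. \<xi> \<subseteq> F \<Longrightarrow> f \<xi> = f (\<xi> \<inter> A)"
  shows "Ex p F f = Ex p A f" using Ex_cong[of F f "\<lambda>\<xi>. f (\<xi> \<inter> A)" p] assms by (simp add: Ex_restrict)

lemma Ex_indep:
  assumes "finite F" "A \<inter> B = {}"
    and f: "\<And>\<xi>. \<xi> \<subseteq> F \<Longrightarrow> f \<xi> = f (\<xi> \<inter> A)" and g: "\<And>\<xi>. \<xi> \<subseteq> F \<Longrightarrow> g \<xi> = g (\<xi> \<inter> B)"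
  shows "Ex p F (\<lambda>\<xi>. f \<xi> * g \<xi>) = Ex p F f * Ex p F g"
proof -
  let ?A = "F \<inter> A" and ?B = "F - A"
  have F: "F = ?A \<union> ?B" by auto
  have 1: "f (a \<union> b) = f a" "g (a \<union> b) = g b" if "a \<subseteq> ?A" "b \<subseteq> ?B" for a b
  proof -
    have "(a \<union> b) \<inter> A = a \<inter> A" "(a \<union> b) \<inter> B = b \<inter> B" "a \<union> b \<subseteq> F" "a \<subseteq> F" "b \<subseteq> F" using that assms(2) by auto
    then show "f (a \<union> b) = f a" "g (a \<union> b) = g b" using f[of "a \<union> b"] f[of a] g[of "a \<union> b"] g[of b] by auto
  qed
  have *: "Ex p F k = Ex p ?A (\<lambda>a. Ex p ?B (\<lambda>b. k (a \<union> b)))" for k using assms(1) by (subst (1) F, subst Ex_Un) auto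
  have "Ex p F (\<lambda>\<xi>. f \<xi> * g \<xi>) = Ex p ?A (\<lambda>a. Ex p ?B (\<lambda>b. f a * g b))" unfolding * using 1 by (intro Ex_cong) auto
  also have "\<dots> = Ex p ?A f * Ex p ?B g" by (simp add: Ex_cmult Ex_cmult_right)
  also have "Ex p ?A f = Ex p F f"
  proof -
    have "Ex p F f = Ex p ?A (\<lambda>a. Ex p ?B (\<lambda>b. f a))" unfolding *[of f] using 1 by (intro Ex_cong) auto
    then show ?thesis using assms(1) by simp
  qed
  also have "Ex p ?B g = Ex p F g"
  proof -
    have "Ex p F g = Ex p ?A (\<lambda>a. Ex p ?B g)" unfolding *[of g] using 1 by (intro Ex_cong) auto
    then show ?thesis using assms(1) by simp
  qed
  finally show ?thesis .
qed

section \<open>Monotonicity, positive association and insertion tolerance\<close>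

lemma Ex_mono_set:
  assumes "0 \<le> p" "p \<le> 1" "finite F'" "F \<subseteq> F'" "mono f"
  shows "Ex p F f \<le> Ex p F' f"
proof -
  have "Ex p F f = Ex p F' (\<lambda>\<xi>. f (\<xi> \<inter> F))" using assms by (simp add: Ex_restrict)
  also have "\<dots> \<le> Ex p F' f" using assms by (intro Ex_mono) (auto intro: monoD)
  finally show ?thesis .
qed

lemma Pr_mono_set:
  "0 \<le> p \<Longrightarrow> p \<le> 1 \<Longrightarrow> finite F' \<Longrightarrow> F \<subseteq> F' \<Longrightarrow> incr A \<Longrightarrow> Pr p F A \<le> Pr p F' A" by (intro Ex_mono_set mono_of_bool_incr)

lemma mono_insert_comp: "mono f \<Longrightarrow> mono (\<lambda>\<xi>. f (insert e \<xi>))" for f :: "'e set \<Rightarrow> real"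
  by (rule monoI) (auto intro: monoD)

lemma Ex_le_insert:
  fixes f :: "'e set \<Rightarrow> real"
  assumes "0 \<le> p" "p \<le> 1" "mono f"
  shows "Ex p F f \<le> Ex p F (\<lambda>\<xi>. f (insert e \<xi>))" using assms by (intro Ex_mono) (auto intro: monoD)

text \<open>Induction replaces the usual coupling: raising the probability of one edge moves weight
  to the larger of its two conditional expectations.\<close>

lemma Ex_mono_p:
  assumes "finite F" "0 \<le> p" "p \<le> q" "q \<le> 1" "mono f"
  shows "Ex p F f \<le> Ex q F f" using assms
proof (induction F arbitrary: f rule: finite_induct)
  case (insert e F)
  let ?f = "\<lambda>\<xi>. f (insert e \<xi>)"
  have 1: "Ex p F ?f \<le> Ex q F ?f" "Ex p F f \<le> Ex q F f"
    using insert.IH[of f] insert.IH[of ?f] insert.prems mono_insert_comp[of f e] by auto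
  have 2: "Ex q F f \<le> Ex q F ?f" using insert by (intro Ex_le_insert) auto
  have "p * Ex p F ?f + (1 - p) * Ex p F f \<le> p * Ex q F ?f + (1 - p) * Ex q F f"
    using 1 insert.prems by (intro add_mono mult_left_mono) auto
  also have "\<dots> \<le> q * Ex q F ?f + (1 - q) * Ex q F f"
    using mult_right_mono[of p q "Ex q F ?f - Ex q F f"] 2 insert.prems by (simp add: algebra_simps)
  finally show ?case using insert by (simp add: Ex_insert)
qed simp

text \<open>Chebyshev's sum inequality for the last edge: opening it changes both conditional
  expectations in the same direction, so the product of the two increments is nonnegative.\<close>

lemma Harris:
  assumes "finite F" "0 \<le> p" "p \<le> 1" "mono f" "mono g"
  shows "Ex p F f * Ex p F g \<le> Ex p F (\<lambda>\<xi>. f \<xi> * g \<xi>)" using assms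
proof (induction F arbitrary: f g rule: finite_induct)
  case (insert e F)
  let ?f = "\<lambda>\<xi>. f (insert e \<xi>)" and ?g = "\<lambda>\<xi>. g (insert e \<xi>)"
  have IH: "Ex p F f * Ex p F g \<le> Ex p F (\<lambda>\<xi>. f \<xi> * g \<xi>)"
    "Ex p F ?f * Ex p F ?g \<le> Ex p F (\<lambda>\<xi>. ?f \<xi> * ?g \<xi>)"
    using insert.IH[of f g] insert.IH[of ?f ?g] insert.prems mono_insert_comp[of f e] mono_insert_comp[of g e] by auto
  have le: "Ex p F f \<le> Ex p F ?f" "Ex p F g \<le> Ex p F ?g" using insert by (auto intro!: Ex_le_insert)
  have "0 \<le> p * (1 - p) * ((Ex p F ?f - Ex p F f) * (Ex p F ?g - Ex p F g))"
    using le insert.prems by (intro mult_nonneg_nonneg) auto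
  then have "(p * Ex p F ?f + (1 - p) * Ex p F f) * (p * Ex p F ?g + (1 - p) * Ex p F g)
     \<le> p * (Ex p F ?f * Ex p F ?g) + (1 - p) * (Ex p F f * Ex p F g)"
    by (simp add: algebra_simps)
  also have "\<dots> \<le> p * Ex p F (\<lambda>\<xi>. ?f \<xi> * ?g \<xi>) + (1 - p) * Ex p F (\<lambda>\<xi>. f \<xi> * g \<xi>)"
    using IH insert.prems by (intro add_mono mult_left_mono) auto
  finally show ?case using insert by (simp add: Ex_insert)
qed simp

lemma Harris_Pr:
  assumes "finite F" "0 \<le> p" "p \<le> 1" "incr A" "incr B"
  shows "Pr p F A * Pr p F B \<le> Pr p F (\<lambda>\<xi>. A \<xi> \<and> B \<xi>)"
  using Harris[OF assms(1-3) mono_of_bool_incr[OF assms(4)] mono_of_bool_incr[OF assms(5)]] unfolding of_bool_conj .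

lemma Pr_superset:
  assumes "finite F" "S \<subseteq> F"
  shows "Pr p F (\<lambda>\<xi>. S \<subseteq> \<xi>) = p ^ card S"
proof -
  have fS: "finite S" using assms finite_subset by auto
  have "Pr p F (\<lambda>\<xi>. S \<subseteq> \<xi>) = Pr p S (\<lambda>\<xi>. S \<subseteq> \<xi>)" using assms by (intro Ex_depends) auto
  also have "\<dots> = p ^ card S" using fS
  proof (induction S rule: finite_induct)
    case (insert e S)
    have 1: "Pr p S (\<lambda>\<xi>. insert e S \<subseteq> insert e \<xi>) = Pr p S (\<lambda>\<xi>. S \<subseteq> \<xi>)" using insert by (intro Ex_cong) auto
    have 2: "Pr p S (\<lambda>\<xi>. insert e S \<subseteq> \<xi>) = Pr p S (\<lambda>\<xi>. False)"
      using insert by (intro Ex_cong arg_cong[where f = of_bool]) blast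
    show ?case using insert 1 2 by (simp add: Ex_insert)
  qed simp
  finally show ?thesis .
qed

text \<open>Insertion tolerance without counting preimages of a modification map: \<open>A\<close>
  is positively correlated with the openness of \<open>S\<close>, so forcing \<open>S\<close> open
  costs at most the factor \<open>(1 / p) ^ k\<close>.\<close>

lemma Pr_insertion:
  assumes F: "finite F'" "F \<subseteq> F'" "S \<subseteq> F'" "card S \<le> k" and p: "0 < p" "p \<le> 1" and A: "incr A"
    and AB: "\<And>\<xi>. A \<xi> \<Longrightarrow> S \<subseteq> \<xi> \<Longrightarrow> B \<xi>"
  shows "Pr p F A \<le> (1 / p) ^ k * Pr p F' B"
proof -
  have p0: "0 \<le> p" using p by simp
  have "Pr p F A * p ^ k \<le> Pr p F' A * Pr p F' (\<lambda>\<xi>. S \<subseteq> \<xi>)"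
    unfolding Pr_superset[OF F(1,3)] using p p0 F A by (intro mult_mono Pr_mono_set power_decreasing) auto
  also have "\<dots> \<le> Pr p F' (\<lambda>\<xi>. A \<xi> \<and> S \<subseteq> \<xi>)" using F p p0 A by (intro Harris_Pr) (auto simp: incr_def)
  also have "\<dots> \<le> Pr p F' B" using AB p p0 by (intro Pr_mono) auto
  finally show ?thesis using p by (simp add: power_one_over pos_le_divide_eq)
qed

text \<open>
  Working with a relation between the two witnesses, rather than with two events, makes the
  van den Berg--Kesten inequality a plain induction on the edge set.
\<close>

definition djoint :: "('e set \<Rightarrow> 'e set \<Rightarrow> bool) \<Rightarrow> 'e set \<Rightarrow> bool" where
  "djoint R \<xi> \<longleftrightarrow> (\<exists>I J. I \<subseteq> \<xi> \<and> J \<subseteq> \<xi> \<and> I \<inter> J = {} \<and> R I J)"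

lemma BK_rel:
  fixes R :: "'e set \<Rightarrow> 'e set \<Rightarrow> bool"
  assumes "finite F" "0 \<le> p" "p \<le> 1"
    and R: "\<And>I J I' J'. R I J \<Longrightarrow> I \<subseteq> I' \<Longrightarrow> J \<subseteq> J' \<Longrightarrow> R I' J'"
  shows "Pr p F (djoint R) \<le> Ex p F (\<lambda>\<xi>. Pr p F (R \<xi>))" using assms
proof (induction F arbitrary: R rule: finite_induct)
  case empty
  then show ?case by (auto simp: djoint_def)
next
  case (insert e F)
  have p: "0 \<le> p" "p \<le> 1" by fact+
  define R1 where "R1 = (\<lambda>I J. R (insert e I) J \<or> R I (insert e J))"
  let ?Q = "\<lambda>R. Ex p F (\<lambda>\<xi>. Pr p F (R \<xi>))"
  let ?R10 = "\<lambda>I. R (insert e I)" and ?R01 = "\<lambda>I J. R I (insert e J)"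
    and ?R11 = "\<lambda>I J. R (insert e I) (insert e J)"
  note up = insert.prems(3)
  \<comment> \<open>Disjoint witnesses cannot both contain \<open>e\<close>, so at most one of the
    two needs it.\<close>
  have 1: "Pr p F (\<lambda>\<xi>. djoint R (insert e \<xi>)) \<le> Pr p F (djoint R1)"
  proof (rule Pr_mono[OF p])
    fix \<xi> assume om: "\<xi> \<subseteq> F" and "djoint R (insert e \<xi>)"
    then obtain I J where IJ: "I \<subseteq> insert e \<xi>" "J \<subseteq> insert e \<xi>" "I \<inter> J = {}" "R I J" unfolding djoint_def by blast
    have "I \<subseteq> insert e (I - {e})" "J \<subseteq> insert e (J - {e})" by auto
    then have "R1 (I - {e}) (J - {e})" unfolding R1_def using IJ(3,4) up
      by (metis Diff_empty Diff_insert0 disjoint_iff order_refl)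
    with IJ show "djoint R1 \<xi>" unfolding djoint_def by (intro exI[of _ "I - {e}"] exI[of _ "J - {e}"]) auto
  qed
  have R1up: "R1 I J \<Longrightarrow> I \<subseteq> I' \<Longrightarrow> J \<subseteq> J' \<Longrightarrow> R1 I' J'" for I J I' J'
    unfolding R1_def using up[of "insert e I" J "insert e I'" J'] up[of I "insert e J" I' "insert e J'"] by blast
  have 2: "Pr p F (djoint R1) \<le> ?Q R1" "Pr p F (djoint R) \<le> ?Q R" using insert.IH[OF p R1up] insert.IH[OF p up] by auto
  \<comment> \<open>Pointwise: if \<open>R a b\<close> holds, both terms on the right are 1; if only
    \<open>R1 a b\<close> holds, one of them is.\<close>
  have 3: "?Q R1 + ?Q R \<le> ?Q ?R10 + ?Q ?R01" unfolding Ex_add[symmetric]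
  proof (intro Ex_mono[OF p])
    fix a b
    have "R a b \<Longrightarrow> R (insert e a) b" "R a b \<Longrightarrow> R a (insert e b)" using up by blast+
    then show "of_bool (R1 a b) + of_bool (R a b)
      \<le> of_bool (R (insert e a) b) + (of_bool (R a (insert e b)) :: real)"
      unfolding R1_def by auto
  qed
  have 4: "?Q R1 \<le> ?Q ?R11"
  proof (intro Ex_mono[OF p])
    fix a b
    show "of_bool (R1 a b) \<le> (of_bool (R (insert e a) (insert e b)) :: real)"
      unfolding R1_def using up[of "insert e a" b "insert e a" "insert e b"]
        up[of a "insert e b" "insert e a" "insert e b"] by auto
  qed
  have "Pr p (insert e F) (djoint R) \<le> p * ?Q R1 + (1 - p) * ?Q R"
    unfolding Ex_insert[OF insert(1,2)] using 1 2 p by (intro add_mono mult_left_mono) auto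
  \<comment> \<open>Write \<open>p\<close> as \<open>p\<^sup>2 + p * (1 - p)\<close> and
    \<open>1 - p\<close> as \<open>p * (1 - p) + (1 - p)\<^sup>2\<close>; the mixed terms are
    covered by fact 3 and the term with \<open>p\<^sup>2\<close> by fact 4.\<close>
  also have "\<dots> \<le> p\<^sup>2 * ?Q ?R11 + p * (1 - p) * (?Q ?R10 + ?Q ?R01) + (1 - p)\<^sup>2 * ?Q R"
  proof -
    have "p * (1 - p) * (?Q R1 + ?Q R) \<le> p * (1 - p) * (?Q ?R10 + ?Q ?R01)" using 3 p by (intro mult_left_mono) auto
    moreover have "p\<^sup>2 * ?Q R1 \<le> p\<^sup>2 * ?Q ?R11" using 4 by (intro mult_left_mono) auto
    ultimately show ?thesis by (simp add: algebra_simps power2_eq_square)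
  qed
  also have "\<dots> = Ex p (insert e F) (\<lambda>\<xi>. Pr p (insert e F) (R \<xi>))" unfolding Ex_insert[OF insert(1,2)] Ex_add Ex_cmult
    by (simp add: algebra_simps power2_eq_square)
  finally show ?case .
qed

lemma BK:
  assumes "finite F" "0 \<le> p" "p \<le> 1" "incr A" "incr B"
  shows "Pr p F (djoint (\<lambda>I J. A I \<and> B J)) \<le> Pr p F A * Pr p F B"
proof -
  have "Pr p F (djoint (\<lambda>I J. A I \<and> B J)) \<le> Ex p F (\<lambda>\<xi>. Pr p F (\<lambda>\<xi>'. A \<xi> \<and> B \<xi>'))" using assms(1-3)
  proof (rule BK_rel)
    show "A I' \<and> B J'" if "A I \<and> B J" "I \<subseteq> I'" "J \<subseteq> J'" for I J I' J' using that assms(4,5) by (auto dest: incrD)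
  qed
  also have "\<dots> = Pr p F A * Pr p F B" by (simp add: of_bool_conj Ex_cmult Ex_cmult_right)
  finally show ?thesis .
qed

lemma incr_djoint: "incr (djoint R)" unfolding incr_def djoint_def by (meson subset_trans)

lemma Ex_image:
  assumes "inj_on b F" "finite F"
  shows "Ex p (b ` F) f = Ex p F (\<lambda>\<xi>. f (b ` \<xi>))" using assms(2,1)
proof (induction F arbitrary: f rule: finite_induct)
  case (insert e F)
  then show ?case by (simp add: Ex_insert)
qed simp

section \<open>Dependence on the edge probability\<close>

lemma continuous_Ex: "continuous_on UNIV (\<lambda>p. Ex p F f)" unfolding Ex_def by (intro continuous_intros)

text \<open>The increment ignores the current state of \<open>e\<close>; for an increasing event it
  is the indicator that \<open>e\<close> is pivotal. The product rule applied to
  \<open>Ex_insert\<close> gives the induction step.\<close>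

lemma Russo:
  assumes "finite F"
  shows "\<exists>D. ((\<lambda>p. Ex p F f) has_real_derivative D) (at p) \<and>
    D = (\<Sum>e\<in>F. Ex p F (\<lambda>\<xi>. f (insert e \<xi>) - f (\<xi> - {e})))"
  using assms
proof (induction F arbitrary: f rule: finite_induct)
  case (insert e F)
  let ?f = "\<lambda>\<xi>. f (insert e \<xi>)"
  let ?D = "\<lambda>f. \<Sum>e\<in>F. Ex p F (\<lambda>\<xi>. f (insert e \<xi>) - f (\<xi> - {e}))"
  have 1: "((\<lambda>p. Ex p F ?f) has_real_derivative ?D ?f) (at p)" using insert.IH[of ?f] by blast
  have 2: "((\<lambda>p. Ex p F f) has_real_derivative ?D f) (at p)" using insert.IH[of f] by blast
  have 3: "((\<lambda>p. Ex p (insert e F) f) has_real_derivative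
      (Ex p F ?f + p * ?D ?f) + ((1 - p) * ?D f - Ex p F f)) (at p)"
    unfolding Ex_insert[OF insert(1,2)] by (auto intro!: derivative_eq_intros 1 2 simp: algebra_simps)
  have e: "Ex p (insert e F) (\<lambda>\<xi>. f (insert e \<xi>) - f (\<xi> - {e})) = Ex p F ?f - Ex p F f"
  proof -
    have *: "Ex p F (\<lambda>\<xi>. f (insert e \<xi>) - f (insert e \<xi> - {e})) = Ex p F (\<lambda>\<xi>. f (insert e \<xi>) - f \<xi>)"
      "Ex p F (\<lambda>\<xi>. f (insert e \<xi>) - f (\<xi> - {e})) = Ex p F (\<lambda>\<xi>. f (insert e \<xi>) - f \<xi>)"
    proof -
      have d: "\<xi> - {e} = \<xi>" if "\<xi> \<subseteq> F" for \<xi> using that insert(2) by auto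
      then show "Ex p F (\<lambda>\<xi>. f (insert e \<xi>) - f (insert e \<xi> - {e})) = Ex p F (\<lambda>\<xi>. f (insert e \<xi>) - f \<xi>)"
        by (intro Ex_cong) simp
      show "Ex p F (\<lambda>\<xi>. f (insert e \<xi>) - f (\<xi> - {e})) = Ex p F (\<lambda>\<xi>. f (insert e \<xi>) - f \<xi>)"
        by (intro Ex_cong) (simp add: d)
    qed
    show ?thesis unfolding Ex_insert[OF insert(1,2)] insert_absorb2 * by (simp add: Ex_diff algebra_simps)
  qed
  have e': "Ex p (insert e F) (\<lambda>\<xi>. f (insert d \<xi>) - f (\<xi> - {d})) =
      p * Ex p F (\<lambda>\<xi>. ?f (insert d \<xi>) - ?f (\<xi> - {d})) + (1 - p) * Ex p F (\<lambda>\<xi>. f (insert d \<xi>) - f (\<xi> - {d}))"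
    if "d \<in> F" for d
  proof -
    have "insert e \<xi> - {d} = insert e (\<xi> - {d})" for \<xi> using that insert(2) by auto
    then show ?thesis by (simp add: Ex_insert[OF insert(1,2)] insert_commute)
  qed
  have "(\<Sum>d\<in>insert e F. Ex p (insert e F) (\<lambda>\<xi>. f (insert d \<xi>) - f (\<xi> - {d})))
     = Ex p F ?f - Ex p F f + (p * ?D ?f + (1 - p) * ?D f)"
    using insert(1,2) by (simp add: e e' sum.distrib sum_distrib_left)
  then have "(Ex p F ?f + p * ?D ?f) + ((1 - p) * ?D f - Ex p F f) =
      (\<Sum>d\<in>insert e F. Ex p (insert e F) (\<lambda>\<xi>. f (insert d \<xi>) - f (\<xi> - {d})))"
    by (simp only:)
  with 3 show ?case by blast
qed simp

section \<open>Connections and paths\<close>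

text \<open>No vertex set enters, so a point without edges in \<xi> is its own cluster. This is the
  case \<open>y = x\<close> in \<open>conn_Union\<close> and in the lemmas on slabs.\<close>

definition conn :: "'v set set \<Rightarrow> 'v \<Rightarrow> 'v \<Rightarrow> bool" where
  "conn \<xi> = (\<lambda>a b. {a, b} \<in> \<xi>)\<^sup>*\<^sup>*"

abbreviation tau :: "real \<Rightarrow> 'v set set \<Rightarrow> 'v \<Rightarrow> 'v \<Rightarrow> real" where
  "tau p F x y \<equiv> Pr p F (\<lambda>\<xi>. conn \<xi> x y)"

abbreviation tauR :: "real \<Rightarrow> 'v set set \<Rightarrow> 'v set set \<Rightarrow> 'v \<Rightarrow> 'v \<Rightarrow> real" where
  "tauR p F R x y \<equiv> Pr p F (\<lambda>\<xi>. conn (\<xi> \<inter> R) x y)"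

lemma conn_refl [simp]: "conn \<xi> x x" by (simp add: conn_def)

lemma conn_edge: "{x, y} \<in> \<xi> \<Longrightarrow> conn \<xi> x y" by (auto simp: conn_def)

lemma conn_trans [trans]: "conn \<xi> x y \<Longrightarrow> conn \<xi> y z \<Longrightarrow> conn \<xi> x z" by (auto simp: conn_def)

lemma conn_mono: "conn \<xi> x y \<Longrightarrow> \<xi> \<subseteq> \<xi>' \<Longrightarrow> conn \<xi>' x y"
  unfolding conn_def by (rule rtranclp_mono[THEN predicate2D, rotated]) auto

lemma conn_sym: "conn \<xi> x y \<Longrightarrow> conn \<xi> y x"
proof -
  have "symp (\<lambda>a b. {a, b} \<in> \<xi>)" by (auto simp: symp_def insert_commute)
  then show "conn \<xi> x y \<Longrightarrow> conn \<xi> y x" unfolding conn_def by (metis symp_rtranclp sympD)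
qed

lemma conn_commute: "conn \<xi> x y \<longleftrightarrow> conn \<xi> y x" using conn_sym by metis

lemma conn_induct [consumes 1, case_names refl step]:
  assumes "conn \<xi> x y" "P x" "\<And>y z. conn \<xi> x y \<Longrightarrow> {y, z} \<in> \<xi> \<Longrightarrow> P y \<Longrightarrow> P z"
  shows "P y" using assms unfolding conn_def by (induction rule: rtranclp_induct) blast+

lemma conn_Union: "conn \<xi> x y \<Longrightarrow> y = x \<or> y \<in> \<Union>\<xi>" by (induction rule: conn_induct) auto

lemma conn_empty [simp]: "conn {} x y \<longleftrightarrow> x = y" using conn_Union[of "{}" x y] by auto

lemma incr_conn: "incr (\<lambda>\<xi>. conn (\<xi> \<inter> R) x y)" "incr (\<lambda>\<xi>. conn \<xi> x y)" by (rule incrI, erule conn_mono, blast)+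

lemma conn_image: "conn \<xi> x y \<Longrightarrow> conn ((`) b ` \<xi>) (b x) (b y)"
proof (induction rule: conn_induct)
  case (step y z)
  have "{b y, b z} \<in> (`) b ` \<xi>" using imageI[OF step(2), of "(`) b"] by simp
  with step(3) show ?case by (meson conn_edge conn_trans)
qed simp

section \<open>Paths as vertex lists\<close>

lemma path_edges_Nil [simp]: "path_edges [] = {}" "path_edges [x] = {}" by (auto simp: path_edges_def)

lemma path_edges_Cons [simp]: "path_edges (x # y # xs) = insert {x, y} (path_edges (y # xs))"
proof -
  have "(\<exists>i. P i \<and> Suc i < length (x # y # xs)) \<longleftrightarrow> (P 0 \<or> (\<exists>i. P (Suc i) \<and> Suc i < length (y # xs)))" for P
    by (metis Suc_less_eq length_Cons not0_implies_Suc zero_less_Suc)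
  from this[of "\<lambda>i. e = {(x # y # xs) ! i, (x # y # xs) ! Suc i}" for e] show ?thesis unfolding path_edges_def by auto
qed

lemma path_edges_append: "path_edges (xs @ z # ys) = path_edges (xs @ [z]) \<union> path_edges (z # ys)"
proof (induction xs)
  case (Cons a xs)
  then show ?case by (cases xs) auto
qed simp

lemma path_edges_subset_set: "e \<in> path_edges xs \<Longrightarrow> e \<subseteq> set xs" by (auto simp: path_edges_def)

lemma finite_path_edges [simp]: "finite (path_edges xs)"
  using path_edges_subset_set[of _ xs] finite_subset[of "path_edges xs" "Pow (set xs)"] by blast

lemma set_path_edges: "length xs \<ge> 2 \<Longrightarrow> \<Union>(path_edges xs) = set xs"
proof (induction xs rule: induct_list012)
  case (3 x y zs)
  then show ?case by (cases zs) auto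
qed auto

definition spath :: "'v set set \<Rightarrow> 'v \<Rightarrow> 'v \<Rightarrow> 'v list \<Rightarrow> bool" where
  "spath \<xi> x y xs \<longleftrightarrow> xs \<noteq> [] \<and> hd xs = x \<and> last xs = y \<and> distinct xs \<and> path_edges xs \<subseteq> \<xi>"

lemma conn_path: "xs \<noteq> [] \<Longrightarrow> path_edges xs \<subseteq> \<xi> \<Longrightarrow> conn \<xi> (hd xs) (last xs)"
proof (induction xs rule: induct_list012)
  case (3 x y zs)
  then have "conn \<xi> x y" "conn \<xi> y (last (y # zs))" by (auto intro: conn_edge)
  then show ?case using conn_trans by fastforce
qed auto

lemma spath_conn: "spath \<xi> x y xs \<Longrightarrow> conn \<xi> x y" using conn_path[of xs \<xi>] by (auto simp: spath_def)

lemma conn_spath: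
  assumes "conn \<xi> x y"
  obtains xs where "spath \<xi> x y xs"
proof -
  from assms have "\<exists>xs. spath \<xi> x y xs"
  proof (induction rule: conn_induct)
    case refl
    show ?case by (intro exI[of _ "[x]"]) (auto simp: spath_def)
  next
    case (step y z)
    then obtain xs where xs: "spath \<xi> x y xs" by blast
    show ?case
    proof (cases "z \<in> set xs")
      case True
      then obtain as bs where xs': "xs = as @ z # bs" by (meson split_list)
      have "spath \<xi> x z (as @ [z])" using xs path_edges_append[of as z bs] unfolding xs' spath_def by (cases as) auto
      then show ?thesis by blast
    next
      case False
      have "xs \<noteq> []" "last xs = y" using xs by (auto simp: spath_def)
      then have "xs = butlast xs @ [y]" by (metis append_butlast_last_id)
      then have "path_edges (xs @ [z]) = path_edges xs \<union> {{y, z}}"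
        using path_edges_append[of "butlast xs" y "[z]"] by (metis append.assoc append_Cons append_Nil path_edges_Cons path_edges_Nil(2))
      then have "spath \<xi> x z (xs @ [z])" using xs False step(2) by (auto simp: spath_def)
      then show ?thesis by blast
    qed
  qed
  with that show thesis by blast
qed

lemma spath_set: "spath \<xi> x y xs \<Longrightarrow> set xs \<subseteq> insert x (\<Union>\<xi>)"
proof -
  assume s: "spath \<xi> x y xs"
  show ?thesis
  proof (cases "length xs \<ge> 2")
    case True
    with s set_path_edges[OF True] show ?thesis by (auto simp: spath_def)
  next
    case False
    with s have "xs = [x]" by (cases xs) (auto simp: spath_def Suc_le_eq)
    then show ?thesis by auto
  qed
qed

lemma spath_in: "spath \<xi> x y xs \<Longrightarrow> x \<in> set xs" "spath \<xi> x y xs \<Longrightarrow> y \<in> set xs" by (auto simp: spath_def)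

text \<open>A common edge of the two pieces could contain no vertex but the cut vertex
  \<open>z\<close>, whereas an edge of a simple path has two different ends. This edge-disjointness
  is what makes cutting a path an occurrence of two disjoint witnesses.\<close>

lemma spath_split:
  assumes "spath \<xi> x y (as @ z # bs)"
  shows "spath \<xi> x z (as @ [z])" "spath \<xi> z y (z # bs)"
    "path_edges (as @ [z]) \<inter> path_edges (z # bs) = {}"
proof -
  show "spath \<xi> x z (as @ [z])" "spath \<xi> z y (z # bs)"
    using assms path_edges_append[of as z bs] by (cases as; auto simp: spath_def)+
  have d: "distinct (as @ z # bs)" using assms by (simp add: spath_def)
  have False if e1: "e \<in> path_edges (as @ [z])" and e2: "e \<in> path_edges (z # bs)" for e
  proof -
    have "e \<subseteq> {z}" using path_edges_subset_set[OF e1] path_edges_subset_set[OF e2] d by fastforce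
    moreover obtain i where i: "Suc i < length (z # bs)" "e = {(z # bs) ! i, (z # bs) ! Suc i}"
      using e2 by (auto simp: path_edges_def)
    moreover have "distinct (z # bs)" using d by simp
    ultimately show False by (metis Suc_lessD insert_subset n_not_Suc_n nth_eq_iff_index_eq singletonD)
  qed
  then show "path_edges (as @ [z]) \<inter> path_edges (z # bs) = {}" by blast
qed

lemma spath_sub: "spath \<xi> x y xs \<Longrightarrow> spath (path_edges xs) x y xs" by (auto simp: spath_def)

lemma djoint_conn:
  assumes "spath \<xi> x y (as @ z # bs)" "path_edges (as @ [z]) \<subseteq> R" "path_edges (z # bs) \<subseteq> S"
  shows "djoint (\<lambda>I J. conn (I \<inter> R) x z \<and> conn (J \<inter> S) z y) \<xi>"
proof -
  note s = spath_split[OF assms(1)]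
  have "path_edges (as @ [z]) \<inter> R = path_edges (as @ [z])" "path_edges (z # bs) \<inter> S = path_edges (z # bs)"
    using assms by auto
  then have "conn (path_edges (as @ [z]) \<inter> R) x z" "conn (path_edges (z # bs) \<inter> S) z y"
    using spath_conn[OF spath_sub[OF s(1)]] spath_conn[OF spath_sub[OF s(2)]] by auto
  then show ?thesis unfolding djoint_def using s
    by (intro exI[of _ "path_edges (as @ [z])"] exI[of _ "path_edges (z # bs)"])
       (auto simp: spath_def)
qed

text \<open>A union bound over the cut vertex. The regions allowed to the two pieces may depend on
  \<open>z\<close>, as they do when \<open>z\<close> is an extremal vertex of the path.\<close>

lemma BK_conn:
  assumes "finite F" "0 \<le> p" "p \<le> 1" "finite Z"
    and "\<And>\<xi>. \<xi> \<subseteq> F \<Longrightarrow> A \<xi> \<Longrightarrow> \<exists>z\<in>Z. djoint (\<lambda>I J. conn (I \<inter> R z) x z \<and> conn (J \<inter> S z) z y) \<xi>"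
  shows "Pr p F A \<le> (\<Sum>z\<in>Z. tauR p F (R z) x z * tauR p F (S z) z y)"
proof -
  have "Pr p F A \<le> (\<Sum>z\<in>Z. Pr p F (djoint (\<lambda>I J. conn (I \<inter> R z) x z \<and> conn (J \<inter> S z) z y)))"
    using assms by (intro Pr_Bex_le) auto
  also have "\<dots> \<le> (\<Sum>z\<in>Z. tauR p F (R z) x z * tauR p F (S z) z y)"
    using assms by (intro sum_mono BK) (auto intro: incr_conn)
  finally show ?thesis .
qed

text \<open>Cut the path to \<open>y'\<close> where it last meets the path to \<open>y\<close>.\<close>

lemma tree_graph:
  assumes F: "finite F" and p: "0 \<le> p" "p \<le> 1" and Z: "finite Z" "insert x (\<Union>(F \<inter> R)) \<subseteq> Z"
  shows "Pr p F (\<lambda>\<xi>. conn (\<xi> \<inter> R) x y \<and> conn (\<xi> \<inter> R) x y')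
    \<le> (\<Sum>z\<in>Z. tauR p F R x z * tau p F z y * tau p F z y')"
proof -
  let ?A = "\<lambda>z. djoint (\<lambda>I J. conn (I \<inter> R) x z \<and> conn J z y)"
  let ?D = "\<lambda>z. djoint (\<lambda>I J. ?A z I \<and> conn J z y')"
  have "Pr p F (\<lambda>\<xi>. conn (\<xi> \<inter> R) x y \<and> conn (\<xi> \<inter> R) x y') \<le> (\<Sum>z\<in>Z. Pr p F (?D z))"
  proof (rule Pr_Bex_le[OF p Z(1)])
    fix \<xi> assume om: "\<xi> \<subseteq> F" "conn (\<xi> \<inter> R) x y \<and> conn (\<xi> \<inter> R) x y'"
    then obtain xs ys where s: "spath (\<xi> \<inter> R) x y xs" "spath (\<xi> \<inter> R) x y' ys" by (meson conn_spath)
    have "\<exists>z\<in>set ys. z \<in> set xs" using spath_in[OF s(1)] spath_in[OF s(2)] by auto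
    from split_list_last_prop[OF this]
    obtain as z bs where ys: "ys = as @ z # bs" "z \<in> set xs" "\<forall>u\<in>set bs. u \<notin> set xs" by blast
    obtain cs ds where xs: "xs = cs @ z # ds" using ys(2) by (meson split_list)
    have "z \<in> Z" using spath_set[OF s(1)] ys(2) om(1) Z(2) by auto
    moreover have "?D z \<xi>"
    proof -
      have 1: "?A z (path_edges xs)"
      proof -
        have "djoint (\<lambda>I J. conn (I \<inter> R) x z \<and> conn (J \<inter> UNIV) z y) (path_edges xs)"
          using spath_sub[OF s(1)] s(1) unfolding xs
          by (intro djoint_conn[where as = cs and bs = ds]) (auto simp: spath_def path_edges_append[of cs z ds])
        then show ?thesis by simp
      qed
      have 2: "conn (path_edges (z # bs)) z y'"
        using spath_conn[OF spath_sub[OF spath_split(2)[OF s(2)[unfolded ys(1)]]]] .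
      have "path_edges xs \<inter> path_edges (z # bs) = {}"
      proof -
        have False if e1: "e \<in> path_edges xs" and e2: "e \<in> path_edges (z # bs)" for e
        proof -
          have "e \<subseteq> {z}" using path_edges_subset_set[OF e1] path_edges_subset_set[OF e2] ys(3) by fastforce
          moreover obtain i where i: "Suc i < length (z # bs)" "e = {(z # bs) ! i, (z # bs) ! Suc i}"
            using e2 by (auto simp: path_edges_def)
          moreover have "distinct (z # bs)" using s(2) by (simp add: spath_def ys)
          ultimately show False by (metis Suc_lessD insert_subset n_not_Suc_n nth_eq_iff_index_eq singletonD)
        qed
        then show ?thesis by blast
      qed
      moreover have "path_edges xs \<subseteq> \<xi>" "path_edges (z # bs) \<subseteq> \<xi>"
        using s spath_split(2)[OF s(2)[unfolded ys(1)]] by (auto simp: spath_def)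
      ultimately show ?thesis unfolding djoint_def[of "\<lambda>I J. ?A z I \<and> conn J z y'"] using 1 2 by blast
    qed
    ultimately show "\<exists>z\<in>Z. ?D z \<xi>" by blast
  qed
  also have "\<dots> \<le> (\<Sum>z\<in>Z. tauR p F R x z * tau p F z y * tau p F z y')"
  proof (rule sum_mono)
    fix z
    have "Pr p F (?D z) \<le> Pr p F (?A z) * tau p F z y'" by (rule BK[OF F p incr_djoint incr_conn(2)])
    also have "\<dots> \<le> tauR p F R x z * tau p F z y * tau p F z y'"
      using p by (intro mult_right_mono BK[OF F p incr_conn]) auto
    finally show "Pr p F (?D z) \<le> \<dots>" .
  qed
  finally show ?thesis .
qed

section \<open>Randomly coalescing flows\<close>

text \<open>A Paley--Zygmund estimate for clustered variables: the excess of the second moment is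
  linear in the mean, and for the mean itself only the lower bound \<open>m\<close> is at
  hand.\<close>

lemma second_moment:
  fixes f :: "'e set \<Rightarrow> real"
  assumes "finite F" "0 \<le> p" "p \<le> 1" and f: "\<And>\<xi>. \<xi> \<subseteq> F \<Longrightarrow> 0 \<le> f \<xi>"
    and m: "0 < m" "m \<le> Ex p F f" and s: "Ex p F (\<lambda>\<xi>. f \<xi> * f \<xi>) \<le> (Ex p F f)\<^sup>2 + c * Ex p F f" "0 \<le> c"
  shows "m / (m + c) \<le> Pr p F (\<lambda>\<xi>. 0 < f \<xi>)"
proof -
  define e where "e = Ex p F f"
  have e: "0 < e" "m \<le> e" using m by (auto simp: e_def)
  define a where "a = e + c"
  have a: "0 < a" using e s(2) by (simp add: a_def)
  \<comment> \<open>This is \<open>(f \<xi> - a)\<^sup>2 \<ge> 0\<close> where \<open>f\<close> is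
    positive. With \<open>a = e + c\<close>, an upper bound for the ratio of second to first moment,
    its expectation does the work of Cauchy--Schwarz.\<close>
  have "2 * a * f \<xi> \<le> f \<xi> * f \<xi> + a\<^sup>2 * of_bool (0 < f \<xi>)" if "\<xi> \<subseteq> F" for \<xi>
  proof (cases "0 < f \<xi>")
    case True
    have "0 \<le> (f \<xi> - a)\<^sup>2" by simp
    with True show ?thesis by (simp add: power2_eq_square algebra_simps)
  next
    case False
    with f[OF that] show ?thesis by auto
  qed
  then have "Ex p F (\<lambda>\<xi>. 2 * a * f \<xi>) \<le> Ex p F (\<lambda>\<xi>. f \<xi> * f \<xi> + a\<^sup>2 * of_bool (0 < f \<xi>))"
    using assms by (intro Ex_mono) auto
  then have "2 * a * e \<le> Ex p F (\<lambda>\<xi>. f \<xi> * f \<xi>) + a\<^sup>2 * Pr p F (\<lambda>\<xi>. 0 < f \<xi>)"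
    unfolding Ex_add Ex_cmult by (simp add: e_def)
  also have "\<dots> \<le> e * a + a\<^sup>2 * Pr p F (\<lambda>\<xi>. 0 < f \<xi>)"
    using s(1) unfolding e_def[symmetric] a_def by (simp add: power2_eq_square algebra_simps)
  finally have "a * e \<le> a * (a * Pr p F (\<lambda>\<xi>. 0 < f \<xi>))" by (simp add: power2_eq_square algebra_simps)
  then have "e / (e + c) \<le> Pr p F (\<lambda>\<xi>. 0 < f \<xi>)" using a by (simp add: divide_le_eq a_def mult.commute)
  moreover have "m / (m + c) \<le> e / (e + c)"
    using e s(2) m by (simp add: frac_le_eq divide_simps mult_left_mono algebra_simps)
  ultimately show ?thesis by linarith
qed

text \<open>\<open>J i \<xi> x z\<close> is the fraction of the mass at \<open>x\<close> that is
  handed to \<open>z\<close> on the next level; the flow is the part of a unit mass started at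
  \<open>x\<close> that survives \<open>m\<close> such steps.\<close>

primrec flow :: "(nat \<Rightarrow> 'a set) \<Rightarrow> (nat \<Rightarrow> 'e set \<Rightarrow> 'a \<Rightarrow> 'a \<Rightarrow> real) \<Rightarrow> nat \<Rightarrow> nat \<Rightarrow> 'e set \<Rightarrow> 'a \<Rightarrow> real" where
  "flow S J 0 i \<xi> x = 1"
| "flow S J (Suc m) i \<xi> x = (\<Sum>z\<in>S (Suc i). J i \<xi> x z * flow S J m (Suc i) \<xi> z)"

text \<open>Different levels look at disjoint edges, and within one level only close vertices share
  edges. The row bound \<open>q\<close> keeps mass alive in the mean; the column bound
  \<open>C\<close> limits how many lineages can meet in one vertex.\<close>

locale random_flow =
  fixes p :: real and F :: "'e set" and S :: "nat \<Rightarrow> 'a set"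
    and J :: "nat \<Rightarrow> 'e set \<Rightarrow> 'a \<Rightarrow> 'a \<Rightarrow> real"
    and G :: "nat \<Rightarrow> 'a \<Rightarrow> 'e set" and Slab :: "nat \<Rightarrow> 'e set" and close :: "'a \<Rightarrow> 'a \<Rightarrow> bool"
    and b q C :: real and k :: nat
  assumes F: "finite F" and p: "0 \<le> p" "p \<le> 1" and S: "\<And>i. finite (S i)"
    and J_nonneg: "\<And>i \<xi> x z. 0 \<le> J i \<xi> x z"
    and J_le: "\<And>i \<xi> x. x \<in> S i \<Longrightarrow> (\<Sum>z\<in>S (Suc i). J i \<xi> x z) \<le> 1"
    and J_dep: "\<And>i \<xi> x z. x \<in> S i \<Longrightarrow> J i \<xi> x z = J i (\<xi> \<inter> G i x) x z"
    and G: "\<And>i x. x \<in> S i \<Longrightarrow> G i x \<subseteq> Slab i"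
    and Slab: "\<And>i j. i < j \<Longrightarrow> Slab i \<inter> Slab j = {}"
    and far: "\<And>i x x'. x \<in> S i \<Longrightarrow> x' \<in> S i \<Longrightarrow> \<not> close x x' \<Longrightarrow> G i x \<inter> G i x' = {}"
    and near: "\<And>i x. x \<in> S i \<Longrightarrow> real (card {x' \<in> S i. close x x'}) \<le> b"
    and row: "\<And>i x. i < k \<Longrightarrow> x \<in> S i \<Longrightarrow> q \<le> (\<Sum>z\<in>S (Suc i). Ex p F (\<lambda>\<xi>. J i \<xi> x z))"
    and col: "\<And>i z. i < k \<Longrightarrow> z \<in> S (Suc i) \<Longrightarrow> (\<Sum>x\<in>S i. Ex p F (\<lambda>\<xi>. J i \<xi> x z)) \<le> C"
    and q: "0 < q" and C: "0 \<le> C"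
begin

abbreviation "Z \<equiv> flow S J"
definition "mean m i x = Ex p F (\<lambda>\<xi>. Z m i \<xi> x)"
definition "EJ i x z = Ex p F (\<lambda>\<xi>. J i \<xi> x z)"

lemma EJ_nonneg: "0 \<le> EJ i x z" unfolding EJ_def using p J_nonneg by (intro Ex_nonneg) auto

lemma Z_bounds: "x \<in> S i \<Longrightarrow> 0 \<le> Z m i \<xi> x \<and> Z m i \<xi> x \<le> 1"
proof (induction m arbitrary: i x)
  case (Suc m)
  have "(\<Sum>z\<in>S (Suc i). J i \<xi> x z * Z m (Suc i) \<xi> z) \<le> (\<Sum>z\<in>S (Suc i). J i \<xi> x z * 1)"
    using Suc.IH J_nonneg by (intro sum_mono mult_left_mono) auto
  also have "\<dots> \<le> 1" using J_le[OF Suc.prems] by simp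
  finally show ?case using Suc.IH J_nonneg by (auto intro!: sum_nonneg mult_nonneg_nonneg)
qed simp

lemma mean_nonneg: "x \<in> S i \<Longrightarrow> 0 \<le> mean m i x" unfolding mean_def using p Z_bounds by (intro Ex_nonneg) auto

lemma J_dep': "x \<in> S i \<Longrightarrow> G i x \<subseteq> A \<Longrightarrow> J i \<xi> x z = J i (\<xi> \<inter> A) x z"
  using J_dep[of x i \<xi> z] J_dep[of x i "\<xi> \<inter> A" z] by (simp add: Int_assoc Int_absorb1)

lemma Z_dep: "x \<in> S i \<Longrightarrow> (\<Union>j\<in>{i..}. Slab j) \<subseteq> A \<Longrightarrow> Z m i \<xi> x = Z m i (\<xi> \<inter> A) x"
proof (induction m arbitrary: i x)
  case (Suc m)
  have "J i \<xi> x z = J i (\<xi> \<inter> A) x z" for z using Suc.prems G[OF Suc.prems(1)] by (intro J_dep') auto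
  moreover have "Z m (Suc i) \<xi> z = Z m (Suc i) (\<xi> \<inter> A) z" if "z \<in> S (Suc i)" for z
    using Suc.prems(2) that by (intro Suc.IH) (auto simp: subset_eq)
  ultimately show ?case by simp
qed simp

lemma later: "Slab i \<inter> (\<Union>j\<in>{Suc i..}. Slab j) = {}" using Slab[of i] by (fastforce simp: Suc_le_eq)

lemma mean_Suc:
  assumes "x \<in> S i"
  shows "mean (Suc m) i x = (\<Sum>z\<in>S (Suc i). EJ i x z * mean m (Suc i) z)"
proof -
  have "Ex p F (\<lambda>\<xi>. J i \<xi> x z * Z m (Suc i) \<xi> z) = EJ i x z * mean m (Suc i) z" if "z \<in> S (Suc i)" for z
    unfolding EJ_def mean_def
  proof (rule Ex_indep[OF F later])
    show "J i \<xi> x z = J i (\<xi> \<inter> Slab i) x z" for \<xi> by (rule J_dep'[OF assms G[OF assms]])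
    show "Z m (Suc i) \<xi> z = Z m (Suc i) (\<xi> \<inter> \<Union> (Slab ` {Suc i..})) z" for \<xi> by (rule Z_dep[OF that subset_refl])
  qed
  then show ?thesis unfolding mean_def by (simp add: Ex_sum)
qed

lemma mean_ge: "x \<in> S i \<Longrightarrow> i + m \<le> k \<Longrightarrow> q ^ m \<le> mean m i x"
proof (induction m arbitrary: i x)
  case 0
  then show ?case by (simp add: mean_def F)
next
  case (Suc m)
  have "q ^ Suc m \<le> (\<Sum>z\<in>S (Suc i). EJ i x z) * q ^ m"
    using row[OF _ Suc.prems(1)] Suc.prems(2) q by (simp add: EJ_def mult_right_mono)
  also have "\<dots> \<le> (\<Sum>z\<in>S (Suc i). EJ i x z * mean m (Suc i) z)"
    unfolding sum_distrib_right using Suc.IH Suc.prems(2) EJ_nonneg by (intro sum_mono mult_left_mono) auto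
  finally show ?case by (simp add: mean_Suc[OF Suc.prems(1)])
qed

text \<open>An upper bound for the covariance of two flows: at each level where the two lineages are
  close, their joint moment is estimated by one of the means.\<close>

primrec rest :: "nat \<Rightarrow> nat \<Rightarrow> 'a \<Rightarrow> 'a \<Rightarrow> real" where
  "rest 0 i x x' = 0"
| "rest (Suc m) i x x' = of_bool (close x x') * mean (Suc m) i x +
    (\<Sum>z\<in>S (Suc i). \<Sum>z'\<in>S (Suc i). EJ i x z * EJ i x' z' * rest m (Suc i) z z')"

lemma rest_nonneg: "x \<in> S i \<Longrightarrow> 0 \<le> rest m i x x'" using EJ_nonneg mean_nonneg
  by (induction m arbitrary: i x x') (auto intro!: sum_nonneg add_nonneg_nonneg mult_nonneg_nonneg)

lemma pair:
  "x \<in> S i \<Longrightarrow> x' \<in> S i \<Longrightarrow>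
    Ex p F (\<lambda>\<xi>. Z m i \<xi> x * Z m i \<xi> x') \<le> mean m i x * mean m i x' + rest m i x x'"
proof (induction m arbitrary: i x x')
  case 0
  then show ?case by (simp add: mean_def F)
next
  case (Suc m)
  note xx = Suc.prems
  let ?S = "S (Suc i)" and ?A = "\<lambda>\<xi> z z'. J i \<xi> x z * J i \<xi> x' z'"
    and ?B = "\<lambda>\<xi> z z'. Z m (Suc i) \<xi> z * Z m (Suc i) \<xi> z'"
  show ?case
  proof (cases "close x x'")
    case True
    \<comment> \<open>Close vertices may use common edges, but both flows are at most 1, so their
      product is at most either of them.\<close>
    have "Ex p F (\<lambda>\<xi>. Z (Suc m) i \<xi> x * Z (Suc m) i \<xi> x') \<le> mean (Suc m) i x"
      unfolding mean_def using Z_bounds[OF xx(1), of "Suc m"] Z_bounds[OF xx(2), of "Suc m"] p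
      by (intro Ex_mono mult_left_le) auto
    moreover have "0 \<le> mean (Suc m) i x * mean (Suc m) i x'" using mean_nonneg xx by simp
    moreover have "0 \<le> (\<Sum>z\<in>?S. \<Sum>z'\<in>?S. EJ i x z * EJ i x' z' * rest m (Suc i) z z')"
      using EJ_nonneg rest_nonneg by (intro sum_nonneg mult_nonneg_nonneg) auto
    ultimately show ?thesis using True by simp
  next
    case False
    have 1: "Ex p F (\<lambda>\<xi>. ?A \<xi> z z' * ?B \<xi> z z') =
        EJ i x z * EJ i x' z' * Ex p F (\<lambda>\<xi>. ?B \<xi> z z')" if z: "z \<in> ?S" "z' \<in> ?S" for z z'
    proof -
      have "Ex p F (\<lambda>\<xi>. ?A \<xi> z z' * ?B \<xi> z z') = Ex p F (\<lambda>\<xi>. ?A \<xi> z z') * Ex p F (\<lambda>\<xi>. ?B \<xi> z z')"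
      proof (rule Ex_indep[OF F later])
        show "?A \<xi> z z' = ?A (\<xi> \<inter> Slab i) z z'" for \<xi>
          using J_dep'[OF xx(1) G[OF xx(1)], of \<xi> z] J_dep'[OF xx(2) G[OF xx(2)], of \<xi> z'] by simp
        show "?B \<xi> z z' = ?B (\<xi> \<inter> \<Union> (Slab ` {Suc i..})) z z'" for \<xi>
          using Z_dep[OF z(1) subset_refl, of m \<xi>] Z_dep[OF z(2) subset_refl, of m \<xi>] by simp
      qed
      also have "Ex p F (\<lambda>\<xi>. ?A \<xi> z z') = EJ i x z * EJ i x' z'" unfolding EJ_def
      proof (rule Ex_indep[OF F far[OF xx False]])
        show "J i \<xi> x z = J i (\<xi> \<inter> G i x) x z" for \<xi> by (rule J_dep[OF xx(1)])
        show "J i \<xi> x' z' = J i (\<xi> \<inter> G i x') x' z'" for \<xi> by (rule J_dep[OF xx(2)])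
      qed
      finally show ?thesis .
    qed
    have "Ex p F (\<lambda>\<xi>. Z (Suc m) i \<xi> x * Z (Suc m) i \<xi> x') =
        Ex p F (\<lambda>\<xi>. \<Sum>z\<in>?S. \<Sum>z'\<in>?S. ?A \<xi> z z' * ?B \<xi> z z')"
      unfolding flow.simps sum_product by (intro Ex_cong sum.cong refl) (simp add: mult_ac)
    also have "\<dots> = (\<Sum>z\<in>?S. \<Sum>z'\<in>?S. EJ i x z * EJ i x' z' * Ex p F (\<lambda>\<xi>. ?B \<xi> z z'))"
      unfolding Ex_sum using 1 by (intro sum.cong refl) auto
    also have "\<dots> \<le> (\<Sum>z\<in>?S. \<Sum>z'\<in>?S. EJ i x z * EJ i x' z' *
        (mean m (Suc i) z * mean m (Suc i) z' + rest m (Suc i) z z'))"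
      using Suc.IH EJ_nonneg by (intro sum_mono mult_left_mono mult_nonneg_nonneg) auto
    also have "\<dots> = mean (Suc m) i x * mean (Suc m) i x' + rest (Suc m) i x x'"
    proof -
      have "mean (Suc m) i x * mean (Suc m) i x' =
          (\<Sum>z\<in>?S. \<Sum>z'\<in>?S. EJ i x z * EJ i x' z' * (mean m (Suc i) z * mean m (Suc i) z'))"
        unfolding mean_Suc[OF xx(1)] mean_Suc[OF xx(2)] sum_product by (intro sum.cong refl) (simp add: mult_ac)
      with False show ?thesis by (simp add: sum.distrib distrib_left)
    qed
    finally show ?thesis .
  qed
qed

text \<open>Follow the first lineage to the level where its partner is close: there are at most
  \<open>b\<close> partners there, and each level between the start and this meeting contributes a
  column sum, at most \<open>C\<close>. Hence the geometric sum.\<close>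

lemma rest_sum: "x \<in> S i \<Longrightarrow> i + m \<le> k \<Longrightarrow> (\<Sum>x'\<in>S i. rest m i x x') \<le> b * (\<Sum>j<m. C ^ j) * mean m i x"
proof (induction m arbitrary: i x)
  case (Suc m)
  note x = Suc.prems(1)
  let ?S = "S (Suc i)" and ?K = "b * (\<Sum>j<m. C ^ j)"
  have b: "0 \<le> b" using near[OF x] by (smt (verit) of_nat_0_le_iff)
  have 1: "(\<Sum>x'\<in>S i. of_bool (close x x') * mean (Suc m) i x) \<le> b * mean (Suc m) i x"
  proof -
    have "(\<Sum>x'\<in>S i. of_bool (close x x') :: real) = real (card {x' \<in> S i. close x x'})"
      using S[of i] by (simp add: sum.If_cases of_bool_def Int_def)
    then show ?thesis
      unfolding sum_distrib_right[symmetric] using near[OF x] mean_nonneg[OF x] by (intro mult_right_mono) auto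
  qed
  have "(\<Sum>x'\<in>S i. \<Sum>z\<in>?S. \<Sum>z'\<in>?S. EJ i x z * EJ i x' z' * rest m (Suc i) z z') =
      (\<Sum>z\<in>?S. \<Sum>x'\<in>S i. \<Sum>z'\<in>?S. EJ i x z * EJ i x' z' * rest m (Suc i) z z')"
    by (rule sum.swap)
  also have "\<dots> = (\<Sum>z\<in>?S. EJ i x z * (\<Sum>z'\<in>?S. (\<Sum>x'\<in>S i. EJ i x' z') * rest m (Suc i) z z'))"
  proof (rule sum.cong[OF refl])
    fix z
    show "(\<Sum>x'\<in>S i. \<Sum>z'\<in>?S. EJ i x z * EJ i x' z' * rest m (Suc i) z z') =
       EJ i x z * (\<Sum>z'\<in>?S. (\<Sum>x'\<in>S i. EJ i x' z') * rest m (Suc i) z z')"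
      by (subst sum.swap) (simp add: sum_distrib_left sum_distrib_right mult.assoc)
  qed
  also have "\<dots> \<le> (\<Sum>z\<in>?S. EJ i x z * (\<Sum>z'\<in>?S. C * rest m (Suc i) z z'))"
    using col[of i] Suc.prems(2) EJ_nonneg rest_nonneg unfolding EJ_def[symmetric]
    by (intro sum_mono mult_left_mono mult_right_mono) auto
  also have "\<dots> \<le> (\<Sum>z\<in>?S. EJ i x z * (C * (?K * mean m (Suc i) z)))"
    unfolding sum_distrib_left[symmetric] using Suc.IH Suc.prems(2) C EJ_nonneg by (intro sum_mono mult_left_mono) auto
  also have "\<dots> = C * ?K * mean (Suc m) i x"
  proof -
    have "(\<Sum>z\<in>?S. e z * (C * (K * g z))) = C * K * (\<Sum>z\<in>?S. e z * g z)" for K and e g :: "'a \<Rightarrow> real"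
      by (simp add: sum_distrib_left algebra_simps)
    then show ?thesis unfolding mean_Suc[OF x] .
  qed
  finally have "(\<Sum>x'\<in>S i. rest (Suc m) i x x') \<le> b * mean (Suc m) i x + C * ?K * mean (Suc m) i x"
    using 1 by (simp add: sum.distrib)
  also have "\<dots> = b * (\<Sum>j<Suc m. C ^ j) * mean (Suc m) i x"
    unfolding sum.lessThan_Suc_shift by (simp add: sum_distrib_left algebra_simps)
  finally show ?case .
qed simp

text \<open>The price of the correlations does not grow with \<open>W\<close>, so the bound
  approaches 1 as soon as \<open>card W * q ^ k\<close> dominates that price.\<close>

theorem flow_positive:
  assumes W: "W \<subseteq> S 0" "W \<noteq> {}"
  shows "real (card W) * q ^ k / (real (card W) * q ^ k + b * (\<Sum>j<k. C ^ j)) \<le>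
    Pr p F (\<lambda>\<xi>. \<exists>x\<in>W. 0 < Z k 0 \<xi> x)"
proof -
  have fW: "finite W" using W S finite_subset by blast
  have Z0: "0 \<le> Z k 0 \<xi> x" if "x \<in> W" for \<xi> x using that W Z_bounds by blast
  obtain x0 where "x0 \<in> S 0" using W by auto
  then have b: "0 \<le> b" using near[of x0 0] by (smt (verit) of_nat_0_le_iff)
  let ?f = "\<lambda>\<xi>. \<Sum>x\<in>W. Z k 0 \<xi> x"
  have e: "Ex p F ?f = (\<Sum>x\<in>W. mean k 0 x)" by (simp add: Ex_sum mean_def)
  have "real (card W) * q ^ k / (real (card W) * q ^ k + b * (\<Sum>j<k. C ^ j)) \<le> Pr p F (\<lambda>\<xi>. 0 < ?f \<xi>)"
  proof (rule second_moment[OF F p])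
    show "0 \<le> ?f \<xi>" for \<xi> using Z0 by (rule sum_nonneg)
    show "0 < real (card W) * q ^ k" using W fW q by (auto simp: card_gt_0_iff)
    show "real (card W) * q ^ k \<le> Ex p F ?f" unfolding e using mean_ge W by (intro sum_bounded_below) auto
    show "0 \<le> b * (\<Sum>j<k. C ^ j)" using b C by (intro mult_nonneg_nonneg sum_nonneg) auto
    have "Ex p F (\<lambda>\<xi>. ?f \<xi> * ?f \<xi>) = (\<Sum>x\<in>W. \<Sum>x'\<in>W. Ex p F (\<lambda>\<xi>. Z k 0 \<xi> x * Z k 0 \<xi> x'))"
      by (simp add: sum_product Ex_sum)
    also have "\<dots> \<le> (\<Sum>x\<in>W. \<Sum>x'\<in>W. mean k 0 x * mean k 0 x' + rest k 0 x x')" using W by (intro sum_mono pair) auto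
    also have "\<dots> = (\<Sum>x\<in>W. mean k 0 x)\<^sup>2 + (\<Sum>x\<in>W. \<Sum>x'\<in>W. rest k 0 x x')"
      by (simp add: sum.distrib sum_product power2_eq_square)
    also have "(\<Sum>x\<in>W. \<Sum>x'\<in>W. rest k 0 x x') \<le> (\<Sum>x\<in>W. \<Sum>x'\<in>S 0. rest k 0 x x')"
      using W S rest_nonneg by (intro sum_mono sum_mono2) auto
    also have "\<dots> \<le> (\<Sum>x\<in>W. b * (\<Sum>j<k. C ^ j) * mean k 0 x)" using W by (intro sum_mono rest_sum) auto
    finally show "Ex p F (\<lambda>\<xi>. ?f \<xi> * ?f \<xi>) \<le> (Ex p F ?f)\<^sup>2 + b * (\<Sum>j<k. C ^ j) * Ex p F ?f"
      unfolding e by (simp add: sum_distrib_left)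
  qed
  also have "\<dots> \<le> Pr p F (\<lambda>\<xi>. \<exists>x\<in>W. 0 < Z k 0 \<xi> x)"
  proof (intro Pr_mono p)
    fix \<xi> assume "0 < ?f \<xi>"
    then show "\<exists>x\<in>W. 0 < Z k 0 \<xi> x" using sum_nonpos[of W "\<lambda>x. Z k 0 \<xi> x"] by (meson not_less)
  qed
  finally show ?thesis .
qed

end

section \<open>Graphs with a height function\<close>

text \<open>\<open>nb E n x\<close> is the ball of radius \<open>n\<close> around \<open>x\<close>.\<close>

definition nb :: "'v set set \<Rightarrow> nat \<Rightarrow> 'v \<Rightarrow> 'v set" where
  "nb E n x = {y. \<exists>C\<subseteq>E. finite C \<and> card C \<le> n \<and> conn C x y}"

lemma nb_refl: "x \<in> nb E n x" unfolding nb_def by (auto intro!: exI[of _ "{}"])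

lemma nb_sym: "y \<in> nb E n x \<Longrightarrow> x \<in> nb E n y" unfolding nb_def by (auto intro: conn_sym)

lemma nb_mono: "m \<le> n \<Longrightarrow> nb E m x \<subseteq> nb E n x" unfolding nb_def by (blast intro: order_trans)

lemma nb_trans:
  assumes "y \<in> nb E m x" "z \<in> nb E n y"
  shows "z \<in> nb E (m + n) x"
proof -
  obtain C D where C: "C \<subseteq> E" "finite C" "card C \<le> m" "conn C x y"
    and D: "D \<subseteq> E" "finite D" "card D \<le> n" "conn D y z" using assms unfolding nb_def by blast
  have "conn (C \<union> D) x z" using C(4) D(4) by (meson conn_mono conn_trans sup_ge1 sup_ge2)
  moreover have "card (C \<union> D) \<le> m + n" using card_Un_le[of C D] C(3) D(3) by linarith
  ultimately show ?thesis unfolding nb_def using C D by (auto intro!: exI[of _ "C \<union> D"])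
qed

lemma nb_edge: "{x, y} \<in> E \<Longrightarrow> y \<in> nb E 1 x" unfolding nb_def by (auto intro!: exI[of _ "{{x, y}}"] conn_edge)

lemma card_path_edges_distinct: "distinct xs \<Longrightarrow> card (path_edges xs) = length xs - 1"
proof (induction xs rule: induct_list012)
  case (3 x y zs)
  have "{x, y} \<notin> path_edges (y # zs)" using 3(3) path_edges_subset_set[of "{x, y}" "y # zs"] by auto
  then show ?case using 3 by simp
qed auto

lemma conn_in_nb:
  assumes "conn C x y" "C \<subseteq> E" "finite C"
  shows "y \<in> nb E (card C) x" unfolding nb_def using assms by auto

text \<open>A layer by layer description of balls, from which the finiteness and the size of
  \<open>nb\<close> are read off through \<open>nb_sub_bl\<close>.\<close>

primrec bl :: "'v set set \<Rightarrow> nat \<Rightarrow> 'v \<Rightarrow> 'v set" where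
  "bl E 0 x = {x}"
| "bl E (Suc n) x = bl E n x \<union> (\<Union>y\<in>bl E n x. {z. {y, z} \<in> E})"

lemma spath_in_bl: "spath E x y xs \<Longrightarrow> y \<in> bl E (length xs - 1) x"
proof (induction xs arbitrary: y rule: rev_induct)
  case (snoc z xs)
  then have z: "y = z" by (auto simp: spath_def)
  show ?case
  proof (cases xs rule: rev_cases)
    case Nil
    then show ?thesis using snoc.prems by (auto simp: spath_def)
  next
    case (snoc ws w)
    have s: "spath E x y (ws @ w # [z])" using snoc.prems unfolding snoc by simp
    have "w \<in> bl E (length xs - 1) x" using snoc.IH spath_split(1)[OF s] unfolding snoc by simp
    moreover have "{w, z} \<in> E" using spath_split(2)[OF s] by (auto simp: spath_def)
    ultimately show ?thesis unfolding z snoc by auto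
  qed
qed (simp add: spath_def)

lemma bl_mono: "m \<le> n \<Longrightarrow> bl E m x \<subseteq> bl E n x" by (rule lift_Suc_mono_le[of "\<lambda>n. bl E n x"]) auto

lemma nb_sub_bl: "nb E n x \<subseteq> bl E n x"
proof
  fix y assume "y \<in> nb E n x"
  then obtain C where C: "C \<subseteq> E" "finite C" "card C \<le> n" "conn C x y" unfolding nb_def by blast
  obtain xs where xs: "spath C x y xs" using C(4) by (rule conn_spath)
  have "length xs - 1 = card (path_edges xs)" using xs by (simp add: card_path_edges_distinct spath_def)
  also have "\<dots> \<le> n" using xs C card_mono[of C "path_edges xs"] by (simp add: spath_def)
  finally have "bl E (length xs - 1) x \<subseteq> bl E n x" by (rule bl_mono)
  moreover have "spath E x y xs" using xs C(1) by (auto simp: spath_def)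
  ultimately show "y \<in> bl E n x" using spath_in_bl[of E x y xs] by blast
qed

lemma sum_le_multiplicity:
  fixes w :: "'b \<Rightarrow> real"
  assumes "finite A" "\<And>y. y \<in> f ` A \<Longrightarrow> card {x \<in> A. f x = y} \<le> M" "\<And>y. y \<in> f ` A \<Longrightarrow> 0 \<le> w y"
  shows "(\<Sum>x\<in>A. w (f x)) \<le> M * (\<Sum>y\<in>f ` A. w y)"
proof -
  have "(\<Sum>x\<in>A. w (f x)) = (\<Sum>y\<in>f ` A. \<Sum>x\<in>{x \<in> A. f x = y}. w (f x))" by (rule sum.image_gen[OF assms(1)])
  also have "\<dots> = (\<Sum>y\<in>f ` A. card {x \<in> A. f x = y} * w y)" by (intro sum.cong refl) simp
  also have "\<dots> \<le> (\<Sum>y\<in>f ` A. M * w y)" using assms by (intro sum_mono mult_right_mono) auto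
  finally show ?thesis by (simp add: sum_distrib_left)
qed

text \<open>
  The height \<open>h\<close> is the logarithm of the modular function, corrected by a constant on each orbit so that
  some path climbs by \<open>g\<close> in its last step only. The functions in the mass transport principle \<open>mtp\<close>
  carry a finite edge set because all percolation takes place on finite edge sets.
\<close>

locale tilted =
  fixes V :: "'v set" and E :: "'v set set" and \<Gamma> :: "('v \<Rightarrow> 'v) set" and h :: "'v \<Rightarrow> real"
    and Orb :: "'v set" and rt :: 'v and Reps :: "'v set" and t0 g :: real and dg D L :: nat
  assumes edge: "e \<in> E \<Longrightarrow> \<exists>x\<in>V. \<exists>y\<in>V. x \<noteq> y \<and> e = {x, y}"
    and fin_deg: "v \<in> V \<Longrightarrow> finite {e \<in> E. v \<in> e}" and deg: "v \<in> V \<Longrightarrow> card {e \<in> E. v \<in> e} \<le> dg"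
    and connected: "x \<in> V \<Longrightarrow> y \<in> V \<Longrightarrow> conn E x y"
    and lip: "{x, y} \<in> E \<Longrightarrow> \<bar>h x - h y\<bar> \<le> t0"
    and aut: "\<beta> \<in> \<Gamma> \<Longrightarrow> bij_betw \<beta> V V" "\<beta> \<in> \<Gamma> \<Longrightarrow> e \<subseteq> V \<Longrightarrow> \<beta> ` e \<in> E \<longleftrightarrow> e \<in> E"
    and h_shift: "\<beta> \<in> \<Gamma> \<Longrightarrow> x \<in> V \<Longrightarrow> y \<in> V \<Longrightarrow> h (\<beta> x) - h (\<beta> y) = h x - h y"
    and Orb_sub: "Orb \<subseteq> V" and rt: "rt \<in> Orb"
    and Orb_trans: "x \<in> Orb \<Longrightarrow> y \<in> Orb \<Longrightarrow> \<exists>\<beta>\<in>\<Gamma>. \<beta> x = y"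
    and Orb_inv: "\<beta> \<in> \<Gamma> \<Longrightarrow> x \<in> V \<Longrightarrow> \<beta> x \<in> Orb \<longleftrightarrow> x \<in> Orb"
    and Reps: "finite Reps" "Reps \<subseteq> V" "x \<in> V \<Longrightarrow> \<exists>v\<in>Reps. \<exists>\<beta>\<in>\<Gamma>. \<beta> v = x"
    and near_Orb: "x \<in> V \<Longrightarrow> \<exists>a\<in>Orb. a \<in> nb E D x"
    and g: "0 < g" "g \<le> t0"
    and climb: "\<exists>C\<subseteq>E. \<exists>z\<in>Orb. finite C \<and> card C \<le> L \<and> conn C rt z \<and> h z = h rt + g \<and>
      (\<forall>e\<in>C. (\<forall>u\<in>e. h rt \<le> h u \<and> h u \<le> h rt + g) \<and> (\<exists>u\<in>e. h u = h rt))"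
    and mtp: "\<And>(f :: 'v set set \<Rightarrow> 'v \<Rightarrow> 'v \<Rightarrow> real) K F A.
      \<lbrakk>\<And>\<beta> F x y. \<beta> \<in> \<Gamma> \<Longrightarrow> finite F \<Longrightarrow> F \<subseteq> E \<Longrightarrow> x \<in> Orb \<Longrightarrow> y \<in> Orb \<Longrightarrow> f ((`) \<beta> ` F) (\<beta> x) (\<beta> y) = f F x y;
       \<And>F F' x y. finite F' \<Longrightarrow> F' \<subseteq> E \<Longrightarrow> F \<subseteq> F' \<Longrightarrow> x \<in> Orb \<Longrightarrow> y \<in> Orb \<Longrightarrow> f F x y \<le> f F' x y;
       \<And>F x y. 0 \<le> f F x y;
       \<And>F B. finite F \<Longrightarrow> F \<subseteq> E \<Longrightarrow> finite B \<Longrightarrow> B \<subseteq> Orb \<Longrightarrow> (\<Sum>y\<in>B. f F rt y) \<le> K;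
       finite F; F \<subseteq> E; finite A; A \<subseteq> Orb\<rbrakk>
      \<Longrightarrow> (\<Sum>x\<in>A. f F x rt * exp (h x - h rt)) \<le> K"
begin

lemma rt_V: "rt \<in> V" using rt Orb_sub by auto

lemma edge_sub: "e \<in> E \<Longrightarrow> e \<subseteq> V" "e \<in> E \<Longrightarrow> finite e" "{x, y} \<in> E \<Longrightarrow> x \<in> V \<and> y \<in> V"
  using edge[of e] edge[of "{x, y}"] by (auto simp: doubleton_eq_iff)

lemma edge_pair: "e \<in> E \<Longrightarrow> u \<in> e \<Longrightarrow> \<exists>w. e = {w, u}" using edge[of e] by (auto simp: insert_commute)

lemma finite_verts: "finite F \<Longrightarrow> F \<subseteq> E \<Longrightarrow> finite (\<Union>F)" using edge_sub(2) by auto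

lemma verts_V: "F \<subseteq> E \<Longrightarrow> \<Union>F \<subseteq> V" using edge_sub(1) by auto

lemma bl_props: "x \<in> V \<Longrightarrow> bl E n x \<subseteq> V \<and> finite (bl E n x) \<and> card (bl E n x) \<le> (dg + 1) ^ n"
proof (induction n)
  case (Suc n)
  have 2: "finite {z. {y, z} \<in> E} \<and> card {z. {y, z} \<in> E} \<le> dg" if "y \<in> V" for y
  proof -
    have inj: "inj_on (\<lambda>z. {y, z}) {z. {y, z} \<in> E}" by (auto simp: inj_on_def doubleton_eq_iff)
    have sub: "(\<lambda>z. {y, z}) ` {z. {y, z} \<in> E} \<subseteq> {e \<in> E. y \<in> e}" by auto
    show ?thesis
      using inj_on_finite[OF inj sub fin_deg[OF that]] card_inj_on_le[OF inj sub fin_deg[OF that]] deg[OF that] by simp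
  qed
  have IH: "bl E n x \<subseteq> V" "finite (bl E n x)" "card (bl E n x) \<le> (dg + 1) ^ n" using Suc by auto
  have "card (\<Union>y\<in>bl E n x. {z. {y, z} \<in> E}) \<le> (\<Sum>y\<in>bl E n x. card {z. {y, z} \<in> E})" using IH by (intro card_UN_le) auto
  also have "\<dots> \<le> (\<Sum>y\<in>bl E n x. dg)" using 2 IH by (intro sum_mono) auto
  finally have "card (bl E (Suc n) x) \<le> card (bl E n x) + card (bl E n x) * dg"
    using card_Un_le[of "bl E n x" "\<Union>y\<in>bl E n x. {z. {y, z} \<in> E}"] by simp
  also have "\<dots> \<le> (dg + 1) ^ Suc n" using IH(3) by (simp add: algebra_simps add_mono)
  finally show ?case using IH 2 edge_sub(3) by auto
qed simp

lemma nb_V: "x \<in> V \<Longrightarrow> nb E n x \<subseteq> V"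
  and finite_nb: "x \<in> V \<Longrightarrow> finite (nb E n x)"
  and card_nb: "x \<in> V \<Longrightarrow> card (nb E n x) \<le> (dg + 1) ^ n"
proof -
  assume "x \<in> V"
  note b = bl_props[OF this, of n] and s = nb_sub_bl[of E n x]
  show "nb E n x \<subseteq> V" "finite (nb E n x)" using b s finite_subset by auto
  show "card (nb E n x) \<le> (dg + 1) ^ n" using b card_mono[OF _ s] by fastforce
qed

lemma lip_nb:
  assumes "y \<in> nb E n x"
  shows "\<bar>h y - h x\<bar> \<le> n * t0"
proof -
  have bl: "y \<in> bl E n x \<Longrightarrow> \<bar>h y - h x\<bar> \<le> n * t0" for y
  proof (induction n arbitrary: y)
    case (Suc n)
    have t: "0 \<le> t0" using g by simp
    from Suc.prems consider "y \<in> bl E n x" | w where "w \<in> bl E n x" "{w, y} \<in> E" by auto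
    then show ?case
    proof cases
      case 1
      then have "\<bar>h y - h x\<bar> \<le> n * t0" by (rule Suc.IH)
      with t show ?thesis by (simp add: algebra_simps)
    next
      case 2
      have "\<bar>h w - h x\<bar> \<le> n * t0" "\<bar>h w - h y\<bar> \<le> t0" using Suc.IH[OF 2(1)] lip[OF 2(2)] by auto
      then show ?thesis by (simp add: algebra_simps)
    qed
  qed simp
  show ?thesis using bl[of y] nb_sub_bl[of E n x] assms by blast
qed

text \<open>The fibres of a map that moves points by at most \<open>n\<close> lie in balls of radius
  \<open>n\<close>. This is the counting cost whenever endpoints are replaced by nearby vertices of
  the orbit.\<close>

lemma multiplicity:
  assumes "A \<subseteq> V" "\<And>x. x \<in> A \<Longrightarrow> f x \<in> nb E n x" "y \<in> f ` A"
  shows "card {x \<in> A. f x = y} \<le> (dg + 1) ^ n"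
proof -
  have "{x \<in> A. f x = y} \<subseteq> nb E n y" using assms(2) nb_sym by fastforce
  moreover have y: "y \<in> V" using assms nb_V by blast
  ultimately have "card {x \<in> A. f x = y} \<le> card (nb E n y)" by (intro card_mono finite_nb)
  with card_nb[OF y, of n] show ?thesis by linarith
qed

lemma sum_multiplicity:
  fixes w :: "'v \<Rightarrow> real"
  assumes "A \<subseteq> V" "finite A" "\<And>x. x \<in> A \<Longrightarrow> f x \<in> nb E n x" "\<And>y. y \<in> f ` A \<Longrightarrow> 0 \<le> w y"
  shows "(\<Sum>x\<in>A. w (f x)) \<le> real ((dg + 1) ^ n) * (\<Sum>y\<in>f ` A. w y)"
  using assms multiplicity[OF assms(1) assms(3)] by (intro sum_le_multiplicity) auto

subsection \<open>Automorphisms\<close>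

lemma aut_V: "\<beta> \<in> \<Gamma> \<Longrightarrow> x \<in> V \<Longrightarrow> \<beta> x \<in> V" using aut(1) bij_betwE by blast

lemma aut_inj: "\<beta> \<in> \<Gamma> \<Longrightarrow> inj_on ((`) \<beta>) (Pow V)" using aut(1)[of \<beta>] by (simp add: bij_betw_def inj_on_image_Pow)

lemma aut_inj_E: "\<beta> \<in> \<Gamma> \<Longrightarrow> F \<subseteq> E \<Longrightarrow> inj_on ((`) \<beta>) F" by (rule inj_on_subset[OF aut_inj]) (use edge_sub(1) in auto)

lemma aut_edges: "\<beta> \<in> \<Gamma> \<Longrightarrow> F \<subseteq> E \<Longrightarrow> (`) \<beta> ` F \<subseteq> E" using aut(2)[of \<beta>] edge_sub(1) by (meson image_subsetI subsetD)

lemma aut_edges_onto: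
  assumes "\<beta> \<in> \<Gamma>" "e \<in> E"
  shows "\<exists>e'\<in>E. e = \<beta> ` e'"
proof -
  have "\<beta> ` V = V" using aut(1)[OF assms(1)] by (simp add: bij_betw_def)
  then obtain e' where "e' \<subseteq> V" "e = \<beta> ` e'" using edge_sub(1)[OF assms(2)] by (metis subset_imageE)
  with aut(2)[OF assms(1), of e'] assms(2) show ?thesis by blast
qed

lemma conn_aut:
  assumes "\<beta> \<in> \<Gamma>" "\<xi> \<subseteq> E" "x \<in> V" "y \<in> V"
  shows "conn ((`) \<beta> ` \<xi>) (\<beta> x) (\<beta> y) \<longleftrightarrow> conn \<xi> x y"
proof
  assume "conn ((`) \<beta> ` \<xi>) (\<beta> x) (\<beta> y)"
  from conn_image[OF this, of "inv_into V \<beta>"]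
  have 1: "conn ((`) (inv_into V \<beta>) ` (`) \<beta> ` \<xi>) (inv_into V \<beta> (\<beta> x)) (inv_into V \<beta> (\<beta> y))" .
  have inj: "inj_on \<beta> V" using aut(1)[OF assms(1)] by (simp add: bij_betw_def)
  have "inv_into V \<beta> ` \<beta> ` e = e" if "e \<in> \<xi>" for e
  proof (rule inv_into_image_cancel[OF inj])
    show "e \<subseteq> V" using that assms(2) edge_sub(1) by blast
  qed
  then have "(`) (inv_into V \<beta>) ` (`) \<beta> ` \<xi> = \<xi>" by (force simp: image_image)
  with 1 show "conn \<xi> x y" using inj assms by simp
qed (rule conn_image)

lemma Pr_aut:
  assumes "\<beta> \<in> \<Gamma>" "F \<subseteq> E" "finite F"
  shows "Ex p ((`) \<beta> ` F) f = Ex p F (\<lambda>\<xi>. f ((`) \<beta> ` \<xi>))" using Ex_image[OF aut_inj_E[OF assms(1,2)] assms(3)] .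

lemma aut_Int: "\<beta> \<in> \<Gamma> \<Longrightarrow> A \<subseteq> E \<Longrightarrow> B \<subseteq> E \<Longrightarrow> (`) \<beta> ` (A \<inter> B) = (`) \<beta> ` A \<inter> (`) \<beta> ` B"
  using aut_inj_E[of \<beta> E] by (metis inj_on_image_Int order_refl)

lemma Pr_conn_aut:
  assumes "\<beta> \<in> \<Gamma>" "F \<subseteq> E" "finite F" "x \<in> V" "y \<in> V" "R \<subseteq> E"
  shows "Pr p ((`) \<beta> ` F) (\<lambda>\<xi>. conn (\<xi> \<inter> (`) \<beta> ` R) (\<beta> x) (\<beta> y)) = tauR p F R x y"
proof -
  have "conn ((`) \<beta> ` \<xi> \<inter> (`) \<beta> ` R) (\<beta> x) (\<beta> y) = conn (\<xi> \<inter> R) x y" if "\<xi> \<subseteq> F" for \<xi>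
  proof -
    have "\<xi> \<subseteq> E" "\<xi> \<inter> R \<subseteq> E" using that assms by auto
    then show ?thesis using assms aut_Int[of \<beta> \<xi> R] conn_aut[of \<beta> "\<xi> \<inter> R" x y] by simp
  qed
  then show ?thesis unfolding Pr_aut[OF assms(1-3)] by (intro Ex_cong) simp
qed

lemma Pr_conn_aut':
  assumes "\<beta> \<in> \<Gamma>" "F \<subseteq> E" "finite F" "x \<in> V" "y \<in> V"
  shows "Pr p ((`) \<beta> ` F) (\<lambda>\<xi>. conn \<xi> (\<beta> x) (\<beta> y)) = tau p F x y"
proof -
  have "Pr p F (\<lambda>\<xi>. conn ((`) \<beta> ` \<xi>) (\<beta> x) (\<beta> y)) = tau p F x y"
    using assms conn_aut[of \<beta> _ x y] by (intro Ex_cong) auto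
  then show ?thesis unfolding Pr_aut[OF assms(1-3)] .
qed

subsection \<open>Slabs\<close>

text \<open>An edge belongs to \<open>Reg a b\<close> exactly when its lower end has height in
  \<open>[a, b)\<close>. Thus consecutive slabs are disjoint, hence independent, and still a path
  may use the edge that carries it across level \<open>b\<close>. The closed \<open>Band\<close> is
  the region of a path with prescribed extremal heights.\<close>

definition Reg :: "real \<Rightarrow> real \<Rightarrow> 'v set set" where
  "Reg a b = {e \<in> E. (\<forall>u\<in>e. a \<le> h u) \<and> (\<exists>u\<in>e. h u < b)}"

definition Band :: "real \<Rightarrow> real \<Rightarrow> 'v set set" where
  "Band a b = {e \<in> E. \<forall>u\<in>e. a \<le> h u \<and> h u \<le> b}"

lemma Reg_E: "Reg a b \<subseteq> E" and Band_E: "Band a b \<subseteq> E" by (auto simp: Reg_def Band_def)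

lemma Reg_disjoint: "b \<le> c \<Longrightarrow> Reg a b \<inter> Reg c d = {}" by (fastforce simp: Reg_def)

lemma Reg_mono: "a' \<le> a \<Longrightarrow> b \<le> b' \<Longrightarrow> Reg a b \<subseteq> Reg a' b'"
proof
  fix e assume a: "a' \<le> a" "b \<le> b'" "e \<in> Reg a b"
  then obtain u where "e \<in> E" "\<forall>u\<in>e. a \<le> h u" "u \<in> e" "h u < b" by (auto simp: Reg_def)
  with a show "e \<in> Reg a' b'" unfolding Reg_def by (auto intro!: bexI[of _ u])
qed

lemma Band_mono: "a' \<le> a \<Longrightarrow> b \<le> b' \<Longrightarrow> Band a b \<subseteq> Band a' b'" by (auto simp: Band_def)

lemma Band_Reg: "b < c \<Longrightarrow> a' \<le> a \<Longrightarrow> Band a b \<subseteq> Reg a' c"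
proof
  fix e assume a: "b < c" "a' \<le> a" "e \<in> Band a b"
  then have "e \<in> E" by (auto simp: Band_def)
  then have "e \<noteq> {}" using edge[of e] by auto
  with a show "e \<in> Reg a' c" by (fastforce simp: Reg_def Band_def)
qed

lemma conn_Band: "conn (\<xi> \<inter> Band a b) x y \<Longrightarrow> y = x \<or> (a \<le> h y \<and> h y \<le> b)"
  using conn_Union[of "\<xi> \<inter> Band a b" x y] by (auto simp: Band_def)

lemma conn_Reg:
  assumes "conn (\<xi> \<inter> Reg a b) x y"
  shows "y = x \<or> (a \<le> h y \<and> h y < b + t0)"
proof (cases "y = x")
  case False
  then obtain e where e: "e \<in> Reg a b" "y \<in> e" using conn_Union[OF assms] by auto
  then obtain u where u: "u \<in> e" "h u < b" by (auto simp: Reg_def)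
  have eE: "e \<in> E" using e Reg_E by auto
  obtain w where w: "e = {w, y}" using edge_pair[OF eE e(2)] by auto
  have "\<bar>h w - h y\<bar> \<le> t0" using lip eE w by auto
  moreover have "0 < t0" using g by simp
  ultimately have "h y < b + t0" using u w by auto
  then show ?thesis using e by (auto simp: Reg_def)
qed simp

lemma Reg_image:
  assumes "\<beta> \<in> \<Gamma>" "x \<in> V"
  shows "(`) \<beta> ` Reg a b = Reg (a + (h (\<beta> x) - h x)) (b + (h (\<beta> x) - h x))"
    and "(`) \<beta> ` Band a b = Band (a + (h (\<beta> x) - h x)) (b + (h (\<beta> x) - h x))"
proof -
  let ?s = "h (\<beta> x) - h x"
  have s: "h (\<beta> u) = h u + ?s" if "e \<in> E" "u \<in> e" for e u
    using h_shift[OF assms(1), of u x] that edge_sub(1) assms(2) by fastforce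
  have E: "\<beta> ` e \<in> E" if "e \<in> E" for e using aut(2)[OF assms(1)] edge_sub(1) that by blast
  show "(`) \<beta> ` Reg a b = Reg (a + ?s) (b + ?s)"
  proof (intro equalityI subsetI)
    fix e assume "e \<in> Reg (a + ?s) (b + ?s)"
    then have e: "e \<in> E" "\<forall>u\<in>e. a + ?s \<le> h u" "\<exists>u\<in>e. h u < b + ?s" by (auto simp: Reg_def)
    obtain e' where e': "e' \<in> E" "e = \<beta> ` e'" using aut_edges_onto[OF assms(1) e(1)] by blast
    have "e' \<in> Reg a b" using e e' s[OF e'(1)] by (auto simp: Reg_def)
    with e' show "e \<in> (`) \<beta> ` Reg a b" by blast
  qed (auto simp: Reg_def s E)
  show "(`) \<beta> ` Band a b = Band (a + ?s) (b + ?s)"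
  proof (intro equalityI subsetI)
    fix e assume "e \<in> Band (a + ?s) (b + ?s)"
    then have e: "e \<in> E" "\<forall>u\<in>e. a + ?s \<le> h u \<and> h u \<le> b + ?s" by (auto simp: Band_def)
    obtain e' where e': "e' \<in> E" "e = \<beta> ` e'" using aut_edges_onto[OF assms(1) e(1)] by blast
    have "e' \<in> Band a b" using e e' s[OF e'(1)] by (auto simp: Band_def)
    with e' show "e \<in> (`) \<beta> ` Band a b" by blast
  qed (auto simp: Band_def s E)
qed

lemma nb_image:
  assumes "\<beta> \<in> \<Gamma>" "x \<in> V"
  shows "\<beta> ` nb E n x = nb E n (\<beta> x)"
proof (intro equalityI subsetI)
  fix y assume "y \<in> \<beta> ` nb E n x"
  then obtain C z where C: "C \<subseteq> E" "finite C" "card C \<le> n" "conn C x z" "y = \<beta> z" unfolding nb_def by blast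
  then show "y \<in> nb E n (\<beta> x)"
    unfolding nb_def using aut_edges[OF assms(1) C(1)] conn_image[OF C(4), of \<beta>] card_image_le[OF C(2), of "(`) \<beta>"]
    by (auto intro!: exI[of _ "(`) \<beta> ` C"])
next
  fix y assume y: "y \<in> nb E n (\<beta> x)"
  then obtain C where C: "C \<subseteq> E" "finite C" "card C \<le> n" "conn C (\<beta> x) y" unfolding nb_def by blast
  have "y \<in> V" using y nb_V aut_V assms by blast
  then obtain z where z: "z \<in> V" "y = \<beta> z" using aut(1)[OF assms(1)] by (auto simp: bij_betw_def)
  define C' where "C' = {e \<in> E. \<beta> ` e \<in> C}"
  have im: "(`) \<beta> ` C' = C"
  proof (intro equalityI subsetI)
    fix e assume "e \<in> C"
    with C(1) obtain e' where "e' \<in> E" "e = \<beta> ` e'" using aut_edges_onto[OF assms(1)] by blast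
    with \<open>e \<in> C\<close> show "e \<in> (`) \<beta> ` C'" by (auto simp: C'_def)
  qed (auto simp: C'_def)
  have "card C' = card C" "finite C'"
    using card_image[OF aut_inj_E[OF assms(1), of C']] finite_image_iff[OF aut_inj_E[OF assms(1), of C']] im C(2)
    by (auto simp: C'_def)
  moreover have "conn C' x z" using conn_aut[OF assms(1) _ assms(2) z(1), of C'] C(4) im z by (auto simp: C'_def)
  moreover have "C' \<subseteq> E" by (auto simp: C'_def)
  ultimately have "\<exists>C\<subseteq>E. finite C \<and> card C \<le> n \<and> conn C x z" using C(3) by (intro exI[of _ C']) simp
  then have "z \<in> nb E n x" by (simp add: nb_def)
  with z show "y \<in> \<beta> ` nb E n x" by blast
qed

subsection \<open>Climbing\<close>

lemma climb_at:
  assumes "y \<in> Orb"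
  shows "\<exists>C\<subseteq>E. \<exists>z\<in>Orb. finite C \<and> card C \<le> L \<and> conn C y z \<and> h z = h y + g \<and>
      (\<forall>e\<in>C. (\<forall>u\<in>e. h y \<le> h u \<and> h u \<le> h y + g) \<and> (\<exists>u\<in>e. h u = h y))"
proof -
  obtain C z where C: "C \<subseteq> E" "z \<in> Orb" "finite C" "card C \<le> L" "conn C rt z" "h z = h rt + g"
    "\<And>e. e \<in> C \<Longrightarrow> (\<forall>u\<in>e. h rt \<le> h u \<and> h u \<le> h rt + g) \<and> (\<exists>u\<in>e. h u = h rt)" using climb by blast
  obtain \<beta> where b: "\<beta> \<in> \<Gamma>" "\<beta> rt = y" using Orb_trans[OF rt assms] by blast
  have s: "h (\<beta> u) = h u + (h y - h rt)" if "u \<in> V" for u using h_shift[OF b(1) that rt_V] b(2) by simp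
  have 1: "(\<forall>u\<in>\<beta> ` e. h y \<le> h u \<and> h u \<le> h y + g) \<and> (\<exists>u\<in>\<beta> ` e. h u = h y)" if "e \<in> C" for e
  proof -
    have "e \<subseteq> V" using that C(1) edge_sub(1) by blast
    then show ?thesis using C(7)[OF that] s by (auto simp: subset_iff)
  qed
  have zV: "z \<in> V" using C(2) Orb_sub by auto
  show ?thesis
  proof (rule exI[of _ "(`) \<beta> ` C"], intro conjI bexI[of _ "\<beta> z"])
    show "(`) \<beta> ` C \<subseteq> E" by (rule aut_edges[OF b(1) C(1)])
    show "card ((`) \<beta> ` C) \<le> L" using card_image_le[OF C(3), of "(`) \<beta>"] C(4) by linarith
    show "conn ((`) \<beta> ` C) y (\<beta> z)" using conn_image[OF C(5), of \<beta>] b(2) by simp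
    show "h (\<beta> z) = h y + g" using s[OF zV] C(6) by simp
    show "\<beta> z \<in> Orb" using Orb_inv[OF b(1) zV] C(2) by simp
  qed (use 1 C in auto)
qed

text \<open>Every edge of a unit climb has an end at the starting height, which is below
  \<open>T\<close> as long as the climb goes on. So the edges stay in the slab even when the last
  climb overshoots, by at most \<open>g\<close>.\<close>

lemma climb_to:
  assumes "y \<in> Orb" "T \<le> h y + n * g"
  shows "\<exists>C z. C \<subseteq> Reg (h y) T \<and> finite C \<and> card C \<le> n * L \<and> z \<in> Orb \<and> T \<le> h z \<and> h z \<le> max (h y) (T + g) \<and> conn C y z"
  using assms
proof (induction n arbitrary: y)
  case 0
  then show ?case by (intro exI[of _ "{}"] exI[of _ y]) auto
next
  case (Suc n)
  show ?case
  proof (cases "T \<le> h y")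
    case True
    then show ?thesis using Suc.prems by (intro exI[of _ "{}"] exI[of _ y]) auto
  next
    case False
    obtain C z where C: "C \<subseteq> E" "z \<in> Orb" "finite C" "card C \<le> L" "conn C y z" "h z = h y + g"
      "\<And>e. e \<in> C \<Longrightarrow> (\<forall>u\<in>e. h y \<le> h u \<and> h u \<le> h y + g) \<and> (\<exists>u\<in>e. h u = h y)" using climb_at[OF Suc.prems(1)] by blast
    have "T \<le> h z + n * g" using Suc.prems(2) C(6) by (simp add: algebra_simps)
    from Suc.IH[OF C(2) this] obtain C' z' where C': "C' \<subseteq> Reg (h z) T" "finite C'" "card C' \<le> n * L"
      "z' \<in> Orb" "T \<le> h z'" "h z' \<le> max (h z) (T + g)" "conn C' z z'" by blast
    have "C \<subseteq> Reg (h y) T"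
    proof
      fix e assume e: "e \<in> C"
      then obtain u where "u \<in> e" "h u = h y" using C(7) by blast
      with e C(1,7) False show "e \<in> Reg (h y) T" unfolding Reg_def by (auto intro!: bexI[of _ u])
    qed
    moreover have "C' \<subseteq> Reg (h y) T" using C'(1) Reg_mono[of "h y" "h z" T T] C(6) g by auto
    moreover have "card (C \<union> C') \<le> Suc n * L" using card_Un_le[of C C'] C(4) C'(3) by simp
    moreover have "conn (C \<union> C') y z'" using C(5) C'(7) by (meson conn_mono conn_trans sup_ge1 sup_ge2)
    moreover have "h z' \<le> max (h y) (T + g)" using C'(6) C(6) False by simp
    ultimately show ?thesis using C C' by (intro exI[of _ "C \<union> C'"] exI[of _ z']) auto
  qed
qed

text \<open>A climb used backwards: choose the automorphism that takes its top, rather than its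
  foot, to \<open>y\<close>.\<close>

lemma descend:
  assumes "y \<in> Orb"
  shows "\<exists>C\<subseteq>E. \<exists>w\<in>Orb. finite C \<and> card C \<le> n * L \<and> conn C w y \<and> h w = h y - n * g \<and>
      (\<forall>e\<in>C. \<forall>u\<in>e. h w \<le> h u \<and> h u \<le> h y)"
  using assms
proof (induction n arbitrary: y)
  case 0
  then show ?case by (intro exI[of _ "{}"]) auto
next
  case (Suc n)
  obtain C z where C: "C \<subseteq> E" "z \<in> Orb" "finite C" "card C \<le> L" "conn C rt z" "h z = h rt + g"
    "\<And>e. e \<in> C \<Longrightarrow> (\<forall>u\<in>e. h rt \<le> h u \<and> h u \<le> h rt + g) \<and> (\<exists>u\<in>e. h u = h rt)" using climb by blast
  obtain \<beta> where b: "\<beta> \<in> \<Gamma>" "\<beta> z = y" using Orb_trans[OF C(2) Suc.prems] by blast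
  have zV: "z \<in> V" using C(2) Orb_sub by auto
  have s: "h (\<beta> u) = h u + (h y - h z)" if "u \<in> V" for u using h_shift[OF b(1) that zV] b(2) by simp
  have w: "\<beta> rt \<in> Orb" using Orb_inv[OF b(1) rt_V] rt by simp
  have hw: "h (\<beta> rt) = h y - g" using s[OF rt_V] C(6) by simp
  from Suc.IH[OF w] obtain C' w' where C': "C' \<subseteq> E" "w' \<in> Orb" "finite C'" "card C' \<le> n * L"
    "conn C' w' (\<beta> rt)" "h w' = h (\<beta> rt) - n * g" "\<forall>e\<in>C'. \<forall>u\<in>e. h w' \<le> h u \<and> h u \<le> h (\<beta> rt)" by blast
  have hw': "h w' = h y - Suc n * g" using C'(6) hw by (simp add: algebra_simps)
  have le: "h w' \<le> h (\<beta> rt)" using C'(6) g by simp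
  have 1: "\<forall>u\<in>\<beta> ` e. h (\<beta> rt) \<le> h u \<and> h u \<le> h y" if "e \<in> C" for e
  proof -
    have "e \<subseteq> V" using that C(1) edge_sub(1) by blast
    then show ?thesis using C(6) C(7)[OF that] s hw by (auto simp: subset_iff)
  qed
  show ?case
  proof (rule exI[of _ "(`) \<beta> ` C \<union> C'"], intro conjI bexI[of _ w'])
    show "(`) \<beta> ` C \<union> C' \<subseteq> E" using aut_edges[OF b(1) C(1)] C'(1) by auto
    show "card ((`) \<beta> ` C \<union> C') \<le> Suc n * L"
      using card_Un_le[of "(`) \<beta> ` C" C'] card_image_le[OF C(3), of "(`) \<beta>"] C(4) C'(4) by simp
    show "conn ((`) \<beta> ` C \<union> C') w' y"
      using conn_image[OF C(5), of \<beta>] b(2) C'(5) by (meson conn_mono conn_trans sup_ge1 sup_ge2)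
    show "\<forall>e\<in>(`) \<beta> ` C \<union> C'. \<forall>u\<in>e. h w' \<le> h u \<and> h u \<le> h y"
    proof (intro ballI)
      fix e u assume "e \<in> (`) \<beta> ` C \<union> C'" "u \<in> e"
      then consider "h (\<beta> rt) \<le> h u \<and> h u \<le> h y" | "h w' \<le> h u \<and> h u \<le> h (\<beta> rt)" using 1 C'(7) by blast
      then show "h w' \<le> h u \<and> h u \<le> h y" using le hw g by cases auto
    qed
  qed (use C C' hw' in auto)
qed

end

section \<open>Reaching high levels\<close>

context tilted
begin

definition reach :: "'v \<Rightarrow> real \<Rightarrow> real \<Rightarrow> 'v set set \<Rightarrow> bool" where
  "reach x r T \<xi> \<longleftrightarrow> (\<exists>z\<in>Orb. T \<le> h z \<and> conn (\<xi> \<inter> Reg r T) x z)"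

text \<open>What is found when the slab between \<open>h x\<close> and \<open>r\<close> is explored
  from \<open>x\<close>. For \<open>h x \<le> r\<close> no candidate is higher than
  \<open>r + t0\<close>, since it is reached by an edge with an end below \<open>r\<close> or is
  \<open>x\<close> itself.\<close>

definition cand :: "'v \<Rightarrow> real \<Rightarrow> 'v set set \<Rightarrow> 'v set" where
  "cand x r \<xi> = {y \<in> Orb. r \<le> h y \<and> conn (\<xi> \<inter> Reg (h x) r) x y}"

lemma incr_reach: "incr (reach x r T)"
proof (rule incrI)
  fix \<xi> \<xi>' :: "'v set set" assume s: "\<xi> \<subseteq> \<xi>'" and "reach x r T \<xi>"
  then obtain z where z: "z \<in> Orb" "T \<le> h z" "conn (\<xi> \<inter> Reg r T) x z" unfolding reach_def by blast
  have "conn (\<xi>' \<inter> Reg r T) x z" by (rule conn_mono[OF z(3)]) (use s in auto)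
  with z show "reach x r T \<xi>'" unfolding reach_def by blast
qed

lemma incr_reach_Bex: "incr (\<lambda>\<xi>. \<exists>y\<in>Q. reach y r T \<xi>)" using incr_reach unfolding incr_def by blast

lemma reach_cand: "reach x (h x) T \<xi> \<longleftrightarrow> cand x T \<xi> \<noteq> {}" by (auto simp: reach_def cand_def)

lemma reach_mono_start:
  assumes "r' \<le> r" "reach x r T \<xi>"
  shows "reach x r' T \<xi>"
proof -
  obtain z where z: "z \<in> Orb" "T \<le> h z" "conn (\<xi> \<inter> Reg r T) x z" using assms(2) unfolding reach_def by blast
  have "conn (\<xi> \<inter> Reg r' T) x z" by (rule conn_mono[OF z(3)]) (use Reg_mono[OF assms(1), of T T] in auto)
  with z show ?thesis unfolding reach_def by blast
qed

lemma reach_Reg: "reach x r T (\<xi> \<inter> Reg r T) = reach x r T \<xi>" by (simp add: reach_def Int_assoc)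

lemma cand_Reg: "cand x r (\<xi> \<inter> Reg (h x) r) = cand x r \<xi>" by (simp add: cand_def Int_assoc)

lemma cand_sub: "\<xi> \<subseteq> F \<Longrightarrow> cand x r \<xi> \<subseteq> insert x (\<Union>F)"
proof
  fix y assume "\<xi> \<subseteq> F" "y \<in> cand x r \<xi>"
  then have "conn (\<xi> \<inter> Reg (h x) r) x y" by (simp add: cand_def)
  from conn_Union[OF this] \<open>\<xi> \<subseteq> F\<close> show "y \<in> insert x (\<Union>F)" by auto
qed

lemma cand_height: "h x \<le> r \<Longrightarrow> y \<in> cand x r \<xi> \<Longrightarrow> r \<le> h y \<and> h y \<le> r + t0"
  using conn_Reg[of \<xi> "h x" r x y] g by (auto simp: cand_def)

lemma cand_Orb: "cand x r \<xi> \<subseteq> Orb" by (auto simp: cand_def)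

lemma finite_cand: "finite F \<Longrightarrow> F \<subseteq> E \<Longrightarrow> \<xi> \<subseteq> F \<Longrightarrow> finite (cand x r \<xi>)"
  using cand_sub[of \<xi> F x r] finite_verts[of F] by (meson finite.insertI finite_subset)

lemma reach_join:
  assumes "y \<in> cand x r \<xi>" "reach y r T \<xi>" "h x \<le> r" "r \<le> T"
  shows "reach x (h x) T \<xi>"
proof -
  obtain z where z: "z \<in> Orb" "T \<le> h z" "conn (\<xi> \<inter> Reg r T) y z" using assms(2) unfolding reach_def by blast
  have "conn (\<xi> \<inter> Reg (h x) T) x y" using assms(1) Reg_mono[of "h x" "h x" r T] assms(4) unfolding cand_def
    by (auto intro: conn_mono)
  moreover have "conn (\<xi> \<inter> Reg (h x) T) y z"
    using z(3) by (rule conn_mono) (use Reg_mono[of "h x" r T T] assms(3) in auto)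
  ultimately show ?thesis using z unfolding reach_def by (blast intro: conn_trans)
qed

text \<open>Explore the slab up to level \<open>r\<close>; everything above is independent of what was found.\<close>

lemma explore:
  assumes p: "0 \<le> p" "p \<le> 1" and x: "x \<in> Orb" "h x \<le> r" "r \<le> T" and F: "finite F" "F \<subseteq> E"
    and f: "\<And>Q. finite Q \<Longrightarrow> Q \<subseteq> Orb \<Longrightarrow> (\<And>y. y \<in> Q \<Longrightarrow> r \<le> h y \<and> h y \<le> r + t0) \<Longrightarrow>
      \<exists>F'. finite F' \<and> F' \<subseteq> E \<and> f Q \<le> Pr p F' (\<lambda>\<xi>. \<exists>y\<in>Q. reach y r T \<xi>)"
  shows "\<exists>F'. finite F' \<and> F' \<subseteq> E \<and> F \<subseteq> F' \<and> Ex p F (\<lambda>\<xi>. f (cand x r \<xi>)) \<le> Pr p F' (reach x (h x) T)"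
proof -
  \<comment> \<open>Only finitely many sets can occur as candidates, so that one finite edge set
    serves all of them.\<close>
  define U where "U = Pow (insert x (\<Union>F) \<inter> {y \<in> Orb. r \<le> h y \<and> h y \<le> r + t0})"
  have U: "finite U" using finite_verts[OF F] by (simp add: U_def)
  have "\<forall>Q\<in>U. \<exists>F'. finite F' \<and> F' \<subseteq> E \<and> f Q \<le> Pr p F' (\<lambda>\<xi>. \<exists>y\<in>Q. reach y r T \<xi>)"
  proof
    fix Q assume "Q \<in> U"
    then have "Q \<subseteq> insert x (\<Union>F)" "Q \<subseteq> Orb" "\<And>y. y \<in> Q \<Longrightarrow> r \<le> h y \<and> h y \<le> r + t0" by (auto simp: U_def)
    moreover have "finite (insert x (\<Union>F))" using finite_verts[OF F] by simp
    ultimately show "\<exists>F'. finite F' \<and> F' \<subseteq> E \<and> f Q \<le> Pr p F' (\<lambda>\<xi>. \<exists>y\<in>Q. reach y r T \<xi>)"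
      by (intro f) (auto intro: finite_subset)
  qed
  from bchoice[OF this] obtain FQ where FQ: "\<And>Q. Q \<in> U \<Longrightarrow> finite (FQ Q) \<and> FQ Q \<subseteq> E \<and>
      f Q \<le> Pr p (FQ Q) (\<lambda>\<xi>. \<exists>y\<in>Q. reach y r T \<xi>)" by blast
  define F' where "F' = F \<union> \<Union>(FQ ` U)"
  have F': "finite F'" "F' \<subseteq> E" "F \<subseteq> F'" using F U FQ by (auto simp: F'_def)
  let ?c = "\<lambda>\<xi>. cand x r (\<xi> \<inter> F)" and ?R = "\<lambda>Q \<xi>. \<exists>y\<in>Q. reach y r T \<xi>"
  have cU: "?c \<xi> \<in> U" for \<xi> using cand_sub[of "\<xi> \<inter> F" F x r] cand_height[OF x(2)] cand_Orb by (fastforce simp: U_def)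
  have "Ex p F (\<lambda>\<xi>. f (cand x r \<xi>)) = Ex p F' (\<lambda>\<xi>. f (?c \<xi>))"
    using Ex_restrict[OF F'(1,3), where f = "\<lambda>\<xi>. f (cand x r \<xi>)" and p = p] by simp
  also have "\<dots> = Ex p F' (\<lambda>\<xi>. \<Sum>Q\<in>U. of_bool (?c \<xi> = Q) * f Q)"
  proof (intro Ex_cong)
    fix \<xi>
    have "(\<Sum>Q\<in>U. of_bool (?c \<xi> = Q) * f Q) = (\<Sum>Q\<in>U. if Q = ?c \<xi> then f Q else 0)" by (intro sum.cong refl) auto
    then show "f (?c \<xi>) = (\<Sum>Q\<in>U. of_bool (?c \<xi> = Q) * f Q)" using U cU by simp
  qed
  also have "\<dots> = (\<Sum>Q\<in>U. Pr p F' (\<lambda>\<xi>. ?c \<xi> = Q) * f Q)" by (simp add: Ex_sum Ex_cmult_right)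
  also have "\<dots> \<le> (\<Sum>Q\<in>U. Pr p F' (\<lambda>\<xi>. ?c \<xi> = Q) * Pr p F' (?R Q))"
  proof (intro sum_mono mult_left_mono)
    fix Q assume Q: "Q \<in> U"
    have "f Q \<le> Pr p (FQ Q) (?R Q)" using FQ Q by blast
    also have "\<dots> \<le> Pr p F' (?R Q)" using Q by (intro Pr_mono_set p F' incr_reach_Bex) (auto simp: F'_def)
    finally show "f Q \<le> Pr p F' (?R Q)" .
  qed (use p in auto)
  also have "\<dots> = (\<Sum>Q\<in>U. Ex p F' (\<lambda>\<xi>. of_bool (?c \<xi> = Q) * of_bool (?R Q \<xi>)))"
  proof (intro sum.cong refl)
    fix Q
    have c: "?c \<xi> = ?c (\<xi> \<inter> Reg (h x) r)" for \<xi> using cand_Reg[of x r "\<xi> \<inter> F"] by (simp add: Int_ac)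
    show "Pr p F' (\<lambda>\<xi>. ?c \<xi> = Q) * Pr p F' (?R Q) = Ex p F' (\<lambda>\<xi>. of_bool (?c \<xi> = Q) * of_bool (?R Q \<xi>))"
    proof (rule Ex_indep[symmetric, OF F'(1) Reg_disjoint[of r r "h x" T]])
      show "of_bool (?c \<xi> = Q) = of_bool (?c (\<xi> \<inter> Reg (h x) r) = Q)" for \<xi> using c[of \<xi>] by simp
      show "of_bool (?R Q \<xi>) = of_bool (?R Q (\<xi> \<inter> Reg r T))" for \<xi> by (simp add: reach_Reg)
    qed simp
  qed
  also have "\<dots> = Ex p F' (\<lambda>\<xi>. \<Sum>Q\<in>U. of_bool (?c \<xi> = Q) * of_bool (?R Q \<xi>))" by (simp add: Ex_sum)
  also have "\<dots> \<le> Pr p F' (reach x (h x) T)"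
  proof (intro Ex_mono p)
    fix \<xi>
    have "(\<Sum>Q\<in>U. of_bool (?c \<xi> = Q) * of_bool (?R Q \<xi>)) = (\<Sum>Q\<in>U. if Q = ?c \<xi> then of_bool (?R Q \<xi>) else (0::real))"
      by (intro sum.cong refl) auto
    also have "\<dots> = of_bool (?R (?c \<xi>) \<xi>)" using U cU by simp
    also have "\<dots> \<le> of_bool (reach x (h x) T \<xi>)"
    proof -
      have "reach x (h x) T \<xi>" if R: "?R (?c \<xi>) \<xi>"
      proof -
        obtain y where y: "y \<in> ?c \<xi>" "reach y r T \<xi>" using R by blast
        have "y \<in> cand x r \<xi>" using y(1) unfolding cand_def by (auto elim: conn_mono)
        then show ?thesis using reach_join y(2) x by blast
      qed
      then show ?thesis by auto
    qed
    finally show "(\<Sum>Q\<in>U. of_bool (?c \<xi> = Q) * of_bool (?R Q \<xi>)) \<le> (of_bool (reach x (h x) T \<xi>) :: real)" .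
  qed
  finally show ?thesis using F' by blast
qed

lemma reach_aut:
  assumes "\<beta> \<in> \<Gamma>" "\<xi> \<subseteq> E" "x \<in> V"
  shows "reach (\<beta> x) (r + (h (\<beta> x) - h x)) (T + (h (\<beta> x) - h x)) ((`) \<beta> ` \<xi>) \<longleftrightarrow> reach x r T \<xi>"
proof -
  let ?s = "h (\<beta> x) - h x"
  have im: "(`) \<beta> ` \<xi> \<inter> Reg (r + ?s) (T + ?s) = (`) \<beta> ` (\<xi> \<inter> Reg r T)"
    using Reg_image(1)[OF assms(1,3)] aut_Int[OF assms(1,2) Reg_E] by simp
  have *: "z \<in> Orb \<and> T \<le> h z \<and> conn (\<xi> \<inter> Reg r T) x z \<longleftrightarrow>
      \<beta> z \<in> Orb \<and> T + ?s \<le> h (\<beta> z) \<and> conn ((`) \<beta> ` (\<xi> \<inter> Reg r T)) (\<beta> x) (\<beta> z)" if "z \<in> V" for z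
    using conn_aut[OF assms(1) _ assms(3) that, of "\<xi> \<inter> Reg r T"] assms(2)
      h_shift[OF assms(1) that assms(3)] Orb_inv[OF assms(1) that] by auto
  have onto: "\<exists>z\<in>V. w = \<beta> z" if "w \<in> V" for w using aut(1)[OF assms(1)] that by (auto simp: bij_betw_def)
  show ?thesis unfolding reach_def im
  proof
    assume "\<exists>w\<in>Orb. T + ?s \<le> h w \<and> conn ((`) \<beta> ` (\<xi> \<inter> Reg r T)) (\<beta> x) w"
    then obtain w where w: "w \<in> Orb" "T + ?s \<le> h w" "conn ((`) \<beta> ` (\<xi> \<inter> Reg r T)) (\<beta> x) w" by blast
    obtain z where "z \<in> V" "w = \<beta> z" using onto w(1) Orb_sub by blast
    with w * show "\<exists>z\<in>Orb. T \<le> h z \<and> conn (\<xi> \<inter> Reg r T) x z" by blast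
  next
    assume "\<exists>z\<in>Orb. T \<le> h z \<and> conn (\<xi> \<inter> Reg r T) x z"
    then obtain z where "z \<in> Orb" "T \<le> h z" "conn (\<xi> \<inter> Reg r T) x z" by blast
    moreover have "z \<in> V" using \<open>z \<in> Orb\<close> Orb_sub by auto
    ultimately show "\<exists>w\<in>Orb. T + ?s \<le> h w \<and> conn ((`) \<beta> ` (\<xi> \<inter> Reg r T)) (\<beta> x) w" using * by blast
  qed
qed

lemma Pr_reach_aut:
  assumes "\<beta> \<in> \<Gamma>" "F \<subseteq> E" "finite F" "x \<in> V"
  shows "Pr p ((`) \<beta> ` F) (reach (\<beta> x) (h (\<beta> x)) (h (\<beta> x) + \<sigma>)) = Pr p F (reach x (h x) (h x + \<sigma>))"
proof -
  have "reach (\<beta> x) (h (\<beta> x)) (h (\<beta> x) + \<sigma>) ((`) \<beta> ` \<xi>) = reach x (h x) (h x + \<sigma>) \<xi>" if "\<xi> \<subseteq> F" for \<xi>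
    using reach_aut[OF assms(1) _ assms(4), of \<xi> "h x" "h x + \<sigma>"] that assms(2) by (simp add: algebra_simps)
  then show ?thesis unfolding Pr_aut[OF assms(1-3)] by (intro Ex_cong) simp
qed

text \<open>The probability of reaching relative height \<open>\<sigma>\<close> inside the upper half-space.\<close>

definition aa :: "real \<Rightarrow> real \<Rightarrow> real" where
  "aa p \<sigma> = (SUP F\<in>{F. finite F \<and> F \<subseteq> E}. Pr p F (reach rt (h rt) (h rt + \<sigma>)))"

lemma aa_bdd:
  "0 \<le> p \<Longrightarrow> p \<le> 1 \<Longrightarrow> bdd_above ((\<lambda>F. Pr p F (reach rt (h rt) (h rt + \<sigma>))) ` {F. finite F \<and> F \<subseteq> E})"
  by (rule bdd_aboveI[of _ 1]) auto

lemma aa_upper: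
  assumes "0 \<le> p" "p \<le> 1" "x \<in> Orb" "finite F" "F \<subseteq> E"
  shows "Pr p F (reach x (h x) (h x + \<sigma>)) \<le> aa p \<sigma>"
proof -
  obtain \<beta> where b: "\<beta> \<in> \<Gamma>" "\<beta> x = rt" using Orb_trans assms(3) rt by blast
  have "x \<in> V" using assms(3) Orb_sub by auto
  from Pr_reach_aut[OF b(1) assms(5,4) this, of p \<sigma>]
  have "Pr p F (reach x (h x) (h x + \<sigma>)) = Pr p ((`) \<beta> ` F) (reach rt (h rt) (h rt + \<sigma>))" by (simp add: b(2))
  also have "\<dots> \<le> aa p \<sigma>" unfolding aa_def using assms aut_edges[OF b(1) assms(5)] by (intro cSUP_upper aa_bdd) auto
  finally show ?thesis .
qed

lemma aa_lower:
  assumes "0 \<le> p" "p \<le> 1" "x \<in> Orb" "c < aa p \<sigma>"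
  shows "\<exists>F. finite F \<and> F \<subseteq> E \<and> c < Pr p F (reach x (h x) (h x + \<sigma>))"
proof -
  have "{F. finite F \<and> F \<subseteq> E} \<noteq> {}" by blast
  then obtain F where F: "finite F" "F \<subseteq> E" "c < Pr p F (reach rt (h rt) (h rt + \<sigma>))"
    using less_cSUP_iff[OF _ aa_bdd[OF assms(1,2), of \<sigma>], of c] assms(4) unfolding aa_def by auto
  obtain \<beta> where b: "\<beta> \<in> \<Gamma>" "\<beta> rt = x" using Orb_trans assms(3) rt by blast
  from Pr_reach_aut[OF b(1) F(2,1) rt_V, of p \<sigma>] F(3) b(2)
  have "c < Pr p ((`) \<beta> ` F) (reach x (h x) (h x + \<sigma>))" by simp
  then show ?thesis using F(1) aut_edges[OF b(1) F(2)] by blast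
qed

lemma aa_nonneg: "0 \<le> p \<Longrightarrow> p \<le> 1 \<Longrightarrow> 0 \<le> aa p \<sigma>"
  by (rule order_trans[OF Pr_nonneg aa_upper[of p rt "{}" \<sigma>]]) (auto simp: rt)

section \<open>Supermultiplicativity of the reaching probabilities\<close>

definition m0 :: nat where "m0 = nat \<lceil>t0 / g\<rceil>"

lemma m0: "t0 \<le> m0 * g"
proof -
  have "t0 / g \<le> m0" unfolding m0_def by (simp add: real_nat_ceiling_ge)
  then show ?thesis using g by (simp add: pos_divide_le_eq)
qed

text \<open>A lower bound for the probability of gaining height \<open>t\<close> from a start that
  may already be up to \<open>t0\<close> too high: explore to relative height \<open>t - t0\<close>,
  which misses the target by at most \<open>t0\<close>, and force \<open>m0\<close> unit climbs.
  With this correction the sequence becomes supermultiplicative.\<close>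

definition lam :: "real \<Rightarrow> real \<Rightarrow> real" where
  "lam p t = aa p (t - t0) * p ^ (m0 * L)"

lemma lam_nonneg: "0 \<le> p \<Longrightarrow> p \<le> 1 \<Longrightarrow> 0 \<le> lam p t" by (simp add: lam_def aa_nonneg)

lemma climb_Pr:
  assumes p: "0 \<le> p" "p \<le> 1" and y: "y \<in> Orb" "T \<le> h y + n * g" "r \<le> h y"
  shows "\<exists>F. finite F \<and> F \<subseteq> E \<and> p ^ (n * L) \<le> Pr p F (reach y r T)"
proof -
  obtain C z where C: "C \<subseteq> Reg (h y) T" "finite C" "card C \<le> n * L" "z \<in> Orb" "T \<le> h z" "conn C y z"
    using climb_to[OF y(1,2)] by meson
  have CR: "C \<subseteq> Reg r T" using C(1) Reg_mono[OF y(3), of T T] by auto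
  have "reach y r T \<xi>" if "C \<subseteq> \<xi>" for \<xi>
  proof -
    have "conn (\<xi> \<inter> Reg r T) y z" by (rule conn_mono[OF C(6)]) (use that CR in auto)
    with C show ?thesis unfolding reach_def by blast
  qed
  then have "Pr p C (\<lambda>\<xi>. C \<subseteq> \<xi>) \<le> Pr p C (reach y r T)" using p by (intro Pr_mono) auto
  then have "p ^ card C \<le> Pr p C (reach y r T)" using Pr_superset[OF C(2) subset_refl, of p] by simp
  moreover have "p ^ (n * L) \<le> p ^ card C" using C(3) p by (intro power_decreasing) auto
  ultimately have "p ^ (n * L) \<le> Pr p C (reach y r T)" by linarith
  then show ?thesis using C(2) CR Reg_E by blast
qed

lemma single:
  assumes p: "0 \<le> p" "p \<le> 1" and y: "y \<in> Orb" "T - t \<le> h y" "h y \<le> T - t + t0" and t: "t0 \<le> t"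
    and c: "c < aa p (t - t0)"
  shows "\<exists>F. finite F \<and> F \<subseteq> E \<and> c * p ^ (m0 * L) \<le> Pr p F (reach y (h y) T)"
proof -
  let ?r = "h y + (t - t0)"
  obtain F where F: "finite F" "F \<subseteq> E" "c < Pr p F (reach y (h y) ?r)" using aa_lower[OF p y(1) c] by blast
  define f where "f = (\<lambda>Q :: 'v set. of_bool (Q \<noteq> {}) * p ^ (m0 * L))"
  have "\<exists>F'. finite F' \<and> F' \<subseteq> E \<and> F \<subseteq> F' \<and> Ex p F (\<lambda>\<xi>. f (cand y ?r \<xi>)) \<le> Pr p F' (reach y (h y) T)"
  proof (rule explore[OF p y(1)])
    fix Q assume Q: "finite Q" "Q \<subseteq> Orb" "\<And>u. u \<in> Q \<Longrightarrow> ?r \<le> h u \<and> h u \<le> ?r + t0"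
    show "\<exists>F'. finite F' \<and> F' \<subseteq> E \<and> f Q \<le> Pr p F' (\<lambda>\<xi>. \<exists>u\<in>Q. reach u ?r T \<xi>)"
    proof (cases "Q = {}")
      case True
      then show ?thesis by (auto simp: f_def intro!: exI[of _ "{}"])
    next
      case False
      then obtain u where u: "u \<in> Q" by auto
      then have "u \<in> Orb" "?r \<le> h u" "T \<le> h u + m0 * g" using Q(2) Q(3)[OF u] y m0 by auto
      from climb_Pr[OF p this(1,3,2)] obtain F' where F': "finite F'" "F' \<subseteq> E" "p ^ (m0 * L) \<le> Pr p F' (reach u ?r T)"
        by blast
      have "Pr p F' (reach u ?r T) \<le> Pr p F' (\<lambda>\<xi>. \<exists>u\<in>Q. reach u ?r T \<xi>)" using p u by (intro Pr_mono) auto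
      with F' False show ?thesis by (auto simp: f_def)
    qed
  qed (use y t F in auto)
  then obtain F' where F': "finite F'" "F' \<subseteq> E" "Ex p F (\<lambda>\<xi>. f (cand y ?r \<xi>)) \<le> Pr p F' (reach y (h y) T)" by blast
  have "Ex p F (\<lambda>\<xi>. f (cand y ?r \<xi>)) = Pr p F (reach y (h y) ?r) * p ^ (m0 * L)"
    unfolding f_def Ex_cmult_right reach_cand ..
  moreover have "c * p ^ (m0 * L) \<le> Pr p F (reach y (h y) ?r) * p ^ (m0 * L)"
    using F(3) p by (intro mult_right_mono) auto
  ultimately show ?thesis using F' by auto
qed

lemma aa_pos:
  assumes "0 < p" "p \<le> 1"
  shows "0 < aa p \<sigma>"
proof -
  define n where "n = nat \<lceil>\<sigma> / g\<rceil>"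
  have "\<sigma> / g \<le> n" unfolding n_def by (simp add: real_nat_ceiling_ge)
  then have "h rt + \<sigma> \<le> h rt + n * g" using g by (simp add: pos_divide_le_eq)
  from climb_Pr[OF _ assms(2) rt this order_refl] assms(1)
  obtain F where F: "finite F" "F \<subseteq> E" "p ^ (n * L) \<le> Pr p F (reach rt (h rt) (h rt + \<sigma>))" by auto
  have "0 < p ^ (n * L)" using assms by simp
  also note F(3)
  also have "Pr p F (reach rt (h rt) (h rt + \<sigma>)) \<le> aa p \<sigma>" using assms F rt by (intro aa_upper) auto
  finally show ?thesis .
qed

text \<open>Explore to relative height \<open>s - t0\<close> and continue from one candidate by
  \<open>single\<close>. The suprema are approached from below by \<open>c\<close> and
  \<open>d\<close> and recovered at the end.\<close>

lemma aa_supermult: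
  assumes p: "0 \<le> p" "p \<le> 1" and s: "t0 \<le> s" and t: "t0 \<le> t"
  shows "aa p (s - t0) * (aa p (t - t0) * p ^ (m0 * L)) \<le> aa p (s + t - t0)"
proof -
  let ?A = "aa p (s - t0)" and ?B = "aa p (t - t0)" and ?P = "p ^ (m0 * L)"
  have *: "c * (d * ?P) \<le> aa p (s + t - t0)" if c: "0 \<le> c" "c < ?A" and d: "0 \<le> d" "d < ?B" for c d
  proof -
    let ?r = "h rt + (s - t0)" and ?T = "h rt + (s + t - t0)"
    obtain F where F: "finite F" "F \<subseteq> E" "c < Pr p F (reach rt (h rt) ?r)" using aa_lower[OF p rt c(2)] by blast
    define f where "f = (\<lambda>Q :: 'v set. of_bool (Q \<noteq> {}) * (d * ?P))"
    have "\<exists>F'. finite F' \<and> F' \<subseteq> E \<and> F \<subseteq> F' \<and> Ex p F (\<lambda>\<xi>. f (cand rt ?r \<xi>)) \<le> Pr p F' (reach rt (h rt) ?T)"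
    proof (rule explore[OF p rt])
      fix Q assume Q: "finite Q" "Q \<subseteq> Orb" "\<And>u. u \<in> Q \<Longrightarrow> ?r \<le> h u \<and> h u \<le> ?r + t0"
      show "\<exists>F'. finite F' \<and> F' \<subseteq> E \<and> f Q \<le> Pr p F' (\<lambda>\<xi>. \<exists>u\<in>Q. reach u ?r ?T \<xi>)"
      proof (cases "Q = {}")
        case True
        then show ?thesis by (auto simp: f_def intro!: exI[of _ "{}"])
      next
        case False
        then obtain u where u: "u \<in> Q" by auto
        then have "u \<in> Orb" "?T - t \<le> h u" "h u \<le> ?T - t + t0" using Q by (force simp: algebra_simps)+
        from single[OF p this t d(2)] obtain F' where F': "finite F'" "F' \<subseteq> E"
          "d * ?P \<le> Pr p F' (reach u (h u) ?T)" by blast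
        have "Pr p F' (reach u (h u) ?T) \<le> Pr p F' (\<lambda>\<xi>. \<exists>u\<in>Q. reach u ?r ?T \<xi>)"
          using p u Q(3)[OF u] reach_mono_start by (intro Pr_mono) blast+
        with F' False show ?thesis by (auto simp: f_def intro: order_trans)
      qed
    qed (use s t F g in auto)
    then obtain F' where F': "finite F'" "F' \<subseteq> E" "Ex p F (\<lambda>\<xi>. f (cand rt ?r \<xi>)) \<le> Pr p F' (reach rt (h rt) ?T)"
      by blast
    have "c * (d * ?P) \<le> Pr p F (reach rt (h rt) ?r) * (d * ?P)" using F(3) p d by (intro mult_right_mono) auto
    also have "\<dots> = Ex p F (\<lambda>\<xi>. f (cand rt ?r \<xi>))" unfolding f_def Ex_cmult_right reach_cand ..
    also have "\<dots> \<le> Pr p F' (reach rt (h rt) ?T)" by fact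
    also have "\<dots> \<le> aa p (s + t - t0)" by (rule aa_upper[OF p rt F'(1,2)])
    finally show ?thesis .
  qed
  show ?thesis
  proof (cases "0 < ?A \<and> 0 < ?B")
    case True
    show ?thesis
    proof (rule field_le_mult_one_interval)
      fix u :: real assume u: "0 < u" "u < 1"
      have "v * (u * (?A * (?B * ?P))) \<le> aa p (s + t - t0)" if "0 < v" "v < 1" for v
        using *[of "u * ?A" "v * ?B"] u that True by (simp add: mult_ac)
      then show "u * (?A * (?B * ?P)) \<le> aa p (s + t - t0)" by (rule field_le_mult_one_interval)
    qed
  next
    case False
    then have z: "?A * (?B * ?P) = 0" using aa_nonneg[OF p, of "s - t0"] aa_nonneg[OF p, of "t - t0"] by auto
    show ?thesis unfolding z by (rule aa_nonneg[OF p])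
  qed
qed

lemma lam_supermult:
  assumes "0 \<le> p" "p \<le> 1" "t0 \<le> s" "t0 \<le> t"
  shows "lam p s * lam p t \<le> lam p (s + t)" using mult_right_mono[OF aa_supermult[OF assms], of "p ^ (m0 * L)"] assms
  by (simp add: lam_def mult_ac)

lemma lam_power:
  assumes "0 \<le> p" "p \<le> 1" "t0 \<le> t"
  shows "lam p t ^ Suc n \<le> lam p (real (Suc n) * t)"
proof (induction n)
  case (Suc n)
  have t: "0 < t" using assms g by simp
  have "t0 \<le> real (Suc n) * t" using assms t by (simp add: algebra_simps add_increasing2)
  have "lam p t ^ Suc (Suc n) \<le> lam p t * lam p (real (Suc n) * t)"
    using Suc lam_nonneg[OF assms(1,2)] by (simp add: mult_left_mono)
  also have "\<dots> \<le> lam p (t + real (Suc n) * t)" by (rule lam_supermult) fact+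
  finally show ?case by (simp add: algebra_simps)
qed simp

text \<open>A bound for the susceptibility of all finite subgraphs at once; a bound instead of a
  value keeps all sums finite.\<close>

definition chi :: "real \<Rightarrow> real \<Rightarrow> bool" where
  "chi p Y \<longleftrightarrow> (\<forall>F A x. finite F \<longrightarrow> F \<subseteq> E \<longrightarrow> finite A \<longrightarrow> A \<subseteq> V \<longrightarrow> x \<in> V \<longrightarrow>
    (\<Sum>y\<in>A. tau p F x y) \<le> Y)"

lemma mtp_at:
  fixes f :: "'v set set \<Rightarrow> 'v \<Rightarrow> 'v \<Rightarrow> real"
  assumes inv: "\<And>\<beta> F x y. \<beta> \<in> \<Gamma> \<Longrightarrow> finite F \<Longrightarrow> F \<subseteq> E \<Longrightarrow> x \<in> Orb \<Longrightarrow> y \<in> Orb \<Longrightarrow> f ((`) \<beta> ` F) (\<beta> x) (\<beta> y) = f F x y"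
    and mono: "\<And>F F' x y. finite F' \<Longrightarrow> F' \<subseteq> E \<Longrightarrow> F \<subseteq> F' \<Longrightarrow> x \<in> Orb \<Longrightarrow> y \<in> Orb \<Longrightarrow> f F x y \<le> f F' x y"
    and nonneg: "\<And>F x y. 0 \<le> f F x y"
    and K: "\<And>F B. finite F \<Longrightarrow> F \<subseteq> E \<Longrightarrow> finite B \<Longrightarrow> B \<subseteq> Orb \<Longrightarrow> (\<Sum>y\<in>B. f F rt y) \<le> K"
    and F: "finite F" "F \<subseteq> E" and A: "finite A" "A \<subseteq> Orb" and x: "x \<in> Orb"
  shows "(\<Sum>y\<in>A. f F y x * exp (h y - h x)) \<le> K"
proof -
  obtain \<beta> where b: "\<beta> \<in> \<Gamma>" "\<beta> x = rt" using Orb_trans x rt by blast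
  have xV: "x \<in> V" using x Orb_sub by auto
  have A': "\<beta> ` A \<subseteq> Orb" using A(2) Orb_inv[OF b(1)] Orb_sub by auto
  have "(\<Sum>y\<in>A. f F y x * exp (h y - h x)) = (\<Sum>y\<in>\<beta> ` A. f ((`) \<beta> ` F) y rt * exp (h y - h rt))"
  proof (subst sum.reindex)
    show "inj_on \<beta> A" using aut(1)[OF b(1)] A(2) Orb_sub by (auto simp: bij_betw_def intro: inj_on_subset)
    have "f ((`) \<beta> ` F) (\<beta> y) rt * exp (h (\<beta> y) - h rt) = f F y x * exp (h y - h x)" if "y \<in> A" for y
    proof -
      have yV: "y \<in> Orb" using that A by auto
      show ?thesis using inv[OF b(1) F yV x] h_shift[OF b(1) _ xV, of y] yV Orb_sub by (auto simp: b(2))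
    qed
    then show "(\<Sum>y\<in>A. f F y x * exp (h y - h x)) =
      sum ((\<lambda>y. f ((`) \<beta> ` F) y rt * exp (h y - h rt)) \<circ> \<beta>) A" by simp
  qed
  also have "\<dots> \<le> K" using aut_edges[OF b(1) F(2)] A' F A(1)
    by (intro mtp[of f K "(`) \<beta> ` F" "\<beta> ` A", OF inv mono nonneg K]) auto
  finally show ?thesis .
qed

text \<open>Transporting the symmetric two-point function turns the untilted sum into the one tilted
  by the full modular weight.\<close>

lemma chi_tilted:
  assumes p: "0 \<le> p" "p \<le> 1" and Y: "chi p Y" and F: "finite F" "F \<subseteq> E" and A: "finite A" "A \<subseteq> Orb" and x: "x \<in> Orb"
  shows "(\<Sum>y\<in>A. tau p F x y * exp (h y - h x)) \<le> Y" unfolding conn_commute[of _ x]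
proof (rule mtp_at[where f = "\<lambda>F x y. tau p F x y"])
  fix \<beta> F x y assume a: "\<beta> \<in> \<Gamma>" "finite F" "F \<subseteq> E" "x \<in> Orb" "y \<in> Orb"
  show "Pr p ((`) \<beta> ` F) (\<lambda>\<xi>. conn \<xi> (\<beta> x) (\<beta> y)) = tau p F x y" using a Orb_sub by (intro Pr_conn_aut') auto
next
  fix F B assume "finite F" "F \<subseteq> E" "finite B" "B \<subseteq> Orb"
  then show "(\<Sum>y\<in>B. tau p F rt y) \<le> Y" using Y rt_V Orb_sub unfolding chi_def by blast
qed (use p F A x in \<open>auto intro!: Pr_mono_set incr_conn\<close>)

text \<open>Markov's inequality for the tilted sum: an endpoint at relative height at least \<sigma>
  carries a weight of at least \<open>exp \<sigma>\<close>.\<close>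

lemma aa_le_chi:
  assumes p: "0 \<le> p" "p \<le> 1" and Y: "chi p Y"
  shows "aa p \<sigma> \<le> Y * exp (- \<sigma>)" unfolding aa_def
proof (rule cSUP_least)
  fix F assume "F \<in> {F. finite F \<and> F \<subseteq> E}"
  then have F: "finite F" "F \<subseteq> E" by auto
  define A where "A = {z \<in> insert rt (\<Union>F). z \<in> Orb \<and> h rt + \<sigma> \<le> h z}"
  have A: "finite A" "A \<subseteq> Orb" using finite_verts[OF F] finite_subset[of A "insert rt (\<Union>F)"] by (auto simp: A_def)
  have "Pr p F (reach rt (h rt) (h rt + \<sigma>)) \<le> (\<Sum>z\<in>A. tau p F rt z)"
  proof (rule Pr_Bex_le[OF p A(1)])
    fix \<xi> assume om: "\<xi> \<subseteq> F" "reach rt (h rt) (h rt + \<sigma>) \<xi>"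
    then obtain z where z: "z \<in> Orb" "h rt + \<sigma> \<le> h z" "conn (\<xi> \<inter> Reg (h rt) (h rt + \<sigma>)) rt z"
      unfolding reach_def by blast
    have c: "conn \<xi> rt z" by (rule conn_mono[OF z(3)]) auto
    then have "z \<in> A" using conn_Union[OF c] om(1) z by (auto simp: A_def)
    with c show "\<exists>z\<in>A. conn \<xi> rt z" by blast
  qed
  also have "\<dots> \<le> (\<Sum>z\<in>A. tau p F rt z * exp (h z - h rt) * exp (- \<sigma>))"
  proof (rule sum_mono)
    fix z assume "z \<in> A"
    then have 1: "1 \<le> exp (h z - h rt) * exp (- \<sigma>)" by (simp add: A_def exp_add[symmetric])
    then show "tau p F rt z \<le> tau p F rt z * exp (h z - h rt) * exp (- \<sigma>)"
      using mult_left_mono[OF 1 Pr_nonneg[OF p]] by (simp add: mult.assoc)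
  qed
  also have "\<dots> \<le> Y * exp (- \<sigma>)"
    unfolding sum_distrib_right[symmetric] using chi_tilted[OF p Y F A rt] by (intro mult_right_mono) auto
  finally show "Pr p F (reach rt (h rt) (h rt + \<sigma>)) \<le> Y * exp (- \<sigma>)" .
qed auto

text \<open>Fekete's argument. A violation at \<open>t\<close> would be amplified exponentially
  along the multiples of \<open>t\<close>, against the bound of \<open>aa_le_chi\<close>; so the
  constant \<open>Y\<close> disappears.\<close>

lemma lam_le_chi:
  assumes p: "0 \<le> p" "p \<le> 1" and Y: "chi p Y" and t: "t0 \<le> t"
  shows "lam p t \<le> exp (- t)"
proof (rule ccontr)
  assume "\<not> lam p t \<le> exp (- t)"
  then have 1: "1 < lam p t * exp t" by (simp add: exp_minus field_simps)
  obtain n where n: "Y * exp t0 < (lam p t * exp t) ^ n" using real_arch_pow[OF 1] by blast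
  have "(lam p t * exp t) ^ n \<le> (lam p t * exp t) ^ Suc n" using 1 by (intro power_increasing) auto
  also have "\<dots> = lam p t ^ Suc n * exp (real (Suc n) * t)" unfolding power_mult_distrib by (simp only: exp_of_nat_mult)
  also have "\<dots> \<le> aa p (real (Suc n) * t - t0) * exp (real (Suc n) * t)"
  proof (intro mult_right_mono)
    have "p ^ (m0 * L) \<le> 1" using p by (simp add: power_le_one)
    then have "lam p (real (Suc n) * t) \<le> aa p (real (Suc n) * t - t0)"
      unfolding lam_def using aa_nonneg[OF p] by (intro mult_left_le) auto
    with lam_power[OF p t, of n] show "lam p t ^ Suc n \<le> aa p (real (Suc n) * t - t0)" by linarith
  qed simp
  also have "\<dots> \<le> Y * exp (- (real (Suc n) * t - t0)) * exp (real (Suc n) * t)"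
    by (intro mult_right_mono aa_le_chi[OF p Y]) simp
  also have "\<dots> = Y * exp t0" by (simp add: mult.assoc exp_add[symmetric])
  finally show False using n by simp
qed

text \<open>Expectations over a finite edge set are polynomials in p. The factor
  \<open>q ^ k\<close> accommodates the forced climbs in \<open>lam\<close>.\<close>

lemma Pr_limit_left:
  assumes "p0 < p" and le: "\<And>q. p0 < q \<Longrightarrow> q < p \<Longrightarrow> Ex q F f * q ^ k \<le> c"
  shows "Ex p F f * p ^ k \<le> c"
proof (rule tendsto_upperbound)
  have "continuous_on UNIV (\<lambda>q. Ex q F f * q ^ k)" by (intro continuous_intros continuous_Ex)
  then have "((\<lambda>q. Ex q F f * q ^ k) \<longlongrightarrow> Ex p F f * p ^ k) (at p)"
    by (simp add: continuous_on_eq_continuous_at isCont_def)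
  then show "((\<lambda>q. Ex q F f * q ^ k) \<longlongrightarrow> Ex p F f * p ^ k) (at_left p)" by (rule filterlim_mono) (auto simp: at_le)
  show "\<forall>\<^sub>F q in at_left p. Ex q F f * q ^ k \<le> c" using eventually_at_left[OF assms(1)] le assms(1) by blast
qed simp

text \<open>The bound is free of \<open>Y\<close>, so it survives a limit along which
  \<open>Y\<close> may explode. The supremum in \<open>aa\<close> is taken only after the
  limit.\<close>

lemma lam_le_limit:
  assumes p: "p0 < p" "0 \<le> p0" "p \<le> 1" and c: "\<And>q. p0 < q \<Longrightarrow> q < p \<Longrightarrow> \<exists>Y. chi q Y" and t: "t0 \<le> t"
  shows "lam p t \<le> exp (- t)"
proof -
  have *: "Pr p F (reach rt (h rt) (h rt + (t - t0))) * p ^ (m0 * L) \<le> exp (- t)" if F: "finite F" "F \<subseteq> E" for F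
  proof (rule Pr_limit_left[OF p(1)])
    fix q assume q: "p0 < q" "q < p"
    then obtain Y where "chi q Y" using c by blast
    then have "lam q t \<le> exp (- t)" using lam_le_chi[of q Y t] q p t by simp
    moreover have "Pr q F (reach rt (h rt) (h rt + (t - t0))) * q ^ (m0 * L) \<le> lam q t"
      unfolding lam_def using q p F by (intro mult_right_mono aa_upper rt) auto
    ultimately show "Pr q F (reach rt (h rt) (h rt + (t - t0))) * q ^ (m0 * L) \<le> exp (- t)" by linarith
  qed
  have pp: "0 < p ^ (m0 * L)" using p by simp
  have "aa p (t - t0) \<le> exp (- t) / p ^ (m0 * L)"
    unfolding aa_def using * pp by (intro cSUP_least) (auto simp: pos_le_divide_eq)
  then show ?thesis using pp by (simp add: lam_def pos_le_divide_eq)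
qed

end

section \<open>Lineages\<close>

text \<open>Discarding everything off one path leaves only edges near the start. Such locality of
  the forced climbs is needed for the independence of distant lineages.\<close>

lemma conn_shrink:
  assumes "conn C y z" "finite C"
  shows "\<exists>C'\<subseteq>C. conn C' y z \<and> (\<forall>e\<in>C'. e \<subseteq> nb C (card C) y)"
proof -
  obtain xs where xs: "spath C y z xs" using assms(1) by (rule conn_spath)
  have "u \<in> nb C (card C) y" if u: "u \<in> set xs" for u
  proof -
    obtain as bs where "xs = as @ u # bs" using u by (meson split_list)
    with xs have "conn C y u" using spath_conn[OF spath_split(1)[of C y z as u bs]] by simp
    then show ?thesis using conn_in_nb[of C y u C] assms(2) by simp
  qed
  then have "\<forall>e\<in>path_edges xs. e \<subseteq> nb C (card C) y" using path_edges_subset_set by blast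
  moreover have "path_edges xs \<subseteq> C" using xs by (simp add: spath_def)
  moreover have "conn (path_edges xs) y z" using spath_conn[OF spath_sub[OF xs]] .
  ultimately show ?thesis by blast
qed

lemma nb_mono_edges: "C \<subseteq> E \<Longrightarrow> nb C n x \<subseteq> nb E n x" unfolding nb_def by (blast intro: order_trans)

context tilted
begin

definition Loc :: "nat \<Rightarrow> real \<Rightarrow> 'v \<Rightarrow> 'v set set" where
  "Loc R \<sigma> x = {e \<in> Reg (h x) (h x + \<sigma>). e \<subseteq> nb E R x}"

lemma Loc_sub: "Loc R \<sigma> x \<subseteq> Reg (h x) (h x + \<sigma>)" "Loc R \<sigma> x \<subseteq> E" "\<Union>(Loc R \<sigma> x) \<subseteq> nb E R x"
  using Reg_E by (auto simp: Loc_def)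

lemma finite_Loc: "x \<in> V \<Longrightarrow> finite (Loc R \<sigma> x)"
  using finite_nb[of x R] finite_subset[of "Loc R \<sigma> x" "Pow (nb E R x)"] by (auto simp: Loc_def)

lemma Loc_image:
  assumes "\<beta> \<in> \<Gamma>" "x \<in> V"
  shows "(`) \<beta> ` Loc R \<sigma> x = Loc R \<sigma> (\<beta> x)"
proof -
  have 1: "\<beta> ` e \<subseteq> nb E R (\<beta> x) \<longleftrightarrow> e \<subseteq> nb E R x" if "e \<subseteq> V" for e unfolding nb_image[OF assms, symmetric]
    using inj_on_image_subset_iff[of \<beta> V e "nb E R x"] that nb_V[OF assms(2)] aut(1)[OF assms(1)]
    by (auto simp: bij_betw_def)
  have 2: "Reg (h (\<beta> x)) (h (\<beta> x) + \<sigma>) = (`) \<beta> ` Reg (h x) (h x + \<sigma>)"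
    unfolding Reg_image(1)[OF assms] by (simp add: algebra_simps)
  have 3: "e \<subseteq> V" if "e \<in> Reg a b" for e a b using that Reg_E edge_sub(1) by blast
  show ?thesis
  proof (intro equalityI subsetI)
    fix e assume "e \<in> (`) \<beta> ` Loc R \<sigma> x"
    then obtain e' where "e' \<in> Reg (h x) (h x + \<sigma>)" "e' \<subseteq> nb E R x" "e = \<beta> ` e'" by (auto simp: Loc_def)
    with 1 3 show "e \<in> Loc R \<sigma> (\<beta> x)" unfolding Loc_def 2 by blast
  next
    fix e assume "e \<in> Loc R \<sigma> (\<beta> x)"
    then obtain e' where "e' \<in> Reg (h x) (h x + \<sigma>)" "e \<subseteq> nb E R (\<beta> x)" "e = \<beta> ` e'" unfolding Loc_def 2 by blast
    with 1 3 show "e \<in> (`) \<beta> ` Loc R \<sigma> x" unfolding Loc_def by blast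
  qed
qed

lemma cand_aut:
  assumes "\<beta> \<in> \<Gamma>" "\<xi> \<subseteq> E" "x \<in> V"
  shows "cand (\<beta> x) (h (\<beta> x) + \<sigma>) ((`) \<beta> ` \<xi>) = \<beta> ` cand x (h x + \<sigma>) \<xi>"
proof -
  let ?R = "Reg (h x) (h x + \<sigma>)"
  have im: "(`) \<beta> ` \<xi> \<inter> Reg (h (\<beta> x)) (h (\<beta> x) + \<sigma>) = (`) \<beta> ` (\<xi> \<inter> ?R)"
  proof -
    have "Reg (h (\<beta> x)) (h (\<beta> x) + \<sigma>) = (`) \<beta> ` ?R" unfolding Reg_image(1)[OF assms(1,3)] by (simp add: algebra_simps)
    then show ?thesis using aut_Int[OF assms(1,2) Reg_E] by simp
  qed
  have *: "z \<in> cand x (h x + \<sigma>) \<xi> \<longleftrightarrow> \<beta> z \<in> cand (\<beta> x) (h (\<beta> x) + \<sigma>) ((`) \<beta> ` \<xi>)" if "z \<in> V" for z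
    unfolding cand_def mem_Collect_eq im using conn_aut[OF assms(1) _ assms(3) that, of "\<xi> \<inter> ?R"] assms(2)
      h_shift[OF assms(1) that assms(3)] Orb_inv[OF assms(1) that] by auto
  have onto: "\<exists>z\<in>V. w = \<beta> z" if "w \<in> V" for w using aut(1)[OF assms(1)] that by (auto simp: bij_betw_def)
  show ?thesis
  proof (intro equalityI subsetI)
    fix w assume w: "w \<in> cand (\<beta> x) (h (\<beta> x) + \<sigma>) ((`) \<beta> ` \<xi>)"
    then have "w \<in> V" using cand_Orb Orb_sub by blast
    then obtain z where "z \<in> V" "w = \<beta> z" using onto by blast
    with w * show "w \<in> \<beta> ` cand x (h x + \<sigma>) \<xi>" by blast
  next
    fix w assume "w \<in> \<beta> ` cand x (h x + \<sigma>) \<xi>"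
    then obtain z where "z \<in> cand x (h x + \<sigma>) \<xi>" "w = \<beta> z" by blast
    moreover have "z \<in> V" using calculation cand_Orb Orb_sub by blast
    ultimately show "w \<in> cand (\<beta> x) (h (\<beta> x) + \<sigma>) ((`) \<beta> ` \<xi>)" using * by blast
  qed
qed

text \<open>Each vertex splits a unit mass equally among the candidates it reaches locally.\<close>

definition share :: "nat \<Rightarrow> real \<Rightarrow> 'v set set \<Rightarrow> 'v \<Rightarrow> 'v \<Rightarrow> real" where
  "share R \<sigma> \<xi> x y = of_bool (y \<in> cand x (h x + \<sigma>) (\<xi> \<inter> Loc R \<sigma> x)) /
    real (card (cand x (h x + \<sigma>) (\<xi> \<inter> Loc R \<sigma> x)))"

lemma share_nonneg: "0 \<le> share R \<sigma> \<xi> x y" by (simp add: share_def)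

lemma share_Loc: "share R \<sigma> (\<xi> \<inter> Loc R \<sigma> x) x y = share R \<sigma> \<xi> x y" by (simp add: share_def Int_assoc)

lemma finite_candL: "x \<in> V \<Longrightarrow> finite (cand x r (\<xi> \<inter> Loc R \<sigma> x))"
  using finite_cand[OF finite_Loc[of x R \<sigma>] Loc_sub(2), of "\<xi> \<inter> Loc R \<sigma> x" x r] by simp

lemma candL_nb: "y \<in> cand x r (\<xi> \<inter> Loc R \<sigma> x) \<Longrightarrow> y \<in> nb E R x"
  using cand_sub[of "\<xi> \<inter> Loc R \<sigma> x" "Loc R \<sigma> x" x r] Loc_sub(3)[of R \<sigma> x] nb_refl[of x E R] by auto

lemma share_sum:
  assumes "x \<in> V" "finite N" "cand x (h x + \<sigma>) (\<xi> \<inter> Loc R \<sigma> x) \<subseteq> N"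
  shows "(\<Sum>y\<in>N. share R \<sigma> \<xi> x y) = of_bool (reach x (h x) (h x + \<sigma>) (\<xi> \<inter> Loc R \<sigma> x))"
proof -
  let ?C = "cand x (h x + \<sigma>) (\<xi> \<inter> Loc R \<sigma> x)"
  have "(\<Sum>y\<in>N. share R \<sigma> \<xi> x y) = (\<Sum>y\<in>?C. share R \<sigma> \<xi> x y)"
    using assms by (intro sum.mono_neutral_right) (auto simp: share_def)
  also have "\<dots> = of_bool (?C \<noteq> {})" using finite_candL[OF assms(1), of "h x + \<sigma>" \<xi> R \<sigma>] by (auto simp: share_def)
  finally show ?thesis by (simp add: reach_cand)
qed

lemma share_sum_le:
  assumes "x \<in> V" "finite N"
  shows "(\<Sum>y\<in>N. share R \<sigma> \<xi> x y) \<le> of_bool (reach x (h x) (h x + \<sigma>) (\<xi> \<inter> Loc R \<sigma> x))"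
proof -
  have "(\<Sum>y\<in>N. share R \<sigma> \<xi> x y) \<le> (\<Sum>y\<in>N \<union> cand x (h x + \<sigma>) (\<xi> \<inter> Loc R \<sigma> x). share R \<sigma> \<xi> x y)"
    using assms finite_candL share_nonneg by (intro sum_mono2) auto
  also have "\<dots> = of_bool (reach x (h x) (h x + \<sigma>) (\<xi> \<inter> Loc R \<sigma> x))" using assms finite_candL by (intro share_sum) auto
  finally show ?thesis .
qed

definition wt :: "real \<Rightarrow> nat \<Rightarrow> real \<Rightarrow> 'v \<Rightarrow> 'v \<Rightarrow> real" where
  "wt p R \<sigma> x y = Ex p (Loc R \<sigma> x) (\<lambda>\<xi>. share R \<sigma> \<xi> x y)"

lemma wt_eq:
  assumes "finite F" "Loc R \<sigma> x \<subseteq> F"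
  shows "Ex p F (\<lambda>\<xi>. share R \<sigma> \<xi> x y) = wt p R \<sigma> x y"
  unfolding wt_def using assms by (intro Ex_depends) (simp_all add: share_Loc)

lemma wt_nonneg: "0 \<le> p \<Longrightarrow> p \<le> 1 \<Longrightarrow> 0 \<le> wt p R \<sigma> x y" unfolding wt_def by (intro Ex_nonneg share_nonneg)

lemma wt_aut:
  assumes "\<beta> \<in> \<Gamma>" "x \<in> V" "y \<in> V"
  shows "wt p R \<sigma> (\<beta> x) (\<beta> y) = wt p R \<sigma> x y"
proof -
  have inj: "inj_on \<beta> V" using aut(1)[OF assms(1)] by (simp add: bij_betw_def)
  have "share R \<sigma> ((`) \<beta> ` \<xi>) (\<beta> x) (\<beta> y) = share R \<sigma> \<xi> x y" if "\<xi> \<subseteq> Loc R \<sigma> x" for \<xi>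
  proof -
    have i: "(`) \<beta> ` \<xi> \<inter> Loc R \<sigma> (\<beta> x) = (`) \<beta> ` \<xi>" using that Loc_image[OF assms(1,2), of R \<sigma>] by auto
    have w: "\<xi> \<inter> Loc R \<sigma> x = \<xi>" using that by auto
    have oE: "\<xi> \<subseteq> E" using that Loc_sub(2)[of R \<sigma> x] by blast
    have cV: "cand x (h x + \<sigma>) \<xi> \<subseteq> V" using cand_Orb Orb_sub by blast
    have "\<beta> y \<in> \<beta> ` cand x (h x + \<sigma>) \<xi> \<longleftrightarrow> y \<in> cand x (h x + \<sigma>) \<xi>" using inj_on_image_mem_iff[OF inj assms(3) cV] .
    moreover have "card (\<beta> ` cand x (h x + \<sigma>) \<xi>) = card (cand x (h x + \<sigma>) \<xi>)"
      using inj_on_subset[OF inj cV] by (rule card_image)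
    ultimately show ?thesis unfolding share_def i w cand_aut[OF assms(1) oE assms(2)] by simp
  qed
  then show ?thesis
    unfolding wt_def Loc_image[OF assms(1,2), symmetric] Pr_aut[OF assms(1) Loc_sub(2) finite_Loc[OF assms(2)]]
    by (intro Ex_cong)
qed

text \<open>The mass received by one vertex. The transported function carries the factor
  \<open>exp (h y - h x)\<close>, which the weight of the mass transport principle cancels; shares
  rise by at most \<open>\<sigma> + t0\<close>, and the total mass sent is at most the probability
  of reaching \<sigma>.\<close>

lemma wt_column:
  assumes p: "0 \<le> p" "p \<le> 1" and \<sigma>: "0 \<le> \<sigma>" and A: "finite A" "A \<subseteq> Orb" and y: "y \<in> Orb"
  shows "(\<Sum>x\<in>A. wt p R \<sigma> x y) \<le> exp (\<sigma> + t0) * aa p \<sigma>"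
proof -
  have "(\<Sum>x\<in>A. wt p R \<sigma> x y * exp (h y - h x) * exp (h x - h y)) \<le> exp (\<sigma> + t0) * aa p \<sigma>"
  \<comment> \<open>The edge set argument is idle here, hence \<open>{}\<close>: the function
    \<open>wt\<close> brings along its own finite set \<open>Loc R \<sigma> x\<close>.\<close>
  proof (rule mtp_at[where f = "\<lambda>F x y. wt p R \<sigma> x y * exp (h y - h x)" and F = "{}"])
    fix \<beta> x y assume "\<beta> \<in> \<Gamma>" "x \<in> Orb" "y \<in> Orb"
    moreover have "x \<in> V" "y \<in> V" using calculation Orb_sub by auto
    ultimately show "wt p R \<sigma> (\<beta> x) (\<beta> y) * exp (h (\<beta> y) - h (\<beta> x)) = wt p R \<sigma> x y * exp (h y - h x)"
      using wt_aut h_shift by simp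
  next
    fix B assume B: "finite B" "B \<subseteq> Orb"
    have "wt p R \<sigma> rt y * exp (h y - h rt) \<le> wt p R \<sigma> rt y * exp (\<sigma> + t0)" for y
    proof (cases "h y \<le> h rt + \<sigma> + t0")
      case True
      then show ?thesis using wt_nonneg[OF p] by (intro mult_left_mono) auto
    next
      case False
      then have "share R \<sigma> \<xi> rt y = 0" for \<xi> using cand_height[of rt "h rt + \<sigma>" y] \<sigma> by (auto simp: share_def)
      then have "wt p R \<sigma> rt y = 0" using finite_Loc[OF rt_V] by (simp add: wt_def)
      then show ?thesis by simp
    qed
    then have "(\<Sum>y\<in>B. wt p R \<sigma> rt y * exp (h y - h rt)) \<le> (\<Sum>y\<in>B. wt p R \<sigma> rt y) * exp (\<sigma> + t0)"
      unfolding sum_distrib_right by (intro sum_mono)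
    also have "(\<Sum>y\<in>B. wt p R \<sigma> rt y) \<le> aa p \<sigma>"
    proof -
      have "(\<Sum>y\<in>B. wt p R \<sigma> rt y) = Ex p (Loc R \<sigma> rt) (\<lambda>\<xi>. \<Sum>y\<in>B. share R \<sigma> \<xi> rt y)" by (simp add: wt_def Ex_sum)
      also have "\<dots> \<le> Pr p (Loc R \<sigma> rt) (\<lambda>\<xi>. reach rt (h rt) (h rt + \<sigma>) (\<xi> \<inter> Loc R \<sigma> rt))"
        using share_sum_le[OF rt_V B(1)] by (intro Ex_mono p)
      also have "\<dots> = Pr p (Loc R \<sigma> rt) (reach rt (h rt) (h rt + \<sigma>))"
        by (intro Ex_cong arg_cong[where f = of_bool] arg_cong[where f = "reach rt (h rt) (h rt + \<sigma>)"]) auto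
      also have "\<dots> \<le> aa p \<sigma>" using finite_Loc[OF rt_V] Loc_sub(2) by (intro aa_upper p rt) auto
      finally show ?thesis .
    qed
    finally show "(\<Sum>y\<in>B. wt p R \<sigma> rt y * exp (h y - h rt)) \<le> exp (\<sigma> + t0) * aa p \<sigma>"
      by (simp add: mult.commute mult_left_mono)
  qed (use wt_nonneg[OF p] A y in auto)
  then show ?thesis by (simp add: mult.assoc exp_add[symmetric])
qed

lemma finite_in_ball:
  assumes "finite U" "U \<subseteq> V" "x \<in> V"
  shows "\<exists>R. U \<subseteq> nb E R x" using assms(1,2)
proof (induction U rule: finite_induct)
  case (insert u U)
  then obtain R where R: "U \<subseteq> nb E R x" by auto
  have "conn E x u" using connected assms(3) insert.prems by simp
  then obtain xs where xs: "spath E x u xs" by (rule conn_spath)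
  then have "u \<in> nb E (card (path_edges xs)) x"
    using conn_in_nb[OF spath_conn[OF spath_sub[OF xs]]] by (auto simp: spath_def)
  with R nb_mono[of R "max R (card (path_edges xs))" E x] nb_mono[of "card (path_edges xs)" "max R (card (path_edges xs))" E x]
  show ?case by (intro exI[of _ "max R (card (path_edges xs))"]) auto
qed simp

text \<open>Half of a positive supremum is exceeded on some finite edge set, which lies in a ball
  around \<open>rt\<close>; transitivity on the orbit makes the radius uniform.\<close>

lemma local_reach:
  assumes p: "0 < p" "p \<le> 1"
  shows "\<exists>R. \<forall>x\<in>Orb. aa p \<sigma> / 2 \<le> Pr p (Loc R \<sigma> x) (reach x (h x) (h x + \<sigma>))"
proof -
  have p': "0 \<le> p" using p by simp
  have "aa p \<sigma> / 2 < aa p \<sigma>" using aa_pos[OF p] by simp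
  from aa_lower[OF p' p(2) rt this] obtain F where F: "finite F" "F \<subseteq> E"
    "aa p \<sigma> / 2 < Pr p F (reach rt (h rt) (h rt + \<sigma>))" by blast
  obtain R where R: "\<Union>F \<subseteq> nb E R rt" using finite_in_ball[OF finite_verts verts_V rt_V] F by blast
  have "Pr p F (reach rt (h rt) (h rt + \<sigma>)) = Pr p (F \<inter> Reg (h rt) (h rt + \<sigma>)) (reach rt (h rt) (h rt + \<sigma>))"
  proof (rule Ex_depends[OF F(1)])
    fix \<xi> assume "\<xi> \<subseteq> F"
    then have "\<xi> \<inter> (F \<inter> Reg (h rt) (h rt + \<sigma>)) = \<xi> \<inter> Reg (h rt) (h rt + \<sigma>)" by auto
    then show "of_bool (reach rt (h rt) (h rt + \<sigma>) \<xi>) =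
      of_bool (reach rt (h rt) (h rt + \<sigma>) (\<xi> \<inter> (F \<inter> Reg (h rt) (h rt + \<sigma>))))"
      by (simp add: reach_Reg)
  qed simp
  also have "\<dots> \<le> Pr p (Loc R \<sigma> rt) (reach rt (h rt) (h rt + \<sigma>))"
    using R by (intro Pr_mono_set p' p finite_Loc rt_V incr_reach) (auto simp: Loc_def)
  finally have *: "aa p \<sigma> / 2 \<le> Pr p (Loc R \<sigma> rt) (reach rt (h rt) (h rt + \<sigma>))" using F(3) by simp
  have "aa p \<sigma> / 2 \<le> Pr p (Loc R \<sigma> x) (reach x (h x) (h x + \<sigma>))" if "x \<in> Orb" for x
  proof -
    obtain \<beta> where b: "\<beta> \<in> \<Gamma>" "\<beta> rt = x" using Orb_trans rt \<open>x \<in> Orb\<close> by blast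
    show ?thesis using * Pr_reach_aut[OF b(1) Loc_sub(2) finite_Loc[OF rt_V] rt_V, of p R \<sigma> \<sigma>]
      by (simp add: Loc_image[OF b(1) rt_V] b(2))
  qed
  then show ?thesis by blast
qed

lemma climb_choice:
  assumes "y \<in> Orb" "T - t0 \<le> h y"
  shows "\<exists>C z. C \<subseteq> Reg (h y) T \<and> finite C \<and> card C \<le> m0 * L \<and> z \<in> Orb \<and> T \<le> h z \<and> h z \<le> max (h y) (T + g) \<and>
    conn C y z \<and> (\<forall>e\<in>C. e \<subseteq> nb E (m0 * L) y)"
proof -
  have "T \<le> h y + m0 * g" using assms(2) m0 by simp
  from climb_to[OF assms(1) this] obtain C z where C: "C \<subseteq> Reg (h y) T" "finite C" "card C \<le> m0 * L" "z \<in> Orb" "T \<le> h z"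
    "h z \<le> max (h y) (T + g)" "conn C y z" by blast
  obtain C' where C': "C' \<subseteq> C" "conn C' y z" "\<forall>e\<in>C'. e \<subseteq> nb C (card C) y" using conn_shrink[OF C(7,2)] by blast
  have "nb C (card C) y \<subseteq> nb E (m0 * L) y"
    using nb_mono[OF C(3), of E y] nb_mono_edges[of C E "card C" y] C(1) Reg_E by blast
  then have "\<forall>e\<in>C'. e \<subseteq> nb E (m0 * L) y" using C'(3) by blast
  moreover have "card C' \<le> m0 * L" using card_mono[OF C(2) C'(1)] C(3) by linarith
  ultimately show ?thesis using C C' finite_subset[OF C'(1) C(2)] by (intro exI[of _ C'] exI[of _ z]) auto
qed

text \<open>One climb is fixed for each vertex and level, so that its being open is an event about a
  deterministic set of edges. Edge set and top are chosen together because they must match.\<close>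

definition "climb_pick T y = (SOME Cz. fst Cz \<subseteq> Reg (h y) T \<and> finite (fst Cz) \<and> card (fst Cz) \<le> m0 * L \<and>
    snd Cz \<in> Orb \<and> T \<le> h (snd Cz) \<and> h (snd Cz) \<le> max (h y) (T + g) \<and> conn (fst Cz) y (snd Cz) \<and>
    (\<forall>e\<in>fst Cz. e \<subseteq> nb E (m0 * L) y))"
definition "cl T y = fst (climb_pick T y)"
definition "en T y = snd (climb_pick T y)"

lemma climb_pick:
  assumes "y \<in> Orb" "T - t0 \<le> h y"
  shows "cl T y \<subseteq> Reg (h y) T" "finite (cl T y)" "card (cl T y) \<le> m0 * L" "en T y \<in> Orb" "T \<le> h (en T y)"
    "h (en T y) \<le> max (h y) (T + g)" "conn (cl T y) y (en T y)" "\<forall>e\<in>cl T y. e \<subseteq> nb E (m0 * L) y"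
    "en T y \<in> nb E (m0 * L) y"
proof -
  obtain C z where "C \<subseteq> Reg (h y) T \<and> finite C \<and> card C \<le> m0 * L \<and> z \<in> Orb \<and> T \<le> h z \<and> h z \<le> max (h y) (T + g) \<and>
    conn C y z \<and> (\<forall>e\<in>C. e \<subseteq> nb E (m0 * L) y)" using climb_choice[OF assms] by blast
  then have ex: "\<exists>Cz. fst Cz \<subseteq> Reg (h y) T \<and> finite (fst Cz) \<and> card (fst Cz) \<le> m0 * L \<and>
    snd Cz \<in> Orb \<and> T \<le> h (snd Cz) \<and> h (snd Cz) \<le> max (h y) (T + g) \<and> conn (fst Cz) y (snd Cz) \<and>
    (\<forall>e\<in>fst Cz. e \<subseteq> nb E (m0 * L) y)" by (intro exI[of _ "(C, z)"]) simp
  from someI_ex[OF ex] show p: "cl T y \<subseteq> Reg (h y) T" "finite (cl T y)" "card (cl T y) \<le> m0 * L" "en T y \<in> Orb" "T \<le> h (en T y)"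
    "h (en T y) \<le> max (h y) (T + g)" "conn (cl T y) y (en T y)" "\<forall>e\<in>cl T y. e \<subseteq> nb E (m0 * L) y"
    unfolding cl_def en_def climb_pick_def by blast+
  have "cl T y \<subseteq> E" using p(1) Reg_E by blast
  from conn_in_nb[OF p(7) this p(2)] nb_mono[OF p(3), of E y]
  show "en T y \<in> nb E (m0 * L) y" by blast
qed

end

text \<open>Levels have distance \<open>s\<close>. From a vertex at most \<open>t0\<close> above one
  level, an exploration of height \<open>s - t0\<close> ends within \<open>t0\<close> of the next
  level, and the fixed climb makes up for what is missing. The error therefore does not
  accumulate.\<close>

locale lineage = tilted +
  fixes p s r :: real and R k :: nat and W :: "'a set"
  assumes p: "0 < p" "p \<le> 1" and s: "2 * t0 \<le> s"
    and R: "\<And>x. x \<in> Orb \<Longrightarrow> aa p (s - t0) / 2 \<le> Pr p (Loc R (s - t0) x) (reach x (h x) (h x + (s - t0)))"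
    and W: "finite W" "W \<subseteq> Orb" "\<And>y. y \<in> W \<Longrightarrow> r \<le> h y \<and> h y \<le> r + t0"
    and lam_le: "lam p s \<le> exp (- s)"
begin

abbreviation "\<sigma> \<equiv> s - t0"

lemma p0: "0 \<le> p" using p by simp

lemma s_pos: "0 \<le> \<sigma>" "t0 \<le> s" "0 < t0" using s g by auto

definition lev :: "nat \<Rightarrow> real" where "lev i = r + real i * s"

lemma lev_Suc: "lev (Suc i) = lev i + s" by (simp add: lev_def algebra_simps)

lemma lev_mono: "i \<le> j \<Longrightarrow> lev i \<le> lev j" using s_pos by (simp add: lev_def mult_right_mono)

primrec St :: "nat \<Rightarrow> 'a set" where
  "St 0 = W"
| "St (Suc i) = {z \<in> (\<Union>x\<in>St i. nb E (R + m0 * L) x). z \<in> Orb \<and> lev (Suc i) \<le> h z \<and> h z \<le> lev (Suc i) + t0}"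

lemma St: "finite (St i)" "St i \<subseteq> Orb" "x \<in> St i \<Longrightarrow> lev i \<le> h x \<and> h x \<le> lev i + t0"
proof -
  show fin: "finite (St i)" and O: "St i \<subseteq> Orb" for i
  proof (induction i)
    case (Suc i)
    case 1
    have "finite (\<Union>x\<in>St i. nb E (R + m0 * L) x)" using Suc Orb_sub by (auto intro!: finite_nb)
    then show ?case by (rule rev_finite_subset) auto
  next
    case (Suc i)
    case 2
    show ?case by auto
  qed (use W in auto)
  show "x \<in> St i \<Longrightarrow> lev i \<le> h x \<and> h x \<le> lev i + t0" using W(3) by (cases i) (auto simp: lev_def)
qed

lemma St_V: "x \<in> St i \<Longrightarrow> x \<in> V" "x \<in> St i \<Longrightarrow> x \<in> Orb" using St(2) Orb_sub by blast+

definition near_cand :: "nat \<Rightarrow> 'a \<Rightarrow> 'a set" where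
  "near_cand i x = {y \<in> nb E R x. y \<in> Orb \<and> h x + \<sigma> \<le> h y \<and> h y \<le> h x + s}"

lemma near_cand_level:
  assumes "x \<in> St i" "y \<in> near_cand i x"
  shows "y \<in> Orb" "lev (Suc i) - t0 \<le> h y" "h y \<le> lev (Suc i) + t0" "h x + \<sigma> \<le> h y"
  using St(3)[OF assms(1)] assms(2) by (auto simp: near_cand_def lev_Suc)

lemma finite_near_cand: "x \<in> St i \<Longrightarrow> finite (near_cand i x)" using finite_nb[OF St_V(1)] by (simp add: near_cand_def)

lemma cand_near: "x \<in> St i \<Longrightarrow> cand x (h x + \<sigma>) (\<xi> \<inter> Loc R \<sigma> x) \<subseteq> near_cand i x"
proof
  fix y assume x: "x \<in> St i" and y: "y \<in> cand x (h x + \<sigma>) (\<xi> \<inter> Loc R \<sigma> x)"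
  then show "y \<in> near_cand i x" using candL_nb[OF y] cand_height[OF _ y] s_pos cand_Orb by (auto simp: near_cand_def)
qed

text \<open>A share arriving at the candidate \<open>y\<close> is passed on to the top of the climb
  fixed for \<open>y\<close> if this climb is open, and is lost otherwise.\<close>

definition J :: "nat \<Rightarrow> 'a set set \<Rightarrow> 'a \<Rightarrow> 'a \<Rightarrow> real" where
  "J i \<xi> x z = (\<Sum>y\<in>near_cand i x. share R \<sigma> \<xi> x y * of_bool (cl (lev (Suc i)) y \<subseteq> \<xi> \<and> en (lev (Suc i)) y = z))"

definition G :: "nat \<Rightarrow> 'a \<Rightarrow> 'a set set" where
  "G i x = Loc R \<sigma> x \<union> (\<Union>y\<in>near_cand i x. cl (lev (Suc i)) y)"

text \<open>The distance is twice the radius of a ball that contains all edges used from one vertex;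
  beyond it two vertices use disjoint edges.\<close>

definition close :: "'a \<Rightarrow> 'a \<Rightarrow> bool" where
  "close x x' \<longleftrightarrow> x' \<in> nb E ((R + m0 * L) + (R + m0 * L)) x"

definition Slab :: "nat \<Rightarrow> 'a set set" where "Slab i = Reg (lev i) (lev (Suc i))"

definition F :: "'a set set" where "F = (\<Union>i<k. \<Union>x\<in>St i. G i x)"

lemma en_St:
  assumes "x \<in> St i" "y \<in> near_cand i x"
  shows "en (lev (Suc i)) y \<in> St (Suc i)"
proof -
  note y = near_cand_level[OF assms]
  note c = climb_pick[OF y(1,2)]
  have "en (lev (Suc i)) y \<in> nb E (R + m0 * L) x" using nb_trans[of y E R x] c(9) assms(2) by (auto simp: near_cand_def)
  moreover have "h (en (lev (Suc i)) y) \<le> lev (Suc i) + t0" using c(6) y(3) g by simp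
  ultimately show ?thesis using assms(1) c by auto
qed

lemma G_props:
  assumes "x \<in> St i"
  shows "finite (G i x)" "G i x \<subseteq> Slab i" "\<Union>(G i x) \<subseteq> nb E (R + m0 * L) x"
proof -
  show "finite (G i x)"
    unfolding G_def using finite_Loc[OF St_V(1)[OF assms]] finite_near_cand[OF assms] near_cand_level[OF assms] climb_pick(2)
    by auto
  have "Loc R \<sigma> x \<subseteq> Slab i"
    using Loc_sub(1)[of R \<sigma> x] Reg_mono[of "lev i" "h x" "h x + \<sigma>" "lev (Suc i)"] St(3)[OF assms]
    by (auto simp: Slab_def lev_Suc)
  moreover have "cl (lev (Suc i)) y \<subseteq> Slab i" if y: "y \<in> near_cand i x" for y
  proof -
    have "lev i \<le> h y" using near_cand_level[OF assms y] St(3)[OF assms] s_pos by simp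
    then show ?thesis
      using climb_pick(1)[OF near_cand_level(1,2)[OF assms y]] Reg_mono[of "lev i" "h y" "lev (Suc i)" "lev (Suc i)"]
      by (auto simp: Slab_def)
  qed
  ultimately show "G i x \<subseteq> Slab i" unfolding G_def by blast
  have "e \<subseteq> nb E (R + m0 * L) x" if "y \<in> near_cand i x" "e \<in> cl (lev (Suc i)) y" for e y
    using climb_pick(8)[OF near_cand_level(1,2)[OF assms that(1)]] that nb_trans[of y E R x]
    by (auto simp: near_cand_def)
  moreover have "nb E R x \<subseteq> nb E (R + m0 * L) x" by (rule nb_mono) simp
  ultimately show "\<Union>(G i x) \<subseteq> nb E (R + m0 * L) x" using Loc_sub(3)[of R \<sigma> x] unfolding G_def by blast
qed

lemma F: "finite F" "F \<subseteq> E" "i < k \<Longrightarrow> x \<in> St i \<Longrightarrow> G i x \<subseteq> F"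
proof -
  show "finite F" unfolding F_def using G_props(1) St(1) by auto
  show "F \<subseteq> E" unfolding F_def using G_props(2) Reg_E unfolding Slab_def by blast
qed (auto simp: F_def)

lemma J_nonneg: "0 \<le> J i \<xi> x z" unfolding J_def by (intro sum_nonneg mult_nonneg_nonneg share_nonneg) auto

lemma J_sum:
  assumes "x \<in> St i"
  shows "(\<Sum>z\<in>St (Suc i). J i \<xi> x z) = (\<Sum>y\<in>near_cand i x. share R \<sigma> \<xi> x y * of_bool (cl (lev (Suc i)) y \<subseteq> \<xi>))"
proof -
  have "(\<Sum>z\<in>St (Suc i). J i \<xi> x z) = (\<Sum>y\<in>near_cand i x. \<Sum>z\<in>St (Suc i).
      share R \<sigma> \<xi> x y * of_bool (cl (lev (Suc i)) y \<subseteq> \<xi> \<and> en (lev (Suc i)) y = z))"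
    unfolding J_def by (rule sum.swap)
  also have "\<dots> = (\<Sum>y\<in>near_cand i x. share R \<sigma> \<xi> x y * of_bool (cl (lev (Suc i)) y \<subseteq> \<xi>))"
  proof (rule sum.cong[OF refl])
    fix y assume y: "y \<in> near_cand i x"
    have "(\<Sum>z\<in>St (Suc i). share R \<sigma> \<xi> x y * of_bool (cl (lev (Suc i)) y \<subseteq> \<xi> \<and> en (lev (Suc i)) y = z)) =
      (\<Sum>z\<in>St (Suc i). if z = en (lev (Suc i)) y then share R \<sigma> \<xi> x y * of_bool (cl (lev (Suc i)) y \<subseteq> \<xi>) else 0)"
      by (intro sum.cong refl) auto
    then show "(\<Sum>z\<in>St (Suc i). share R \<sigma> \<xi> x y * of_bool (cl (lev (Suc i)) y \<subseteq> \<xi> \<and> en (lev (Suc i)) y = z)) =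
      share R \<sigma> \<xi> x y * of_bool (cl (lev (Suc i)) y \<subseteq> \<xi>)"
      using en_St[OF assms y] St(1)[of "Suc i"] by (simp del: St.simps)
  qed
  finally show ?thesis .
qed

lemma J_le_1: "x \<in> St i \<Longrightarrow> (\<Sum>z\<in>St (Suc i). J i \<xi> x z) \<le> 1"
proof -
  assume x: "x \<in> St i"
  have "(\<Sum>y\<in>near_cand i x. share R \<sigma> \<xi> x y * of_bool (cl (lev (Suc i)) y \<subseteq> \<xi>)) \<le> (\<Sum>y\<in>near_cand i x. share R \<sigma> \<xi> x y)"
    by (intro sum_mono mult_left_le share_nonneg) simp
  also have "\<dots> \<le> 1" by (rule order_trans[OF share_sum_le[OF St_V(1)[OF x] finite_near_cand[OF x]]]) simp
  finally show ?thesis unfolding J_sum[OF x] .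
qed

lemma J_dep: "J i \<xi> x z = J i (\<xi> \<inter> G i x) x z"
proof -
  have "share R \<sigma> (\<xi> \<inter> G i x) x y = share R \<sigma> \<xi> x y" for y
  proof -
    have "\<xi> \<inter> G i x \<inter> Loc R \<sigma> x = \<xi> \<inter> Loc R \<sigma> x" by (auto simp: G_def)
    then show ?thesis by (simp add: share_def)
  qed
  moreover have "cl (lev (Suc i)) y \<subseteq> \<xi> \<inter> G i x \<longleftrightarrow> cl (lev (Suc i)) y \<subseteq> \<xi>" if "y \<in> near_cand i x" for y
    using that by (auto simp: G_def)
  ultimately show ?thesis unfolding J_def by (intro sum.cong) auto
qed

lemma G_far:
  assumes "x \<in> St i" "x' \<in> St i" "\<not> close x x'"
  shows "G i x \<inter> G i x' = {}"
proof (rule ccontr)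
  assume "G i x \<inter> G i x' \<noteq> {}"
  then obtain e where e: "e \<in> G i x" "e \<in> G i x'" by auto
  then have "e \<in> E" using G_props(2)[OF assms(1)] Reg_E unfolding Slab_def by blast
  then obtain u where u: "u \<in> e" using edge by blast
  have "u \<in> nb E (R + m0 * L) x" "u \<in> nb E (R + m0 * L) x'"
    using G_props(3)[OF assms(1)] G_props(3)[OF assms(2)] e u by blast+
  then show False using assms(3) nb_trans nb_sym unfolding close_def by metis
qed

lemma close_card: "x \<in> St i \<Longrightarrow> real (card {x' \<in> St i. close x x'}) \<le> real ((dg + 1) ^ ((R + m0 * L) + (R + m0 * L)))"
proof -
  assume x: "x \<in> St i"
  have "card {x' \<in> St i. close x x'} \<le> card (nb E ((R + m0 * L) + (R + m0 * L)) x)"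
    using finite_nb[OF St_V(1)[OF x]] by (intro card_mono) (auto simp: close_def)
  also have "\<dots> \<le> (dg + 1) ^ ((R + m0 * L) + (R + m0 * L))" by (rule card_nb[OF St_V(1)[OF x]])
  finally show ?thesis by (simp only: of_nat_le_iff)
qed

text \<open>The exploration uses edges whose lower end is below \<open>h x + \<sigma>\<close>, the
  climb starts at or above this height, so the two are independent.\<close>

lemma share_climb:
  assumes "i < k" "x \<in> St i" "y \<in> near_cand i x"
  shows "wt p R \<sigma> x y * p ^ (m0 * L) \<le> Ex p F (\<lambda>\<xi>. share R \<sigma> \<xi> x y * of_bool (cl (lev (Suc i)) y \<subseteq> \<xi>))"
proof -
  note y = near_cand_level[OF assms(2,3)]
  note c = climb_pick[OF y(1,2)]
  have GF: "G i x \<subseteq> F" using F(3) assms by blast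
  have clF: "cl (lev (Suc i)) y \<subseteq> F" using GF assms(3) by (auto simp: G_def)
  have "Ex p F (\<lambda>\<xi>. share R \<sigma> \<xi> x y * of_bool (cl (lev (Suc i)) y \<subseteq> \<xi>)) =
    Ex p F (\<lambda>\<xi>. share R \<sigma> \<xi> x y) * Pr p F (\<lambda>\<xi>. cl (lev (Suc i)) y \<subseteq> \<xi>)"
  proof (rule Ex_indep[OF F(1)])
    have "Loc R \<sigma> x \<inter> cl (lev (Suc i)) y \<subseteq> Reg (h x) (h x + \<sigma>) \<inter> Reg (h y) (lev (Suc i))" using Loc_sub(1) c(1) by blast
    then show "Loc R \<sigma> x \<inter> cl (lev (Suc i)) y = {}" using Reg_disjoint[OF y(4)] by blast
    show "share R \<sigma> \<xi> x y = share R \<sigma> (\<xi> \<inter> Loc R \<sigma> x) x y" for \<xi> by (simp add: share_Loc)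
    show "of_bool (cl (lev (Suc i)) y \<subseteq> \<xi>) = of_bool (cl (lev (Suc i)) y \<subseteq> \<xi> \<inter> cl (lev (Suc i)) y)" for \<xi> by simp
  qed
  also have "\<dots> = wt p R \<sigma> x y * p ^ card (cl (lev (Suc i)) y)"
    using wt_eq[OF F(1), of R \<sigma> x] GF Pr_superset[OF F(1) clF] by (simp add: G_def)
  also have "\<dots> \<ge> wt p R \<sigma> x y * p ^ (m0 * L)"
    using c(3) p wt_nonneg[OF p0 p(2)] by (intro mult_left_mono power_decreasing) auto
  finally show ?thesis .
qed

lemma J_row:
  assumes "i < k" "x \<in> St i"
  shows "lam p s / 2 \<le> (\<Sum>z\<in>St (Suc i). Ex p F (\<lambda>\<xi>. J i \<xi> x z))"
proof -
  have "lam p s / 2 = aa p \<sigma> / 2 * p ^ (m0 * L)" by (simp add: lam_def)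
  also have "\<dots> \<le> Pr p (Loc R \<sigma> x) (reach x (h x) (h x + \<sigma>)) * p ^ (m0 * L)"
    using R[OF St_V(2)[OF assms(2)]] p by (intro mult_right_mono) auto
  also have "Pr p (Loc R \<sigma> x) (reach x (h x) (h x + \<sigma>)) = (\<Sum>y\<in>near_cand i x. wt p R \<sigma> x y)"
  proof -
    have "(\<Sum>y\<in>near_cand i x. wt p R \<sigma> x y) = Ex p (Loc R \<sigma> x) (\<lambda>\<xi>. \<Sum>y\<in>near_cand i x. share R \<sigma> \<xi> x y)"
      by (simp add: wt_def Ex_sum)
    also have "\<dots> = Pr p (Loc R \<sigma> x) (\<lambda>\<xi>. reach x (h x) (h x + \<sigma>) (\<xi> \<inter> Loc R \<sigma> x))"
      using share_sum[OF St_V(1)[OF assms(2)] finite_near_cand[OF assms(2)] cand_near[OF assms(2)]]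
      by (intro Ex_cong) simp
    also have "\<dots> = Pr p (Loc R \<sigma> x) (reach x (h x) (h x + \<sigma>))"
      by (intro Ex_cong arg_cong[where f = of_bool] arg_cong[where f = "reach x (h x) (h x + \<sigma>)"]) auto
    finally show ?thesis ..
  qed
  also have "(\<Sum>y\<in>near_cand i x. wt p R \<sigma> x y) * p ^ (m0 * L) \<le>
      (\<Sum>y\<in>near_cand i x. Ex p F (\<lambda>\<xi>. share R \<sigma> \<xi> x y * of_bool (cl (lev (Suc i)) y \<subseteq> \<xi>)))"
    unfolding sum_distrib_right using share_climb[OF assms] by (intro sum_mono)
  also have "\<dots> = Ex p F (\<lambda>\<xi>. \<Sum>z\<in>St (Suc i). J i \<xi> x z)" unfolding J_sum[OF assms(2)] Ex_sum ..
  finally show ?thesis by (simp add: Ex_sum del: St.simps)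
qed

text \<open>A vertex receives mass only through candidates within distance \<open>m0 * L\<close>,
  and each of these collects at most \<open>exp s * aa p \<sigma>\<close>. By \<open>lam_le\<close>
  this is bounded by a constant free of \<open>s\<close>, although the row sums are only known to be
  at least \<open>lam p s / 2\<close>.\<close>

lemma J_col:
  assumes "i < k" "z \<in> St (Suc i)"
  shows "(\<Sum>x\<in>St i. Ex p F (\<lambda>\<xi>. J i \<xi> x z)) \<le> real ((dg + 1) ^ (m0 * L)) / p ^ (m0 * L)"
proof -
  let ?T = "lev (Suc i)"
  define Y where "Y = {y \<in> nb E (m0 * L) z. y \<in> Orb}"
  have zV: "z \<in> V" using St_V(1)[OF assms(2)] .
  have Y: "finite Y" "card Y \<le> (dg + 1) ^ (m0 * L)" "Y \<subseteq> Orb"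
    using finite_nb[OF zV, of "m0 * L"] card_nb[OF zV, of "m0 * L"] card_mono[of "nb E (m0 * L) z" Y] by (auto simp: Y_def)
  have "J i \<xi> x z \<le> (\<Sum>y\<in>Y. share R \<sigma> \<xi> x y)" if x: "x \<in> St i" for x \<xi>
  proof -
    have "J i \<xi> x z \<le> (\<Sum>y\<in>near_cand i x. if y \<in> Y then share R \<sigma> \<xi> x y else 0)" unfolding J_def
    proof (rule sum_mono)
      fix y assume y: "y \<in> near_cand i x"
      note yy = near_cand_level[OF x y]
      have "y \<in> Y" if "en ?T y = z" using climb_pick(9)[OF yy(1,2)] nb_sym yy(1) that by (auto simp: Y_def)
      then show "share R \<sigma> \<xi> x y * of_bool (cl ?T y \<subseteq> \<xi> \<and> en ?T y = z) \<le> (if y \<in> Y then share R \<sigma> \<xi> x y else 0)"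
        using share_nonneg by auto
    qed
    also have "\<dots> = (\<Sum>y\<in>near_cand i x \<inter> Y. share R \<sigma> \<xi> x y)"
      by (rule sum.inter_restrict[OF finite_near_cand[OF x], symmetric])
    also have "\<dots> \<le> (\<Sum>y\<in>Y. share R \<sigma> \<xi> x y)" using Y share_nonneg by (intro sum_mono2) auto
    finally show ?thesis .
  qed
  then have "(\<Sum>x\<in>St i. Ex p F (\<lambda>\<xi>. J i \<xi> x z)) \<le> (\<Sum>x\<in>St i. Ex p F (\<lambda>\<xi>. \<Sum>y\<in>Y. share R \<sigma> \<xi> x y))"
    using p0 p by (intro sum_mono Ex_mono) auto
  also have "\<dots> = (\<Sum>x\<in>St i. \<Sum>y\<in>Y. wt p R \<sigma> x y)"
    unfolding Ex_sum using F(3)[OF assms(1)] wt_eq[OF F(1), of R \<sigma>] by (intro sum.cong refl) (auto simp: G_def)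
  also have "\<dots> = (\<Sum>y\<in>Y. \<Sum>x\<in>St i. wt p R \<sigma> x y)" by (rule sum.swap)
  also have "\<dots> \<le> (\<Sum>y\<in>Y. 1 / p ^ (m0 * L))"
  proof (rule sum_mono)
    fix y assume "y \<in> Y"
    then have "(\<Sum>x\<in>St i. wt p R \<sigma> x y) \<le> exp (\<sigma> + t0) * aa p \<sigma>" using Y(3) by (intro wt_column p0 p s_pos St) auto
    also have "aa p \<sigma> \<le> exp (- s) / p ^ (m0 * L)" using lam_le p by (simp add: lam_def pos_le_divide_eq)
    also have "exp (\<sigma> + t0) * (exp (- s) / p ^ (m0 * L)) = 1 / p ^ (m0 * L)" by (simp add: exp_add[symmetric])
    finally show "(\<Sum>x\<in>St i. wt p R \<sigma> x y) \<le> 1 / p ^ (m0 * L)" by simp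
  qed
  also have "\<dots> \<le> real ((dg + 1) ^ (m0 * L)) / p ^ (m0 * L)"
    using Y(2) p by (simp add: divide_right_mono del: of_nat_power)
  finally show ?thesis .
qed

sublocale random_flow p F St J G Slab close "real ((dg + 1) ^ ((R + m0 * L) + (R + m0 * L)))"
  "lam p s / 2" "real ((dg + 1) ^ (m0 * L)) / p ^ (m0 * L)" k
proof
  show "x \<in> St i \<Longrightarrow> J i \<xi> x z = J i (\<xi> \<inter> G i x) x z" for i \<xi> x z by (rule J_dep)
  show "i < j \<Longrightarrow> Slab i \<inter> Slab j = {}" for i j unfolding Slab_def by (rule Reg_disjoint) (simp add: lev_mono)
  have "0 < aa p \<sigma>" using aa_pos[OF p] .
  then show "0 < lam p s / 2" using p by (simp add: lam_def)
  show "0 \<le> real ((dg + 1) ^ (m0 * L)) / p ^ (m0 * L)" using p by simp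
qed (use F(1) p0 p St(1) J_nonneg J_le_1 G_props(2) G_far close_card J_row J_col in \<open>auto simp del: St.simps\<close>)

lemma flow_reach:
  "x \<in> St i \<Longrightarrow> 0 < flow St J m i \<xi> x \<Longrightarrow>
    \<exists>z\<in>Orb. lev (i + m) \<le> h z \<and> conn (\<xi> \<inter> Reg (lev i) (lev (i + m))) x z"
proof (induction m arbitrary: i x)
  case 0
  then show ?case using St(3)[OF 0(1)] St_V(2)[OF 0(1)] by (auto intro!: bexI[of _ x])
next
  case (Suc m)
  have "\<exists>z\<in>St (Suc i). 0 < J i \<xi> x z * flow St J m (Suc i) \<xi> z"
  proof (rule ccontr)
    assume "\<not> ?thesis"
    then have "(\<Sum>z\<in>St (Suc i). J i \<xi> x z * flow St J m (Suc i) \<xi> z) \<le> 0"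
      by (intro sum_nonpos) (auto simp: not_less simp del: St.simps)
    then show False using Suc.prems(2) by (simp del: St.simps)
  qed
  then obtain z where z: "z \<in> St (Suc i)" "0 < J i \<xi> x z * flow St J m (Suc i) \<xi> z" by blast
  have pos: "0 < J i \<xi> x z" "0 < flow St J m (Suc i) \<xi> z"
    using z(2) J_nonneg[of i \<xi> x z] by (auto simp: zero_less_mult_iff)
  obtain w where w: "w \<in> Orb" "lev (Suc i + m) \<le> h w" "conn (\<xi> \<inter> Reg (lev (Suc i)) (lev (Suc i + m))) z w"
    using Suc.IH[OF z(1) pos(2)] by blast
  have "\<exists>y\<in>near_cand i x. share R \<sigma> \<xi> x y * of_bool (cl (lev (Suc i)) y \<subseteq> \<xi> \<and> en (lev (Suc i)) y = z) \<noteq> 0"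
    using pos(1) unfolding J_def by (metis (no_types, lifting) less_irrefl sum.neutral)
  then obtain y where y: "y \<in> near_cand i x" "share R \<sigma> \<xi> x y \<noteq> 0" "cl (lev (Suc i)) y \<subseteq> \<xi>" "en (lev (Suc i)) y = z"
    by (auto split: if_splits)
  have "conn (\<xi> \<inter> Loc R \<sigma> x \<inter> Reg (h x) (h x + \<sigma>)) x y" using y(2) by (auto simp: share_def cand_def split: if_splits)
  moreover have "\<xi> \<inter> Loc R \<sigma> x \<inter> Reg (h x) (h x + \<sigma>) \<subseteq> \<xi> \<inter> G i x" by (auto simp: G_def)
  ultimately have 1: "conn (\<xi> \<inter> G i x) x y" by (rule conn_mono)
  have "conn (cl (lev (Suc i)) y) y z" using climb_pick(7)[OF near_cand_level(1,2)[OF Suc.prems(1) y(1)]] y(4) by simp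
  moreover have "cl (lev (Suc i)) y \<subseteq> \<xi> \<inter> G i x" using y by (auto simp: G_def)
  ultimately have 2: "conn (\<xi> \<inter> G i x) y z" by (rule conn_mono)
  let ?R = "Reg (lev i) (lev (i + Suc m))"
  have "\<xi> \<inter> G i x \<subseteq> \<xi> \<inter> ?R"
    using G_props(2)[OF Suc.prems(1)] Reg_mono[of "lev i" "lev i" "lev (Suc i)" "lev (i + Suc m)"] lev_mono[of "Suc i" "i + Suc m"]
    unfolding Slab_def by auto
  then have "conn (\<xi> \<inter> ?R) x z" using conn_trans[OF 1 2] by (rule conn_mono[rotated])
  moreover have "conn (\<xi> \<inter> ?R) z w"
    using w(3) by (rule conn_mono) (use Reg_mono[of "lev i" "lev (Suc i)" "lev (Suc i + m)" "lev (i + Suc m)"] lev_mono[of i "Suc i"] in auto)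
  ultimately have "conn (\<xi> \<inter> ?R) x w" by (rule conn_trans)
  then show ?case using w by auto
qed

end

context tilted
begin

definition CC :: "real \<Rightarrow> real" where "CC p = real ((dg + 1) ^ (m0 * L)) / p ^ (m0 * L)"

text \<open>A large set of vertices at one level reaches high almost as often as independent vertices would.\<close>

lemma union_bound:
  assumes p: "0 < p" "p \<le> 1" and s: "2 * t0 \<le> s" and lam_le: "lam p s \<le> exp (- s)"
  shows "\<exists>b\<ge>1. \<forall>k r W. finite W \<longrightarrow> W \<noteq> {} \<longrightarrow> W \<subseteq> Orb \<longrightarrow> (\<forall>y\<in>W. r \<le> h y \<and> h y \<le> r + t0) \<longrightarrow>
    (\<exists>F. finite F \<and> F \<subseteq> E \<and>
      real (card W) * (lam p s / 2) ^ k / (real (card W) * (lam p s / 2) ^ k + b * (\<Sum>j<k. CC p ^ j)) \<le>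
      Pr p F (\<lambda>\<xi>. \<exists>y\<in>W. reach y r (r + real k * s) \<xi>))"
proof -
  obtain R where R: "\<forall>x\<in>Orb. aa p (s - t0) / 2 \<le> Pr p (Loc R (s - t0) x) (reach x (h x) (h x + (s - t0)))"
    using local_reach[OF p] by blast
  show ?thesis
  \<comment> \<open>The constant for close pairs depends on the radius \<open>R\<close>, hence on
    \<open>p\<close> and \<open>s\<close>, but not on \<open>k\<close>, \<open>r\<close> or
    \<open>W\<close>.\<close>
  proof (intro exI[of _ "real ((dg + 1) ^ ((R + m0 * L) + (R + m0 * L)))"] conjI allI impI)
    show "1 \<le> real ((dg + 1) ^ ((R + m0 * L) + (R + m0 * L)))" by simp
    fix k r W assume W': "finite W" "W \<noteq> {}" "W \<subseteq> Orb" "\<forall>y\<in>W. r \<le> h y \<and> h y \<le> r + t0"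
    interpret lineage V E \<Gamma> h Orb rt Reps t0 g dg D L p s r R k W by unfold_locales (use p s R W' lam_le in auto)
    have "real (card W) * (lam p s / 2) ^ k / (real (card W) * (lam p s / 2) ^ k +
        real ((dg + 1) ^ ((R + m0 * L) + (R + m0 * L))) * (\<Sum>j<k. CC p ^ j)) \<le>
      Pr p F (\<lambda>\<xi>. \<exists>x\<in>W. 0 < flow St J k 0 \<xi> x)"
      using flow_positive[of W] W' unfolding CC_def by simp
    also have "\<dots> \<le> Pr p F (\<lambda>\<xi>. \<exists>y\<in>W. reach y r (r + real k * s) \<xi>)"
    proof (intro Pr_mono p0 p)
      fix \<xi> assume "\<exists>x\<in>W. 0 < flow St J k 0 \<xi> x"
      then obtain x where x: "x \<in> W" "0 < flow St J k 0 \<xi> x" by blast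
      from flow_reach[of x 0 k \<xi>] x show "\<exists>y\<in>W. reach y r (r + real k * s) \<xi>" by (auto simp: reach_def lev_def)
    qed
    finally show "\<exists>F. finite F \<and> F \<subseteq> E \<and> real (card W) * (lam p s / 2) ^ k / (real (card W) * (lam p s / 2) ^ k +
        real ((dg + 1) ^ ((R + m0 * L) + (R + m0 * L))) * (\<Sum>j<k. CC p ^ j)) \<le>
      Pr p F (\<lambda>\<xi>. \<exists>y\<in>W. reach y r (r + real k * s) \<xi>)" using F(1,2) by blast
  qed
qed

end

section \<open>Moments of the number of crossing points\<close>

context tilted
begin

abbreviation NN :: "'v \<Rightarrow> real \<Rightarrow> 'v set set \<Rightarrow> real" where
  "NN x t \<xi> \<equiv> real (card (cand x (h x + t) \<xi>))"

section \<open>The exponential rate and the truncated first moment\<close>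

lemma CC_ge_1: "0 < p \<Longrightarrow> p \<le> 1 \<Longrightarrow> 1 \<le> CC p"
proof -
  assume p: "0 < p" "p \<le> 1"
  have "1 \<le> real ((dg + 1) ^ (m0 * L))" by simp
  moreover have "p ^ (m0 * L) \<le> 1" "0 < p ^ (m0 * L)" using p by (simp_all add: power_le_one)
  ultimately have "p ^ (m0 * L) \<le> real ((dg + 1) ^ (m0 * L))" by linarith
  then show ?thesis unfolding CC_def using p by (simp only: pos_le_divide_eq zero_less_power mult_1)
qed

lemma lam_pos: "0 < p \<Longrightarrow> p \<le> 1 \<Longrightarrow> 0 < lam p t" using aa_pos[of p "t - t0"] by (simp add: lam_def)

text \<open>The rate \<alpha> is the infimum of \<open>- ln (lam p t) / t\<close>, so the upper
  bound is immediate. A nearly optimal \<open>t\<close> exists, and by supermultiplicativity its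
  multiples are nearly optimal too, which supplies arbitrarily large \<open>s\<close>.\<close>

lemma lam_exponent:
  assumes p: "0 < p" "p \<le> 1" and le: "\<And>t. t0 \<le> t \<Longrightarrow> lam p t \<le> exp (- t)" and \<delta>: "0 < \<delta>"
  shows "\<exists>\<alpha>\<ge>1. (\<forall>t\<ge>t0. lam p t \<le> exp (- \<alpha> * t)) \<and> (\<forall>B. \<exists>s\<ge>B. t0 \<le> s \<and> exp (- (\<alpha> + \<delta>) * s) \<le> lam p s)"
proof -
  define S where "S = {- ln (lam p t) / t | t. t0 \<le> t}"
  define \<alpha> where "\<alpha> = Inf S"
  have t0: "0 < t0" using g by simp
  have S1: "1 \<le> z" if z: "z \<in> S" for z
  proof -
    obtain t where t: "z = - ln (lam p t) / t" "t0 \<le> t" using z unfolding S_def mem_Collect_eq by (elim exE conjE)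
    have "ln (lam p t) \<le> ln (exp (- t))" using le[OF t(2)] lam_pos[OF p, of t] by (subst ln_le_cancel_iff) auto
    then have 1: "ln (lam p t) \<le> - t" by simp
    have "0 < t" using t(2) t0 by simp
    then show ?thesis unfolding t(1) using 1 by (subst pos_le_divide_eq) auto
  qed
  have ne: "S \<noteq> {}" unfolding S_def by blast
  have bdd: "bdd_below S" using S1 by (rule bdd_belowI)
  have "1 \<le> \<alpha>" unfolding \<alpha>_def using S1 ne by (intro cInf_greatest)
  moreover have "lam p t \<le> exp (- \<alpha> * t)" if "t0 \<le> t" for t
  proof -
    have "\<alpha> \<le> - ln (lam p t) / t" unfolding \<alpha>_def using that bdd by (intro cInf_lower) (auto simp only: S_def)
    moreover have "0 < t" using that t0 by simp
    ultimately have "\<alpha> * t \<le> - ln (lam p t)" by (subst (asm) pos_le_divide_eq) auto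
    then have "ln (lam p t) \<le> - \<alpha> * t" by simp
    then have "exp (ln (lam p t)) \<le> exp (- \<alpha> * t)" by simp
    then show ?thesis using lam_pos[OF p, of t] by simp
  qed
  moreover have "\<exists>s\<ge>B. t0 \<le> s \<and> exp (- (\<alpha> + \<delta>) * s) \<le> lam p s" for B
  proof -
    obtain z where z: "z \<in> S" "z < \<alpha> + \<delta>" using cInf_less_iff[OF ne bdd, of "\<alpha> + \<delta>"] \<delta> unfolding \<alpha>_def by auto
    obtain t where "z = - ln (lam p t) / t" and t0t: "t0 \<le> t"
      using z(1) unfolding S_def mem_Collect_eq by (elim exE conjE)
    with z(2) have t: "t0 \<le> t" "- ln (lam p t) / t < \<alpha> + \<delta>" by auto
    have "0 < t" using t(1) t0 by simp
    with t(2) have "- ln (lam p t) < (\<alpha> + \<delta>) * t" by (subst (asm) pos_divide_less_eq) auto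
    then have "- (\<alpha> + \<delta>) * t \<le> ln (lam p t)" by (simp add: algebra_simps)
    then have "exp (- (\<alpha> + \<delta>) * t) \<le> exp (ln (lam p t))" by simp
    then have low: "exp (- (\<alpha> + \<delta>) * t) \<le> lam p t" using lam_pos[OF p, of t] by simp
    define n where "n = nat \<lceil>B / t\<rceil>"
    have "B / t \<le> n" by (simp add: n_def real_nat_ceiling_ge)
    then have "B \<le> n * t" using t t0 by (simp add: pos_divide_le_eq)
    then have "B \<le> real (Suc n) * t" using t t0 by (simp add: algebra_simps)
    moreover have "t0 \<le> real (Suc n) * t" using t t0 by (simp add: algebra_simps add_increasing2)
    moreover have "exp (- (\<alpha> + \<delta>) * (real (Suc n) * t)) \<le> lam p (real (Suc n) * t)"
    proof -
      have "exp (- (\<alpha> + \<delta>) * (real (Suc n) * t)) = exp (- (\<alpha> + \<delta>) * t) ^ Suc n"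
        by (simp only: exp_of_nat_mult[symmetric]) (simp add: algebra_simps)
      also have "\<dots> \<le> lam p t ^ Suc n" using low by (intro power_mono) auto
      also have "\<dots> \<le> lam p (real (Suc n) * t)" using p t by (intro lam_power) auto
      finally show ?thesis .
    qed
    ultimately show ?thesis by blast
  qed
  ultimately show ?thesis by blast
qed

text \<open>If many candidates at height \<open>t\<close> were likely, the flow started from them
  would reach height \<open>t + k * s\<close> too often. The survival bound has the form
  \<open>N / (N + m)\<close>, comparable to \<open>min N m / m\<close>, so it controls the first
  moment truncated at \<open>m\<close>.\<close>

lemma truncated_step:
  assumes p: "0 < p" "p \<le> 1" and s: "2 * t0 \<le> s" and lam_le: "lam p s \<le> exp (- s)"
  shows "\<exists>b\<ge>1. \<forall>k\<ge>1. \<forall>x\<in>Orb. \<forall>t\<ge>0. \<forall>F. finite F \<longrightarrow> F \<subseteq> E \<longrightarrow>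
    (let m = b * (\<Sum>j<k. CC p ^ j) / (lam p s / 2) ^ k in
      Ex p F (\<lambda>\<xi>. min (NN x t \<xi>) m) \<le> 2 * m * aa p (t + real k * s))"
proof -
  obtain b where b: "1 \<le> b" and ub: "\<And>k r W. finite W \<Longrightarrow> W \<noteq> {} \<Longrightarrow> W \<subseteq> Orb \<Longrightarrow> (\<forall>y\<in>W. r \<le> h y \<and> h y \<le> r + t0) \<Longrightarrow>
    (\<exists>F. finite F \<and> F \<subseteq> E \<and>
      real (card W) * (lam p s / 2) ^ k / (real (card W) * (lam p s / 2) ^ k + b * (\<Sum>j<k. CC p ^ j)) \<le>
      Pr p F (\<lambda>\<xi>. \<exists>y\<in>W. reach y r (r + real k * s) \<xi>))"
    using union_bound[OF p s lam_le] by blast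
  have p0: "0 \<le> p" using p by simp
  have s0: "0 \<le> s" using s g by simp
  show ?thesis
  proof (intro exI[of _ b] conjI allI ballI impI b)
    fix k :: nat and x and t :: real and F :: "'v set set" assume k: "1 \<le> k" and x: "x \<in> Orb" and t: "0 \<le> t" and F: "finite F" "F \<subseteq> E"
    define q where "q = (lam p s / 2) ^ k"
    define m where "m = b * (\<Sum>j<k. CC p ^ j) / q"
    define f where "f = (\<lambda>W :: 'v set. real (card W) / (real (card W) + m))"
    have q: "0 < q" using lam_pos[OF p, of s] by (simp add: q_def)
    have "0 < (\<Sum>j<k. CC p ^ j)" using CC_ge_1[OF p] k by (intro sum_pos) (auto simp: lessThan_empty_iff)
    then have m: "0 < m" using b q by (simp add: m_def)
    have fq: "f W = real (card W) * q / (real (card W) * q + b * (\<Sum>j<k. CC p ^ j))" for W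
    proof -
      have "real (card W) * q + b * (\<Sum>j<k. CC p ^ j) = (real (card W) + m) * q"
        using q by (simp add: m_def distrib_right)
      then show ?thesis using q by (simp add: f_def)
    qed
    have "\<exists>F'. finite F' \<and> F' \<subseteq> E \<and> F \<subseteq> F' \<and>
      Ex p F (\<lambda>\<xi>. f (cand x (h x + t) \<xi>)) \<le> Pr p F' (reach x (h x) (h x + t + real k * s))"
    proof (rule explore[OF p0 p(2) x])
      fix Q assume Q: "finite Q" "Q \<subseteq> Orb" "\<And>y. y \<in> Q \<Longrightarrow> h x + t \<le> h y \<and> h y \<le> h x + t + t0"
      show "\<exists>F'. finite F' \<and> F' \<subseteq> E \<and> f Q \<le> Pr p F' (\<lambda>\<xi>. \<exists>y\<in>Q. reach y (h x + t) (h x + t + real k * s) \<xi>)"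
      proof (cases "Q = {}")
        case True
        then show ?thesis by (auto simp: f_def intro!: exI[of _ "{}"])
      next
        case False
        then show ?thesis using ub[OF Q(1) False Q(2), of "h x + t" k] Q(3) unfolding fq q_def by blast
      qed
    qed (use t s0 F in auto)
    then obtain F' where F': "finite F'" "F' \<subseteq> E"
      "Ex p F (\<lambda>\<xi>. f (cand x (h x + t) \<xi>)) \<le> Pr p F' (reach x (h x) (h x + t + real k * s))" by blast
    have "min (NN x t \<xi>) m \<le> 2 * m * f (cand x (h x + t) \<xi>)" for \<xi>
    proof -
      define N where "N = NN x t \<xi>"
      have N: "0 \<le> N" by (simp add: N_def)
      have "min N m * (N + m) \<le> 2 * m * N"
      proof (cases "N \<le> m")
        case True
        then have "N * (N + m) \<le> N * (m + m)" using N by (intro mult_left_mono) auto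
        then show ?thesis using True by (simp add: algebra_simps)
      next
        case False
        then have "m * (N + m) \<le> m * (N + N)" using m by (intro mult_left_mono) auto
        then show ?thesis using False by (simp add: algebra_simps)
      qed
      then have "min N m \<le> 2 * m * N / (N + m)" using N m by (simp add: pos_le_divide_eq)
      then show ?thesis by (simp add: f_def N_def)
    qed
    then have "Ex p F (\<lambda>\<xi>. min (NN x t \<xi>) m) \<le> Ex p F (\<lambda>\<xi>. 2 * m * f (cand x (h x + t) \<xi>))"
      using p p0 by (intro Ex_mono)
    also have "\<dots> = 2 * m * Ex p F (\<lambda>\<xi>. f (cand x (h x + t) \<xi>))" by (rule Ex_cmult)
    also have "\<dots> \<le> 2 * m * aa p (t + real k * s)"
    proof -
      have "Pr p F' (reach x (h x) (h x + (t + real k * s))) \<le> aa p (t + real k * s)"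
        by (rule aa_upper[OF p0 p(2) x F'(1,2)])
      then show ?thesis using F'(3) m by (intro mult_left_mono) (auto simp: add.assoc)
    qed
    finally show "let m = b * (\<Sum>j<k. CC p ^ j) / (lam p s / 2) ^ k in
      Ex p F (\<lambda>\<xi>. min (NN x t \<xi>) m) \<le> 2 * m * aa p (t + real k * s)"
      unfolding Let_def m_def q_def .
  qed
qed

text \<open>The truncation level \<open>m\<close> is about \<open>exp (\<alpha> * k * s)\<close> and
  the reaching probability about \<open>exp (- t - \<alpha> * k * s)\<close>. The rate \<alpha>
  cancels in their product; the errors of order \<delta> in the exponents become the power
  \<open>n powr \<epsilon>\<close>.\<close>

lemma truncated_moment:
  assumes p: "0 < p" "p \<le> 1" and le: "\<And>t. t0 \<le> t \<Longrightarrow> lam p t \<le> exp (- t)" and \<epsilon>: "0 < \<epsilon>"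
  shows "\<exists>C>0. \<forall>x\<in>Orb. \<forall>t\<ge>0. \<forall>n\<ge>1. \<forall>F. finite F \<longrightarrow> F \<subseteq> E \<longrightarrow>
    Ex p F (\<lambda>\<xi>. min (NN x t \<xi>) n) \<le> C * n powr \<epsilon> * exp (- t)"
proof -
  define \<delta> where "\<delta> = \<epsilon> / 4"
  have \<delta>: "0 < \<delta>" using \<epsilon> by (simp add: \<delta>_def)
  have t0: "0 < t0" using g by simp
  obtain \<alpha> where \<alpha>: "1 \<le> \<alpha>" "\<And>t. t0 \<le> t \<Longrightarrow> lam p t \<le> exp (- \<alpha> * t)"
    "\<And>B. \<exists>s\<ge>B. t0 \<le> s \<and> exp (- (\<alpha> + \<delta>) * s) \<le> lam p s" using lam_exponent[OF p le \<delta>] by blast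
  have CC: "1 \<le> CC p" by (rule CC_ge_1[OF p])
  \<comment> \<open>The spacing is so large that \<open>exp (\<delta> * s)\<close> dominates both
    the factor 2 lost in the row sums and the column bound.\<close>
  obtain s where s: "max (2 * t0) (max (ln 2 / \<delta>) (ln (CC p) / \<delta>)) \<le> s" "exp (- (\<alpha> + \<delta>) * s) \<le> lam p s"
    using \<alpha>(3) by blast
  have s': "2 * t0 \<le> s" "ln 2 \<le> \<delta> * s" "ln (CC p) \<le> \<delta> * s" "0 < s"
    using s(1) \<delta> t0 by (auto simp: pos_divide_le_eq mult.commute)
  have "exp (ln (CC p)) \<le> exp (\<delta> * s)" using s'(3) by simp
  then have CCs: "CC p \<le> exp (\<delta> * s)" using CC by simp
  define q where "q = lam p s / 2"
  have q: "0 < q" using lam_pos[OF p] by (simp add: q_def)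
  have q_low: "exp (- (\<alpha> + 2 * \<delta>) * s) \<le> q"
  proof -
    have e: "exp (ln 2) = (2 :: real)" by simp
    have "exp (ln 2) \<le> exp (\<delta> * s)" using s'(2) by (subst exp_le_cancel_iff)
    then have "2 \<le> exp (\<delta> * s)" unfolding e .
    then have "exp (- (\<alpha> + 2 * \<delta>) * s) * 2 \<le> exp (- (\<alpha> + 2 * \<delta>) * s) * exp (\<delta> * s)" by (intro mult_left_mono) auto
    also have "\<dots> = exp (- (\<alpha> + \<delta>) * s)" by (simp add: exp_add[symmetric] algebra_simps)
    finally show ?thesis using s(2) by (simp add: q_def)
  qed
  have lam_s: "lam p s \<le> exp (- s)" using le s' t0 by simp
  from truncated_step[OF p s'(1) lam_s] obtain b where b: "1 \<le> b"
    and ts0: "\<forall>k\<ge>1. \<forall>x\<in>Orb. \<forall>t\<ge>0. \<forall>F. finite F \<longrightarrow> F \<subseteq> E \<longrightarrow>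
      (let m = b * (\<Sum>j<k. CC p ^ j) / q ^ k in Ex p F (\<lambda>\<xi>. min (NN x t \<xi>) m) \<le> 2 * m * aa p (t + real k * s))"
    unfolding q_def[symmetric] by (elim exE conjE)
  have ts: "Ex p F (\<lambda>\<xi>. min (NN x t \<xi>) (b * (\<Sum>j<k. CC p ^ j) / q ^ k)) \<le>
      2 * (b * (\<Sum>j<k. CC p ^ j) / q ^ k) * aa p (t + real k * s)"
    if "1 \<le> k" "x \<in> Orb" "0 \<le> t" "finite F" "F \<subseteq> E" for k x t F by (rule ts0[unfolded Let_def, rule_format, OF that])
  define P where "P = p ^ (m0 * L)"
  have P: "0 < P" using p by (simp add: P_def)
  define C where "C = 2 * (b / (\<delta> * s)) / P * exp (8 * \<delta> * s)"
  have C: "0 < C" using b \<delta> s' P by (simp add: C_def)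
  show ?thesis
  proof (intro exI[of _ C] conjI C ballI allI impI)
    fix x t n F assume x: "x \<in> Orb" and t: "0 \<le> (t :: real)" and n: "1 \<le> (n :: real)" and F: "finite F" "F \<subseteq> E"
    \<comment> \<open>The least number of levels, up to rounding, with
      \<open>exp (k * s) \<ge> n\<close>; this gives \<open>m \<ge> n\<close>.\<close>
    define k where "k = nat \<lceil>ln n / s\<rceil> + 1"
    have k1: "1 \<le> k" by (simp add: k_def)
    have ln0: "0 \<le> ln n" using n by simp
    have "ln n / s \<le> nat \<lceil>ln n / s\<rceil>" by (rule real_nat_ceiling_ge)
    then have "ln n / s \<le> real k" by (simp add: k_def)
    then have kn: "ln n \<le> real k * s" using s' by (simp add: pos_divide_le_eq)
    have "real (nat \<lceil>ln n / s\<rceil>) \<le> ln n / s + 1" using ln0 s' by (simp add: of_nat_nat)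
    then have "real k \<le> ln n / s + 2" by (simp add: k_def)
    then have ks: "real k * s \<le> ln n + 2 * s" using s' mult_right_mono[of "real k" "ln n / s + 2" s] by (simp add: distrib_right)
    define m where "m = b * (\<Sum>j<k. CC p ^ j) / q ^ k"
    have S1: "1 \<le> (\<Sum>j<k. CC p ^ j)" using member_le_sum[of 0 "{..<k}" "\<lambda>j. CC p ^ j"] k1 CC by simp
    have m_low: "n \<le> m"
    proof -
      have "lam p s \<le> exp (- s)" by (rule lam_s)
      then have "q \<le> exp (- s)" using lam_pos[OF p, of s] by (simp add: q_def)
      then have "q ^ k \<le> exp (- s) ^ k" using q by (intro power_mono) auto
      also have "\<dots> = exp (- (real k * s))" by (simp add: exp_of_nat_mult[symmetric])
      also have "\<dots> \<le> exp (- ln n)" using kn by simp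
      also have "\<dots> = 1 / n" using n by (simp add: exp_minus field_simps)
      finally have "n \<le> 1 / q ^ k" using n q by (simp add: field_simps)
      also have "\<dots> \<le> b * (\<Sum>j<k. CC p ^ j) / q ^ k"
        using b S1 q mult_mono[of 1 b 1 "\<Sum>j<k. CC p ^ j"] by (intro divide_right_mono) auto
      finally show ?thesis by (simp add: m_def)
    qed
    have m_up: "m \<le> b / (\<delta> * s) * exp ((\<alpha> + 4 * \<delta>) * (real k * s))"
    proof -
      have "(\<Sum>j<k. CC p ^ j) \<le> (\<Sum>j<k. exp (\<delta> * s * real k))"
      proof (rule sum_mono)
        fix j assume "j \<in> {..<k}"
        then have "CC p ^ j \<le> CC p ^ k" using CC by (intro power_increasing) auto
        also have "\<dots> \<le> exp (\<delta> * s) ^ k" using CCs CC by (intro power_mono) auto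
        finally show "CC p ^ j \<le> exp (\<delta> * s * real k)" by (simp add: exp_of_nat_mult[symmetric] mult_ac)
      qed
      also have "\<dots> = real k * exp (\<delta> * s * real k)" by simp
      also have "\<dots> \<le> (exp (\<delta> * s * real k) / (\<delta> * s)) * exp (\<delta> * s * real k)"
      proof (intro mult_right_mono)
        have "\<delta> * s * real k \<le> exp (\<delta> * s * real k)" using exp_ge_add_one_self[of "\<delta> * s * real k"] by linarith
        then show "real k \<le> exp (\<delta> * s * real k) / (\<delta> * s)" using \<delta> s' by (simp add: pos_le_divide_eq mult_ac)
      qed simp
      finally have 1: "(\<Sum>j<k. CC p ^ j) \<le> exp (2 * \<delta> * (real k * s)) / (\<delta> * s)"
        by (simp add: exp_add[symmetric] algebra_simps)
      have "exp (- (\<alpha> + 2 * \<delta>) * s) ^ k \<le> q ^ k" using q_low by (intro power_mono) auto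
      then have "exp (- ((\<alpha> + 2 * \<delta>) * (real k * s))) \<le> q ^ k" by (simp add: exp_of_nat_mult[symmetric] algebra_simps)
      then have "exp (- ((\<alpha> + 2 * \<delta>) * (real k * s))) * exp ((\<alpha> + 2 * \<delta>) * (real k * s)) \<le>
          q ^ k * exp ((\<alpha> + 2 * \<delta>) * (real k * s))" by (rule mult_right_mono) simp
      then have "1 \<le> q ^ k * exp ((\<alpha> + 2 * \<delta>) * (real k * s))" unfolding exp_add[symmetric] by simp
      then have 2: "1 / q ^ k \<le> exp ((\<alpha> + 2 * \<delta>) * (real k * s))" using q by (simp add: pos_divide_le_eq mult.commute)
      have "m = b * (\<Sum>j<k. CC p ^ j) * (1 / q ^ k)" by (simp add: m_def)
      also have "\<dots> \<le> b * (exp (2 * \<delta> * (real k * s)) / (\<delta> * s)) * exp ((\<alpha> + 2 * \<delta>) * (real k * s))"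
        using 1 2 b q S1 \<delta> s' by (intro mult_mono mult_left_mono mult_nonneg_nonneg) auto
      also have "\<dots> = b / (\<delta> * s) * (exp (2 * \<delta> * (real k * s)) * exp ((\<alpha> + 2 * \<delta>) * (real k * s)))" by simp
      also have "exp (2 * \<delta> * (real k * s)) * exp ((\<alpha> + 2 * \<delta>) * (real k * s)) = exp ((\<alpha> + 4 * \<delta>) * (real k * s))"
        by (simp add: exp_add[symmetric] algebra_simps)
      finally show ?thesis .
    qed
    have m0': "0 \<le> m" using m_low n by simp
    have "aa p (t + real k * s) = lam p (t + real k * s + t0) / P" using p by (simp add: lam_def P_def)
    also have "\<dots> \<le> exp (- \<alpha> * (t + real k * s + t0)) / P"
      using \<alpha>(2)[of "t + real k * s + t0"] t s' P by (intro divide_right_mono) auto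
    also have "\<dots> \<le> exp (- t - \<alpha> * (real k * s)) / P"
    proof -
      have "t \<le> \<alpha> * t" "0 \<le> \<alpha> * t0" using \<alpha>(1) t t0 mult_right_mono[of 1 \<alpha> t] by auto
      then show ?thesis using P by (intro divide_right_mono) (auto simp: algebra_simps)
    qed
    finally have A: "aa p (t + real k * s) \<le> exp (- t - \<alpha> * (real k * s)) / P" .
    have "Ex p F (\<lambda>\<xi>. min (NN x t \<xi>) n) \<le> Ex p F (\<lambda>\<xi>. min (NN x t \<xi>) m)" using p m_low by (intro Ex_mono) auto
    also have "\<dots> \<le> 2 * m * aa p (t + real k * s)" unfolding m_def by (rule ts[OF k1 x t F])
    also have "\<dots> \<le> 2 * (b / (\<delta> * s) * exp ((\<alpha> + 4 * \<delta>) * (real k * s))) * (exp (- t - \<alpha> * (real k * s)) / P)"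
      using m_up A m0' b \<delta> s' p by (intro mult_mono mult_left_mono aa_nonneg) auto
    also have "\<dots> = 2 * (b / (\<delta> * s)) / P * (exp ((\<alpha> + 4 * \<delta>) * (real k * s)) * exp (- t - \<alpha> * (real k * s)))" by simp
    also have "exp ((\<alpha> + 4 * \<delta>) * (real k * s)) * exp (- t - \<alpha> * (real k * s)) = exp (4 * \<delta> * (real k * s)) * exp (- t)"
      by (simp add: exp_add[symmetric] algebra_simps)
    also have "2 * (b / (\<delta> * s)) / P * (exp (4 * \<delta> * (real k * s)) * exp (- t)) \<le>
      2 * (b / (\<delta> * s)) / P * ((exp (8 * \<delta> * s) * n powr \<epsilon>) * exp (- t))"
    proof (intro mult_left_mono mult_right_mono)
      have "4 * \<delta> * (real k * s) \<le> 4 * \<delta> * (ln n + 2 * s)" using ks \<delta> by (intro mult_left_mono) auto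
      then have "exp (4 * \<delta> * (real k * s)) \<le> exp (8 * \<delta> * s + \<epsilon> * ln n)" by (simp add: \<delta>_def algebra_simps)
      then show "exp (4 * \<delta> * (real k * s)) \<le> exp (8 * \<delta> * s) * n powr \<epsilon>" using n by (simp add: exp_add powr_def)
    qed (use b \<delta> s' P in auto)
    also have "\<dots> = C * n powr \<epsilon> * exp (- t)" by (simp add: C_def)
    finally show "Ex p F (\<lambda>\<xi>. min (NN x t \<xi>) n) \<le> C * n powr \<epsilon> * exp (- t)" .
  qed
qed

section \<open>The second moment and removal of the truncation\<close>

lemma cand_mono: "\<xi> \<subseteq> \<xi>' \<Longrightarrow> cand x r \<xi> \<subseteq> cand x r \<xi>'"
proof
  fix y assume "\<xi> \<subseteq> \<xi>'" "y \<in> cand x r \<xi>"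
  moreover have "conn (\<xi>' \<inter> Reg (h x) r) x y"
    by (rule conn_mono[of "\<xi> \<inter> Reg (h x) r"]) (use calculation in \<open>auto simp: cand_def\<close>)
  ultimately show "y \<in> cand x r \<xi>'" by (simp add: cand_def)
qed

lemma Reg_height: "e \<in> Reg a b \<Longrightarrow> u \<in> e \<Longrightarrow> h u \<le> b + t0"
proof -
  assume e: "e \<in> Reg a b" "u \<in> e"
  then obtain v where v: "v \<in> e" "h v < b" by (auto simp: Reg_def)
  have "e \<in> E" using e Reg_E by auto
  then obtain w where w: "e = {w, u}" using edge_pair e by blast
  then have "\<bar>h w - h u\<bar> \<le> t0" using lip \<open>e \<in> E\<close> by blast
  then show "h u \<le> b + t0" using v w g by auto
qed

text \<open>The tilt 1/2 is self-dual: mass transport exchanges the tilts \<lambda> and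
  \<open>1 - \<lambda>\<close>, so no direction of summation is preferred.\<close>

definition XX :: "real \<Rightarrow> real \<Rightarrow> bool" where
  "XX p Y \<longleftrightarrow> (\<forall>F A x. finite F \<longrightarrow> F \<subseteq> E \<longrightarrow> finite A \<longrightarrow> A \<subseteq> V \<longrightarrow> x \<in> V \<longrightarrow>
    (\<Sum>y\<in>A. tau p F x y * exp ((h y - h x) / 2)) \<le> Y)"

lemma XX_D: "XX p Y \<Longrightarrow> finite F \<Longrightarrow> F \<subseteq> E \<Longrightarrow> finite A \<Longrightarrow> A \<subseteq> V \<Longrightarrow> x \<in> V \<Longrightarrow>
    (\<Sum>y\<in>A. tau p F x y * exp ((h y - h x) / 2)) \<le> Y"
  unfolding XX_def by blast

text \<open>Each of the three legs of the tree costs a factor \<open>Y\<close>. The two legs that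
  end above height \<open>t\<close> decay through the weight, and the branch point is at most
  \<open>t0\<close> above that height; this leaves \<open>exp (- t / 2)\<close>.\<close>

lemma NN_square:
  assumes p: "0 \<le> p" "p \<le> 1" and Y: "XX p Y" and x: "x \<in> Orb" and t: "0 \<le> t" and F: "finite F" "F \<subseteq> E"
  shows "Ex p F (\<lambda>\<xi>. NN x t \<xi> * NN x t \<xi>) \<le> Y ^ 3 * exp (t0 / 2) * exp (- t / 2)"
proof -
  let ?R = "Reg (h x) (h x + t)"
  have xV: "x \<in> V" using x Orb_sub by auto
  have Y0: "0 \<le> Y" using XX_D[OF Y F, of "{}" x] xV by simp
  define A where "A = {y \<in> insert x (\<Union>F). y \<in> Orb \<and> h x + t \<le> h y}"
  have A: "finite A" "A \<subseteq> V" using finite_verts[OF F] finite_subset[of A "insert x (\<Union>F)"] Orb_sub by (auto simp: A_def)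
  define Z where "Z = insert x (\<Union>(F \<inter> ?R))"
  have Z: "finite Z" "Z \<subseteq> V" using finite_verts[of "F \<inter> ?R"] verts_V[of "F \<inter> ?R"] F xV by (auto simp: Z_def)
  have Zh: "h z \<le> h x + t + t0" if "z \<in> Z" for z using that Reg_height t g by (fastforce simp: Z_def)
  have NN: "NN x t \<xi> = (\<Sum>y\<in>A. of_bool (conn (\<xi> \<inter> ?R) x y))" if "\<xi> \<subseteq> F" for \<xi>
  proof -
    have "cand x (h x + t) \<xi> = {y \<in> A. conn (\<xi> \<inter> ?R) x y}"
      using cand_sub[OF that, of x "h x + t"] by (auto simp: A_def cand_def)
    then show ?thesis using A(1) by (simp add: of_bool_def sum.If_cases Int_def)
  qed
  define w where "w = (\<lambda>z. \<Sum>y\<in>A. tau p F z y)"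
  have w: "0 \<le> w z" for z unfolding w_def using p by (intro sum_nonneg) auto
  have w_le: "w z * exp ((h x + t - h z) / 2) \<le> Y" if "z \<in> Z" for z
  proof -
    have "w z * exp ((h x + t - h z) / 2) \<le> (\<Sum>y\<in>A. tau p F z y * exp ((h y - h z) / 2))"
      unfolding w_def sum_distrib_right using p by (intro sum_mono mult_left_mono) (auto simp: A_def)
    also have "\<dots> \<le> Y" using that Z by (intro XX_D[OF Y F A]) auto
    finally show ?thesis .
  qed
  have "Ex p F (\<lambda>\<xi>. NN x t \<xi> * NN x t \<xi>) = Ex p F (\<lambda>\<xi>. \<Sum>y\<in>A. \<Sum>y'\<in>A. of_bool (conn (\<xi> \<inter> ?R) x y \<and> conn (\<xi> \<inter> ?R) x y'))"
    using NN by (intro Ex_cong) (simp add: sum_product of_bool_conj)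
  also have "\<dots> = (\<Sum>y\<in>A. \<Sum>y'\<in>A. Pr p F (\<lambda>\<xi>. conn (\<xi> \<inter> ?R) x y \<and> conn (\<xi> \<inter> ?R) x y'))" by (simp add: Ex_sum)
  also have "\<dots> \<le> (\<Sum>y\<in>A. \<Sum>y'\<in>A. \<Sum>z\<in>Z. tauR p F ?R x z * tau p F z y * tau p F z y')"
    by (intro sum_mono tree_graph F p Z) (simp add: Z_def)
  also have "\<dots> = (\<Sum>z\<in>Z. tauR p F ?R x z * (w z * w z))"
  proof -
    have "(\<Sum>y\<in>A. \<Sum>y'\<in>A. \<Sum>z\<in>Z. a z * c z y * c z y') = (\<Sum>z\<in>Z. a z * ((\<Sum>y\<in>A. c z y) * (\<Sum>y\<in>A. c z y)))"
      for a :: "'v \<Rightarrow> real" and c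
    proof -
      have "(\<Sum>y\<in>A. \<Sum>y'\<in>A. \<Sum>z\<in>Z. a z * c z y * c z y') = (\<Sum>y\<in>A. \<Sum>z\<in>Z. \<Sum>y'\<in>A. a z * c z y * c z y')"
        by (intro sum.cong refl sum.swap)
      also have "\<dots> = (\<Sum>z\<in>Z. \<Sum>y\<in>A. \<Sum>y'\<in>A. a z * c z y * c z y')" by (rule sum.swap)
      also have "\<dots> = (\<Sum>z\<in>Z. a z * ((\<Sum>y\<in>A. c z y) * (\<Sum>y\<in>A. c z y)))"
        unfolding sum_product unfolding sum_distrib_left mult.assoc ..
      finally show ?thesis .
    qed
    then show ?thesis unfolding w_def .
  qed
  also have "\<dots> \<le> (\<Sum>z\<in>Z. tau p F x z * (Y * Y * exp (- (h x + t - h z))))"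
  proof (rule sum_mono)
    fix z assume z: "z \<in> Z"
    have "w z \<le> Y * exp (- (h x + t - h z) / 2)"
    proof -
      define a where "a = (h x + t - h z) / 2"
      have "w z * exp a * exp (- a) \<le> Y * exp (- a)" using w_le[OF z] by (intro mult_right_mono) (auto simp: a_def)
      then have "w z \<le> Y * exp (- a)" by (simp add: mult.assoc exp_add[symmetric])
      then show ?thesis by (simp add: a_def minus_divide_left)
    qed
    then have "w z * w z \<le> (Y * exp (- (h x + t - h z) / 2)) * (Y * exp (- (h x + t - h z) / 2))"
      using w Y0 by (intro mult_mono) auto
    also have "\<dots> = Y * Y * (exp (- (h x + t - h z) / 2) * exp (- (h x + t - h z) / 2))" by simp
    also have "exp (- (h x + t - h z) / 2) * exp (- (h x + t - h z) / 2) = exp (- (h x + t - h z))"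
      by (simp add: exp_add[symmetric])
    finally have 1: "w z * w z \<le> Y * Y * exp (- (h x + t - h z))" .
    have 2: "tauR p F ?R x z \<le> tau p F x z" by (rule Pr_mono[OF p]) (erule conn_mono, blast)
    show "tauR p F ?R x z * (w z * w z) \<le> tau p F x z * (Y * Y * exp (- (h x + t - h z)))"
      by (rule mult_mono[OF 2 1]) (use w p in auto)
  qed
  also have "\<dots> \<le> (\<Sum>z\<in>Z. tau p F x z * exp ((h z - h x) / 2) * (Y * Y * (exp (t0 / 2) * exp (- t / 2))))"
  proof (rule sum_mono)
    fix z assume z: "z \<in> Z"
    \<comment> \<open>Half of the exponent is kept as the weight of \<open>z\<close>; for the other
      half, \<open>z\<close> is at most \<open>t + t0\<close> above \<open>x\<close>.\<close>
    have "exp (- (h x + t - h z)) \<le> exp ((h z - h x) / 2) * (exp (t0 / 2) * exp (- t / 2))"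
      using Zh[OF z] by (simp add: exp_add[symmetric] field_simps)
    then have "tau p F x z * (Y * Y) * exp (- (h x + t - h z)) \<le>
      tau p F x z * (Y * Y) * (exp ((h z - h x) / 2) * (exp (t0 / 2) * exp (- t / 2)))"
      using p Y0 by (intro mult_left_mono mult_nonneg_nonneg) auto
    then show "tau p F x z * (Y * Y * exp (- (h x + t - h z))) \<le>
      tau p F x z * exp ((h z - h x) / 2) * (Y * Y * (exp (t0 / 2) * exp (- t / 2)))"
      by (simp add: mult_ac)
  qed
  also have "\<dots> \<le> Y * (Y * Y * (exp (t0 / 2) * exp (- t / 2)))"
    unfolding sum_distrib_right[symmetric] using Y0 by (intro mult_right_mono XX_D[OF Y F Z xV]) auto
  finally show ?thesis by (simp add: power3_eq_cube mult_ac)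
qed

text \<open>The rate 3/4 must exceed 1/2, the growth of the weight in \<open>XX\<close>. Beyond the
  truncation the second moment gives this rate with no positive power of \<open>Y\<close>; the power
  \<open>3 * \<epsilon>\<close> stems from the truncated part alone. The constant belongs to
  \<open>p\<close> and serves all \<open>q \<le> p\<close>.\<close>

lemma NN_moment:
  assumes p: "0 < p" "p \<le> 1" and le: "\<And>t. t0 \<le> t \<Longrightarrow> lam p t \<le> exp (- t)" and \<epsilon>: "0 < \<epsilon>" "\<epsilon> \<le> 1"
  shows "\<exists>C>0. \<forall>q Y. 0 \<le> q \<longrightarrow> q \<le> p \<longrightarrow> 1 \<le> Y \<longrightarrow> XX q Y \<longrightarrow> (\<forall>x\<in>Orb. \<forall>t\<ge>0. \<forall>F. finite F \<longrightarrow> F \<subseteq> E \<longrightarrow>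
    Ex q F (\<lambda>\<xi>. NN x t \<xi>) \<le> C * Y powr (3 * \<epsilon>) * exp (- (3 / 4) * t))"
proof -
  have "\<exists>C>0. \<forall>x\<in>Orb. \<forall>t\<ge>0. \<forall>n\<ge>1. \<forall>F. finite F \<longrightarrow> F \<subseteq> E \<longrightarrow>
      Ex p F (\<lambda>\<xi>. min (NN x t \<xi>) n) \<le> C * n powr \<epsilon> * exp (- t)"
    by (rule truncated_moment) (use p le \<epsilon> in auto)
  then obtain C where C1: "0 < C"
    and C0: "\<forall>x\<in>Orb. \<forall>t\<ge>0. \<forall>n\<ge>1. \<forall>F. finite F \<longrightarrow> F \<subseteq> E \<longrightarrow>
      Ex p F (\<lambda>\<xi>. min (NN x t \<xi>) n) \<le> C * n powr \<epsilon> * exp (- t)"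
    by (elim exE conjE)
  have C: "0 < C" "\<And>x t n F. x \<in> Orb \<Longrightarrow> 0 \<le> t \<Longrightarrow> 1 \<le> n \<Longrightarrow> finite F \<Longrightarrow> F \<subseteq> E \<Longrightarrow>
    Ex p F (\<lambda>\<xi>. min (NN x t \<xi>) n) \<le> C * n powr \<epsilon> * exp (- t)"
    by (rule C1, rule C0[rule_format])
  show ?thesis
  proof (intro exI[of _ "C + exp (t0 / 2)"] conjI allI impI ballI)
    fix q Y and x and t :: real and F :: "'v set set" assume q: "0 \<le> q" "q \<le> p" and Y: "1 \<le> Y" "XX q Y" and x: "x \<in> Orb" and t: "0 \<le> t" and F: "finite F" "F \<subseteq> E"
    \<comment> \<open>\<open>Y ^ 3\<close> cancels the same factor in \<open>NN_square\<close>, and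
      \<open>exp (t / 4)\<close> improves its decay from 1/2 to 3/4.\<close>
    define n where "n = Y ^ 3 * exp (t / 4)"
    have Y3: "1 \<le> Y ^ 3" using Y by simp
    have n: "1 \<le> n" unfolding n_def using Y Y3 t mult_mono[of 1 "Y ^ 3" 1 "exp (t / 4)"] by simp
    \<comment> \<open>Intersecting with \<open>F\<close> keeps the candidate sets finite, so that
      the count is monotone on all edge sets although \<open>card\<close> is 0 on infinite
      sets.\<close>
    have "Ex q F (\<lambda>\<xi>. min (NN x t \<xi>) n) = Ex q F (\<lambda>\<xi>. min (NN x t (\<xi> \<inter> F)) n)"
      by (intro Ex_cong) (simp add: Int_absorb2)
    also have "\<dots> \<le> Ex p F (\<lambda>\<xi>. min (NN x t (\<xi> \<inter> F)) n)"
    proof (rule Ex_mono_p[OF F(1) q p(2)])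
      show "mono (\<lambda>\<xi>. min (NN x t (\<xi> \<inter> F)) n)"
      proof (rule monoI)
        fix \<xi> \<xi>' :: "'v set set" assume "\<xi> \<subseteq> \<xi>'"
        then have "cand x (h x + t) (\<xi> \<inter> F) \<subseteq> cand x (h x + t) (\<xi>' \<inter> F)" by (intro cand_mono) auto
        then have "card (cand x (h x + t) (\<xi> \<inter> F)) \<le> card (cand x (h x + t) (\<xi>' \<inter> F))"
          using finite_cand[OF F, of "\<xi>' \<inter> F"] by (intro card_mono) auto
        then show "min (NN x t (\<xi> \<inter> F)) n \<le> min (NN x t (\<xi>' \<inter> F)) n" by auto
      qed
    qed
    also have "\<dots> = Ex p F (\<lambda>\<xi>. min (NN x t \<xi>) n)" by (intro Ex_cong) (simp add: Int_absorb2)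
    also have "\<dots> \<le> C * n powr \<epsilon> * exp (- t)" by (rule C(2)[OF x t n F])
    also have "n powr \<epsilon> = Y powr (3 * \<epsilon>) * exp (\<epsilon> * t / 4)"
    proof -
      have "n powr \<epsilon> = (Y powr 3) powr \<epsilon> * exp (t / 4) powr \<epsilon>" using Y by (simp add: n_def powr_mult powr_numeral)
      also have "(Y powr 3) powr \<epsilon> = Y powr (3 * \<epsilon>)" by (rule powr_powr)
      also have "exp (t / 4) powr \<epsilon> = exp (\<epsilon> * t / 4)" by (simp add: powr_def)
      finally show ?thesis .
    qed
    also have "C * (Y powr (3 * \<epsilon>) * exp (\<epsilon> * t / 4)) * exp (- t) \<le> C * Y powr (3 * \<epsilon>) * exp (- (3 / 4) * t)"
    proof -
      have "\<epsilon> * t \<le> 1 * t" using \<epsilon> t by (intro mult_right_mono) auto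
      then have "exp (\<epsilon> * t / 4) * exp (- t) \<le> exp (- (3 / 4) * t)" by (simp add: exp_add[symmetric])
      then have "C * Y powr (3 * \<epsilon>) * (exp (\<epsilon> * t / 4) * exp (- t)) \<le> C * Y powr (3 * \<epsilon>) * exp (- (3 / 4) * t)"
        using C(1) by (intro mult_left_mono) auto
      then show ?thesis by (simp add: mult_ac)
    qed
    finally have 1: "Ex q F (\<lambda>\<xi>. min (NN x t \<xi>) n) \<le> C * Y powr (3 * \<epsilon>) * exp (- (3 / 4) * t)" .
    have "Ex q F (\<lambda>\<xi>. NN x t \<xi> * NN x t \<xi>) * (1 / n) \<le> Y ^ 3 * exp (t0 / 2) * exp (- t / 2) * (1 / n)"
      using q p n by (intro mult_right_mono NN_square[OF _ _ Y(2) x t F]) auto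
    also have "\<dots> = exp (t0 / 2) * (exp (- t / 2) / exp (t / 4))" using Y by (simp add: n_def)
    also have "\<dots> = exp (t0 / 2) * exp (- (3 / 4) * t)" by (simp add: exp_diff[symmetric])
    also have "\<dots> \<le> exp (t0 / 2) * Y powr (3 * \<epsilon>) * exp (- (3 / 4) * t)"
    proof -
      have "1 \<le> Y powr (3 * \<epsilon>)" using Y \<epsilon> by (simp add: ge_one_powr_ge_zero)
      then have "exp (t0 / 2) * 1 * exp (- (3 / 4) * t) \<le> exp (t0 / 2) * Y powr (3 * \<epsilon>) * exp (- (3 / 4) * t)"
        by (intro mult_right_mono mult_left_mono) auto
      then show ?thesis by simp
    qed
    finally have 2: "Ex q F (\<lambda>\<xi>. NN x t \<xi> * NN x t \<xi>) * (1 / n) \<le> exp (t0 / 2) * Y powr (3 * \<epsilon>) * exp (- (3 / 4) * t)" .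
    have "NN x t \<xi> \<le> min (NN x t \<xi>) n + NN x t \<xi> * NN x t \<xi> * (1 / n)" for \<xi>
    proof (cases "NN x t \<xi> \<le> n")
      case True
      then show ?thesis using n by simp
    next
      case False
      then have "NN x t \<xi> * n \<le> NN x t \<xi> * NN x t \<xi>" by (intro mult_left_mono) auto
      then have "NN x t \<xi> \<le> NN x t \<xi> * NN x t \<xi> * (1 / n)" using n by (simp add: pos_le_divide_eq)
      then show ?thesis using n by (simp add: min_def)
    qed
    then have "Ex q F (\<lambda>\<xi>. NN x t \<xi>) \<le> Ex q F (\<lambda>\<xi>. min (NN x t \<xi>) n + NN x t \<xi> * NN x t \<xi> * (1 / n))"
      using q p by (intro Ex_mono) auto
    also have "\<dots> = Ex q F (\<lambda>\<xi>. min (NN x t \<xi>) n) + Ex q F (\<lambda>\<xi>. NN x t \<xi> * NN x t \<xi>) * (1 / n)"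
      unfolding Ex_add Ex_cmult_right ..
    finally show "Ex q F (\<lambda>\<xi>. NN x t \<xi>) \<le> (C + exp (t0 / 2)) * Y powr (3 * \<epsilon>) * exp (- (3 / 4) * t)"
      using 1 2 by (simp add: distrib_right)
  qed (use C in \<open>auto intro: add_pos_pos\<close>)
qed

end

section \<open>From crossing points to connections in bands\<close>

lemma powr_le_bound:
  assumes "1 \<le> (B::real)" "real k \<le> c" shows "B ^ k \<le> B powr c"
proof -
  have "B ^ k = B powr real k" using assms by (simp add: powr_realpow)
  also have "\<dots> \<le> B powr c" using assms by (intro powr_mono) auto
  finally show ?thesis .
qed

context tilted
begin

section \<open>Short connections to the orbit with controlled heights\<close>

lemma near_path:
  assumes "x \<in> V"
  shows "\<exists>a C. a \<in> Orb \<and> C \<subseteq> E \<and> finite C \<and> card C \<le> D \<and> conn C x a \<and> a \<in> nb E D x \<and>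
    (\<forall>e\<in>C. \<forall>v\<in>e. \<bar>h v - h x\<bar> \<le> D * t0) \<and> \<bar>h a - h x\<bar> \<le> D * t0"
proof -
  obtain a where a: "a \<in> Orb" "a \<in> nb E D x" using near_Orb[OF assms] by blast
  then obtain C where C: "C \<subseteq> E" "finite C" "card C \<le> D" "conn C x a" unfolding nb_def by blast
  obtain C' where C': "C' \<subseteq> C" "conn C' x a" "\<forall>e\<in>C'. e \<subseteq> nb C (card C) x" using conn_shrink[OF C(4,2)] by blast
  have "nb C (card C) x \<subseteq> nb E D x" using nb_mono[OF C(3), of E x] nb_mono_edges[OF C(1), of "card C" x] by blast
  then have "\<forall>e\<in>C'. \<forall>v\<in>e. \<bar>h v - h x\<bar> \<le> D * t0" using C'(3) lip_nb by blast
  moreover have "card C' \<le> D" using card_mono[OF C(2) C'(1)] C(3) by linarith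
  ultimately show ?thesis
    using a C C' finite_subset[OF C'(1) C(2)] lip_nb[OF a(2)] by (intro exI[of _ a] exI[of _ C'] conjI) auto
qed

text \<open>Unit climbs that suffice to gain \<open>u\<close> after a detour to the orbit, which may
  lose \<open>D * t0\<close>, with a margin of \<open>D * t0 + 1\<close> left over.\<close>

definition nd :: "real \<Rightarrow> nat" where "nd u = nat \<lceil>(u + 2 * (D * t0) + 1) / g\<rceil>"

lemma nd: "0 \<le> u \<Longrightarrow> u + 2 * (D * t0) + 1 \<le> nd u * g"
proof -
  have "(u + 2 * (D * t0) + 1) / g \<le> nd u" unfolding nd_def by (rule real_nat_ceiling_ge)
  then show ?thesis using g by (simp add: pos_divide_le_eq)
qed

lemma nd_le: "0 \<le> u \<Longrightarrow> nd u \<le> (u + 2 * (D * t0) + 1) / g + 1"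
proof -
  assume "0 \<le> u"
  then have "0 \<le> (u + 2 * (D * t0) + 1) / g" using g by simp
  then show ?thesis unfolding nd_def by linarith
qed

lemma down_path:
  assumes "x \<in> V" "0 \<le> u"
  shows "\<exists>w C. w \<in> Orb \<and> C \<subseteq> E \<and> finite C \<and> card C \<le> D + nd u * L \<and> conn C w x \<and> w \<in> nb E (D + nd u * L) x \<and>
    h w \<le> h x - u - D * t0 \<and> (\<forall>e\<in>C. \<forall>v\<in>e. h w \<le> h v \<and> h v \<le> h x + D * t0)"
proof -
  from near_path[OF assms(1)] obtain a C where C: "a \<in> Orb" "C \<subseteq> E" "finite C" "card C \<le> D" "conn C x a" "a \<in> nb E D x"
    "\<forall>e\<in>C. \<forall>v\<in>e. \<bar>h v - h x\<bar> \<le> D * t0" "\<bar>h a - h x\<bar> \<le> D * t0" by (elim exE conjE)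
  from descend[OF C(1), of "nd u"] obtain C' w where C': "C' \<subseteq> E" "w \<in> Orb" "finite C'" "card C' \<le> nd u * L" "conn C' w a"
    "h w = h a - nd u * g" "\<forall>e\<in>C'. \<forall>v\<in>e. h w \<le> h v \<and> h v \<le> h a" by (elim exE conjE bexE)
  have hw: "h w \<le> h x - u - D * t0" using C(8) C'(6) nd[OF assms(2)] by linarith
  have cc: "card (C' \<union> C) \<le> D + nd u * L" using card_Un_le[of C' C] C(4) C'(4) by linarith
  have cn: "conn (C' \<union> C) w x"
    using conn_mono[OF C'(5), of "C' \<union> C"] conn_mono[OF conn_sym[OF C(5)], of "C' \<union> C"] conn_trans[of "C' \<union> C" w a x] by simp
  have "x \<in> nb E (D + nd u * L) w" using conn_in_nb[OF cn] nb_mono[OF cc, of E w] C(2,3) C'(1,3) by auto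
  then have "w \<in> nb E (D + nd u * L) x" by (rule nb_sym)
  moreover have "\<forall>e\<in>C' \<union> C. \<forall>v\<in>e. h w \<le> h v \<and> h v \<le> h x + D * t0"
  proof (intro ballI)
    fix e v assume "e \<in> C' \<union> C" "v \<in> e"
    then have "\<bar>h v - h x\<bar> \<le> D * t0 \<or> (h w \<le> h v \<and> h v \<le> h a)" using C(7) C'(7) by auto
    then show "h w \<le> h v \<and> h v \<le> h x + D * t0" using hw C(8) assms(2) by linarith
  qed
  ultimately show ?thesis using C C' hw cc cn by (intro exI[of _ w] exI[of _ "C' \<union> C"] conjI) auto
qed

lemma up_path:
  assumes "y \<in> V" "0 \<le> u" "h y + D * t0 < T" "T \<le> h y + u + D * t0 + 1"
  shows "\<exists>z C. z \<in> Orb \<and> C \<subseteq> E \<and> finite C \<and> card C \<le> D + nd u * L \<and> conn C y z \<and> z \<in> nb E (D + nd u * L) y \<and>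
    T \<le> h z \<and> (\<forall>e\<in>C. (\<forall>v\<in>e. h y - D * t0 \<le> h v) \<and> (\<exists>v\<in>e. h v < T))"
proof -
  from near_path[OF assms(1)] obtain a C where C: "a \<in> Orb" "C \<subseteq> E" "finite C" "card C \<le> D" "conn C y a" "a \<in> nb E D y"
    "\<forall>e\<in>C. \<forall>v\<in>e. \<bar>h v - h y\<bar> \<le> D * t0" "\<bar>h a - h y\<bar> \<le> D * t0" by (elim exE conjE)
  have "T \<le> h a + nd u * g" using C(8) nd[OF assms(2)] assms(4) by linarith
  from climb_to[OF C(1) this] obtain C' z where C': "C' \<subseteq> Reg (h a) T" "finite C'" "card C' \<le> nd u * L" "z \<in> Orb" "T \<le> h z"
    "conn C' a z" by (elim exE conjE)
  have C'E: "C' \<subseteq> E" using C'(1) Reg_E by blast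
  have cc: "card (C \<union> C') \<le> D + nd u * L" using card_Un_le[of C C'] C(4) C'(3) by linarith
  have cn: "conn (C \<union> C') y z"
    using conn_mono[OF C(5), of "C \<union> C'"] conn_mono[OF C'(6), of "C \<union> C'"] conn_trans[of "C \<union> C'" y a z] by simp
  have "z \<in> nb E (D + nd u * L) y" using conn_in_nb[OF cn] nb_mono[OF cc, of E y] C(2,3) C'E C'(2) by auto
  moreover have "(\<forall>v\<in>e. h y - D * t0 \<le> h v) \<and> (\<exists>v\<in>e. h v < T)" if e: "e \<in> C \<union> C'" for e
  proof (cases "e \<in> C")
    case True
    then have "e \<in> E" using C(2) by auto
    then obtain v where "v \<in> e" using edge by blast
    moreover have "h y - D * t0 \<le> h v \<and> h v < T" if "v \<in> e" for v using C(7) True that assms(3) by force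
    ultimately show ?thesis by blast
  next
    case False
    then have "e \<in> Reg (h a) T" using e C'(1) by auto
    moreover have "h y - D * t0 \<le> h a" using C(8) by linarith
    ultimately show ?thesis unfolding Reg_def by force
  qed
  ultimately show ?thesis using C C' C'E cc cn by (intro exI[of _ z] exI[of _ "C \<union> C'"] conjI ballI) auto
qed

text \<open>Opening boundedly many edges turns a connection in a band into a crossing of a slab.\<close>

lemma insertion:
  assumes q: "0 < q" "q \<le> 1" and F: "finite F" "F \<subseteq> E" and A: "finite A" "A \<subseteq> V"
    and x: "x \<in> V" "lo \<le> h x" "h x \<le> hi" and u: "0 \<le> u" "h x - u \<le> lo"
    and Ah: "\<And>y. y \<in> A \<Longrightarrow> lo \<le> h y \<and> h y \<le> hi \<and> hi - u \<le> h y"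
  shows "\<exists>x'\<in>Orb. \<exists>t\<ge>hi - lo. \<exists>F'. finite F' \<and> F' \<subseteq> E \<and>
    (\<Sum>y\<in>A. tauR q F (Band lo hi) x y) \<le>
      (1 / q) ^ (2 * (D + nd u * L)) * real ((dg + 1) ^ (D + nd u * L)) * Ex q F' (NN x' t)"
proof -
  let ?k = "D + nd u * L" and ?B = "Band lo hi"
  have q0: "0 \<le> q" using q by simp
  \<comment> \<open>The spare 1 puts the band and the detour from \<open>x\<close> strictly below
    \<open>T\<close>, as membership in the half-open slab requires.\<close>
  define T where "T = hi + D * t0 + 1"
  have Dt: "0 \<le> D * t0" using g by simp
  from down_path[OF x(1) u(1)] obtain w Cw where w: "w \<in> Orb" "Cw \<subseteq> E" "finite Cw" "card Cw \<le> ?k" "conn Cw w x"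
    "h w \<le> h x - u - D * t0" "\<forall>e\<in>Cw. \<forall>v\<in>e. h w \<le> h v \<and> h v \<le> h x + D * t0" by (elim exE conjE)
  have hw: "h w \<le> lo - D * t0" using w(6) u by linarith
  have "\<forall>y\<in>A. \<exists>zC. fst zC \<in> Orb \<and> snd zC \<subseteq> E \<and> finite (snd zC) \<and> card (snd zC) \<le> ?k \<and> conn (snd zC) y (fst zC) \<and>
    fst zC \<in> nb E ?k y \<and> T \<le> h (fst zC) \<and> (\<forall>e\<in>snd zC. (\<forall>v\<in>e. h y - D * t0 \<le> h v) \<and> (\<exists>v\<in>e. h v < T))"
  proof
    fix y assume y: "y \<in> A"
    have "h y + D * t0 < T" "T \<le> h y + u + D * t0 + 1" using Ah[OF y] by (auto simp: T_def)
    from up_path[OF _ u(1) this] y A(2) obtain z C where "z \<in> Orb \<and> C \<subseteq> E \<and> finite C \<and> card C \<le> ?k \<and> conn C y z \<and> z \<in> nb E ?k y \<and>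
      T \<le> h z \<and> (\<forall>e\<in>C. (\<forall>v\<in>e. h y - D * t0 \<le> h v) \<and> (\<exists>v\<in>e. h v < T))" by blast
    then show "\<exists>zC. fst zC \<in> Orb \<and> snd zC \<subseteq> E \<and> finite (snd zC) \<and> card (snd zC) \<le> ?k \<and> conn (snd zC) y (fst zC) \<and>
      fst zC \<in> nb E ?k y \<and> T \<le> h (fst zC) \<and> (\<forall>e\<in>snd zC. (\<forall>v\<in>e. h y - D * t0 \<le> h v) \<and> (\<exists>v\<in>e. h v < T))"
      by (intro exI[of _ "(z, C)"]) simp
  qed
  from bchoice[OF this] obtain zC where zC: "\<forall>y\<in>A. fst (zC y) \<in> Orb \<and> snd (zC y) \<subseteq> E \<and> finite (snd (zC y)) \<and>
    card (snd (zC y)) \<le> ?k \<and> conn (snd (zC y)) y (fst (zC y)) \<and> fst (zC y) \<in> nb E ?k y \<and> T \<le> h (fst (zC y)) \<and>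
    (\<forall>e\<in>snd (zC y). (\<forall>v\<in>e. h y - D * t0 \<le> h v) \<and> (\<exists>v\<in>e. h v < T))" ..
  define z where "z = (\<lambda>y. fst (zC y))"
  define C where "C = (\<lambda>y. snd (zC y))"
  have zC: "z y \<in> Orb" "C y \<subseteq> E" "finite (C y)" "card (C y) \<le> ?k" "conn (C y) y (z y)" "z y \<in> nb E ?k y" "T \<le> h (z y)"
    "\<And>e. e \<in> C y \<Longrightarrow> (\<forall>v\<in>e. h y - D * t0 \<le> h v) \<and> (\<exists>v\<in>e. h v < T)" if "y \<in> A" for y
    using zC[THEN bspec, OF that] unfolding z_def C_def by - (elim conjE, (assumption | erule (1) bspec))+
  define F' where "F' = F \<union> Cw \<union> (\<Union>y\<in>A. C y)"
  have F': "finite F'" "F' \<subseteq> E" using F(1) A(1) w(3) zC(3) F(2) w(2) subsetD[OF zC(2)] by (auto simp: F'_def)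
  define t where "t = T - h w"
  have t: "hi - lo \<le> t" using hw Dt by (simp add: t_def T_def)
  have T: "h w + t = T" by (simp add: t_def)
  let ?R = "Reg (h w) T"
  have BR: "?B \<subseteq> ?R" using hw Dt by (intro Band_Reg) (auto simp: T_def)
  have wR: "Cw \<subseteq> ?R"
  proof
    fix e assume e: "e \<in> Cw"
    then have "e \<in> E" using w by auto
    then obtain v where "v \<in> e" using edge by blast
    moreover have "h v < T" using w(7) e \<open>v \<in> e\<close> x(3) by (force simp: T_def)
    ultimately show "e \<in> ?R" using w(7) e \<open>e \<in> E\<close> unfolding Reg_def by blast
  qed
  have CR: "C y \<subseteq> ?R" if y: "y \<in> A" for y
  proof
    fix e assume e: "e \<in> C y"
    have "h w \<le> h y - D * t0" using hw Ah[OF y] by linarith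
    then show "e \<in> ?R" using zC(8)[OF y e] zC(2)[OF y] e unfolding Reg_def by force
  qed
  have main: "tauR q F ?B x y \<le> (1 / q) ^ (2 * ?k) * Pr q F' (\<lambda>\<xi>. z y \<in> cand w (h w + t) \<xi>)"
    if y: "y \<in> A" for y
  proof -
    let ?S = "Cw \<union> C y"
    have S: "?S \<subseteq> F'" using y by (auto simp: F'_def)
    have cS: "card ?S \<le> 2 * ?k" unfolding mult_2 by (rule order_trans[OF card_Un_le add_mono[OF w(4) zC(4)[OF y]]])
    show ?thesis
    proof (rule Pr_insertion[OF F'(1) _ S cS q incr_conn(1)])
      show "F \<subseteq> F'" by (auto simp: F'_def)
      fix \<xi> assume o: "conn (\<xi> \<inter> ?B) x y" "?S \<subseteq> \<xi>"
      have 1: "conn (\<xi> \<inter> ?R) w x" by (rule conn_mono[OF w(5)]) (use o wR in auto)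
      have 2: "conn (\<xi> \<inter> ?R) x y" by (rule conn_mono[of "\<xi> \<inter> ?B"]) (use o BR in auto)
      have 3: "conn (\<xi> \<inter> ?R) y (z y)" by (rule conn_mono[OF zC(5)[OF y]]) (use o CR[OF y] in auto)
      show "z y \<in> cand w (h w + t) \<xi>"
        unfolding cand_def T using zC(1,7)[OF y] conn_trans[OF conn_trans[OF 1 2] 3] by simp
    qed
  qed
  let ?w = "\<lambda>z. Pr q F' (\<lambda>\<xi>. z \<in> cand w (h w + t) \<xi>)"
  have "(\<Sum>y\<in>A. tauR q F ?B x y) \<le> (1 / q) ^ (2 * ?k) * (\<Sum>y\<in>A. ?w (z y))"
    unfolding sum_distrib_left using main by (intro sum_mono)
  also have "\<dots> \<le> (1 / q) ^ (2 * ?k) * (real ((dg + 1) ^ ?k) * (\<Sum>z\<in>z ` A. ?w z))"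
    using q q0 zC(6) A by (intro mult_left_mono sum_multiplicity) auto
  also have "(\<Sum>z\<in>z ` A. ?w z) \<le> Ex q F' (NN w t)"
  proof -
    have "(\<Sum>z\<in>z ` A. ?w z) = Ex q F' (\<lambda>\<xi>. \<Sum>z\<in>z ` A. of_bool (z \<in> cand w (h w + t) \<xi>))" by (simp add: Ex_sum)
    also have "\<dots> \<le> Ex q F' (NN w t)"
    proof (rule Ex_mono[OF q0 q(2)])
      fix \<xi> assume "\<xi> \<subseteq> F'"
      then have fc: "finite (cand w (h w + t) \<xi>)" by (rule finite_cand[OF F'])
      have "(\<Sum>z\<in>z ` A. of_bool (z \<in> cand w (h w + t) \<xi>)) = real (card (z ` A \<inter> cand w (h w + t) \<xi>))"
        using A(1) by (simp add: of_bool_def sum.If_cases)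
      also have "\<dots> \<le> NN w t \<xi>" using fc by (intro of_nat_mono card_mono) auto
      finally show "(\<Sum>z\<in>z ` A. of_bool (z \<in> cand w (h w + t) \<xi>)) \<le> NN w t \<xi>" .
    qed
    finally show ?thesis .
  qed
  finally have "(\<Sum>y\<in>A. tauR q F ?B x y) \<le>
    (1 / q) ^ (2 * ?k) * (real ((dg + 1) ^ ?k) * Ex q F' (NN w t))"
    using q by (simp add: mult_left_mono)
  then show ?thesis using w(1) t F' by (intro bexI[of _ w] exI[of _ t] exI[of _ F'] conjI) (auto simp: mult.assoc)
qed

text \<open>The number of inserted edges is affine in \<open>u\<close>. The constant
  \<open>kap\<close> bounds it by a multiple of \<open>1 + u\<close>, so that the whole price of
  insertion becomes a power of the single constant \<open>KK\<close>.\<close>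

definition kap :: real where "kap = 2 * (D + L * ((2 * (D * t0) + 1) / g + 1)) + 2 * L / g"

lemma kap: "0 \<le> u \<Longrightarrow> 2 * (D + nd u * L) \<le> kap * (1 + u)"
proof -
  assume u: "0 \<le> u"
  let ?c = "(2 * (D * t0) + 1) / g + 1"
  have "real (nd u) * L \<le> ((u + 2 * (D * t0) + 1) / g + 1) * L" using nd_le[OF u] by (intro mult_right_mono) auto
  also have "\<dots> = L * ?c + L / g * u" by (simp add: add_divide_distrib algebra_simps)
  finally have 1: "2 * (D + nd u * L) \<le> 2 * (D + L * ?c) + 2 * L / g * u" by simp
  have "0 \<le> ?c" using g by simp
  then have 2: "0 \<le> 2 * (D + L * ?c) * u" "0 \<le> 2 * L / g" using u g by auto
  have "2 * (D + L * ?c) + 2 * L / g * u \<le> (2 * (D + L * ?c) + 2 * L / g) * (1 + u)"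
    using 2 by (simp only: distrib_left distrib_right mult_1_right mult_1_left)
  then show ?thesis using 1 unfolding kap_def by linarith
qed

lemma kap_nonneg: "0 \<le> kap" unfolding kap_def using g by auto

definition KK :: "real \<Rightarrow> real" where "KK q = (real (dg + 1) / q) powr kap"

lemma KK_ge_1: "0 < q \<Longrightarrow> q \<le> 1 \<Longrightarrow> 1 \<le> KK q"
proof -
  assume q: "0 < q" "q \<le> 1"
  then have "1 \<le> real (dg + 1) / q" by (simp add: pos_le_divide_eq)
  then show ?thesis unfolding KK_def using kap_nonneg by (rule ge_one_powr_ge_zero)
qed

lemma insertion_const:
  assumes "0 < p0" "p0 \<le> q" "q \<le> 1" "0 \<le> u"
  shows "(1 / q) ^ (2 * (D + nd u * L)) * real ((dg + 1) ^ (D + nd u * L)) \<le> KK p0 powr (1 + u)"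
proof -
  let ?k = "D + nd u * L"
  have "(1 / q) ^ (2 * ?k) \<le> (1 / p0) ^ (2 * ?k)" using assms by (intro power_mono divide_left_mono) auto
  moreover have "(1 / p0) ^ (2 * ?k) \<le> (1 / p0) powr (kap * (1 + u))"
    using assms kap[OF assms(4)] by (intro powr_le_bound) auto
  moreover have "real ((dg + 1) ^ ?k) \<le> real (dg + 1) powr (kap * (1 + u))"
  proof -
    have "real k \<le> c" if "real (2 * k) \<le> c" for k c using that by simp
    then have "real ?k \<le> kap * (1 + u)" using kap[OF assms(4)] by blast
    then show ?thesis using powr_le_bound[of "real (dg + 1)" ?k "kap * (1 + u)"] by simp
  qed
  ultimately have "(1 / q) ^ (2 * ?k) * real ((dg + 1) ^ ?k) \<le> (1 / p0) powr (kap * (1 + u)) * real (dg + 1) powr (kap * (1 + u))"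
    using assms by (intro mult_mono) auto
  also have "\<dots> = (1 / p0 * real (dg + 1)) powr (kap * (1 + u))" by (rule powr_mult[symmetric])
  also have "\<dots> = KK p0 powr (1 + u)" unfolding KK_def by (simp add: powr_powr)
  finally show ?thesis .
qed

text \<open>What \<open>NN_moment\<close> provides, its constant and the power of \<open>Y\<close>
  being merged into \<open>M\<close>.\<close>

definition good :: "real \<Rightarrow> real \<Rightarrow> bool" where
  "good q M \<longleftrightarrow> (\<forall>x\<in>Orb. \<forall>t\<ge>0. \<forall>F. finite F \<longrightarrow> F \<subseteq> E \<longrightarrow> Ex q F (NN x t) \<le> M * exp (- (3 / 4) * t))"

text \<open>The slack \<open>u\<close> tells how far the start may be from the bottom and the ends
  from the top of the band; insertion pays for it exponentially in \<open>u\<close>, while the decay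
  is in the full width.\<close>

lemma band_sum:
  assumes q: "0 < p0" "p0 \<le> q" "q \<le> 1" and M: "good q M" "0 \<le> M" and F: "finite F" "F \<subseteq> E" and A: "finite A" "A \<subseteq> V"
    and x: "x \<in> V" "lo \<le> h x" "h x \<le> hi" and u: "0 \<le> u" "h x - u \<le> lo" "\<And>y. y \<in> A \<Longrightarrow> hi - u \<le> h y"
  shows "(\<Sum>y\<in>A. tauR q F (Band lo hi) x y) \<le> KK p0 powr (1 + u) * (M * exp (- (3 / 4) * (hi - lo)))"
proof -
  let ?A = "{y \<in> A. lo \<le> h y \<and> h y \<le> hi}"
  have q0: "0 < q" using q by simp
  have "tauR q F (Band lo hi) x y = 0" if "y \<in> A - ?A" for y
  proof -
    have "\<not> conn (\<xi> \<inter> Band lo hi) x y" for \<xi> using conn_Band[of \<xi> lo hi x y] that x by auto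
    then show ?thesis using F(1) by simp
  qed
  then have "(\<Sum>y\<in>A. tauR q F (Band lo hi) x y) = (\<Sum>y\<in>?A. tauR q F (Band lo hi) x y)"
    using A(1) by (intro sum.mono_neutral_right) auto
  moreover have "\<exists>x'\<in>Orb. \<exists>t\<ge>hi - lo. \<exists>F'. finite F' \<and> F' \<subseteq> E \<and>
    (\<Sum>y\<in>?A. tauR q F (Band lo hi) x y) \<le>
      (1 / q) ^ (2 * (D + nd u * L)) * real ((dg + 1) ^ (D + nd u * L)) * Ex q F' (NN x' t)"
    by (rule insertion[OF q0 q(3) F _ _ x u(1,2)]) (use A u(3) in auto)
  ultimately obtain x' t F' where x': "x' \<in> Orb" "hi - lo \<le> t" "finite F'" "F' \<subseteq> E"
    "(\<Sum>y\<in>A. tauR q F (Band lo hi) x y) \<le>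
      (1 / q) ^ (2 * (D + nd u * L)) * real ((dg + 1) ^ (D + nd u * L)) * Ex q F' (NN x' t)"
    by auto
  have "Ex q F' (NN x' t) \<le> M * exp (- (3 / 4) * t)" using M(1) x' x unfolding good_def by auto
  also have "\<dots> \<le> M * exp (- (3 / 4) * (hi - lo))" using x'(2) M(2) by (intro mult_left_mono) auto
  finally have 1: "Ex q F' (NN x' t) \<le> M * exp (- (3 / 4) * (hi - lo))" .
  have 2: "0 \<le> Ex q F' (NN x' t)" using q q0 by (intro Ex_nonneg) auto
  have "(1 / q) ^ (2 * (D + nd u * L)) * real ((dg + 1) ^ (D + nd u * L)) * Ex q F' (NN x' t) \<le>
    KK p0 powr (1 + u) * (M * exp (- (3 / 4) * (hi - lo)))"
    using insertion_const[OF q u(1)] 1 2 by (intro mult_mono) auto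
  then show ?thesis using x'(5) by linarith
qed

text \<open>Connections along which one end is a lowest and the other a highest vertex: the basic
  pieces into which paths will be cut.\<close>

definition slabP :: "real \<Rightarrow> 'v set set \<Rightarrow> 'v \<Rightarrow> 'v \<Rightarrow> real" where
  "slabP q F x y = tauR q F (Band (min (h x) (h y)) (max (h x) (h y))) x y"

lemma slabP_sym: "slabP q F x y = slabP q F y x"
  unfolding slabP_def by (simp add: min.commute max.commute conn_commute[of _ x y])

lemma slabP_nonneg: "0 \<le> q \<Longrightarrow> q \<le> 1 \<Longrightarrow> 0 \<le> slabP q F x y" by (simp add: slabP_def)

text \<open>Of the decay rate 3/4 the weight consumes 1/2, which leaves 1/4.\<close>

lemma slab_up:
  assumes q: "0 < p0" "p0 \<le> q" "q \<le> 1" and M: "good q M" "0 \<le> M" and F: "finite F" "F \<subseteq> E" and A: "finite A" "A \<subseteq> V"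
    and x: "x \<in> V" and t: "0 \<le> t" and Ah: "\<And>y. y \<in> A \<Longrightarrow> t \<le> h y - h x \<and> h y - h x \<le> t + 1"
  shows "(\<Sum>y\<in>A. slabP q F x y * exp ((h y - h x) / 2)) \<le> KK p0 powr 2 * M * exp (- (1 / 4) * t)"
proof -
  have q0: "0 \<le> q" using q by simp
  have "slabP q F x y * exp ((h y - h x) / 2) \<le>
      tauR q F (Band (h x) (h x + (t + 1))) x y * exp ((t + 1) / 2)" if y: "y \<in> A" for y
  proof (intro mult_mono)
    have "Band (min (h x) (h y)) (max (h x) (h y)) \<subseteq> Band (h x) (h x + (t + 1))"
      using Ah[OF y] t by (intro Band_mono) auto
    then show "slabP q F x y \<le> tauR q F (Band (h x) (h x + (t + 1))) x y"
      unfolding slabP_def by (intro Pr_mono q0 q) (erule conn_mono, blast)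
  qed (use Ah[OF y] q q0 in auto)
  then have "(\<Sum>y\<in>A. slabP q F x y * exp ((h y - h x) / 2)) \<le>
      (\<Sum>y\<in>A. tauR q F (Band (h x) (h x + (t + 1))) x y) * exp ((t + 1) / 2)"
    unfolding sum_distrib_right by (intro sum_mono)
  also have "\<dots> \<le> KK p0 powr (1 + 1) * (M * exp (- (3 / 4) * (h x + (t + 1) - h x))) * exp ((t + 1) / 2)"
    using Ah t by (intro mult_right_mono band_sum[OF q M F A x]) force+
  also have "\<dots> = KK p0 powr 2 * M * (exp (- (3 / 4) * (t + 1)) * exp ((t + 1) / 2))" by simp
  also have "\<dots> \<le> KK p0 powr 2 * M * exp (- (1 / 4) * t)"
    unfolding exp_add[symmetric] using M by (intro mult_left_mono) (auto simp: field_simps)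
  finally show ?thesis .
qed

text \<open>The most by which moving both endpoints to the orbit can change their difference in
  height.\<close>

definition c1 :: real where "c1 = 2 * (real (D + nd 0 * L) * t0)"

definition KD :: "real \<Rightarrow> real" where
  "KD p0 = KK p0 powr 1 * exp (c1 / 2) * (KK p0 powr (2 + c1 + t0) * exp ((1 + c1) / 2))"

text \<open>Mass transport turns the sum over lower vertices into a sum over higher ones.\<close>

lemma slab_down:
  assumes q: "0 < p0" "p0 \<le> q" "q \<le> 1" and M: "good q M" "0 \<le> M" and F: "finite F" "F \<subseteq> E" and A: "finite A" "A \<subseteq> V"
    and x: "x \<in> V" and t: "0 \<le> t" and Ah: "\<And>y. y \<in> A \<Longrightarrow> t \<le> h x - h y \<and> h x - h y \<le> t + 1"
  shows "(\<Sum>y\<in>A. slabP q F x y * exp ((h y - h x) / 2)) \<le> KD p0 * M * exp (- (1 / 4) * t)"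
proof -
  let ?k = "D + nd 0 * L"
  have q0: "0 \<le> q" "0 < q" using q by auto
  have c1: "0 \<le> c1" using g by (simp add: c1_def)
  have hb: "h x + D * t0 < h x + D * t0 + 1" "h x + D * t0 + 1 \<le> h x + 0 + D * t0 + 1" by auto
  from up_path[OF x order_refl hb] obtain z Cz where z: "z \<in> Orb" "Cz \<subseteq> E" "finite Cz" "card Cz \<le> ?k" "conn Cz x z" "z \<in> nb E ?k x"
    "h x + D * t0 + 1 \<le> h z" "\<forall>e\<in>Cz. (\<forall>v\<in>e. h x - D * t0 \<le> h v) \<and> (\<exists>v\<in>e. h v < h x + D * t0 + 1)" by (elim exE conjE)
  have Dt: "0 \<le> D * t0" using g by simp
  have "\<forall>y\<in>A. \<exists>wC. fst wC \<in> Orb \<and> snd wC \<subseteq> E \<and> finite (snd wC) \<and> card (snd wC) \<le> ?k \<and> conn (snd wC) (fst wC) y \<and>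
    fst wC \<in> nb E ?k y \<and> h (fst wC) \<le> h y - 0 - D * t0 \<and> (\<forall>e\<in>snd wC. \<forall>v\<in>e. h (fst wC) \<le> h v \<and> h v \<le> h y + D * t0)"
  proof
    fix y assume "y \<in> A"
    then have "y \<in> V" using A by auto
    from down_path[OF this order_refl] obtain w C where "w \<in> Orb \<and> C \<subseteq> E \<and> finite C \<and> card C \<le> ?k \<and> conn C w y \<and> w \<in> nb E ?k y \<and>
      h w \<le> h y - 0 - D * t0 \<and> (\<forall>e\<in>C. \<forall>v\<in>e. h w \<le> h v \<and> h v \<le> h y + D * t0)" by (elim exE)
    then show "\<exists>wC. fst wC \<in> Orb \<and> snd wC \<subseteq> E \<and> finite (snd wC) \<and> card (snd wC) \<le> ?k \<and> conn (snd wC) (fst wC) y \<and>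
      fst wC \<in> nb E ?k y \<and> h (fst wC) \<le> h y - 0 - D * t0 \<and> (\<forall>e\<in>snd wC. \<forall>v\<in>e. h (fst wC) \<le> h v \<and> h v \<le> h y + D * t0)"
      by (intro exI[of _ "(w, C)"]) simp
  qed
  from bchoice[OF this] obtain wC where wC: "\<forall>y\<in>A. fst (wC y) \<in> Orb \<and> snd (wC y) \<subseteq> E \<and> finite (snd (wC y)) \<and>
    card (snd (wC y)) \<le> ?k \<and> conn (snd (wC y)) (fst (wC y)) y \<and> fst (wC y) \<in> nb E ?k y \<and> h (fst (wC y)) \<le> h y - 0 - D * t0 \<and>
    (\<forall>e\<in>snd (wC y). \<forall>v\<in>e. h (fst (wC y)) \<le> h v \<and> h v \<le> h y + D * t0)" ..
  define w where "w = (\<lambda>y. fst (wC y))"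
  define C where "C = (\<lambda>y. snd (wC y))"
  have wC: "w y \<in> Orb" "C y \<subseteq> E" "finite (C y)" "card (C y) \<le> ?k" "conn (C y) (w y) y" "w y \<in> nb E ?k y" "h (w y) \<le> h y - 0 - D * t0"
    "\<forall>e\<in>C y. \<forall>v\<in>e. h (w y) \<le> h v \<and> h v \<le> h y + D * t0" if "y \<in> A" for y
    using wC[THEN bspec, OF that] unfolding w_def C_def by - (elim conjE, assumption)+
  define F' where "F' = F \<union> Cz \<union> (\<Union>y\<in>A. C y)"
  have F': "finite F'" "F' \<subseteq> E" using F(1) A(1) z(3) wC(3) F(2) z(2) subsetD[OF wC(2)] by (auto simp: F'_def)
  \<comment> \<open>The transported quantity for orbit vertices. It uses \<open>Reg\<close> and not
    \<open>Band\<close> because \<open>up_path\<close> bounds only one end of each edge from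
    above.\<close>
  define f where "f = (\<lambda>F a b. of_bool (t \<le> h b - h a \<and> h b - h a \<le> t + 1 + c1) *
    tauR q F (Reg (h a) (h b)) a b * exp ((h b - h a) / 2))"
  have hz: "h z - h x \<le> real ?k * t0" using lip_nb[OF z(6)] by linarith
  have diff: "t \<le> h z - h (w y) \<and> h z - h (w y) \<le> t + 1 + c1" if y: "y \<in> A" for y
    using lip_nb[OF wC(6)[OF y]] wC(7)[OF y] z(7) hz Ah[OF y] Dt unfolding c1_def by linarith
  \<comment> \<open>A descent by \<open>d\<close> has weight \<open>exp (- d / 2)\<close>, which is
    \<open>exp (d / 2) * exp (- d)\<close>: the weight of the reverse ascent times the factor
    supplied by \<open>mtp_at\<close>. The repairs of the endpoints cost the remaining
    constants.\<close>
  have main: "slabP q F x y * exp ((h y - h x) / 2) \<le>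
      (1 / q) ^ (2 * ?k) * exp (c1 / 2) * (f F' (w y) z * exp (h (w y) - h z))" if y: "y \<in> A" for y
  proof -
    let ?S = "Cz \<union> C y" and ?B = "Band (min (h x) (h y)) (max (h x) (h y))" and ?R = "Reg (h (w y)) (h z)"
    have S: "?S \<subseteq> F'" using y by (auto simp: F'_def)
    have cS: "card ?S \<le> 2 * ?k" unfolding mult_2 by (rule order_trans[OF card_Un_le add_mono[OF z(4) wC(4)[OF y]]])
    have yx: "h y \<le> h x" using Ah[OF y] t by simp
    have BR: "?B \<subseteq> ?R" using yx wC(7)[OF y] z(7) Dt by (intro Band_Reg) auto
    have zR: "Cz \<subseteq> ?R"
    proof
      fix e assume e: "e \<in> Cz"
      have lo: "h (w y) \<le> h v" if "v \<in> e" for v using z(8) e that wC(7)[OF y] yx by force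
      obtain v where "v \<in> e" "h v < h x + D * t0 + 1" using z(8) e by blast
      then have "h v < h z" using z(7) by linarith
      then show "e \<in> ?R" using lo \<open>v \<in> e\<close> e z(2) unfolding Reg_def by blast
    qed
    have CR: "C y \<subseteq> ?R"
    proof
      fix e assume e: "e \<in> C y"
      then have "e \<in> E" using wC(2)[OF y] by auto
      then obtain v where v: "v \<in> e" using edge by blast
      then have "h v < h z" using wC(8)[OF y] e z(7) yx by force
      then show "e \<in> ?R" using wC(8)[OF y] e v \<open>e \<in> E\<close> unfolding Reg_def by blast
    qed
    have s: "slabP q F x y \<le> (1 / q) ^ (2 * ?k) * tauR q F' ?R (w y) z" unfolding slabP_def
    proof (rule Pr_insertion[OF F'(1) _ S cS q0(2) q(3) incr_conn(1)])
      show "F \<subseteq> F'" by (auto simp: F'_def)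
      fix \<xi> assume o: "conn (\<xi> \<inter> ?B) x y" "?S \<subseteq> \<xi>"
      have 1: "conn (\<xi> \<inter> ?R) (w y) y" by (rule conn_mono[OF wC(5)[OF y]]) (use o CR in auto)
      have 2: "conn (\<xi> \<inter> ?R) y x" by (rule conn_mono[of "\<xi> \<inter> ?B"]) (use o BR conn_sym in auto)
      have 3: "conn (\<xi> \<inter> ?R) x z" by (rule conn_mono[OF z(5)]) (use o zR in auto)
      show "conn (\<xi> \<inter> ?R) (w y) z" by (rule conn_trans[OF conn_trans[OF 1 2] 3])
    qed
    have e: "exp ((h y - h x) / 2) \<le> exp (c1 / 2) * (exp ((h z - h (w y)) / 2) * exp (h (w y) - h z))"
    proof -
      have "h z - h (w y) \<le> c1 + (h x - h y)" using lip_nb[OF wC(6)[OF y]] hz unfolding c1_def by linarith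
      then show ?thesis unfolding exp_add[symmetric] by (simp add: field_simps)
    qed
    have "slabP q F x y * exp ((h y - h x) / 2) \<le> (1 / q) ^ (2 * ?k) * tauR q F' ?R (w y) z *
      (exp (c1 / 2) * (exp ((h z - h (w y)) / 2) * exp (h (w y) - h z)))"
      using s e q q0 by (intro mult_mono) auto
    also have "\<dots> = (1 / q) ^ (2 * ?k) * exp (c1 / 2) * (f F' (w y) z * exp (h (w y) - h z))"
      using diff[OF y] by (simp add: f_def)
    finally show ?thesis .
  qed
  have fn: "0 \<le> f F a b" for F a b unfolding f_def using q0 q by (intro mult_nonneg_nonneg) auto
  let ?KU = "KK p0 powr (2 + c1 + t0) * exp ((1 + c1) / 2) * M * exp (- (1 / 4) * t)"
  have "(\<Sum>y\<in>A. slabP q F x y * exp ((h y - h x) / 2)) \<le> (1 / q) ^ (2 * ?k) * exp (c1 / 2) * (\<Sum>y\<in>A. f F' (w y) z * exp (h (w y) - h z))"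
    unfolding sum_distrib_left using main by (intro sum_mono)
  also have "\<dots> \<le> (1 / q) ^ (2 * ?k) * exp (c1 / 2) * (real ((dg + 1) ^ ?k) * (\<Sum>a\<in>w ` A. f F' a z * exp (h a - h z)))"
    using q0 wC(6) A fn by (intro mult_left_mono sum_multiplicity[where w = "\<lambda>a. f F' a z * exp (h a - h z)"]) auto
  also have "\<dots> \<le> (1 / q) ^ (2 * ?k) * exp (c1 / 2) * (real ((dg + 1) ^ ?k) * ?KU)"
  proof (intro mult_left_mono mtp_at[where f = f])
    fix \<beta> F x y assume b: "\<beta> \<in> \<Gamma>" "finite F" "F \<subseteq> E" "x \<in> Orb" "y \<in> Orb"
    then have xy: "x \<in> V" "y \<in> V" using Orb_sub by auto
    have d: "h (\<beta> y) - h (\<beta> x) = h y - h x" using h_shift[OF b(1) xy(2,1)] .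
    have "h x + (h (\<beta> x) - h x) = h (\<beta> x)" "h y + (h (\<beta> x) - h x) = h (\<beta> y)" using d by linarith+
    then have "Reg (h (\<beta> x)) (h (\<beta> y)) = (`) \<beta> ` Reg (h x) (h y)" unfolding Reg_image(1)[OF b(1) xy(1)] by (simp only:)
    then show "f ((`) \<beta> ` F) (\<beta> x) (\<beta> y) = f F x y" unfolding f_def d using Pr_conn_aut[OF b(1,3,2) xy Reg_E] by simp
  next
    fix F1 F2 x y assume "finite F2" "F2 \<subseteq> E" "F1 \<subseteq> (F2 :: 'v set set)"
    then show "f F1 x y \<le> f F2 x y"
      unfolding f_def using q0 q by (intro mult_right_mono mult_left_mono Pr_mono_set incr_conn) auto
  next
    fix F1 B assume F1: "finite F1" "F1 \<subseteq> E" and B: "finite B" "B \<subseteq> Orb"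
    let ?B = "{y \<in> B. t \<le> h y - h rt \<and> h y - h rt \<le> t + 1 + c1}" and ?hi = "h rt + (t + 1 + c1 + t0)"
    have "(\<Sum>y\<in>B. f F1 rt y) = (\<Sum>y\<in>?B. f F1 rt y)" using B by (intro sum.mono_neutral_right) (auto simp: f_def)
    also have "\<dots> \<le> (\<Sum>y\<in>?B. tauR q F1 (Band (h rt) ?hi) rt y * exp ((t + 1 + c1) / 2))"
    proof (rule sum_mono)
      fix y assume y: "y \<in> ?B"
      have "Reg (h rt) (h y) \<subseteq> Band (h rt) ?hi"
      proof
        fix e assume e: "e \<in> Reg (h rt) (h y)"
        have "h v \<le> ?hi" if "v \<in> e" for v using Reg_height[OF e that] y by simp
        then show "e \<in> Band (h rt) ?hi" using e by (auto simp: Reg_def Band_def)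
      qed
      then have "tauR q F1 (Reg (h rt) (h y)) rt y \<le> tauR q F1 (Band (h rt) ?hi) rt y"
        by (intro Pr_mono q0 q) (erule conn_mono, blast)
      then show "f F1 rt y \<le> tauR q F1 (Band (h rt) ?hi) rt y * exp ((t + 1 + c1) / 2)"
        unfolding f_def using y q0 q by (auto intro!: mult_mono)
    qed
    also have "\<dots> \<le> KK p0 powr (1 + (1 + c1 + t0)) * (M * exp (- (3 / 4) * (?hi - h rt))) * exp ((t + 1 + c1) / 2)"
      unfolding sum_distrib_right[symmetric]
    proof (intro mult_right_mono band_sum[OF q M F1])
      show "?B \<subseteq> V" using B Orb_sub by auto
      show "?hi - (1 + c1 + t0) \<le> h y" if "y \<in> ?B" for y using that by simp
    qed (use B rt_V t c1 g in auto)
    also have "\<dots> = KK p0 powr (2 + c1 + t0) * M * (exp (- (3 / 4) * (t + 1 + c1 + t0)) * exp ((t + 1 + c1) / 2))"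
      by (simp add: add.assoc)
    also have "\<dots> \<le> KK p0 powr (2 + c1 + t0) * M * (exp ((1 + c1) / 2) * exp (- (1 / 4) * t))"
      unfolding exp_add[symmetric] using M t c1 g by (intro mult_left_mono) (auto simp: field_simps)
    finally show "(\<Sum>y\<in>B. f F1 rt y) \<le> ?KU" by (simp add: mult_ac)
  qed (use q0 F' A wC(1) z(1) fn in auto)
  also have "\<dots> = (1 / q) ^ (2 * ?k) * real ((dg + 1) ^ ?k) * (exp (c1 / 2) * ?KU)" by simp
  also have "\<dots> \<le> KK p0 powr (1 + 0) * (exp (c1 / 2) * ?KU)"
    using M by (intro mult_right_mono insertion_const[OF q order_refl]) auto
  also have "\<dots> = KD p0 * M * exp (- (1 / 4) * t)" by (simp add: KD_def)
  finally show ?thesis .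
qed

end

section \<open>The bootstrap\<close>

text \<open>Cut at a lowest vertex \<open>z\<close>. If the path leaves the narrower band,
  \<open>z\<close> is between \<open>t\<close> and \<open>t + 1\<close> below \<open>y\<close>; the
  first piece then ends at its lowest vertex, and the second runs from a lowest to a highest one. A
  general \<eta> allows \<open>- h\<close>, which gives the mirror image.\<close>

lemma extremal_split:
  fixes \<eta> :: "'v \<Rightarrow> real"
  assumes F: "finite F" and p: "0 \<le> p" "p \<le> 1" and Z: "finite Z" "insert x (\<Union>F) \<subseteq> Z"
  shows "tauR p F {e. \<forall>u\<in>e. \<eta> y - (t + 1) \<le> \<eta> u \<and> \<eta> u \<le> \<eta> y} x y \<le>
    tauR p F {e. \<forall>u\<in>e. \<eta> y - t \<le> \<eta> u \<and> \<eta> u \<le> \<eta> y} x y +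
    (\<Sum>z\<in>Z. tauR p F {e. \<forall>u\<in>e. \<eta> z \<le> \<eta> u \<and> \<eta> u \<le> \<eta> z + (t + 1)} x z *
      (of_bool (t \<le> \<eta> y - \<eta> z \<and> \<eta> y - \<eta> z \<le> t + 1) *
       tauR p F {e. \<forall>u\<in>e. \<eta> z \<le> \<eta> u \<and> \<eta> u \<le> \<eta> y} z y))"
proof -
  define B where "B = (\<lambda>t. {e. \<forall>u\<in>e. \<eta> y - t \<le> \<eta> u \<and> \<eta> u \<le> \<eta> y})"
  define R where "R = (\<lambda>z. {e. \<forall>u\<in>e. \<eta> z \<le> \<eta> u \<and> \<eta> u \<le> \<eta> z + (t + 1)})"
  define S where "S = (\<lambda>z. {e. \<forall>u\<in>e. \<eta> z \<le> \<eta> u \<and> \<eta> u \<le> \<eta> y})"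
  define Z' where "Z' = {z \<in> Z. t \<le> \<eta> y - \<eta> z \<and> \<eta> y - \<eta> z \<le> t + 1}"
  let ?A = "\<lambda>\<xi>. conn (\<xi> \<inter> B (t + 1)) x y \<and> \<not> conn (\<xi> \<inter> B t) x y"
  have "Pr p F ?A \<le> (\<Sum>z\<in>Z'. tauR p F (R z) x z * tauR p F (S z) z y)"
  proof (rule BK_conn[OF F p])
    show "finite Z'" using Z by (simp add: Z'_def)
    fix \<xi> assume om: "\<xi> \<subseteq> F" "?A \<xi>"
    then obtain xs where s: "spath (\<xi> \<inter> B (t + 1)) x y xs" by (meson conn_spath)
    have ne: "length xs \<ge> 2"
    proof (rule ccontr)
      assume "\<not> length xs \<ge> 2"
      then have "x = y" using s by (cases xs) (auto simp: spath_def Suc_le_eq)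
      then show False using om by simp
    qed
    have hts: "\<eta> y - (t + 1) \<le> \<eta> u" "\<eta> u \<le> \<eta> y" if "u \<in> set xs" for u
    proof -
      have "u \<in> \<Union>(path_edges xs)" using that by (simp only: set_path_edges[OF ne])
      then obtain e where "e \<in> path_edges xs" "u \<in> e" by blast
      then show "\<eta> y - (t + 1) \<le> \<eta> u" "\<eta> u \<le> \<eta> y" using s by (auto simp: spath_def B_def)
    qed
    have "Min (\<eta> ` set xs) \<in> \<eta> ` set xs" using ne by (intro Min_in) auto
    then obtain z where z': "z \<in> set xs" "\<eta> z = Min (\<eta> ` set xs)" by (metis imageE)
    then have z: "z \<in> set xs" "\<And>u. u \<in> set xs \<Longrightarrow> \<eta> z \<le> \<eta> u" by simp_all
    have low: "\<eta> z < \<eta> y - t"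
    proof (rule ccontr)
      assume n: "\<not> \<eta> z < \<eta> y - t"
      have "path_edges xs \<subseteq> \<xi> \<inter> B t"
      proof
        fix e assume e: "e \<in> path_edges xs"
        have "\<eta> y - t \<le> \<eta> u \<and> \<eta> u \<le> \<eta> y" if "u \<in> e" for u
          using path_edges_subset_set[OF e] that hts(2)[of u] z(2)[of u] n by fastforce
        then show "e \<in> \<xi> \<inter> B t" using e s by (auto simp: spath_def B_def)
      qed
      then have "conn (\<xi> \<inter> B t) x y" using s spath_conn[of "\<xi> \<inter> B t" x y xs] by (simp add: spath_def)
      then show False using om by simp
    qed
    obtain as bs where xs: "xs = as @ z # bs" using z(1) by (meson split_list)
    have "spath \<xi> x y (as @ z # bs)" using s by (simp add: spath_def xs)
    moreover have "path_edges (as @ [z]) \<subseteq> R z"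
    proof
      fix e assume "e \<in> path_edges (as @ [z])"
      then have "e \<subseteq> set xs" using path_edges_subset_set[of e "as @ [z]"] by (auto simp: xs)
      then show "e \<in> R z" using z(2) hts hts(1)[OF z(1)] by (fastforce simp: R_def)
    qed
    moreover have "path_edges (z # bs) \<subseteq> S z"
    proof
      fix e assume "e \<in> path_edges (z # bs)"
      then have "e \<subseteq> set xs" using path_edges_subset_set[of e "z # bs"] by (auto simp: xs)
      then show "e \<in> S z" using z(2) hts by (fastforce simp: S_def)
    qed
    ultimately have "djoint (\<lambda>I J. conn (I \<inter> R z) x z \<and> conn (J \<inter> S z) z y) \<xi>" by (rule djoint_conn)
    moreover have "z \<in> Z'" using spath_set[OF s] z(1) om(1) Z(2) low hts(1)[OF z(1)] by (auto simp: Z'_def)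
    ultimately show "\<exists>z\<in>Z'. djoint (\<lambda>I J. conn (I \<inter> R z) x z \<and> conn (J \<inter> S z) z y) \<xi>" by blast
  qed
  also have "\<dots> = (\<Sum>z\<in>Z. tauR p F (R z) x z *
      (of_bool (t \<le> \<eta> y - \<eta> z \<and> \<eta> y - \<eta> z \<le> t + 1) * tauR p F (S z) z y))"
    unfolding Z'_def using Z by (intro sum.mono_neutral_cong_left) auto
  finally have 1: "Pr p F ?A \<le> \<dots>" .
  have "tauR p F (B (t + 1)) x y \<le> Ex p F (\<lambda>\<xi>. of_bool (conn (\<xi> \<inter> B t) x y) + of_bool (?A \<xi>))"
    using p by (intro Ex_mono) auto
  then show ?thesis using 1 unfolding Ex_add B_def R_def S_def by linarith
qed

text \<open>Cut at a highest vertex; both pieces then have the cut vertex as maximum.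
  \<open>T\<close> is any bound for the oscillation of \<eta> on the finite vertex set.\<close>

lemma maximum_split:
  fixes \<eta> :: "'v \<Rightarrow> real"
  assumes F: "finite F" and p: "0 \<le> p" "p \<le> 1" and Z: "finite Z" "insert x (\<Union>F) \<subseteq> Z"
    and T: "\<And>u v. u \<in> Z \<Longrightarrow> v \<in> Z \<Longrightarrow> \<eta> u - \<eta> v \<le> T"
  shows "tau p F x y \<le>
    (\<Sum>z\<in>Z. tauR p F {e. \<forall>u\<in>e. \<eta> z - T \<le> \<eta> u \<and> \<eta> u \<le> \<eta> z} x z *
       tauR p F {e. \<forall>u\<in>e. \<eta> z - T \<le> \<eta> u \<and> \<eta> u \<le> \<eta> z} z y)"
proof (rule BK_conn[OF F p Z(1)])
  let ?R = "\<lambda>z. {e. \<forall>u\<in>e. \<eta> z - T \<le> \<eta> u \<and> \<eta> u \<le> \<eta> z}"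
  fix \<xi> assume om: "\<xi> \<subseteq> F" "conn \<xi> x y"
  then obtain xs where s: "spath \<xi> x y xs" by (meson conn_spath)
  have sZ: "set xs \<subseteq> Z" using spath_set[OF s] om(1) Z(2) by auto
  have ne: "xs \<noteq> []" using s by (simp add: spath_def)
  have "Max (\<eta> ` set xs) \<in> \<eta> ` set xs" using ne by (intro Max_in) auto
  then obtain z where z': "z \<in> set xs" "\<eta> z = Max (\<eta> ` set xs)" by (metis imageE)
  then have z: "z \<in> set xs" "\<And>u. u \<in> set xs \<Longrightarrow> \<eta> u \<le> \<eta> z" by simp_all
  obtain as bs where xs: "xs = as @ z # bs" using z(1) by (meson split_list)
  have R: "e \<in> ?R z" if "e \<subseteq> set xs" for e
  proof -
    have "\<eta> z - T \<le> \<eta> u \<and> \<eta> u \<le> \<eta> z" if "u \<in> e" for u using T[of z u] z sZ that \<open>e \<subseteq> set xs\<close> by fastforce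
    then show ?thesis by blast
  qed
  have "spath \<xi> x y (as @ z # bs)" using s by (simp add: xs)
  moreover have "path_edges (as @ [z]) \<subseteq> ?R z"
  proof
    fix e assume "e \<in> path_edges (as @ [z])"
    then have "e \<subseteq> set xs" using path_edges_subset_set[of e "as @ [z]"] by (auto simp: xs)
    then show "e \<in> ?R z" by (rule R)
  qed
  moreover have "path_edges (z # bs) \<subseteq> ?R z"
  proof
    fix e assume "e \<in> path_edges (z # bs)"
    then have "e \<subseteq> set xs" using path_edges_subset_set[of e "z # bs"] by (auto simp: xs)
    then show "e \<in> ?R z" by (rule R)
  qed
  ultimately have "djoint (\<lambda>I J. conn (I \<inter> ?R z) x z \<and> conn (J \<inter> ?R z) z y) \<xi>" by (rule djoint_conn)
  then show "\<exists>z\<in>Z. djoint (\<lambda>I J. conn (I \<inter> ?R z) x z \<and> conn (J \<inter> ?R z) z y) \<xi>" using z(1) sZ by blast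
qed

text \<open>An implicit Gronwall inequality, solved for \<open>S (Suc n)\<close> by means of
  \<open>1 / (1 - x) \<le> 1 + 2 * x\<close> on \<open>[0, 1 / 2]\<close>.\<close>

lemma iterate_bound:
  fixes S \<beta> :: "nat \<Rightarrow> real"
  assumes "\<And>n. S (Suc n) \<le> S n + \<beta> n * S (Suc n)" "\<And>n. 0 \<le> S n" "\<And>n. 0 \<le> \<beta> n" "\<And>n. \<beta> n \<le> 1 / 2"
  shows "S n \<le> S 0 * exp (2 * (\<Sum>k<n. \<beta> k))"
proof (induction n)
  case (Suc n)
  have "1 \<le> (1 - \<beta> n) * (1 + 2 * \<beta> n)"
    using mult_nonneg_nonneg[of "\<beta> n" "1 - 2 * \<beta> n"] assms(3,4)[of n] by (simp add: algebra_simps)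
  also have "\<dots> \<le> (1 - \<beta> n) * exp (2 * \<beta> n)"
    using assms(4)[of n] exp_ge_add_one_self[of "2 * \<beta> n"] by (intro mult_left_mono) auto
  finally have "S (Suc n) * 1 \<le> S (Suc n) * ((1 - \<beta> n) * exp (2 * \<beta> n))" using assms(2) by (intro mult_left_mono) auto
  also have "\<dots> = (S (Suc n) - \<beta> n * S (Suc n)) * exp (2 * \<beta> n)" by (simp add: algebra_simps)
  also have "\<dots> \<le> S n * exp (2 * \<beta> n)" using assms(1)[of n] by (intro mult_right_mono) auto
  also have "\<dots> \<le> S 0 * exp (2 * (\<Sum>k<n. \<beta> k)) * exp (2 * \<beta> n)" using Suc by (intro mult_right_mono) auto
  also have "\<dots> = S 0 * exp (2 * (\<Sum>k<Suc n. \<beta> k))" by (simp add: exp_add distrib_left)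
  finally show ?case by simp
qed simp

context tilted
begin

text \<open>The connections from \<open>x\<close> to \<open>y\<close> whose highest, or lowest, vertex is \<open>y\<close>.\<close>

definition EE :: "real \<Rightarrow> 'v set set \<Rightarrow> real \<Rightarrow> 'v \<Rightarrow> 'v \<Rightarrow> real" where
  "EE q F t x y = tauR q F (Band (h y - t) (h y)) x y + tauR q F (Band (h y) (h y + t)) x y"

definition slabB :: "real \<Rightarrow> 'v set set \<Rightarrow> real \<Rightarrow> 'v \<Rightarrow> 'v \<Rightarrow> real" where
  "slabB q F t x y = of_bool (t \<le> \<bar>h y - h x\<bar> \<and> \<bar>h y - h x\<bar> \<le> t + 1) * slabP q F x y"

lemma slabB_sym: "slabB q F t x y = slabB q F t y x"
  unfolding slabB_def by (simp add: slabP_sym[of q F x y] abs_minus_commute)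

lemma EE_nonneg: "0 \<le> q \<Longrightarrow> q \<le> 1 \<Longrightarrow> 0 \<le> EE q F t x y" by (simp add: EE_def)

lemma slabB_nonneg: "0 \<le> q \<Longrightarrow> q \<le> 1 \<Longrightarrow> 0 \<le> slabB q F t x y" by (simp add: slabB_def slabP_nonneg)

lemma Pr_Band:
  assumes "F \<subseteq> E"
  shows "tauR q F (Band a b) x y = tauR q F {e. \<forall>u\<in>e. a \<le> h u \<and> h u \<le> b} x y"
proof (rule Ex_cong)
  fix \<xi> assume "\<xi> \<subseteq> F"
  then have "\<xi> \<inter> Band a b = \<xi> \<inter> {e. \<forall>u\<in>e. a \<le> h u \<and> h u \<le> b}" using assms unfolding Band_def by blast
  then show "of_bool (conn (\<xi> \<inter> Band a b) x y) = (of_bool (conn (\<xi> \<inter> {e. \<forall>u\<in>e. a \<le> h u \<and> h u \<le> b}) x y) :: real)"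
    by simp
qed

text \<open>Cutting a path that ends at its top leaves a first piece that ends at its bottom, and
  conversely, so only the sum of both kinds satisfies a closed recursion. The right side again has
  width \<open>t + 1\<close>, whence the implicit form of \<open>iterate_bound\<close>.\<close>

lemma EE_step:
  assumes F: "finite F" "F \<subseteq> E" and q: "0 \<le> q" "q \<le> 1" and Z: "finite Z" "insert x (\<Union>F) \<subseteq> Z" and t: "0 \<le> t"
  shows "EE q F (t + 1) x y \<le> EE q F t x y + (\<Sum>z\<in>Z. EE q F (t + 1) x z * slabB q F t z y)"
proof -
  let ?U = "\<lambda>t z. tauR q F (Band (h z - t) (h z)) x z"
  let ?L = "\<lambda>t z. tauR q F (Band (h z) (h z + t)) x z"
  let ?u = "\<lambda>z. of_bool (t \<le> h y - h z \<and> h y - h z \<le> t + 1) * tauR q F (Band (h z) (h y)) z y"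
  let ?l = "\<lambda>z. of_bool (t \<le> h z - h y \<and> h z - h y \<le> t + 1) * tauR q F (Band (h y) (h z)) z y"
  have 1: "?U (t + 1) y \<le> ?U t y + (\<Sum>z\<in>Z. ?L (t + 1) z * ?u z)"
    using extremal_split[OF F(1) q Z, of h y t] unfolding Pr_Band[OF F(2)] .
  have sw: "{e. \<forall>u\<in>e. - a \<le> - h u \<and> - h u \<le> - b} = {e. \<forall>u\<in>e. b \<le> h u \<and> h u \<le> a}" for a b by auto
  have m: "- h z + s = - (h z - s)" "- h z - s = - (h z + s)" "- (h y + - h z) = h z - h y" for z s by auto
  have 2: "?L (t + 1) y \<le> ?L t y + (\<Sum>z\<in>Z. ?U (t + 1) z * ?l z)"
    using extremal_split[OF F(1) q Z, of "\<lambda>v. - h v" y t] unfolding Pr_Band[OF F(2)] m sw .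
  have u: "?u z \<le> slabB q F t z y" for z unfolding slabB_def slabP_def using t q by (auto simp: min_absorb1 max_absorb2)
  have l: "?l z \<le> slabB q F t z y" for z unfolding slabB_def slabP_def using t q by (auto simp: min_absorb2 max_absorb1)
  have "EE q F (t + 1) x y = ?U (t + 1) y + ?L (t + 1) y" by (simp add: EE_def)
  also have "\<dots> \<le> (?U t y + ?L t y) + (\<Sum>z\<in>Z. ?L (t + 1) z * ?u z + ?U (t + 1) z * ?l z)"
    using 1 2 by (simp add: sum.distrib)
  also have "\<dots> \<le> EE q F t x y + (\<Sum>z\<in>Z. EE q F (t + 1) x z * slabB q F t z y)"
  proof (intro add_mono sum_mono)
    fix z
    have "?L (t + 1) z * ?u z + ?U (t + 1) z * ?l z \<le> ?L (t + 1) z * slabB q F t z y + ?U (t + 1) z * slabB q F t z y"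
      using q by (intro add_mono mult_left_mono u l) auto
    then show "?L (t + 1) z * ?u z + ?U (t + 1) z * ?l z \<le> EE q F (t + 1) x z * slabB q F t z y"
      unfolding EE_def by (simp add: distrib_right add.commute)
  qed (simp add: EE_def)
  finally show ?thesis .
qed

lemma EE_final:
  assumes F: "finite F" "F \<subseteq> E" and q: "0 \<le> q" "q \<le> 1" and Z: "finite Z" "insert x (\<Union>F) \<subseteq> Z"
    and T: "\<And>u v. u \<in> Z \<Longrightarrow> v \<in> Z \<Longrightarrow> h u - h v \<le> T"
  shows "tau q F x y \<le> (\<Sum>z\<in>Z. EE q F T x z * EE q F T y z)"
proof -
  have "tau q F x y \<le> (\<Sum>z\<in>Z. tauR q F (Band (h z - T) (h z)) x z *
      tauR q F (Band (h z - T) (h z)) z y)"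
    unfolding Pr_Band[OF F(2)] by (rule maximum_split[OF F(1) q Z]) (rule T)
  also have "\<dots> \<le> (\<Sum>z\<in>Z. EE q F T x z * EE q F T y z)"
    unfolding conn_commute[of _ _ y] EE_def using q by (intro sum_mono mult_mono) auto
  finally show ?thesis .
qed

definition KB :: "real \<Rightarrow> real" where "KB p0 = KK p0 powr 2 + KD p0"

lemma KB_ge_1: "0 < p0 \<Longrightarrow> p0 \<le> 1 \<Longrightarrow> 1 \<le> KB p0"
proof -
  assume p: "0 < p0" "p0 \<le> 1"
  have "1 \<le> KK p0 powr 2" using KK_ge_1[OF p] by (rule ge_one_powr_ge_zero) simp
  moreover have "0 \<le> KD p0" by (simp add: KD_def)
  ultimately show ?thesis by (simp add: KB_def)
qed

lemma slabB_sum: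
  assumes q: "0 < p0" "p0 \<le> q" "q \<le> 1" and M: "good q M" "0 \<le> M" and F: "finite F" "F \<subseteq> E" and A: "finite A" "A \<subseteq> V"
    and x: "x \<in> V" and t: "0 \<le> t"
  shows "(\<Sum>y\<in>A. slabB q F t x y * exp ((h y - h x) / 2)) \<le> KB p0 * M * exp (- (1 / 4) * t)"
proof -
  let ?U = "{y \<in> A. t \<le> h y - h x \<and> h y - h x \<le> t + 1}" and ?D = "{y \<in> A. t \<le> h x - h y \<and> h x - h y \<le> t + 1}"
  let ?f = "\<lambda>y. slabP q F x y * exp ((h y - h x) / 2)"
  have fn: "0 \<le> ?f y" for y using q slabP_nonneg[of q F x y] by simp
  have "(\<Sum>y\<in>A. slabB q F t x y * exp ((h y - h x) / 2)) \<le>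
    (\<Sum>y\<in>A. of_bool (y \<in> ?U) * ?f y + of_bool (y \<in> ?D) * ?f y)"
  proof (rule sum_mono)
    fix y assume "y \<in> A"
    then have "of_bool (t \<le> \<bar>h y - h x\<bar> \<and> \<bar>h y - h x\<bar> \<le> t + 1) \<le> (of_bool (y \<in> ?U) + of_bool (y \<in> ?D) :: real)"
      by (auto simp: abs_if)
    then have "of_bool (t \<le> \<bar>h y - h x\<bar> \<and> \<bar>h y - h x\<bar> \<le> t + 1) * ?f y \<le> (of_bool (y \<in> ?U) + of_bool (y \<in> ?D)) * ?f y"
      using fn by (rule mult_right_mono)
    then show "slabB q F t x y * exp ((h y - h x) / 2) \<le> of_bool (y \<in> ?U) * ?f y + of_bool (y \<in> ?D) * ?f y"
      unfolding slabB_def by (simp only: distrib_right mult.assoc)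
  qed
  also have "\<dots> = (\<Sum>y\<in>?U. ?f y) + (\<Sum>y\<in>?D. ?f y)"
  proof -
    have S: "(\<Sum>y\<in>A. of_bool (y \<in> B) * ?f y) = (\<Sum>y\<in>B. ?f y)" if "B \<subseteq> A" for B
      using A(1) that by (intro sum.mono_neutral_cong_right) auto
    have "?U \<subseteq> A" "?D \<subseteq> A" by blast+
    note S[OF this(1)] S[OF this(2)]
    then show ?thesis unfolding sum.distrib by (rule arg_cong2)
  qed
  also have "\<dots> \<le> KK p0 powr 2 * M * exp (- (1 / 4) * t) + KD p0 * M * exp (- (1 / 4) * t)"
    using A by (intro add_mono slab_up[OF q M F _ _ x t] slab_down[OF q M F _ _ x t]) auto
  finally show ?thesis by (simp add: KB_def distrib_right)
qed

text \<open>At the initial width the crude insertion estimate is affordable, with slack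
  \<open>2 * d\<close>. The recursion will be summed over the end as well as over the start, so both
  forms are provided.\<close>

lemma EE_base:
  assumes q: "0 < p0" "p0 \<le> q" "q \<le> 1" and M: "good q M" "0 \<le> M" and F: "finite F" "F \<subseteq> E" and A: "finite A" "A \<subseteq> V"
    and x: "x \<in> V" and d: "0 \<le> d"
  shows "(\<Sum>y\<in>A. EE q F d x y * exp ((h y - h x) / 2)) \<le> 2 * KK p0 powr (1 + 2 * d) * M"
    and "(\<Sum>y\<in>A. EE q F d y x * exp ((h y - h x) / 2)) \<le> 2 * KK p0 powr (1 + 2 * d) * M"
proof -
  have q0: "0 \<le> q" using q by simp
  let ?P = "\<lambda>y. tauR q F (Band (h x - d) (h x + d)) x y"
  let ?A = "{y \<in> A. \<bar>h y - h x\<bar> \<le> d}"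
  \<comment> \<open>A connection inside a band of height \<open>d\<close> that contains one end
    contains both, so the band lies within distance \<open>d\<close> of \<open>h x\<close>.\<close>
  have cmp: "tauR q F (Band a b) x y \<le> of_bool (\<bar>h y - h x\<bar> \<le> d) * ?P y"
    if "b - a = d" "a \<le> h x \<and> h x \<le> b \<or> a \<le> h y \<and> h y \<le> b" for a b y
  proof (cases "a \<le> h x \<and> h x \<le> b \<and> a \<le> h y \<and> h y \<le> b")
    case True
    then have "Band a b \<subseteq> Band (h x - d) (h x + d)" using that by (intro Band_mono) auto
    then have "tauR q F (Band a b) x y \<le> ?P y" by (intro Pr_mono q0 q) (erule conn_mono, blast)
    moreover have "\<bar>h y - h x\<bar> \<le> d" using True that by linarith
    ultimately show ?thesis by simp
  next
    case False
    then have "\<not> conn (\<xi> \<inter> Band a b) x y" for \<xi>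
      using conn_Band[of \<xi> a b x y] conn_Band[of \<xi> a b y x] conn_sym[of "\<xi> \<inter> Band a b" x y] that by auto
    then show ?thesis using q q0 F(1) by simp
  qed
  have sum: "(\<Sum>y\<in>A. f y * exp ((h y - h x) / 2)) \<le> 2 * KK p0 powr (1 + 2 * d) * M"
    if f: "\<And>y. f y \<le> of_bool (\<bar>h y - h x\<bar> \<le> d) * ?P y + of_bool (\<bar>h y - h x\<bar> \<le> d) * ?P y" for f
  proof -
    have "(\<Sum>y\<in>A. f y * exp ((h y - h x) / 2)) \<le> (\<Sum>y\<in>A. of_bool (\<bar>h y - h x\<bar> \<le> d) * (?P y * (2 * exp (d / 2))))"
    proof (rule sum_mono)
      fix y
      have "f y * exp ((h y - h x) / 2) \<le> (of_bool (\<bar>h y - h x\<bar> \<le> d) * ?P y + of_bool (\<bar>h y - h x\<bar> \<le> d) * ?P y) * exp ((h y - h x) / 2)"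
        by (rule mult_right_mono[OF f]) simp
      also have "\<dots> \<le> of_bool (\<bar>h y - h x\<bar> \<le> d) * (?P y * (2 * exp (d / 2)))"
      proof (cases "\<bar>h y - h x\<bar> \<le> d")
        case True
        then have "?P y * exp ((h y - h x) / 2) \<le> ?P y * exp (d / 2)" using q q0 by (intro mult_left_mono) auto
        then show ?thesis using True by simp
      qed simp
      finally show "f y * exp ((h y - h x) / 2) \<le> of_bool (\<bar>h y - h x\<bar> \<le> d) * (?P y * (2 * exp (d / 2)))" .
    qed
    also have "\<dots> = (\<Sum>y\<in>?A. ?P y) * (2 * exp (d / 2))"
      unfolding sum_distrib_right using A(1) by (intro sum.mono_neutral_cong_right) auto
    also have "\<dots> \<le> KK p0 powr (1 + 2 * d) * (M * exp (- (3 / 4) * ((h x + d) - (h x - d)))) * (2 * exp (d / 2))"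
      using A d x by (intro mult_right_mono band_sum[OF q M F]) auto
    also have "\<dots> = 2 * KK p0 powr (1 + 2 * d) * M * (exp (- (3 / 4) * ((h x + d) - (h x - d))) * exp (d / 2))" by simp
    also have "\<dots> \<le> 2 * KK p0 powr (1 + 2 * d) * M * 1"
      unfolding exp_add[symmetric] using M d by (intro mult_left_mono) auto
    finally show ?thesis by simp
  qed
  show "(\<Sum>y\<in>A. EE q F d x y * exp ((h y - h x) / 2)) \<le> 2 * KK p0 powr (1 + 2 * d) * M"
    unfolding EE_def using d by (intro sum add_mono cmp) auto
  show "(\<Sum>y\<in>A. EE q F d y x * exp ((h y - h x) / 2)) \<le> 2 * KK p0 powr (1 + 2 * d) * M"
    unfolding EE_def conn_commute[of _ _ x] using d by (intro sum add_mono cmp) auto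
qed

text \<open>The width from which the recursion starts, chosen so that its first coefficient is 1/10.
  It is logarithmic in \<open>M\<close>, so a power of \<open>KK\<close> with exponent
  \<open>dd\<close> is a power of \<open>M\<close>.\<close>

definition dd :: "real \<Rightarrow> real \<Rightarrow> real" where "dd p0 M = 4 * ln (10 * KB p0 * M)"

lemma dd:
  assumes "0 < p0" "p0 \<le> 1" "1 \<le> M"
  shows "0 \<le> dd p0 M" "KB p0 * M * exp (- (1 / 4) * dd p0 M) = 1 / 10"
proof -
  have 1: "1 \<le> KB p0 * M" using mult_mono[of 1 "KB p0" 1 M] KB_ge_1[of p0] assms by simp
  then have "0 \<le> ln (10 * KB p0 * M)" by (intro ln_ge_zero) (simp add: mult.assoc)
  then show "0 \<le> dd p0 M" by (simp add: dd_def)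
  have "exp (- (1 / 4) * dd p0 M) = 1 / (10 * KB p0 * M)"
    using 1 by (simp add: dd_def exp_minus mult.assoc inverse_eq_divide)
  moreover have "KB p0 * M \<noteq> 0" using 1 by linarith
  ultimately show "KB p0 * M * exp (- (1 / 4) * dd p0 M) = 1 / 10" by simp
qed

lemma exp_quarter_sum: "(\<Sum>k<n. exp (- (1 / 4) * real k)) \<le> 5"
proof -
  have "(5 / 4 :: real) \<le> exp (1 / 4)" using exp_ge_add_one_self[of "1 / 4 :: real"] by simp
  then have e: "exp (- (1 / 4) :: real) \<le> 4 / 5"
    using le_imp_inverse_le[of "5 / 4 :: real" "exp (1 / 4)"] by (simp add: exp_minus)
  have "(\<Sum>k<n. exp (- (1 / 4) * real k)) \<le> (\<Sum>k<n. (4 / 5) ^ k)"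
  proof (rule sum_mono)
    fix k
    have "exp (- (1 / 4) * real k) = exp (- (1 / 4)) ^ k" by (simp add: exp_of_nat_mult[symmetric] mult.commute)
    also have "\<dots> \<le> (4 / 5) ^ k" using e by (intro power_mono) auto
    finally show "exp (- (1 / 4) * real k) \<le> (4 / 5) ^ k" .
  qed
  also have "\<dots> = 5 - 5 * (4 / 5) ^ n" by (simp add: sum_gp_strict)
  also have "\<dots> \<le> 5" by simp
  finally show ?thesis .
qed

lemma EE_sums:
  assumes q: "0 < p0" "p0 \<le> q" "q \<le> 1" and M: "good q M" "1 \<le> M" and F: "finite F" "F \<subseteq> E"
    and x: "x \<in> V" and Z: "Z = insert x (\<Union>F)"
  shows "(\<Sum>z\<in>Z. EE q F (dd p0 M + real n) x z * exp ((h z - h x) / 2)) \<le> 2 * KK p0 powr (1 + 2 * dd p0 M) * M * exp 1"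
    and "y \<in> Z \<Longrightarrow> (\<Sum>z\<in>Z. EE q F (dd p0 M + real n) z y * exp ((h z - h y) / 2)) \<le> 2 * KK p0 powr (1 + 2 * dd p0 M) * M * exp 1"
proof -
  define d where "d = dd p0 M"
  define w where "w = (\<lambda>a b. exp ((h b - h a) / 2))"
  have w: "w a c = w a b * w b c" "0 \<le> w a b" for a b c
    unfolding w_def exp_add[symmetric] by (simp_all add: diff_divide_distrib)
  have d: "0 \<le> d" "KB p0 * M * exp (- (1 / 4) * d) = 1 / 10" using dd[of p0 M] q M by (auto simp: d_def)
  have q0: "0 \<le> q" using q by simp
  have M0: "0 \<le> M" using M by simp
  have fZ: "finite Z" "Z \<subseteq> V" "Z \<noteq> {}" using finite_verts[OF F] verts_V[OF F(2)] x by (auto simp: Z)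
  have ZZ: "insert a (\<Union>F) \<subseteq> Z" if "a \<in> Z" for a using that by (auto simp: Z)
  \<comment> \<open>The geometric series with ratio at most 4/5 sums to at most 5; hence
    \<open>2 * (\<Sum>k<n. \<beta> k) \<le> 1\<close> and the recursion loses only a factor
    \<open>exp 1\<close>.\<close>
  define \<beta> where "\<beta> = (\<lambda>n. (1 / 10) * exp (- (1 / 4) * real n))"
  have \<beta>_eq: "\<beta> n = KB p0 * M * exp (- (1 / 4) * (d + real n))" for n
    unfolding \<beta>_def d(2)[symmetric] by (simp add: exp_add[symmetric] algebra_simps)
  have \<beta>: "0 \<le> \<beta> n" "\<beta> n \<le> 1 / 2" for n
  proof -
    have "exp (- (1 / 4) * real n) \<le> 1" by simp
    moreover have "0 < exp (- (1 / 4) * real n)" by (rule exp_gt_zero)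
    ultimately show "0 \<le> \<beta> n" "\<beta> n \<le> 1 / 2" unfolding \<beta>_def by linarith+
  qed
  have \<beta>s: "2 * (\<Sum>k<n. \<beta> k) \<le> 1" for n
    using exp_quarter_sum[of n] unfolding \<beta>_def sum_distrib_left[symmetric] by linarith
  have it: "S n \<le> B * exp 1" if "\<And>n. S (Suc n) \<le> S n + \<beta> n * S (Suc n)" "\<And>n. 0 \<le> S n" "S 0 \<le> B" for S B
  proof -
    have "S n \<le> S 0 * exp (2 * (\<Sum>k<n. \<beta> k))" using that \<beta> by (intro iterate_bound) auto
    also have "\<dots> \<le> B * exp 1" using that(2)[of 0] that(3) \<beta>s by (intro mult_mono) auto
    finally show ?thesis .
  qed
  have Bs: "(\<Sum>y\<in>Z. slabB q F (d + real n) z y * w z y) \<le> \<beta> n" if "z \<in> Z" for z n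
    unfolding w_def \<beta>_eq using that fZ d by (intro slabB_sum[OF q M(1) M0 F]) auto
  have step: "EE q F (d + real (Suc n)) a b \<le> EE q F (d + real n) a b + (\<Sum>z\<in>Z. EE q F (d + real (Suc n)) a z * slabB q F (d + real n) z b)"
    if "a \<in> Z" for a b n
    using EE_step[OF F q0 q(3) fZ(1) ZZ[OF that], of "d + real n" b] d by (simp add: add.assoc add.commute[of 1])
  have EEn: "0 \<le> EE q F t a b" "0 \<le> slabB q F t a b" for t a b using EE_nonneg slabB_nonneg q0 q by auto
  have "(\<Sum>z\<in>Z. EE q F (d + real n) x z * w x z) \<le> 2 * KK p0 powr (1 + 2 * d) * M * exp 1"
  proof (rule it[where S = "\<lambda>n. \<Sum>z\<in>Z. EE q F (d + real n) x z * w x z"])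
    fix n
    let ?e = "EE q F (d + real (Suc n))"
    have xZ: "x \<in> Z" by (simp add: Z)
    have "(\<Sum>y\<in>Z. ?e x y * w x y) \<le> (\<Sum>y\<in>Z. (EE q F (d + real n) x y + (\<Sum>z\<in>Z. ?e x z * slabB q F (d + real n) z y)) * w x y)"
      using w by (intro sum_mono mult_right_mono step xZ) auto
    also have "\<dots> = (\<Sum>y\<in>Z. EE q F (d + real n) x y * w x y) + (\<Sum>y\<in>Z. \<Sum>z\<in>Z. ?e x z * w x z * (slabB q F (d + real n) z y * w z y))"
      unfolding distrib_right sum.distrib sum_distrib_right
      by (intro arg_cong2[where f = "(+)"] refl sum.cong) (simp add: w(1)[of x _ z for z])
    also have "(\<Sum>y\<in>Z. \<Sum>z\<in>Z. ?e x z * w x z * (slabB q F (d + real n) z y * w z y)) =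
      (\<Sum>z\<in>Z. ?e x z * w x z * (\<Sum>y\<in>Z. slabB q F (d + real n) z y * w z y))"
      unfolding sum_distrib_left by (rule sum.swap)
    also have "\<dots> \<le> (\<Sum>z\<in>Z. ?e x z * w x z * \<beta> n)" using EEn w by (intro sum_mono mult_left_mono Bs) auto
    finally show "(\<Sum>z\<in>Z. ?e x z * w x z) \<le> (\<Sum>z\<in>Z. EE q F (d + real n) x z * w x z) + \<beta> n * (\<Sum>z\<in>Z. ?e x z * w x z)"
      by (simp add: sum_distrib_left mult.commute mult.left_commute)
  qed (use EEn w EE_base(1)[OF q M(1) M0 F fZ(1,2) x d(1)] in \<open>auto intro!: sum_nonneg simp: w_def\<close>)
  then show "(\<Sum>z\<in>Z. EE q F (dd p0 M + real n) x z * exp ((h z - h x) / 2)) \<le> 2 * KK p0 powr (1 + 2 * dd p0 M) * M * exp 1"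
    by (simp add: w_def d_def)
  assume y: "y \<in> Z"
  \<comment> \<open>In the sum over starting points the recursion replaces the end \<open>y\<close>
    by other vertices, so it closes only after taking the maximum over the finite set
    \<open>Z\<close>.\<close>
  define c where "c = (\<lambda>n y. \<Sum>z\<in>Z. EE q F (d + real n) z y * w y z)"
  have "Max (c n ` Z) \<le> 2 * KK p0 powr (1 + 2 * d) * M * exp 1"
  proof (rule it[where S = "\<lambda>n. Max (c n ` Z)"])
    fix n
    let ?e = "EE q F (d + real (Suc n))"
    have "Max (c (Suc n) ` Z) \<in> c (Suc n) ` Z" using fZ by (intro Max_in) auto
    then obtain y where y: "y \<in> Z" "Max (c (Suc n) ` Z) = c (Suc n) y" by (metis imageE)
    have "c (Suc n) y \<le> (\<Sum>x\<in>Z. (EE q F (d + real n) x y + (\<Sum>z\<in>Z. ?e x z * slabB q F (d + real n) z y)) * w y x)"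
      unfolding c_def using w by (intro sum_mono mult_right_mono step) auto
    also have "\<dots> = c n y + (\<Sum>x\<in>Z. \<Sum>z\<in>Z. slabB q F (d + real n) y z * w y z * (?e x z * w z x))"
      unfolding distrib_right sum.distrib sum_distrib_right c_def
      by (intro arg_cong2[where f = "(+)"] refl sum.cong) (simp add: w(1)[of y _ z for z] slabB_sym[of _ _ _ y])
    also have "(\<Sum>x\<in>Z. \<Sum>z\<in>Z. slabB q F (d + real n) y z * w y z * (?e x z * w z x)) =
      (\<Sum>z\<in>Z. slabB q F (d + real n) y z * w y z * c (Suc n) z)"
      unfolding sum_distrib_left c_def by (rule sum.swap)
    also have "\<dots> \<le> (\<Sum>z\<in>Z. slabB q F (d + real n) y z * w y z * Max (c (Suc n) ` Z))"
      using EEn w fZ by (intro sum_mono mult_left_mono Max_ge) auto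
    also have "\<dots> \<le> \<beta> n * Max (c (Suc n) ` Z)" unfolding sum_distrib_right[symmetric] y(2)
      using Bs[OF y(1)] EEn w by (intro mult_right_mono) (auto simp: c_def intro!: sum_nonneg)
    finally show "Max (c (Suc n) ` Z) \<le> Max (c n ` Z) + \<beta> n * Max (c (Suc n) ` Z)"
      using Max_ge[OF finite_imageI[OF fZ(1)] imageI[OF y(1)], of "c n"] y(2) by linarith
  next
    fix n
    have "c n x \<le> Max (c n ` Z)" using fZ by (intro Max_ge) (auto simp: Z)
    moreover have "0 \<le> c n x" unfolding c_def using EEn w by (intro sum_nonneg) auto
    ultimately show "0 \<le> Max (c n ` Z)" by simp
  next
    have "c 0 y \<le> 2 * KK p0 powr (1 + 2 * d) * M" if "y \<in> Z" for y
      using EE_base(2)[OF q M(1) M0 F fZ(1,2) _ d(1), of y] that fZ by (auto simp: c_def w_def)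
    then show "Max (c 0 ` Z) \<le> 2 * KK p0 powr (1 + 2 * d) * M" using fZ by simp
  qed
  moreover have "c n y \<le> Max (c n ` Z)" using fZ y by (intro Max_ge) auto
  ultimately show "(\<Sum>z\<in>Z. EE q F (dd p0 M + real n) z y * exp ((h z - h y) / 2)) \<le> 2 * KK p0 powr (1 + 2 * dd p0 M) * M * exp 1"
    by (simp add: c_def w_def d_def)
qed

text \<open>The square reflects the two pieces of \<open>EE_final\<close>. The number of recursion
  steps needed to exhaust the heights in \<open>F\<close> is unbounded but does not enter the
  estimate.\<close>

lemma XX_from_good:
  assumes q: "0 < p0" "p0 \<le> q" "q \<le> 1" and M: "good q M" "1 \<le> M"
  shows "XX q ((2 * KK p0 powr (1 + 2 * dd p0 M) * M * exp 1)\<^sup>2)" unfolding XX_def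
proof (intro allI impI)
  fix F :: "'v set set" and A x assume a: "finite F" "F \<subseteq> E" "finite A" "A \<subseteq> V" "x \<in> V"
  define Z where "Z = insert x (\<Union>F)"
  let ?r = "2 * KK p0 powr (1 + 2 * dd p0 M) * M * exp 1"
  have fZ: "finite Z" "Z \<subseteq> V" "x \<in> Z" using finite_verts[OF a(1,2)] verts_V[OF a(2)] a by (auto simp: Z_def)
  have q0: "0 \<le> q" using q by simp
  define T0 where "T0 = Max (h ` Z) - Min (h ` Z)"
  define n where "n = nat \<lceil>T0\<rceil>"
  define T where "T = dd p0 M + real n"
  have "0 \<le> dd p0 M" using dd[of p0 M] q M by simp
  then have T: "T0 \<le> T" unfolding T_def n_def using real_nat_ceiling_ge[of T0] by linarith
  have T: "h u - h v \<le> T" if "u \<in> Z" "v \<in> Z" for u v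
  proof -
    have "h u \<le> Max (h ` Z)" "Min (h ` Z) \<le> h v" using fZ that by auto
    then show ?thesis using T unfolding T0_def by linarith
  qed
  define w where "w = (\<lambda>a b. exp ((h b - h a) / 2))"
  have w: "w a c = w a b * w b c" "0 \<le> w a b" for a b c
    unfolding w_def exp_add[symmetric] by (simp_all add: diff_divide_distrib)
  have EEn: "0 \<le> EE q F t a b" for t a b using EE_nonneg q0 q by auto
  have "(\<Sum>y\<in>A. tau q F x y * w x y) = (\<Sum>y\<in>A \<inter> Z. tau q F x y * w x y)"
  proof (rule sum.mono_neutral_right)
    show "\<forall>y\<in>A - A \<inter> Z. tau q F x y * w x y = 0"
    proof
      fix y assume "y \<in> A - A \<inter> Z"
      then have "\<not> conn \<xi> x y" if "\<xi> \<subseteq> F" for \<xi> using conn_Union[of \<xi> x y] that by (auto simp: Z_def)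
      then have "tau q F x y = Ex q F (\<lambda>_. 0)" by (intro Ex_cong) auto
      then show "tau q F x y * w x y = 0" using a(1) by simp
    qed
  qed (use a in auto)
  also have "\<dots> \<le> (\<Sum>y\<in>Z. tau q F x y * w x y)" using q q0 w fZ by (intro sum_mono2) auto
  also have "\<dots> \<le> (\<Sum>y\<in>Z. (\<Sum>z\<in>Z. EE q F T x z * EE q F T y z) * w x y)"
    using w by (intro sum_mono mult_right_mono EE_final[OF a(1,2) q0 q(3) fZ(1) _ T]) (auto simp: Z_def)
  also have "\<dots> = (\<Sum>z\<in>Z. EE q F T x z * w x z * (\<Sum>y\<in>Z. EE q F T y z * w z y))"
    unfolding sum_distrib_left sum_distrib_right
    by (subst sum.swap) (intro sum.cong refl, simp add: w(1)[of x _ z for z])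
  also have "\<dots> \<le> (\<Sum>z\<in>Z. EE q F T x z * w x z * ?r)" using EEn w by (intro sum_mono mult_left_mono)
      (auto simp: w_def T_def intro!: EE_sums(2)[OF q M a(1,2,5) Z_def])
  also have "\<dots> \<le> ?r * ?r" unfolding sum_distrib_right[symmetric] T_def w_def
    using M by (intro mult_right_mono EE_sums(1)[OF q M a(1,2,5) Z_def]) auto
  finally show "(\<Sum>y\<in>A. tau q F x y * exp ((h y - h x) / 2)) \<le> ?r\<^sup>2" by (simp add: power2_eq_square w_def)
qed

section \<open>Self-improvement of the weighted bound\<close>

lemma XX_mono: "XX q Y \<Longrightarrow> Y \<le> Y' \<Longrightarrow> XX q Y'" unfolding XX_def by (meson order_trans)

text \<open>\<open>XX_from_good\<close> yields a constant times \<open>M powr (2 * a)\<close>, and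
  \<open>M\<close> is proportional to \<open>Y powr (3 * \<epsilon>)\<close>. Since \<open>a\<close>
  depends only on \<open>p0\<close>, \<epsilon> may be chosen afterwards to make the resulting power
  of \<open>Y\<close> equal to 1/2.\<close>

lemma bootstrap:
  assumes p: "0 < p0" "p0 \<le> p" "p \<le> 1" and le: "\<And>t. t0 \<le> t \<Longrightarrow> lam p t \<le> exp (- t)"
  shows "\<exists>c\<ge>1. \<forall>q Y. p0 \<le> q \<longrightarrow> q \<le> p \<longrightarrow> 1 \<le> Y \<longrightarrow> XX q Y \<longrightarrow> XX q (c * Y powr (1 / 2))"
proof -
  define lk where "lk = ln (KK p0)"
  have K1: "1 \<le> KK p0" using KK_ge_1 p by simp
  then have lk: "0 \<le> lk" "KK p0 = exp lk" by (auto simp: lk_def)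
  \<comment> \<open>The 8 comes from \<open>2 * dd = 8 * ln (B * M)\<close>, the 1 from the separate
    factor \<open>M\<close>.\<close>
  define a where "a = 1 + 8 * lk"
  have a: "1 \<le> a" using lk by (simp add: a_def)
  define \<epsilon> where "\<epsilon> = 1 / (12 * a)"
  have \<epsilon>: "0 < \<epsilon>" "\<epsilon> \<le> 1" "3 * \<epsilon> * a = 1 / 4" using a by (auto simp: \<epsilon>_def)
  have "\<exists>C>0. \<forall>q Y. 0 \<le> q \<longrightarrow> q \<le> p \<longrightarrow> 1 \<le> Y \<longrightarrow> XX q Y \<longrightarrow> (\<forall>x\<in>Orb. \<forall>t\<ge>0. \<forall>F. finite F \<longrightarrow> F \<subseteq> E \<longrightarrow>
      Ex q F (\<lambda>\<xi>. NN x t \<xi>) \<le> C * Y powr (3 * \<epsilon>) * exp (- (3 / 4) * t))"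
    by (rule NN_moment) (use p le \<epsilon> in auto)
  then obtain C0 where "0 < C0" and
    C0: "\<forall>q Y. 0 \<le> q \<longrightarrow> q \<le> p \<longrightarrow> 1 \<le> Y \<longrightarrow> XX q Y \<longrightarrow> (\<forall>x\<in>Orb. \<forall>t\<ge>0. \<forall>F. finite F \<longrightarrow> F \<subseteq> E \<longrightarrow>
      Ex q F (\<lambda>\<xi>. NN x t \<xi>) \<le> C0 * Y powr (3 * \<epsilon>) * exp (- (3 / 4) * t))" by (elim exE conjE)
  define C where "C = max 1 C0"
  have C: "1 \<le> C" by (simp add: C_def)
  define B where "B = 10 * KB p0"
  have B: "1 \<le> B" using KB_ge_1[of p0] p by (simp add: B_def)
  define K where "K = 2 * exp 1 * KK p0 * B powr (8 * lk) * C powr a"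
  show ?thesis
  proof (intro exI[of _ "max 1 (K\<^sup>2)"] conjI allI impI)
    fix q Y assume q: "p0 \<le> q" "q \<le> p" and Y: "1 \<le> Y" "XX q Y"
    define M where "M = C * Y powr (3 * \<epsilon>)"
    have Y1: "1 \<le> Y powr (3 * \<epsilon>)" using Y(1) \<epsilon>(1) by (intro ge_one_powr_ge_zero) auto
    have M1: "1 \<le> M" unfolding M_def using mult_mono[of 1 C 1 "Y powr (3 * \<epsilon>)"] C Y1 by simp
    have "good q M" unfolding good_def
    proof (intro ballI allI impI)
      fix x F and t :: real assume x: "x \<in> Orb" "0 \<le> t" "finite F" "F \<subseteq> E"
      have "Ex q F (NN x t) \<le> C0 * Y powr (3 * \<epsilon>) * exp (- (3 / 4) * t)"
        using C0[rule_format, of q Y x t F] x q Y p by simp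
      also have "\<dots> \<le> M * exp (- (3 / 4) * t)" unfolding M_def C_def by (intro mult_right_mono) auto
      finally show "Ex q F (NN x t) \<le> M * exp (- (3 / 4) * t)" .
    qed
    then have X: "XX q ((2 * KK p0 powr (1 + 2 * dd p0 M) * M * exp 1)\<^sup>2)" using XX_from_good[of p0 q M] p q M1 by simp
    have "dd p0 M = 4 * ln (B * M)" by (simp add: dd_def B_def)
    then have "KK p0 powr (1 + 2 * dd p0 M) = exp (lk + 8 * lk * ln (B * M))"
      unfolding lk(2) by (simp add: powr_def algebra_simps)
    also have "\<dots> = KK p0 * (B * M) powr (8 * lk)" using B M1 by (simp add: exp_add lk(2) powr_def)
    also have "(B * M) powr (8 * lk) = B powr (8 * lk) * M powr (8 * lk)" by (rule powr_mult)
    finally have "2 * KK p0 powr (1 + 2 * dd p0 M) * M * exp 1 = 2 * exp 1 * KK p0 * B powr (8 * lk) * (M powr 1 * M powr (8 * lk))"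
      using M1 by simp
    also have "M powr 1 * M powr (8 * lk) = M powr a" by (simp add: powr_add a_def)
    also have "M powr a = C powr a * Y powr (1 / 4)" unfolding M_def powr_mult powr_powr \<epsilon>(3) ..
    finally have r: "2 * KK p0 powr (1 + 2 * dd p0 M) * M * exp 1 = K * Y powr (1 / 4)" by (simp add: K_def)
    have "(K * Y powr (1 / 4))\<^sup>2 = K\<^sup>2 * (Y powr (1 / 4) * Y powr (1 / 4))" by (simp add: power2_eq_square)
    also have "Y powr (1 / 4) * Y powr (1 / 4) = Y powr (1 / 2)" by (simp add: powr_add[symmetric])
    also have "K\<^sup>2 * Y powr (1 / 2) \<le> max 1 (K\<^sup>2) * Y powr (1 / 2)" by (intro mult_right_mono) auto
    finally show "XX q (max 1 (K\<^sup>2) * Y powr (1 / 2))" using X unfolding r by (rule XX_mono[rotated])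
  qed simp
qed

text \<open>The infimum \<open>m\<close> of the admissible bounds is admissible and satisfies
  \<open>m \<le> c * m powr (1 / 2)\<close>. Some finite bound is needed to start, but its size
  disappears.\<close>

lemma bootstrap_limit:
  assumes c: "1 \<le> c" "\<And>Y. 1 \<le> Y \<Longrightarrow> XX q Y \<Longrightarrow> XX q (c * Y powr (1 / 2))" and Y: "1 \<le> Y" "XX q Y"
  shows "XX q (c * c)"
proof -
  let ?S = "{Y. 1 \<le> Y \<and> XX q Y}"
  define m where "m = Inf ?S"
  have ne: "?S \<noteq> {}" using Y by auto
  have m1: "1 \<le> m" unfolding m_def using ne by (intro cInf_greatest) auto
  have "XX q m" unfolding XX_def
  proof (intro allI impI)
    fix F A x assume "finite F" "F \<subseteq> E" "finite A" "A \<subseteq> V" "x \<in> V"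
    then show "(\<Sum>y\<in>A. tau q F x y * exp ((h y - h x) / 2)) \<le> m"
      unfolding m_def using ne XX_D by (intro cInf_greatest) auto
  qed
  then have X: "XX q (c * m powr (1 / 2))" using c m1 by simp
  have s1: "1 \<le> m powr (1 / 2)" using m1 by (intro ge_one_powr_ge_zero) auto
  have "c * m powr (1 / 2) \<in> ?S" using X mult_mono[OF c(1) s1] c(1) by simp
  then have "m \<le> c * m powr (1 / 2)" unfolding m_def by (rule cInf_lower) (auto intro: bdd_belowI[of _ 1])
  moreover have mm: "m = m powr (1 / 2) * m powr (1 / 2)" using m1 by (simp add: powr_add[symmetric])
  ultimately have "m powr (1 / 2) * m powr (1 / 2) \<le> c * m powr (1 / 2)" by simp
  then have "m powr (1 / 2) \<le> c" by (rule mult_right_le_imp_le) (use s1 in linarith)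
  then have "m \<le> c * c" using mult_mono[of "m powr (1 / 2)" c "m powr (1 / 2)" c] mm s1 c(1) by linarith
  then show ?thesis using \<open>XX q m\<close> by (rule XX_mono[rotated])
qed

text \<open>By \<open>exp (x / 2) \<le> 1 + exp x\<close> the sum is dominated by those with tilts 0
  and 1, and mass transport reduces the latter to the former. Since it speaks about one orbit only,
  both ends are first moved there by insertion.\<close>

lemma XX_of_chi:
  assumes q: "0 < q" "q \<le> 1" and Y: "chi q Y"
  shows "\<exists>Y'\<ge>1. XX q Y'"
proof -
  have q0: "0 \<le> q" using q by simp
  define K where "K = (1 / q) ^ (2 * D) * exp (2 * (D * t0)) * real ((dg + 1) ^ D)"
  have "XX q (Y + K * Y)" unfolding XX_def
  proof (intro allI impI)
    fix F A x assume F: "finite F" "F \<subseteq> E" and A: "finite A" "A \<subseteq> V" and x: "x \<in> V"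
    from near_path[OF x] obtain a Ca where a: "a \<in> Orb" "Ca \<subseteq> E" "finite Ca" "card Ca \<le> D" "conn Ca x a" "\<bar>h a - h x\<bar> \<le> D * t0"
      by (elim exE conjE)
    have "\<forall>y\<in>A. \<exists>bC. fst bC \<in> Orb \<and> snd bC \<subseteq> E \<and> finite (snd bC) \<and> card (snd bC) \<le> D \<and> conn (snd bC) y (fst bC) \<and>
      fst bC \<in> nb E D y \<and> \<bar>h (fst bC) - h y\<bar> \<le> D * t0"
    proof
      fix y assume "y \<in> A"
      then have "y \<in> V" using A by auto
      from near_path[OF this] obtain b C where "b \<in> Orb \<and> C \<subseteq> E \<and> finite C \<and> card C \<le> D \<and> conn C y b \<and> b \<in> nb E D y \<and>
        \<bar>h b - h y\<bar> \<le> D * t0" by blast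
      then show "\<exists>bC. fst bC \<in> Orb \<and> snd bC \<subseteq> E \<and> finite (snd bC) \<and> card (snd bC) \<le> D \<and> conn (snd bC) y (fst bC) \<and>
        fst bC \<in> nb E D y \<and> \<bar>h (fst bC) - h y\<bar> \<le> D * t0" by (intro exI[of _ "(b, C)"]) simp
    qed
    from bchoice[OF this] obtain bC where bC: "\<forall>y\<in>A. fst (bC y) \<in> Orb \<and> snd (bC y) \<subseteq> E \<and> finite (snd (bC y)) \<and>
      card (snd (bC y)) \<le> D \<and> conn (snd (bC y)) y (fst (bC y)) \<and> fst (bC y) \<in> nb E D y \<and> \<bar>h (fst (bC y)) - h y\<bar> \<le> D * t0" ..
    define b where "b = (\<lambda>y. fst (bC y))"
    define C where "C = (\<lambda>y. snd (bC y))"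
    have bC: "b y \<in> Orb" "C y \<subseteq> E" "finite (C y)" "card (C y) \<le> D" "conn (C y) y (b y)" "b y \<in> nb E D y" "\<bar>h (b y) - h y\<bar> \<le> D * t0"
      if "y \<in> A" for y using bC[THEN bspec, OF that] unfolding b_def C_def by - (elim conjE, assumption)+
    define F' where "F' = F \<union> Ca \<union> (\<Union>y\<in>A. C y)"
    have F': "finite F'" "F' \<subseteq> E" using F(1) A(1) a(3) bC(3) F(2) a(2) subsetD[OF bC(2)] by (auto simp: F'_def)
    let ?w = "\<lambda>c. tau q F' a c * exp (h c - h a)"
    have main: "tau q F x y * exp (h y - h x) \<le> (1 / q) ^ (2 * D) * exp (2 * (D * t0)) * ?w (b y)" if y: "y \<in> A" for y
    proof -
      let ?S = "Ca \<union> C y"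
      have S: "?S \<subseteq> F'" using y by (auto simp: F'_def)
      have cS: "card ?S \<le> 2 * D" unfolding mult_2 by (rule order_trans[OF card_Un_le add_mono[OF a(4) bC(4)[OF y]]])
      have s: "tau q F x y \<le> (1 / q) ^ (2 * D) * tau q F' a (b y)"
      proof (rule Pr_insertion[OF F'(1) _ S cS q incr_conn(2)])
        show "F \<subseteq> F'" by (auto simp: F'_def)
        fix \<xi> assume o: "conn \<xi> x y" "?S \<subseteq> \<xi>"
        have 1: "conn \<xi> a x" by (rule conn_sym, rule conn_mono[OF a(5)]) (use o in auto)
        have 3: "conn \<xi> y (b y)" by (rule conn_mono[OF bC(5)[OF y]]) (use o in auto)
        show "conn \<xi> a (b y)" by (rule conn_trans[OF conn_trans[OF 1 o(1)] 3])
      qed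
      have e: "exp (h y - h x) \<le> exp (2 * (D * t0)) * exp (h (b y) - h a)"
      proof -
        have "h y - h x \<le> 2 * (D * t0) + (h (b y) - h a)" using a(6) bC(7)[OF y] by linarith
        then show ?thesis unfolding exp_add[symmetric] by (subst exp_le_cancel_iff)
      qed
      have "tau q F x y * exp (h y - h x) \<le> ((1 / q) ^ (2 * D) * tau q F' a (b y)) *
        (exp (2 * (D * t0)) * exp (h (b y) - h a))"
        using s e q q0 by (intro mult_mono) auto
      then show ?thesis by (simp only: mult_ac)
    qed
    have "(\<Sum>y\<in>A. tau q F x y * exp ((h y - h x) / 2)) \<le>
      (\<Sum>y\<in>A. tau q F x y + tau q F x y * exp (h y - h x))"
    proof (rule sum_mono)
      fix y
      have "exp ((h y - h x) / 2) \<le> 1 + exp (h y - h x)"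
      proof (cases "h y \<le> h x")
        case True
        then have "exp ((h y - h x) / 2) \<le> 1" by simp
        then show ?thesis using exp_ge_zero[of "h y - h x"] by linarith
      next
        case False
        then have "exp ((h y - h x) / 2) \<le> exp (h y - h x)" by simp
        then show ?thesis by linarith
      qed
      then have "tau q F x y * exp ((h y - h x) / 2) \<le> tau q F x y * (1 + exp (h y - h x))"
        using q q0 by (intro mult_left_mono) auto
      then show "tau q F x y * exp ((h y - h x) / 2) \<le> tau q F x y + tau q F x y * exp (h y - h x)"
        by (simp add: distrib_left)
    qed
    also have "\<dots> \<le> Y + (\<Sum>y\<in>A. (1 / q) ^ (2 * D) * exp (2 * (D * t0)) * ?w (b y))" unfolding sum.distrib
    proof (intro add_mono sum_mono main)
      show "(\<Sum>y\<in>A. tau q F x y) \<le> Y" using Y F A x unfolding chi_def by blast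
    qed
    also have "(\<Sum>y\<in>A. (1 / q) ^ (2 * D) * exp (2 * (D * t0)) * ?w (b y)) \<le>
      (1 / q) ^ (2 * D) * exp (2 * (D * t0)) * (real ((dg + 1) ^ D) * (\<Sum>c\<in>b ` A. ?w c))"
      unfolding sum_distrib_left[symmetric]
      using q q0 bC(6) A by (intro mult_left_mono sum_multiplicity[where w = ?w]) auto
    also have "(\<Sum>c\<in>b ` A. ?w c) \<le> Y" using A bC(1) by (intro chi_tilted[OF q0 q(2) Y F'] a(1)) auto
    finally show "(\<Sum>y\<in>A. tau q F x y * exp ((h y - h x) / 2)) \<le> Y + K * Y"
      using q by (simp add: K_def mult.assoc mult_left_mono)
  qed
  then have "XX q (max 1 (Y + K * Y))" by (rule XX_mono) simp
  then show ?thesis by (intro exI[of _ "max 1 (Y + K * Y)"]) simp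
qed

text \<open>The bound \<open>k * k\<close> is common to all \<open>q\<close> between
  \<open>p0\<close> and \<open>p\<close>, so it passes to the limit in each finite sum.\<close>

lemma XX_critical:
  assumes p: "0 < p0" "p0 < p" "p \<le> 1" and c: "\<And>q. p0 < q \<Longrightarrow> q < p \<Longrightarrow> \<exists>Y. chi q Y"
  shows "\<exists>Y. XX p Y"
proof -
  have "\<exists>c\<ge>1. \<forall>q Y. p0 \<le> q \<longrightarrow> q \<le> p \<longrightarrow> 1 \<le> Y \<longrightarrow> XX q Y \<longrightarrow> XX q (c * Y powr (1 / 2))"
    using p by (intro bootstrap lam_le_limit[OF p(2) _ p(3) c]) auto
  then obtain k where k: "1 \<le> k" "\<forall>q Y. p0 \<le> q \<longrightarrow> q \<le> p \<longrightarrow> 1 \<le> Y \<longrightarrow> XX q Y \<longrightarrow> XX q (k * Y powr (1 / 2))" by (elim exE conjE)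
  have Xq: "XX q (k * k)" if q: "p0 < q" "q < p" for q
  proof -
    obtain Y where "chi q Y" using c[OF q] by blast
    then obtain Y' where "1 \<le> Y'" "XX q Y'" using XX_of_chi[of q Y] q p by auto
    then show ?thesis using k(2)[rule_format, of q] q by (intro bootstrap_limit[OF k(1)]) auto
  qed
  have "XX p (k * k)" unfolding XX_def
  proof (intro allI impI)
    fix F A x assume a: "finite F" "F \<subseteq> E" "finite A" "A \<subseteq> V" "x \<in> V"
    let ?f = "\<lambda>\<xi>. \<Sum>y\<in>A. of_bool (conn \<xi> x y) * exp ((h y - h x) / 2)"
    have e: "Ex q F ?f = (\<Sum>y\<in>A. tau q F x y * exp ((h y - h x) / 2))" for q unfolding Ex_sum Ex_cmult_right ..
    have "Ex p F ?f * p ^ 0 \<le> k * k"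
    proof (rule Pr_limit_left[OF p(2)])
      fix q assume "p0 < q" "q < p"
      from XX_D[OF Xq[OF this] a] show "Ex q F ?f * q ^ 0 \<le> k * k" unfolding e by simp
    qed
    then show "(\<Sum>y\<in>A. tau p F x y * exp ((h y - h x) / 2)) \<le> k * k" unfolding e by simp
  qed
  then show ?thesis ..
qed

end

section \<open>Openness and sharpness of the phase transition\<close>

context tilted
begin

definition inE :: "'v set \<Rightarrow> 'v set set" where
  "inE S = {e \<in> E. e \<subseteq> S}"

definition bdry :: "'v set \<Rightarrow> ('v \<times> 'v) set" where
  "bdry S = {(x, z). x \<in> S \<and> z \<notin> S \<and> {x, z} \<in> E}"

text \<open>The functional of Duminil-Copin and Tassion, tilted by the height.\<close>

definition phi :: "real \<Rightarrow> real \<Rightarrow> 'v \<Rightarrow> 'v set \<Rightarrow> real" where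
  "phi p lm v S = (\<Sum>(x, z)\<in>bdry S. p * tau p (inE S) v x * exp (lm * (h z - h v)))"

section \<open>The Simon--Lieb inequality and its iteration\<close>

lemma inE_E: "inE S \<subseteq> E" by (auto simp: inE_def)

lemma finite_inE: "finite S \<Longrightarrow> S \<subseteq> V \<Longrightarrow> finite (inE S)"
proof -
  assume S: "finite S" "S \<subseteq> V"
  have "inE S \<subseteq> (\<Union>v\<in>S. {e \<in> E. v \<in> e})" unfolding inE_def using edge by fastforce
  moreover have "finite (\<Union>v\<in>S. {e \<in> E. v \<in> e})" using S fin_deg by (intro finite_UN_I) auto
  ultimately show ?thesis by (rule finite_subset)
qed

lemma finite_bdry: "finite S \<Longrightarrow> S \<subseteq> V \<Longrightarrow> finite (bdry S)"
proof -
  assume S: "finite S" "S \<subseteq> V"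
  have "bdry S \<subseteq> S \<times> (\<Union>x\<in>S. nb E 1 x)" by (auto simp: bdry_def simp del: One_nat_def intro: nb_edge)
  moreover have "finite (S \<times> (\<Union>x\<in>S. nb E 1 x))" using S finite_nb by (intro finite_cartesian_product finite_UN_I) auto
  ultimately show ?thesis by (rule finite_subset)
qed

lemma bdry_inj: "inj_on (\<lambda>(x, z). {x, z}) (bdry S)" by (auto simp: inj_on_def bdry_def doubleton_eq_iff)

lemma bdry_V: "(x, z) \<in> bdry S \<Longrightarrow> x \<in> V \<and> z \<in> V" using edge_sub(3) by (auto simp: bdry_def)

text \<open>Cut at the first exit from \<open>S\<close>: the initial piece uses only edges inside
  \<open>S\<close>, the exit edge is independent of it, and the remainder is edge-disjoint from
  both.\<close>

lemma simon_lieb: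
  assumes F: "finite F" "F \<subseteq> E" and p: "0 \<le> p" "p \<le> 1" and S: "finite S" "S \<subseteq> V" and v: "v \<in> S"
  shows "tau p F v y \<le> of_bool (y \<in> S) +
    (\<Sum>(x, z)\<in>bdry S. p * tau p (inE S) v x * tau p F z y)"
proof (cases "y \<in> S")
  case True
  have "0 \<le> (\<Sum>(x, z)\<in>bdry S. p * tau p (inE S) v x * tau p F z y)" using p by (intro sum_nonneg) auto
  then show ?thesis using True Pr_le_1[OF F(1) p, of "\<lambda>\<xi>. conn \<xi> v y"] by (simp add: case_prod_beta')
next
  case False
  define B where "B = (\<lambda>(x, z). djoint (\<lambda>I J. (conn (I \<inter> inE S) v x \<and> {x, z} \<in> I) \<and> conn J z y))"
  have "tau p F v y \<le> (\<Sum>xz\<in>bdry S. Pr p F (B xz))"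
  proof (rule Pr_Bex_le[OF p finite_bdry[OF S]])
    fix \<xi> assume om: "\<xi> \<subseteq> F" "conn \<xi> v y"
    then obtain xs where s: "spath \<xi> v y xs" by (meson conn_spath)
    have "\<exists>u\<in>set xs. u \<notin> S" using spath_in(2)[OF s] False by blast
    from split_list_first_prop[OF this] obtain as z bs where xs: "xs = as @ z # bs" "z \<notin> S" "\<forall>u\<in>set as. u \<in> S" by blast
    have "as \<noteq> []" using s xs v by (auto simp: spath_def)
    then obtain cs x where as: "as = cs @ [x]" by (metis rev_exhaust)
    have pe: "path_edges (as @ [z]) = path_edges as \<union> {{x, z}}"
      unfolding as using path_edges_append[of cs x "[z]"] by simp
    have sub: "path_edges xs = path_edges (as @ [z]) \<union> path_edges (z # bs)" unfolding xs by (rule path_edges_append)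
    have w: "path_edges xs \<subseteq> \<xi>" "hd xs = v" "last xs = y" "distinct xs" using s by (auto simp: spath_def)
    have "path_edges as \<subseteq> inE S"
    proof
      fix e assume e: "e \<in> path_edges as"
      then have "e \<subseteq> S" using path_edges_subset_set[OF e] xs(3) by blast
      moreover have "e \<in> E" using e pe sub w om F by auto
      ultimately show "e \<in> inE S" by (simp add: inE_def)
    qed
    then have "conn ((path_edges as \<union> {{x, z}}) \<inter> inE S) v x"
      using conn_path[of as "(path_edges as \<union> {{x, z}}) \<inter> inE S"] w(2) by (cases cs) (auto simp: xs as)
    moreover have "conn (path_edges (z # bs)) z y"
      using conn_path[of "z # bs" "path_edges (z # bs)"] w(3) by (simp add: xs)
    moreover have "path_edges (as @ [z]) \<inter> path_edges (z # bs) = {}" by (rule spath_split(3)) (use s xs in auto)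
    ultimately have "B (x, z) \<xi>" unfolding B_def djoint_def prod.case using sub w(1) unfolding pe
      by (intro exI[of _ "path_edges as \<union> {{x, z}}"] exI[of _ "path_edges (z # bs)"]) auto
    moreover have "{x, z} \<in> E" using pe sub w(1) om(1) F(2) by auto
    then have "(x, z) \<in> bdry S" using xs as by (simp add: bdry_def)
    ultimately show "\<exists>xz\<in>bdry S. B xz \<xi>" by blast
  qed
  also have "\<dots> \<le> (\<Sum>(x, z)\<in>bdry S. p * tau p (inE S) v x * tau p F z y)"
  proof (rule sum_mono)
    fix xz assume "xz \<in> bdry S"
    then obtain x z where xz: "xz = (x, z)" "x \<in> S" "z \<notin> S" "{x, z} \<in> E" by (auto simp: bdry_def)
    let ?A = "\<lambda>\<xi>. conn (\<xi> \<inter> inE S) v x \<and> {x, z} \<in> \<xi>"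
    let ?F = "F \<union> inE S \<union> {{x, z}}"
    have fF: "finite ?F" using F finite_inE[OF S] by simp
    have e: "{x, z} \<notin> inE S" using xz by (simp add: inE_def)
    have iA: "incr ?A"
    proof (rule incrI)
      fix \<xi> \<xi>' :: "'v set set" assume o: "\<xi> \<subseteq> \<xi>'" "conn (\<xi> \<inter> inE S) v x \<and> {x, z} \<in> \<xi>"
      then have "conn (\<xi>' \<inter> inE S) v x" using conn_mono[of "\<xi> \<inter> inE S" v x "\<xi>' \<inter> inE S"] by blast
      then show "conn (\<xi>' \<inter> inE S) v x \<and> {x, z} \<in> \<xi>'" using o by auto
    qed
    have "Pr p F ?A \<le> Pr p ?F ?A" using fF by (intro Pr_mono_set p iA) auto
    also have "\<dots> = Ex p ?F (\<lambda>\<xi>. of_bool (conn (\<xi> \<inter> inE S) v x) * of_bool ({{x, z}} \<subseteq> \<xi>))" by (intro Ex_cong) simp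
    also have "\<dots> = tauR p ?F (inE S) v x * Pr p ?F (\<lambda>\<xi>. {{x, z}} \<subseteq> \<xi>)"
      by (rule Ex_indep[OF fF, of "inE S" "{{x, z}}"]) (use e in auto)
    also have "tauR p ?F (inE S) v x = tau p (inE S) v x" by (rule Ex_restrict[OF fF]) auto
    also have "Pr p ?F (\<lambda>\<xi>. {{x, z}} \<subseteq> \<xi>) = p" using Pr_superset[OF fF, of "{{x, z}}" p] by simp
    finally have 1: "Pr p F ?A \<le> p * tau p (inE S) v x" by (simp add: mult.commute)
    have "Pr p F (B xz) \<le> Pr p F ?A * tau p F z y"
      unfolding B_def xz(1) prod.case by (rule BK[OF F(1) p iA incr_conn(2)])
    also have "\<dots> \<le> p * tau p (inE S) v x * tau p F z y" using p by (intro mult_right_mono 1) auto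
    finally show "Pr p F (B xz) \<le> (case xz of (x, z) \<Rightarrow> p * tau p (inE S) v x * tau p F z y)" by (simp add: xz(1))
  qed
  finally show ?thesis using False by simp
qed

text \<open>Summing the Simon--Lieb inequality shows that the maximal sum \<open>m\<close> over
  starting vertices satisfies \<open>m \<le> M + m / 2\<close>, unless it is 1.\<close>

lemma SL_sum:
  assumes p: "0 \<le> p" "p \<le> 1"
    and S: "\<And>v. v \<in> V \<Longrightarrow> \<exists>S. finite S \<and> S \<subseteq> V \<and> v \<in> S \<and> phi p lm v S \<le> 1 / 2 \<and> (\<Sum>x\<in>S. exp (lm * (h x - h v))) \<le> M"
    and F: "finite F" "F \<subseteq> E" and A: "finite A" "A \<subseteq> V" and x: "x \<in> V"
  shows "(\<Sum>y\<in>A. tau p F x y * exp (lm * (h y - h x))) \<le> 2 * M"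
proof -
  define w where "w = (\<lambda>a b. exp (lm * (h b - h a)))"
  have w: "w a c = w a b * w b c" "0 \<le> w a b" "w a a = 1" for a b c
    unfolding w_def exp_add[symmetric] by (simp_all add: right_diff_distrib)
  define G where "G = (\<lambda>v. \<Sum>y\<in>A. tau p F v y * w v y)"
  \<comment> \<open>A maximum over the vertices of a finite edge set; every other start is isolated
    and contributes at most 1.\<close>
  define m where "m = Max (insert 1 (G ` (\<Union>F)))"
  have fU: "finite (\<Union>F)" "\<Union>F \<subseteq> V" by (rule finite_verts[OF F], rule verts_V[OF F(2)])
  have Gm: "G v \<le> m" for v
  proof (cases "v \<in> \<Union>F")
    case True
    then show ?thesis unfolding m_def using fU by (intro Max_ge) auto
  next
    case False
    have "tau p F v y = of_bool (y = v)" for y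
    proof -
      have "conn \<xi> v y \<longleftrightarrow> y = v" if "\<xi> \<subseteq> F" for \<xi> using conn_Union[of \<xi> y v] conn_commute[of \<xi> v y] False that by auto
      then have "tau p F v y = Ex p F (\<lambda>_. of_bool (y = v))" by (intro Ex_cong) simp
      then show ?thesis using F(1) by simp
    qed
    then have "G v = (\<Sum>y\<in>A. if y = v then 1 else 0)" unfolding G_def using w(3) by (intro sum.cong) auto
    also have "\<dots> \<le> 1" using A(1) by simp
    also have "1 \<le> m" unfolding m_def using fU by (intro Max_ge) auto
    finally show ?thesis .
  qed
  have step: "G v \<le> M + 1 / 2 * m" if v: "v \<in> V" for v
  proof -
    obtain S where S: "finite S" "S \<subseteq> V" "v \<in> S" "phi p lm v S \<le> 1 / 2" "(\<Sum>x\<in>S. exp (lm * (h x - h v))) \<le> M"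
      using S[OF v] by blast
    have "G v \<le> (\<Sum>y\<in>A. (of_bool (y \<in> S) +
        (\<Sum>(x, z)\<in>bdry S. p * tau p (inE S) v x * tau p F z y)) * w v y)"
      unfolding G_def using w by (intro sum_mono mult_right_mono simon_lieb F p S) auto
    also have "\<dots> = (\<Sum>y\<in>A. of_bool (y \<in> S) * w v y) +
        (\<Sum>y\<in>A. \<Sum>(x, z)\<in>bdry S. p * tau p (inE S) v x * w v z * (tau p F z y * w z y))"
      unfolding distrib_right sum.distrib sum_distrib_right
      by (intro arg_cong2[where f = "(+)"] refl sum.cong) (auto simp: w(1)[of v _ z for z])
    also have "(\<Sum>y\<in>A. \<Sum>(x, z)\<in>bdry S. p * tau p (inE S) v x * w v z * (tau p F z y * w z y)) =
      (\<Sum>(x, z)\<in>bdry S. p * tau p (inE S) v x * w v z * G z)"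
      unfolding G_def sum_distrib_left case_prod_beta' by (rule sum.swap)
    also have "\<dots> \<le> (\<Sum>(x, z)\<in>bdry S. p * tau p (inE S) v x * w v z * m)"
      unfolding case_prod_beta' using p w by (intro sum_mono mult_left_mono Gm) auto
    also have "\<dots> = phi p lm v S * m" unfolding phi_def w_def sum_distrib_right case_prod_beta' ..
    also have "\<dots> \<le> 1 / 2 * m"
    proof (rule mult_right_mono[OF S(4)])
      have "1 \<le> m" unfolding m_def using fU by (intro Max_ge) auto
      then show "0 \<le> m" by simp
    qed
    also have "(\<Sum>y\<in>A. of_bool (y \<in> S) * w v y) = (\<Sum>y\<in>A \<inter> S. w v y)"
      using A(1) by (intro sum.mono_neutral_cong_right) auto
    also have "\<dots> \<le> (\<Sum>y\<in>S. w v y)" using S w by (intro sum_mono2) auto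
    finally show ?thesis using S(5) unfolding w_def by linarith
  qed
  have M1: "1 \<le> M"
  proof -
    obtain S where S: "finite S" "S \<subseteq> V" "x \<in> S" "(\<Sum>y\<in>S. exp (lm * (h y - h x))) \<le> M" using S[OF x] by blast
    have "exp (lm * (h x - h x)) \<le> (\<Sum>y\<in>S. exp (lm * (h y - h x)))" using S by (intro member_le_sum) auto
    then show ?thesis using S(4) by simp
  qed
  have "m \<in> insert 1 (G ` (\<Union>F))" unfolding m_def using fU by (intro Max_in) auto
  then have "m \<le> 2 * M"
  proof
    assume "m \<in> G ` (\<Union>F)"
    then obtain v where v: "v \<in> \<Union>F" "m = G v" by blast
    have "v \<in> V" using v(1) fU(2) by blast
    from step[OF this] show ?thesis unfolding v(2)[symmetric] by simp
  qed (use M1 in simp)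
  then show ?thesis using Gm[of x] unfolding G_def w_def by linarith
qed

lemma inE_aut:
  assumes b: "\<beta> \<in> \<Gamma>" and S: "S \<subseteq> V"
  shows "inE (\<beta> ` S) = (`) \<beta> ` inE S"
proof (intro equalityI subsetI)
  fix e assume e: "e \<in> inE (\<beta> ` S)"
  then obtain e' where e': "e' \<in> E" "e = \<beta> ` e'" using aut_edges_onto[OF b, of e] by (auto simp: inE_def)
  have inj: "inj_on \<beta> V" using aut(1)[OF b] by (simp add: bij_betw_def)
  have "e' \<subseteq> S" using e e' edge_sub(1)[OF e'(1)] S inj inj_on_image_subset_iff[of \<beta> V e' S] by (auto simp: inE_def)
  with e' show "e \<in> (`) \<beta> ` inE S" by (auto simp: inE_def)
next
  fix e assume "e \<in> (`) \<beta> ` inE S"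
  then show "e \<in> inE (\<beta> ` S)" using aut_edges[OF b inE_E[of S]] by (auto simp: inE_def)
qed

lemma bdry_aut:
  assumes b: "\<beta> \<in> \<Gamma>" and S: "S \<subseteq> V"
  shows "bdry (\<beta> ` S) = map_prod \<beta> \<beta> ` bdry S"
proof -
  have inj: "inj_on \<beta> V" and on: "\<beta> ` V = V" using aut(1)[OF b] by (auto simp: bij_betw_def)
  have E: "{\<beta> x, \<beta> z} \<in> E \<longleftrightarrow> {x, z} \<in> E" if "x \<in> V" "z \<in> V" for x z using aut(2)[OF b, of "{x, z}"] that by simp
  have nS: "\<beta> z \<in> \<beta> ` S \<longleftrightarrow> z \<in> S" if "z \<in> V" for z using inj S that by (auto simp: inj_on_def)
  show ?thesis
  proof (intro equalityI subsetI)
    fix q assume "q \<in> bdry (\<beta> ` S)"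
    then obtain x z where q: "q = (\<beta> x, z)" "x \<in> S" "z \<notin> \<beta> ` S" "{\<beta> x, z} \<in> E" by (auto simp: bdry_def)
    then have "z \<in> V" using edge_sub(3) by blast
    then obtain z' where z: "z' \<in> V" "z = \<beta> z'" using on by blast
    have "(x, z') \<in> bdry S" using q z E[of x z'] S by (auto simp: bdry_def)
    then show "q \<in> map_prod \<beta> \<beta> ` bdry S" using q z by force
  next
    fix q assume "q \<in> map_prod \<beta> \<beta> ` bdry S"
    then obtain x z where q: "q = (\<beta> x, \<beta> z)" "(x, z) \<in> bdry S" by auto
    then show "q \<in> bdry (\<beta> ` S)" using bdry_V[OF q(2)] E[of x z] nS[of z] by (auto simp: bdry_def)
  qed
qed

lemma phi_aut:
  assumes b: "\<beta> \<in> \<Gamma>" and S: "finite S" "S \<subseteq> V" and v: "v \<in> V"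
  shows "phi p lm (\<beta> v) (\<beta> ` S) = phi p lm v S"
proof -
  have inj: "inj_on \<beta> V" using aut(1)[OF b] by (simp add: bij_betw_def)
  have inj2: "inj_on (map_prod \<beta> \<beta>) (bdry S)"
    by (rule inj_on_subset[OF map_prod_inj_on[OF inj inj]]) (use bdry_V in auto)
  show ?thesis unfolding phi_def bdry_aut[OF b S(2)] sum.reindex[OF inj2] inE_aut[OF b S(2)]
  proof (intro sum.cong refl)
    fix xz assume xz: "xz \<in> bdry S"
    obtain x z where e: "xz = (x, z)" by fastforce
    have V: "x \<in> V" "z \<in> V" using xz e bdry_V by auto
    show "((\<lambda>(x, z). p * Pr p ((`) \<beta> ` inE S) (\<lambda>\<xi>. conn \<xi> (\<beta> v) x) * exp (lm * (h z - h (\<beta> v)))) \<circ> map_prod \<beta> \<beta>) xz =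
      (case xz of (x, z) \<Rightarrow> p * tau p (inE S) v x * exp (lm * (h z - h v)))"
      using Pr_conn_aut'[OF b inE_E finite_inE[OF S] v V(1), of p] h_shift[OF b V(2) v] by (simp add: e)
  qed
qed

lemma SL:
  assumes p: "0 \<le> p" "p \<le> 1" and S: "\<And>v. v \<in> Reps \<Longrightarrow> \<exists>S. finite S \<and> S \<subseteq> V \<and> v \<in> S \<and> phi p lm v S \<le> 1 / 2"
  shows "\<exists>Y. \<forall>F A x. finite F \<longrightarrow> F \<subseteq> E \<longrightarrow> finite A \<longrightarrow> A \<subseteq> V \<longrightarrow> x \<in> V \<longrightarrow>
    (\<Sum>y\<in>A. tau p F x y * exp (lm * (h y - h x))) \<le> Y"
proof -
  from S have "\<forall>v\<in>Reps. \<exists>S. finite S \<and> S \<subseteq> V \<and> v \<in> S \<and> phi p lm v S \<le> 1 / 2" by blast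
  from bchoice[OF this] obtain S where S: "\<forall>v\<in>Reps. finite (S v) \<and> S v \<subseteq> V \<and> v \<in> S v \<and> phi p lm v (S v) \<le> 1 / 2" ..
  define M where "M = (\<Sum>v\<in>Reps. \<Sum>x\<in>S v. exp (lm * (h x - h v)))"
  have M: "(\<Sum>x\<in>S v. exp (lm * (h x - h v))) \<le> M" if "v \<in> Reps" for v
    unfolding M_def using that Reps(1) by (intro member_le_sum sum_nonneg) auto
  have "\<exists>T. finite T \<and> T \<subseteq> V \<and> u \<in> T \<and> phi p lm u T \<le> 1 / 2 \<and> (\<Sum>x\<in>T. exp (lm * (h x - h u))) \<le> M" if u: "u \<in> V" for u
  proof -
    obtain v \<beta> where v: "v \<in> Reps" "\<beta> \<in> \<Gamma>" "\<beta> v = u" using Reps(3)[OF u] by blast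
    have vV: "v \<in> V" using v(1) Reps(2) by blast
    have Sv: "finite (S v)" "S v \<subseteq> V" "v \<in> S v" "phi p lm v (S v) \<le> 1 / 2" using S v(1) by auto
    have inj: "inj_on \<beta> (S v)" using aut(1)[OF v(2)] Sv(2) by (auto simp: bij_betw_def intro: inj_on_subset)
    have "(\<Sum>x\<in>\<beta> ` S v. exp (lm * (h x - h u))) = (\<Sum>x\<in>S v. exp (lm * (h x - h v)))"
      unfolding sum.reindex[OF inj] o_def v(3)[symmetric]
      using h_shift[OF v(2) _ vV] Sv(2) by (intro sum.cong refl) (simp add: subset_iff)
    then show ?thesis using Sv M[OF v(1)] phi_aut[OF v(2) Sv(1,2) vV, of p lm] v(3) aut_V[OF v(2)]
      by (intro exI[of _ "\<beta> ` S v"]) auto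
  qed
  then have "(\<Sum>y\<in>A. tau p F x y * exp (lm * (h y - h x))) \<le> 2 * M"
    if "finite F" "F \<subseteq> E" "finite A" "A \<subseteq> V" "x \<in> V" for F A x using that by (intro SL_sum[OF p]) auto
  then show ?thesis by blast
qed

lemma chi_SL:
  assumes p: "0 \<le> p" "p \<le> 1" and S: "\<And>v. v \<in> Reps \<Longrightarrow> \<exists>S. finite S \<and> S \<subseteq> V \<and> v \<in> S \<and> phi p 0 v S \<le> 1 / 2"
  shows "\<exists>Y. chi p Y" using SL[OF assms] by (simp add: chi_def)

lemma XX_SL:
  assumes p: "0 \<le> p" "p \<le> 1" and S: "\<And>v. v \<in> Reps \<Longrightarrow> \<exists>S. finite S \<and> S \<subseteq> V \<and> v \<in> S \<and> phi p (1 / 2) v S \<le> 1 / 2"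
  shows "\<exists>Y. XX p Y" using SL[OF assms] by (simp add: XX_def)

text \<open>A singleton has at most \<open>dg\<close> boundary edges, each of weight at most
  \<open>p\<close>. This will make the critical point positive.\<close>

lemma chi_small:
  fixes p :: real
  assumes p: "0 \<le> p" "p \<le> 1" "p * dg \<le> 1 / 2"
  shows "\<exists>Y. chi p Y"
proof (rule chi_SL[OF p(1,2)])
  fix v assume "v \<in> Reps"
  then have v: "v \<in> V" using Reps(2) by blast
  have "card (bdry {v}) = card ((\<lambda>(x, z). {x, z}) ` bdry {v})" by (rule card_image[OF bdry_inj, symmetric])
  also have "\<dots> \<le> card {e \<in> E. v \<in> e}" by (rule card_mono[OF fin_deg[OF v]]) (auto simp: bdry_def)
  also have "\<dots> \<le> dg" by (rule deg[OF v])
  finally have c: "card (bdry {v}) \<le> dg" .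
  have "phi p 0 v {v} \<le> (\<Sum>xz\<in>bdry {v}. p)" unfolding phi_def
  proof (rule sum_mono)
    fix xz assume "xz \<in> bdry {v}"
    have "p * Pr p (inE {v}) A \<le> p * 1" for A using p v finite_inE[of "{v}"] by (intro mult_left_mono Pr_le_1) auto
    then show "(case xz of (x, z) \<Rightarrow> p * tau p (inE {v}) v x * exp (0 * (h z - h v))) \<le> p" by (auto split: prod.split)
  qed
  also have "\<dots> \<le> dg * p" using c p by (simp add: mult_right_mono)
  finally have "phi p 0 v {v} \<le> 1 / 2" using p(3) by (simp add: mult.commute)
  then show "\<exists>S. finite S \<and> S \<subseteq> V \<and> v \<in> S \<and> phi p 0 v S \<le> 1 / 2" using v by (intro exI[of _ "{v}"]) auto
qed

lemma chi_mono_p: "chi p Y \<Longrightarrow> 0 \<le> q \<Longrightarrow> q \<le> p \<Longrightarrow> p \<le> 1 \<Longrightarrow> chi q Y"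
proof -
  assume c: "chi p Y" and q: "0 \<le> q" "q \<le> p" "p \<le> 1"
  show "chi q Y" unfolding chi_def
  proof (intro allI impI)
    fix F A x assume a: "finite F" "F \<subseteq> E" "finite A" "A \<subseteq> V" "x \<in> V"
    have "(\<Sum>y\<in>A. tau q F x y) \<le> (\<Sum>y\<in>A. tau p F x y)"
      using q a by (intro sum_mono Ex_mono_p mono_of_bool_incr incr_conn) auto
    also have "\<dots> \<le> Y" using c a unfolding chi_def by blast
    finally show "(\<Sum>y\<in>A. tau q F x y) \<le> Y" .
  qed
qed

lemma phi_mono_p:
  assumes "0 \<le> q" "q \<le> p" "p \<le> 1" "finite S" "S \<subseteq> V"
  shows "phi q lm v S \<le> phi p lm v S" unfolding phi_def case_prod_beta' using assms finite_inE[of S]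
  by (intro sum_mono mult_right_mono mult_mono Ex_mono_p mono_of_bool_incr incr_conn) auto

text \<open>Repeated climbs visit infinitely many heights. On such vertices the weight in
  \<open>XX\<close> is at least 1, so a two-point function bounded below on them contradicts any
  bound \<open>Y\<close>.\<close>

lemma many_up: "\<exists>A\<subseteq>Orb. finite A \<and> card A = n \<and> (\<forall>y\<in>A. h rt \<le> h y)"
proof -
  have "\<exists>y\<in>Orb. h y = h rt + k * g" for k :: nat
  proof (induction k)
    case 0
    then show ?case using rt by auto
  next
    case (Suc k)
    then obtain y where "y \<in> Orb" "h y = h rt + k * g" by blast
    moreover from climb_at[OF this(1)] obtain z where "z \<in> Orb" "h z = h y + g" by blast
    ultimately show ?case by (intro bexI[of _ z]) (auto simp: algebra_simps)
  qed
  then have "\<forall>k::nat. \<exists>y. y \<in> Orb \<and> h y = h rt + k * g" by blast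
  from choice[OF this] obtain y :: "nat \<Rightarrow> 'v" where y: "\<forall>k. y k \<in> Orb \<and> h (y k) = h rt + k * g" ..
  have inj: "inj y"
  proof (rule injI)
    fix a b assume "y a = y b"
    then have "real a * g = real b * g" using y by (metis add_left_cancel)
    then show "a = b" using g by simp
  qed
  have "card (y ` {..<n}) = n" using card_image[OF inj_on_subset[OF inj], of "{..<n}"] by simp
  then show ?thesis using y g by (intro exI[of _ "y ` {..<n}"]) auto
qed

lemma XX_less_1:
  assumes "XX p Y" "p \<le> 1"
  shows "p < 1"
proof (rule ccontr)
  assume "\<not> p < 1"
  then have p: "p = 1" using assms(2) by simp
  obtain n :: nat where n: "Y < n" using reals_Archimedean2 by blast
  obtain A where A: "A \<subseteq> Orb" "finite A" "card A = n" "\<forall>y\<in>A. h rt \<le> h y" using many_up by blast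
  have "\<forall>y\<in>A. \<exists>C. C \<subseteq> E \<and> finite C \<and> conn C rt y"
  proof
    fix y assume "y \<in> A"
    then have "conn E rt y" using connected rt_V A Orb_sub by blast
    then obtain xs where xs: "spath E rt y xs" by (meson conn_spath)
    then show "\<exists>C. C \<subseteq> E \<and> finite C \<and> conn C rt y"
      using spath_conn[OF spath_sub[OF xs]] by (intro exI[of _ "path_edges xs"]) (auto simp: spath_def)
  qed
  from bchoice[OF this] obtain C where C: "\<forall>y\<in>A. C y \<subseteq> E \<and> finite (C y) \<and> conn (C y) rt y" ..
  define F where "F = (\<Union>y\<in>A. C y)"
  have F: "finite F" "F \<subseteq> E" using A(2) C by (auto simp: F_def)
  have "real n = (\<Sum>y\<in>A. 1)" using A(3) by simp
  also have "\<dots> \<le> (\<Sum>y\<in>A. tau p F rt y * exp ((h y - h rt) / 2))"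
  proof (rule sum_mono)
    fix y assume y: "y \<in> A"
    have "1 = Pr p F (\<lambda>\<xi>. F \<subseteq> \<xi>)" using Pr_superset[OF F(1) order_refl, of p] p by simp
    also have "\<dots> \<le> tau p F rt y"
    proof (rule Pr_mono)
      fix \<xi> assume "F \<subseteq> \<xi>"
      then have "C y \<subseteq> \<xi>" using y by (auto simp: F_def)
      then show "conn \<xi> rt y" using conn_mono[of "C y" rt y \<xi>] C y by simp
    qed (use p in auto)
    finally have "1 \<le> tau p F rt y" .
    moreover have "1 \<le> exp ((h y - h rt) / 2)" using A(4) y by simp
    ultimately show "1 \<le> tau p F rt y * exp ((h y - h rt) / 2)"
      using mult_mono[of 1 "tau p F rt y" 1 "exp ((h y - h rt) / 2)"] by simp
  qed
  also have "\<dots> \<le> Y" using A Orb_sub by (intro XX_D[OF assms(1) F] rt_V) auto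
  finally show False using n by simp
qed

end

text \<open>A stand-in for an infinite cluster that is witnessed by finitely many edges; letting
  \<open>B\<close> run through the balls around \<open>z\<close> recovers the infinite cluster, see
  \<open>infcl_iff\<close>.\<close>

definition out :: "'v set \<Rightarrow> 'v set set \<Rightarrow> 'v \<Rightarrow> bool" where
  "out B \<xi> z \<longleftrightarrow> (\<exists>u. u \<notin> B \<and> conn \<xi> z u)"

lemma incr_out: "incr (\<lambda>\<xi>. out B \<xi> z)"
proof (rule incrI)
  fix \<xi> \<xi>' assume "\<xi> \<subseteq> \<xi>'" "out B \<xi> z"
  then obtain u where "u \<notin> B" "conn \<xi>' z u" unfolding out_def using conn_mono[of \<xi> z _ \<xi>'] by blast
  then show "out B \<xi>' z" by (auto simp: out_def)
qed

section \<open>Openness, and the differential inequality of Duminil-Copin and Tassion\<close>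

context tilted
begin

text \<open>Balls of different radii have disjoint boundaries, so the values of \<open>phi\<close>
  over \<open>N\<close> balls add up to at most a multiple of the weighted two-point sum. For large
  \<open>N\<close> they cannot all exceed 1/4.\<close>

lemma small_phi_ball:
  assumes X: "XX p Y" and p: "0 \<le> p" "p \<le> 1" and v: "v \<in> V"
  shows "\<exists>n. phi p (1 / 2) v (nb E n v) \<le> 1 / 4"
proof (rule ccontr)
  assume "\<not> ?thesis"
  then have big: "1 / 4 < phi p (1 / 2) v (nb E n v)" for n by (simp add: not_le)
  define B where "B = (\<lambda>n. nb E n v)"
  have B: "finite (B n)" "B n \<subseteq> V" for n using finite_nb nb_V v by (auto simp: B_def)
  define K where "K = exp (t0 / 2) * real (dg + 1) * Y"
  obtain N :: nat where N: "4 * K < N" using reals_Archimedean2 by blast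
  define F where "F = inE (B N)"
  have F: "finite F" "F \<subseteq> E" using finite_inE[OF B] inE_E by (auto simp: F_def)
  define w where "w = (\<lambda>x. tau p F v x * exp ((h x - h v) / 2))"
  have w0: "0 \<le> w x" for x using p by (simp add: w_def)
  have fb: "finite (bdry (B n))" for n using finite_bdry B by blast
  have le: "phi p (1 / 2) v (B n) \<le> (\<Sum>(x, z)\<in>bdry (B n). w x * exp (t0 / 2))" if n: "n < N" for n unfolding phi_def
  proof (rule sum_mono)
    fix xz assume xz: "xz \<in> bdry (B n)"
    obtain x z where e: "xz = (x, z)" by fastforce
    have sub: "inE (B n) \<subseteq> F" using nb_mono[of n N E v] n by (auto simp: F_def B_def inE_def)
    have 1: "p * Pr p (inE (B n)) (\<lambda>\<xi>. conn \<xi> v x) \<le> 1 * tau p F v x"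
      using p sub F by (intro mult_mono Pr_mono_set incr_conn) auto
    have "{x, z} \<in> E" using xz e by (simp add: bdry_def)
    then have "1 / 2 * (h z - h v) \<le> (h x - h v) / 2 + t0 / 2" using lip[of x z] by (simp add: abs_le_iff field_simps)
    then have 2: "exp (1 / 2 * (h z - h v)) \<le> exp ((h x - h v) / 2) * exp (t0 / 2)"
      unfolding exp_add[symmetric] by (subst exp_le_cancel_iff)
    have "p * Pr p (inE (B n)) (\<lambda>\<xi>. conn \<xi> v x) * exp (1 / 2 * (h z - h v)) \<le>
      1 * tau p F v x * (exp ((h x - h v) / 2) * exp (t0 / 2))"
      by (rule mult_mono[OF 1 2]) (use p F in auto)
    then show "(case xz of (x, z) \<Rightarrow> p * Pr p (inE (B n)) (\<lambda>\<xi>. conn \<xi> v x) * exp (1 / 2 * (h z - h v))) \<le>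
      (case xz of (x, z) \<Rightarrow> w x * exp (t0 / 2))" by (simp add: e w_def)
  qed
  have disj: "bdry (B m) \<inter> bdry (B n) = {}" if "m < n" for m n
  proof -
    have False if "(x, z) \<in> bdry (B m)" "(x, z) \<in> bdry (B n)" for x z
    proof -
      have "x \<in> nb E m v" "{x, z} \<in> E" "z \<notin> nb E n v" using that by (auto simp: bdry_def B_def)
      then have "z \<in> nb E (m + 1) v" using nb_trans[of x E m v z 1] nb_edge[of x z E] by blast
      then show False using nb_mono[of "m + 1" n E v] \<open>m < n\<close> \<open>z \<notin> nb E n v\<close> by auto
    qed
    then show ?thesis by auto
  qed
  have dj: "bdry (B i) \<inter> bdry (B j) = {}" if "i \<noteq> j" for i j
    using disj[of i j] disj[of j i] that by (cases "i < j") auto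
  have fnb: "finite (nb E 1 x)" if "x \<in> B N" for x by (rule finite_nb) (use that B in blast)
  have "N / 4 = (\<Sum>n<N. 1 / 4)" by simp
  also have "\<dots> \<le> (\<Sum>n<N. phi p (1 / 2) v (B n))" using big by (intro sum_mono) (auto simp: B_def less_imp_le)
  also have "\<dots> \<le> (\<Sum>n<N. \<Sum>(x, z)\<in>bdry (B n). w x * exp (t0 / 2))" using le by (intro sum_mono) auto
  also have "\<dots> = (\<Sum>(x, z)\<in>(\<Union>n<N. bdry (B n)). w x * exp (t0 / 2))"
    by (rule sum.UNION_disjoint[symmetric]) (use fb dj in auto)
  also have "\<dots> \<le> (\<Sum>(x, z)\<in>(SIGMA x:B N. nb E 1 x). w x * exp (t0 / 2))"
  proof (rule sum_mono2)
    show "finite (SIGMA x:B N. nb E 1 x)" using B fnb by (intro finite_SigmaI) auto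
    show "(\<Union>n<N. bdry (B n)) \<subseteq> (SIGMA x:B N. nb E 1 x)"
    proof
      fix q assume "q \<in> (\<Union>n<N. bdry (B n))"
      then obtain n x z where q: "n < N" "q = (x, z)" "x \<in> B n" "{x, z} \<in> E" by (auto simp: bdry_def)
      then show "q \<in> (SIGMA x:B N. nb E 1 x)" using nb_mono[of n N E v] nb_edge[OF q(4)] by (auto simp: B_def)
    qed
  qed (use w0 in auto)
  also have "\<dots> = (\<Sum>x\<in>B N. real (card (nb E 1 x)) * (w x * exp (t0 / 2)))"
    using B fnb by (subst sum.Sigma[symmetric]) auto
  also have "\<dots> \<le> (\<Sum>x\<in>B N. real (dg + 1) * (w x * exp (t0 / 2)))"
  proof (intro sum_mono mult_right_mono)
    fix x assume "x \<in> B N"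
    then have "x \<in> V" using B by blast
    then show "real (card (nb E 1 x)) \<le> real (dg + 1)" using card_nb[of x 1] by simp
  qed (use w0 in auto)
  also have "\<dots> = exp (t0 / 2) * real (dg + 1) * (\<Sum>x\<in>B N. w x)" unfolding sum_distrib_left by (intro sum.cong) auto
  also have "\<dots> \<le> K" unfolding K_def w_def by (intro mult_left_mono XX_D[OF X F B v]) auto
  finally show False using N by simp
qed

text \<open>For a fixed finite set \<open>phi\<close> is continuous in p, and only finitely many
  representatives matter; the gap between 1/4 and 1/2 leaves room to increase p.\<close>

lemma openness:
  assumes X: "XX p Y" and p: "0 \<le> p" "p \<le> 1"
  shows "\<exists>p1>p. p1 \<le> 1 \<and> (\<exists>Y. XX p1 Y)"
proof -
  have p1: "p < 1" using XX_less_1[OF X p(2)] .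
  have "\<forall>v\<in>Reps. \<exists>n. phi p (1 / 2) v (nb E n v) \<le> 1 / 4" using small_phi_ball[OF X p] Reps(2) by blast
  from bchoice[OF this] obtain n where n: "\<forall>v\<in>Reps. phi p (1 / 2) v (nb E (n v) v) \<le> 1 / 4" ..
  have ev: "\<forall>\<^sub>F q in at_right p. phi q (1 / 2) v (nb E (n v) v) < 1 / 2" if v: "v \<in> Reps" for v
  proof -
    have "continuous_on UNIV (\<lambda>q. phi q (1 / 2) v (nb E (n v) v))"
      unfolding phi_def case_prod_beta' by (intro continuous_intros continuous_Ex)
    then have "((\<lambda>q. phi q (1 / 2) v (nb E (n v) v)) \<longlongrightarrow> phi p (1 / 2) v (nb E (n v) v)) (at p)"
      by (simp add: continuous_on_eq_continuous_at isCont_def)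
    then have "((\<lambda>q. phi q (1 / 2) v (nb E (n v) v)) \<longlongrightarrow> phi p (1 / 2) v (nb E (n v) v)) (at_right p)"
      by (rule filterlim_mono) (auto simp: at_le)
    moreover have "phi p (1 / 2) v (nb E (n v) v) < 1 / 2" using n v by fastforce
    ultimately show ?thesis by (rule order_tendstoD(2))
  qed
  have "\<forall>\<^sub>F q in at_right p. \<forall>v\<in>Reps. phi q (1 / 2) v (nb E (n v) v) < 1 / 2"
    using ev Reps(1) by (simp add: eventually_ball_finite)
  then obtain b where b: "b > p" "\<And>q. p < q \<Longrightarrow> q < b \<Longrightarrow> \<forall>v\<in>Reps. phi q (1 / 2) v (nb E (n v) v) < 1 / 2"
    unfolding eventually_at_right[OF p1] by blast
  define q where "q = (p + min b 1) / 2"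
  have q: "p < q" "q < b" "q < 1" using b(1) p1 by (auto simp: q_def min_def)
  have "\<exists>Y. XX q Y"
  proof (rule XX_SL)
    fix v assume v: "v \<in> Reps"
    then have "v \<in> V" using Reps(2) by blast
    then show "\<exists>S. finite S \<and> S \<subseteq> V \<and> v \<in> S \<and> phi q (1 / 2) v S \<le> 1 / 2"
      using b(2)[OF q(1,2)] v finite_nb nb_V nb_refl by (intro exI[of _ "nb E (n v) v"]) (auto simp: less_imp_le)
  qed (use p q in auto)
  then show ?thesis using q by (intro exI[of _ q]) auto
qed

text \<open>Stop the path from \<open>u\<close> when it first meets \<open>S\<close>; until then it
  has used no edge inside \<open>S\<close>.\<close>

lemma conn_outside:
  assumes "conn \<xi> u y"
  shows "conn (\<xi> - inE S) u y \<or> (\<exists>x\<in>S. conn (\<xi> - inE S) u x)" using assms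
proof (induction rule: conn_induct)
  case (step y z)
  show ?case
  proof (cases "conn (\<xi> - inE S) u y \<and> y \<notin> S")
    case True
    then have "{y, z} \<in> \<xi> - inE S" using step(2) by (simp add: inE_def)
    then show ?thesis using conn_trans[OF conjunct1[OF True] conn_edge] by blast
  next
    case False
    then show ?thesis using step(3) by blast
  qed
qed simp

definition sealed :: "'v set \<Rightarrow> 'v set set \<Rightarrow> 'v set" where
  "sealed B \<xi> = {z \<in> B. \<not> out B \<xi> z}"

text \<open>Hence the event that the sealed set is \<open>S\<close> is independent of the connections inside \<open>S\<close>.\<close>

lemma sealed_local: "sealed B \<xi> = S \<longleftrightarrow> sealed B (\<xi> - inE S) = S"
proof -
  have mono: "sealed B \<xi> \<subseteq> sealed B (\<xi> - inE S)"
    unfolding sealed_def using incrD[OF incr_out, of "\<xi> - inE S" \<xi> B] by auto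
  have outs: "out B (\<xi> - inE S) z \<or> (\<exists>x\<in>S. out B (\<xi> - inE S) x)" if oz: "out B \<xi> z" for z
  proof -
    obtain u where u: "u \<notin> B" "conn \<xi> z u" using oz by (auto simp: out_def)
    from conn_outside[OF conn_sym[OF u(2)], of S]
    show ?thesis
    proof
      assume "conn (\<xi> - inE S) u z"
      then have "conn (\<xi> - inE S) z u" by (rule conn_sym)
      then show ?thesis using u(1) by (auto simp: out_def)
    next
      assume "\<exists>x\<in>S. conn (\<xi> - inE S) u x"
      then obtain x where x: "x \<in> S" "conn (\<xi> - inE S) u x" by blast
      have "conn (\<xi> - inE S) x u" by (rule conn_sym[OF x(2)])
      then show ?thesis using u(1) x(1) by (auto simp: out_def)
    qed
  qed
  show ?thesis
  proof
    assume S: "sealed B \<xi> = S"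
    have "z \<in> S" if z: "z \<in> sealed B (\<xi> - inE S)" for z
    proof (rule ccontr)
      assume "z \<notin> S"
      then have "out B \<xi> z" using z S by (auto simp: sealed_def)
      then have "\<exists>x\<in>S. out B (\<xi> - inE S) x" using outs[of z] z by (auto simp: sealed_def)
      then show False using mono unfolding S by (auto simp: sealed_def)
    qed
    then show "sealed B (\<xi> - inE S) = S" using mono S by blast
  next
    assume S: "sealed B (\<xi> - inE S) = S"
    have "z \<in> sealed B \<xi>" if z: "z \<in> S" for z
    proof (rule ccontr)
      assume n: "z \<notin> sealed B \<xi>"
      have zB: "z \<in> B" using z S by (auto simp: sealed_def)
      then have "out B \<xi> z" using n by (auto simp: sealed_def)
      then have "\<exists>x\<in>S. out B (\<xi> - inE S) x" using outs[of z] z by blast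
      then show False using S by (auto simp: sealed_def)
    qed
    then show "sealed B \<xi> = S" using mono S by blast
  qed
qed

text \<open>Given that the sealed set is \<open>S\<close>, the outer end of every boundary edge of
  \<open>S\<close> is connected to the complement of \<open>B\<close>. So the edge is pivotal once
  its inner end is joined to \<open>v\<close> inside \<open>S\<close>, an event independent of the
  sealed set being \<open>S\<close>; this produces \<open>phi\<close>.\<close>

lemma differential_inequality:
  assumes B: "finite B" "B \<subseteq> V" "v \<in> B" and F: "F = {e \<in> E. e \<inter> B \<noteq> {}}"
    and q: "0 \<le> q" "q \<le> 1" and ph: "\<And>S. finite S \<Longrightarrow> S \<subseteq> V \<Longrightarrow> v \<in> S \<Longrightarrow> 1 / 2 \<le> phi q 0 v S"
  shows "finite F" "\<exists>d. ((\<lambda>p. Pr p F (\<lambda>\<xi>. out B \<xi> v)) has_real_derivative d) (at q) \<and> (1 - Pr q F (\<lambda>\<xi>. out B \<xi> v)) / 2 \<le> d"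
proof -
  have "F = (\<Union>x\<in>B. {e \<in> E. x \<in> e})" by (auto simp: F)
  then show fF: "finite F" using B fin_deg by auto
  let ?f = "\<lambda>\<xi>. of_bool (out B \<xi> v) :: real"
  let ?S = "{S. S \<subseteq> B \<and> v \<in> S}"
  let ?g = "\<lambda>S \<xi>. \<Sum>(x, z)\<in>bdry S. of_bool (sealed B \<xi> = S) * of_bool (conn (\<xi> \<inter> inE S) v x) :: real"
  have fS: "finite ?S" using B(1) by simp
  have fmono: "?f \<xi> \<le> ?f \<xi>'" if "\<xi> \<subseteq> \<xi>'" for \<xi> \<xi>' using incrD[OF incr_out that, of B v] by auto
  \<comment> \<open>The pointwise count of pivotal edges: only one \<open>S\<close> contributes for
    a given \<xi>, and \<open>bdry_inj\<close> ensures that no edge is counted twice.\<close>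
  have pt: "(\<Sum>S\<in>?S. ?g S \<xi>) \<le> (\<Sum>e\<in>F. ?f (insert e \<xi>) - ?f (\<xi> - {e}))" if om: "\<xi> \<subseteq> F" for \<xi>
  proof -
    have nn: "0 \<le> ?f (insert e \<xi>) - ?f (\<xi> - {e})" for e using fmono[of "\<xi> - {e}" "insert e \<xi>"] by fastforce
    define S0 where "S0 = sealed B \<xi>"
    show ?thesis
    proof (cases "v \<in> S0")
      case False
      then have "?g S \<xi> = 0" if "S \<in> ?S" for S using that by (auto simp: S0_def intro!: sum.neutral)
      then have "(\<Sum>S\<in>?S. ?g S \<xi>) = 0" by (intro sum.neutral) blast
      then show ?thesis using nn by (simp add: sum_nonneg)
    next
      case True
      have S0: "S0 \<in> ?S" "S0 \<subseteq> B" using True by (auto simp: S0_def sealed_def)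
      have "(\<Sum>S\<in>?S. ?g S \<xi>) = (\<Sum>S\<in>{S0}. ?g S \<xi>)"
        using S0(1) fS by (intro sum.mono_neutral_right) (auto simp: S0_def intro!: sum.neutral)
      also have "\<dots> = (\<Sum>(x, z)\<in>bdry S0. of_bool (conn (\<xi> \<inter> inE S0) v x))" by (simp add: S0_def)
      also have "\<dots> \<le> (\<Sum>xz\<in>bdry S0. ?f (insert {fst xz, snd xz} \<xi>) - ?f (\<xi> - {{fst xz, snd xz}}))"
      proof (rule sum_mono)
        fix xz assume xz: "xz \<in> bdry S0"
        obtain x z where e: "xz = (x, z)" by fastforce
        have b: "x \<in> S0" "z \<notin> S0" "{x, z} \<in> E" using xz e by (auto simp: bdry_def)
        have "of_bool (conn (\<xi> \<inter> inE S0) v x) \<le> ?f (insert {x, z} \<xi>) - ?f (\<xi> - {{x, z}})"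
        proof (cases "conn (\<xi> \<inter> inE S0) v x")
          case c: True
          have "\<not> out B (\<xi> - {{x, z}}) v" using True incrD[OF incr_out, of "\<xi> - {{x, z}}" \<xi> B v] by (auto simp: S0_def sealed_def)
          moreover
          have "out B \<xi> z"
          proof (cases "z \<in> B")
            case True then show ?thesis using b(2) by (auto simp: S0_def sealed_def)
          next
            case False then show ?thesis by (auto simp: out_def)
          qed
          then obtain u where u: "u \<notin> B" "conn \<xi> z u" by (auto simp: out_def)
          have 1: "conn (insert {x, z} \<xi>) v x" by (rule conn_mono[OF c]) auto
          have 2: "conn (insert {x, z} \<xi>) x z" by (rule conn_edge) simp
          have 3: "conn (insert {x, z} \<xi>) z u" by (rule conn_mono[OF u(2)]) auto
          have "out B (insert {x, z} \<xi>) v" using conn_trans[OF conn_trans[OF 1 2] 3] u(1) by (auto simp: out_def)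
          ultimately show ?thesis by simp
        next
          case False
          then show ?thesis using nn[of "{x, z}"] by simp
        qed
        then show "(case xz of (x, z) \<Rightarrow> of_bool (conn (\<xi> \<inter> inE S0) v x)) \<le> ?f (insert {fst xz, snd xz} \<xi>) - ?f (\<xi> - {{fst xz, snd xz}})"
          by (simp add: e)
      qed
      also have "\<dots> = (\<Sum>e\<in>(\<lambda>(x, z). {x, z}) ` bdry S0. ?f (insert e \<xi>) - ?f (\<xi> - {e}))"
        by (subst sum.reindex[OF bdry_inj]) (simp add: case_prod_beta' o_def)
      also have "\<dots> \<le> (\<Sum>e\<in>F. ?f (insert e \<xi>) - ?f (\<xi> - {e}))"
      proof (intro sum_mono2 fF nn)
        show "(\<lambda>(x, z). {x, z}) ` bdry S0 \<subseteq> F" using S0(2) by (auto simp: bdry_def F)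
      qed
      finally show ?thesis .
    qed
  qed
  have sub: "inE S \<subseteq> F" if "S \<subseteq> B" for S using that edge unfolding F inE_def by fastforce
  have "(1 - Pr q F (\<lambda>\<xi>. out B \<xi> v)) / 2 = (\<Sum>S\<in>?S. Pr q F (\<lambda>\<xi>. sealed B \<xi> = S)) / 2"
  proof -
    have "(\<Sum>S\<in>?S. Pr q F (\<lambda>\<xi>. sealed B \<xi> = S)) = Ex q F (\<lambda>\<xi>. \<Sum>S\<in>?S. of_bool (sealed B \<xi> = S))"
      by (rule Ex_sum[symmetric])
    also have "\<dots> = Ex q F (\<lambda>\<xi>. 1 - ?f \<xi>)"
    proof (rule Ex_cong)
      fix \<xi>
      have "(\<Sum>S\<in>?S. of_bool (sealed B \<xi> = S)) = (\<Sum>S\<in>?S. if S = sealed B \<xi> then 1 else (0::real))"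
        by (intro sum.cong) auto
      also have "\<dots> = of_bool (sealed B \<xi> \<in> ?S)" using fS by simp
      also have "sealed B \<xi> \<in> ?S \<longleftrightarrow> \<not> out B \<xi> v" using B(3) by (auto simp: sealed_def)
      finally show "(\<Sum>S\<in>?S. of_bool (sealed B \<xi> = S)) = 1 - ?f \<xi>" by simp
    qed
    finally show ?thesis using fF by (simp add: Ex_diff)
  qed
  also have "\<dots> \<le> (\<Sum>S\<in>?S. Pr q F (\<lambda>\<xi>. sealed B \<xi> = S) * phi q 0 v S)" unfolding sum_divide_distrib
  proof (rule sum_mono)
    fix S assume "S \<in> ?S"
    then have "1 / 2 \<le> phi q 0 v S" using B finite_subset by (intro ph) auto
    then have "Pr q F (\<lambda>\<xi>. sealed B \<xi> = S) * (1 / 2) \<le> Pr q F (\<lambda>\<xi>. sealed B \<xi> = S) * phi q 0 v S"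
      using q by (intro mult_left_mono) auto
    then show "Pr q F (\<lambda>\<xi>. sealed B \<xi> = S) / 2 \<le> Pr q F (\<lambda>\<xi>. sealed B \<xi> = S) * phi q 0 v S" by simp
  qed
  also have "\<dots> \<le> (\<Sum>S\<in>?S. Ex q F (?g S))"
  proof (rule sum_mono)
    fix S assume S: "S \<in> ?S"
    have "Pr q F (\<lambda>\<xi>. sealed B \<xi> = S) * phi q 0 v S \<le>
      (\<Sum>(x, z)\<in>bdry S. Pr q F (\<lambda>\<xi>. sealed B \<xi> = S) * tau q (inE S) v x)"
      unfolding phi_def sum_distrib_left
    proof (rule sum_mono)
      fix xz assume "xz \<in> bdry S"
      have "Pr q F (\<lambda>\<xi>. sealed B \<xi> = S) * (q * tau q (inE S) v x) \<le>
        Pr q F (\<lambda>\<xi>. sealed B \<xi> = S) * (1 * tau q (inE S) v x)" for x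
        using q by (intro mult_left_mono mult_right_mono) auto
      then show "Pr q F (\<lambda>\<xi>. sealed B \<xi> = S) * (case xz of (x, z) \<Rightarrow> q * tau q (inE S) v x * exp (0 * (h z - h v))) \<le>
        (case xz of (x, z) \<Rightarrow> Pr q F (\<lambda>\<xi>. sealed B \<xi> = S) * tau q (inE S) v x)"
        by (simp split: prod.split)
    qed
    also have "\<dots> = (\<Sum>(x, z)\<in>bdry S. Ex q F (\<lambda>\<xi>. of_bool (sealed B \<xi> = S) * of_bool (conn (\<xi> \<inter> inE S) v x)))"
    proof (intro sum.cong refl)
      fix xz assume "xz \<in> bdry S"
      obtain x z where e: "xz = (x, z)" by fastforce
      have "Ex q F (\<lambda>\<xi>. of_bool (sealed B \<xi> = S) * of_bool (conn (\<xi> \<inter> inE S) v x)) =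
        Pr q F (\<lambda>\<xi>. sealed B \<xi> = S) * tauR q F (inE S) v x"
      proof (rule Ex_indep[OF fF, of "- inE S" "inE S"])
        fix \<xi>
        have "sealed B \<xi> = S \<longleftrightarrow> sealed B (\<xi> \<inter> - inE S) = S" using sealed_local[of B \<xi> S] by (simp only: Diff_eq)
        then show "(of_bool (sealed B \<xi> = S) :: real) = of_bool (sealed B (\<xi> \<inter> - inE S) = S)" by simp
      qed auto
      also have "tauR q F (inE S) v x = tau q (inE S) v x" using sub[of S] S by (intro Ex_restrict fF) auto
      finally show "(case xz of (x, z) \<Rightarrow> Pr q F (\<lambda>\<xi>. sealed B \<xi> = S) * tau q (inE S) v x) =
        (case xz of (x, z) \<Rightarrow> Ex q F (\<lambda>\<xi>. of_bool (sealed B \<xi> = S) * of_bool (conn (\<xi> \<inter> inE S) v x)))"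
        by (simp add: e)
    qed
    also have "\<dots> = Ex q F (?g S)" unfolding case_prod_beta' by (rule Ex_sum[symmetric])
    finally show "Pr q F (\<lambda>\<xi>. sealed B \<xi> = S) * phi q 0 v S \<le> Ex q F (?g S)" .
  qed
  also have "\<dots> = Ex q F (\<lambda>\<xi>. \<Sum>S\<in>?S. ?g S \<xi>)" by (rule Ex_sum[symmetric])
  also have "\<dots> \<le> Ex q F (\<lambda>\<xi>. \<Sum>e\<in>F. ?f (insert e \<xi>) - ?f (\<xi> - {e}))" by (rule Ex_mono[OF q pt])
  also have "\<dots> = (\<Sum>e\<in>F. Ex q F (\<lambda>\<xi>. ?f (insert e \<xi>) - ?f (\<xi> - {e})))" by (rule Ex_sum)
  finally show "\<exists>d. ((\<lambda>p. Pr p F (\<lambda>\<xi>. out B \<xi> v)) has_real_derivative d) (at q) \<and> (1 - Pr q F (\<lambda>\<xi>. out B \<xi> v)) / 2 \<le> d"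
    using Russo[OF fF, of ?f q] by auto
qed

text \<open>The differential inequality says that \<open>(1 - \<theta> q) * exp (q / 2)\<close> does
  not increase with \<open>q\<close>.\<close>

lemma sharpness:
  assumes B: "finite B" "B \<subseteq> V" "v \<in> B" and F: "F = {e \<in> E. e \<inter> B \<noteq> {}}"
    and p: "0 \<le> p0" "p0 \<le> p" "p \<le> 1" and ph: "\<And>S. finite S \<Longrightarrow> S \<subseteq> V \<Longrightarrow> v \<in> S \<Longrightarrow> 1 / 2 \<le> phi p0 0 v S"
  shows "1 - exp (- (p - p0) / 2) \<le> Pr p F (\<lambda>\<xi>. out B \<xi> v)"
proof -
  define \<theta> where "\<theta> = (\<lambda>p. Pr p F (\<lambda>\<xi>. out B \<xi> v))"
  let ?g = "\<lambda>q. (1 - \<theta> q) * exp (q / 2)"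
  have fF: "finite F" by (rule differential_inequality(1)[OF B F p(1)]) (use p ph in auto)
  have "?g p \<le> ?g p0"
  proof (rule DERIV_nonpos_imp_nonincreasing[OF p(2)])
    fix q assume q: "p0 \<le> q" "q \<le> p"
    have "1 / 2 \<le> phi q 0 v S" if "finite S" "S \<subseteq> V" "v \<in> S" for S
      using ph[OF that] phi_mono_p[of p0 q S 0 v] p q that by auto
    then obtain d where d: "(\<theta> has_real_derivative d) (at q)" "(1 - \<theta> q) / 2 \<le> d"
      using differential_inequality(2)[OF B F, of q] p q unfolding \<theta>_def by auto
    have "(?g has_real_derivative ((0 - d) * exp (q / 2) + exp (q / 2) * (1 / 2) * (1 - \<theta> q))) (at q)"
      by (rule derivative_eq_intros d(1) refl | simp)+
    moreover have "(0 - d) * exp (q / 2) + exp (q / 2) * (1 / 2) * (1 - \<theta> q) = exp (q / 2) * ((1 - \<theta> q) / 2 - d)"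
      by (simp add: algebra_simps)
    moreover have "exp (q / 2) * ((1 - \<theta> q) / 2 - d) \<le> 0" using d(2) by (intro mult_nonneg_nonpos) auto
    ultimately show "\<exists>y. (?g has_real_derivative y) (at q) \<and> y \<le> 0" by metis
  qed
  also have "\<dots> \<le> 1 * exp (p0 / 2)" unfolding \<theta>_def using p fF by (intro mult_right_mono) auto
  finally have "1 - \<theta> p \<le> exp (p0 / 2) / exp (p / 2)" by (simp add: pos_le_divide_eq)
  also have "\<dots> = exp (- (p - p0) / 2)" by (simp add: exp_diff[symmetric] diff_divide_distrib)
  finally show ?thesis unfolding \<theta>_def by linarith
qed

lemma phase:
  "\<exists>a b c Y. 0 < a \<and> a < b \<and> b < 1 \<and> 0 < c \<and> XX b Y \<and>
    (\<forall>x\<in>Orb. \<forall>n. \<exists>F. finite F \<and> F \<subseteq> E \<and> c \<le> Pr a F (\<lambda>\<xi>. out (nb E n x) \<xi> x))"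
proof -
  define s :: real where "s = 1 / (2 * (real dg + 1))"
  have s: "0 < s" "s \<le> 1" "s * dg \<le> 1 / 2" by (auto simp: s_def field_simps)
  define P where "P = {p::real. 0 \<le> p \<and> p \<le> 1 \<and> (\<exists>Y. chi p Y)}"
  have sP: "s \<in> P" using chi_small[of s] s by (auto simp: P_def)
  have bP: "bdd_above P" by (rule bdd_aboveI[of _ 1]) (auto simp: P_def)
  define pc where "pc = Sup P"
  have pc: "s \<le> pc" "pc \<le> 1" unfolding pc_def using sP bP by (auto intro!: cSup_upper cSup_least simp: P_def)
  have below: "\<exists>Y. chi q Y" if q: "s / 2 < q" "q < pc" for q
  proof -
    obtain r where "r \<in> P" "q < r" using q(2) less_cSupD[of P q] sP unfolding pc_def by blast
    then show ?thesis using chi_mono_p[of r _ q] q s by (auto simp: P_def)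
  qed
  have "\<exists>Y. XX pc Y" by (rule XX_critical[of "s / 2"]) (use s pc below in auto)
  then obtain Y where "XX pc Y" ..
  from openness[OF this] pc s obtain b Y where b: "pc < b" "b \<le> 1" "XX b Y" by auto
  have b1: "b < 1" by (rule XX_less_1[OF b(3,2)])
  \<comment> \<open>Two points between \<open>pc\<close> and \<open>b\<close>: at \<open>a0\<close>
    some representative has no finite set with small \<open>phi\<close>, and the step from
    \<open>a0\<close> to \<open>a\<close> is what \<open>sharpness\<close> integrates over.\<close>
  define a0 where "a0 = (2 * pc + b) / 3"
  define a where "a = (pc + 2 * b) / 3"
  have a: "pc < a0" "a0 < a" "a < b" "0 < a0" using b(1) s pc by (auto simp: a0_def a_def)
  have "\<not> (\<exists>Y. chi a0 Y)"
  proof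
    assume "\<exists>Y. chi a0 Y"
    then have "a0 \<in> P" using a b1 by (auto simp: P_def)
    then have "a0 \<le> pc" unfolding pc_def using bP by (rule cSup_upper)
    then show False using a by simp
  qed
  then have "\<exists>v\<in>Reps. \<not> (\<exists>S. finite S \<and> S \<subseteq> V \<and> v \<in> S \<and> phi a0 0 v S \<le> 1 / 2)"
    using chi_SL[of a0] a b1 by (meson less_imp_le less_trans)
  then obtain v where v: "v \<in> Reps" "\<And>S. finite S \<Longrightarrow> S \<subseteq> V \<Longrightarrow> v \<in> S \<Longrightarrow> 1 / 2 \<le> phi a0 0 v S" by force
  have vV: "v \<in> V" using v(1) Reps(2) by blast
  \<comment> \<open>The representative \<open>v\<close> may lie outside the orbit of
    \<open>rt\<close>. A fixed path from \<open>rt\<close> to \<open>v\<close>, forced open, carries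
    the estimate over at the price \<open>a ^ card C\<close>.\<close>
  obtain xs where xs: "spath E rt v xs" using connected[OF rt_V vV] by (meson conn_spath)
  define C where "C = path_edges xs"
  have C: "finite C" "C \<subseteq> E" "conn C rt v" using xs spath_conn[OF spath_sub[OF xs]] by (auto simp: C_def spath_def)
  define c0 where "c0 = 1 - exp (- (a - a0) / 2)"
  have c0: "0 < c0" using a by (simp add: c0_def)
  define c where "c = c0 * a ^ card C"
  have "\<exists>F. finite F \<and> F \<subseteq> E \<and> c \<le> Pr a F (\<lambda>\<xi>. out (nb E n x) \<xi> x)" if x: "x \<in> Orb" for x n
  proof -
    obtain \<beta> where \<beta>: "\<beta> \<in> \<Gamma>" "\<beta> rt = x" using Orb_trans[OF rt x] by blast
    define v' where "v' = \<beta> v"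
    have v'V: "v' \<in> V" using aut_V[OF \<beta>(1) vV] by (simp add: v'_def)
    have inj: "inj_on \<beta> V" and on: "\<beta> ` V = V" using aut(1)[OF \<beta>(1)] by (auto simp: bij_betw_def)
    have ph: "1 / 2 \<le> phi a0 0 v' S" if S: "finite S" "S \<subseteq> V" "v' \<in> S" for S
    proof -
      define S' where "S' = {u \<in> V. \<beta> u \<in> S}"
      have im: "\<beta> ` S' = S" using on S(2) by (auto simp: S'_def)
      have S': "finite S'" "S' \<subseteq> V" "v \<in> S'"
        using finite_imageD[of \<beta> S'] im S inj_on_subset[OF inj, of S'] vV by (auto simp: S'_def v'_def)
      show ?thesis using v(2)[OF S'] phi_aut[OF \<beta>(1) S'(1,2) vV] im by (simp add: v'_def)
    qed
    let ?k = "card C"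
    define B where "B = nb E (?k + n) v'"
    have B: "finite B" "B \<subseteq> V" "v' \<in> B" using finite_nb[OF v'V] nb_V[OF v'V] nb_refl by (auto simp: B_def)
    define F where "F = {e \<in> E. e \<inter> B \<noteq> {}}"
    have fF: "finite F" by (rule differential_inequality(1)[OF B F_def, of a0]) (use a b1 ph in auto)
    have th: "c0 \<le> Pr a F (\<lambda>\<xi>. out B \<xi> v')" unfolding c0_def by (rule sharpness[OF B F_def]) (use a b1 ph in auto)
    define C' where "C' = (`) \<beta> ` C"
    have C': "finite C'" "C' \<subseteq> E" "conn C' x v'" "card C' \<le> ?k"
      using C(1) aut_edges[OF \<beta>(1) C(2)] conn_image[OF C(3), of \<beta>] \<beta>(2) card_image_le[OF C(1), of "(`) \<beta>"]
      by (auto simp: C'_def v'_def)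
    let ?F = "F \<union> C'"
    have F': "finite ?F" "?F \<subseteq> E" using fF C' by (auto simp: F_def)
    have nb: "nb E n x \<subseteq> B"
    proof
      fix y assume y: "y \<in> nb E n x"
      have "x \<in> nb E ?k v'" using conn_in_nb[OF conn_sym[OF C'(3)] C'(2,1)] nb_mono[OF C'(4), of E v'] by blast
      then show "y \<in> B" unfolding B_def using y by (rule nb_trans)
    qed
    have "c \<le> Pr a ?F (\<lambda>\<xi>. out B \<xi> v') * Pr a ?F (\<lambda>\<xi>. C' \<subseteq> \<xi>)" unfolding c_def
    proof (rule mult_mono)
      show "c0 \<le> Pr a ?F (\<lambda>\<xi>. out B \<xi> v')" using th Pr_mono_set[of a ?F F "\<lambda>\<xi>. out B \<xi> v'"] F' a b1 incr_out by force
      have "a ^ ?k \<le> a ^ card C'" using C'(4) a b1 by (intro power_decreasing) auto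
      then show "a ^ ?k \<le> Pr a ?F (\<lambda>\<xi>. C' \<subseteq> \<xi>)" using Pr_superset[OF F'(1), of C' a] by simp
    qed (use a b1 F' in auto)
    also have "\<dots> \<le> Pr a ?F (\<lambda>\<xi>. out B \<xi> v' \<and> C' \<subseteq> \<xi>)" using a b1 F' by (intro Harris_Pr incr_out) (auto simp: incr_def)
    also have "\<dots> \<le> Pr a ?F (\<lambda>\<xi>. out (nb E n x) \<xi> x)"
    proof (rule Pr_mono)
      fix \<xi> assume o: "out B \<xi> v' \<and> C' \<subseteq> \<xi>"
      then obtain u where "u \<notin> B" "conn \<xi> v' u" by (auto simp: out_def)
      moreover have "conn \<xi> x v'" by (rule conn_mono[OF C'(3)]) (use o in blast)
      ultimately show "out (nb E n x) \<xi> x" using nb conn_trans[of \<xi> x v' u] by (auto simp: out_def)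
    qed (use a b1 in auto)
    finally show ?thesis using F' by blast
  qed
  note H = this
  show ?thesis
  proof (rule exI[of _ a], rule exI[of _ b], rule exI[of _ c], rule exI[of _ Y], intro conjI ballI allI)
    show "0 < a" "a < b" "b < 1" "0 < c" using a b1 c0 by (auto simp: c_def)
    show "XX b Y" by (rule b(3))
    fix x n assume "x \<in> Orb"
    then show "\<exists>F. finite F \<and> F \<subseteq> E \<and> c \<le> Pr a F (\<lambda>\<xi>. out (nb E n x) \<xi> x)" by (rule H)
  qed
qed

end

section \<open>The modular function\<close>

locale conn_graph =
  fixes V :: "'v set" and E :: "'v set set"
  assumes edge: "e \<in> E \<Longrightarrow> \<exists>x\<in>V. \<exists>y\<in>V. x \<noteq> y \<and> e = {x, y}"
    and fin_deg: "v \<in> V \<Longrightarrow> finite {e \<in> E. v \<in> e}"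
    and connected: "x \<in> V \<Longrightarrow> y \<in> V \<Longrightarrow> conn E x y"
begin

lemma edge_V: "e \<in> E \<Longrightarrow> e \<subseteq> V" using edge[of e] by auto

lemma finite_bl: "x \<in> V \<Longrightarrow> bl E n x \<subseteq> V \<and> finite (bl E n x)"
proof (induction n)
  case (Suc n)
  have 2: "finite {z. {y, z} \<in> E}" if "y \<in> V" for y
  proof (rule inj_on_finite[OF _ _ fin_deg[OF that]])
    show "inj_on (\<lambda>z. {y, z}) {z. {y, z} \<in> E}" by (auto simp: inj_on_def doubleton_eq_iff)
  qed auto
  have "{z. {y, z} \<in> E} \<subseteq> V" for y using edge_V[of "{y, z}" for z] by auto
  then show ?case using Suc 2 by auto
qed simp

end

text \<open>The group axioms are required pointwise on \<open>V\<close>, so values of the maps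
  outside \<open>V\<close> are irrelevant.\<close>

locale autgroup = conn_graph V E for V :: "'v set" and E :: "'v set set" +
  fixes \<Gamma> :: "('v \<Rightarrow> 'v) set"
  assumes aut: "\<beta> \<in> \<Gamma> \<Longrightarrow> bij_betw \<beta> V V" "\<beta> \<in> \<Gamma> \<Longrightarrow> e \<subseteq> V \<Longrightarrow> \<beta> ` e \<in> E \<longleftrightarrow> e \<in> E"
    and comp: "\<beta> \<in> \<Gamma> \<Longrightarrow> \<gamma> \<in> \<Gamma> \<Longrightarrow> \<exists>\<delta>\<in>\<Gamma>. \<forall>x\<in>V. \<delta> x = \<beta> (\<gamma> x)"
    and inverse: "\<beta> \<in> \<Gamma> \<Longrightarrow> \<exists>\<delta>\<in>\<Gamma>. \<forall>x\<in>V. \<delta> (\<beta> x) = x \<and> \<beta> (\<delta> x) = x"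
    and ident: "\<exists>\<delta>\<in>\<Gamma>. \<forall>x\<in>V. \<delta> x = x"
begin

definition S :: "'v \<Rightarrow> 'v \<Rightarrow> 'v set" where
  "S x y = {\<beta> y |\<beta>. \<beta> \<in> \<Gamma> \<and> \<beta> x = x}"

definition rel :: "'v \<Rightarrow> 'v \<Rightarrow> bool" where
  "rel x y \<longleftrightarrow> (\<exists>\<beta>\<in>\<Gamma>. \<beta> x = y)"

text \<open>On one orbit this is the logarithm of the modular function. In general it is the
  log-ratio of the Haar measures of the stabilizers of \<open>x\<close> and \<open>y\<close> in the
  closure of the group, which explains the cocycle identity; the proof below counts instead.\<close>

definition ell :: "'v \<Rightarrow> 'v \<Rightarrow> real" where
  "ell x y = ln (real (card (S x y)) / real (card (S y x)))"

lemma aut_V: "\<beta> \<in> \<Gamma> \<Longrightarrow> x \<in> V \<Longrightarrow> \<beta> x \<in> V" using aut(1) bij_betwE by blast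

lemma aut_inj: "\<beta> \<in> \<Gamma> \<Longrightarrow> inj_on \<beta> V" using aut(1) by (simp add: bij_betw_def)

lemma aut_edge: "\<beta> \<in> \<Gamma> \<Longrightarrow> e \<in> E \<Longrightarrow> \<beta> ` e \<in> E" using aut(2)[of \<beta> e] edge_V by blast

lemma rel_refl: "x \<in> V \<Longrightarrow> rel x x" using ident by (auto simp: rel_def)

lemma rel_sym: "x \<in> V \<Longrightarrow> rel x y \<Longrightarrow> rel y x" using inverse unfolding rel_def by metis

lemma rel_trans: "x \<in> V \<Longrightarrow> rel x y \<Longrightarrow> rel y z \<Longrightarrow> rel x z" using comp unfolding rel_def by metis

lemma rel_V: "x \<in> V \<Longrightarrow> rel x y \<Longrightarrow> y \<in> V" using aut_V by (auto simp: rel_def)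

lemma finite_S: "x \<in> V \<Longrightarrow> y \<in> V \<Longrightarrow> finite (S x y) \<and> S x y \<subseteq> V \<and> y \<in> S x y"
proof -
  assume x: "x \<in> V" and y: "y \<in> V"
  obtain xs where xs: "spath E x y xs" using connected[OF x y] by (meson conn_spath)
  define C where "C = path_edges xs"
  have C: "finite C" "C \<subseteq> E" "conn C x y" using xs spath_conn[OF spath_sub[OF xs]] by (auto simp: C_def spath_def)
  have "S x y \<subseteq> nb E (card C) x"
  proof
    fix z assume "z \<in> S x y"
    then obtain \<beta> where b: "\<beta> \<in> \<Gamma>" "\<beta> x = x" "z = \<beta> y" by (auto simp: S_def)
    have "conn ((`) \<beta> ` C) x z" using conn_image[OF C(3), of \<beta>] b by simp
    moreover have "(`) \<beta> ` C \<subseteq> E" using aut_edge[OF b(1)] C(2) by auto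
    ultimately show "z \<in> nb E (card C) x"
      unfolding nb_def using C(1) card_image_le[OF C(1), of "(`) \<beta>"] by (auto intro!: exI[of _ "(`) \<beta> ` C"])
  qed
  then have "finite (S x y)" using finite_bl[OF x] nb_sub_bl finite_subset by (metis (no_types, lifting))
  moreover have "S x y \<subseteq> V" using aut_V y by (auto simp: S_def)
  moreover have "y \<in> S x y"
  proof -
    obtain \<delta> where "\<delta> \<in> \<Gamma>" "\<delta> x = x" "\<delta> y = y" using ident x y by blast
    then show ?thesis by (auto simp: S_def intro!: exI[of _ \<delta>])
  qed
  ultimately show ?thesis by blast
qed

section \<open>Invariance and cocycle property of the modular function\<close>

lemma card_S_pos: "x \<in> V \<Longrightarrow> y \<in> V \<Longrightarrow> 0 < card (S x y)" using finite_S[of x y] by (auto simp: card_gt_0_iff)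

lemma card_S_aut_le:
  assumes b: "\<beta> \<in> \<Gamma>" and x: "x \<in> V" and y: "y \<in> V"
  shows "card (S x y) \<le> card (S (\<beta> x) (\<beta> y))"
proof (rule card_inj_on_le[of \<beta>])
  show "inj_on \<beta> (S x y)" using aut_inj[OF b] finite_S[OF x y] inj_on_subset by blast
  show "finite (S (\<beta> x) (\<beta> y))" using finite_S aut_V[OF b] x y by blast
  show "\<beta> ` S x y \<subseteq> S (\<beta> x) (\<beta> y)"
  proof
    fix w assume "w \<in> \<beta> ` S x y"
    then obtain \<gamma> where g: "\<gamma> \<in> \<Gamma>" "\<gamma> x = x" "w = \<beta> (\<gamma> y)" by (auto simp: S_def)
    obtain \<delta> where d: "\<delta> \<in> \<Gamma>" "\<forall>x\<in>V. \<delta> (\<beta> x) = x \<and> \<beta> (\<delta> x) = x" using inverse[OF b] by blast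
    obtain \<epsilon> where e: "\<epsilon> \<in> \<Gamma>" "\<forall>x\<in>V. \<epsilon> x = \<gamma> (\<delta> x)" using comp[OF g(1) d(1)] by blast
    obtain \<eta> where h: "\<eta> \<in> \<Gamma>" "\<forall>x\<in>V. \<eta> x = \<beta> (\<epsilon> x)" using comp[OF b e(1)] by blast
    have "\<eta> (\<beta> x) = \<beta> x" "\<eta> (\<beta> y) = w" using h e d g x y aut_V[OF b] by simp_all
    then show "w \<in> S (\<beta> x) (\<beta> y)" unfolding S_def using h(1) by blast
  qed
qed

lemma card_S_aut:
  assumes b: "\<beta> \<in> \<Gamma>" and x: "x \<in> V" and y: "y \<in> V"
  shows "card (S (\<beta> x) (\<beta> y)) = card (S x y)"
proof (rule antisym)
  obtain \<delta> where d: "\<delta> \<in> \<Gamma>" "\<forall>x\<in>V. \<delta> (\<beta> x) = x \<and> \<beta> (\<delta> x) = x" using inverse[OF b] by blast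
  show "card (S (\<beta> x) (\<beta> y)) \<le> card (S x y)" using card_S_aut_le[OF d(1), of "\<beta> x" "\<beta> y"] aut_V[OF b] x y d(2) by simp
qed (rule card_S_aut_le[OF assms])

lemma ell_aut: "\<beta> \<in> \<Gamma> \<Longrightarrow> x \<in> V \<Longrightarrow> y \<in> V \<Longrightarrow> ell (\<beta> x) (\<beta> y) = ell x y" by (simp add: ell_def card_S_aut)

definition pairs :: "'v \<Rightarrow> 'v \<Rightarrow> 'v \<Rightarrow> ('v \<times> 'v) set" where
  "pairs x y z = {(\<beta> y, \<beta> z) |\<beta>. \<beta> \<in> \<Gamma> \<and> \<beta> x = x}"

definition U :: "'v \<Rightarrow> 'v \<Rightarrow> 'v \<Rightarrow> 'v set" where
  "U x y z = {\<beta> z |\<beta>. \<beta> \<in> \<Gamma> \<and> \<beta> x = x \<and> \<beta> y = y}"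

lemma card_pairs:
  assumes V: "x \<in> V" "y \<in> V" "z \<in> V"
  shows "card (pairs x y z) = card (S x y) * card (U x y z)"
proof -
  have "\<forall>w\<in>S x y. \<exists>\<beta>. \<beta> \<in> \<Gamma> \<and> \<beta> x = x \<and> \<beta> y = w" by (auto simp: S_def)
  \<comment> \<open>For each \<open>w\<close> one automorphism that fixes \<open>x\<close> and takes
    \<open>y\<close> to \<open>w\<close>; it carries the fibre of \<open>pairs\<close> over
    \<open>y\<close> onto the fibre over \<open>w\<close>.\<close>
  from bchoice[OF this] obtain b where b: "\<forall>w\<in>S x y. b w \<in> \<Gamma> \<and> b w x = x \<and> b w y = w" ..
  have UV: "U x y z \<subseteq> V" using aut_V V by (auto simp: U_def)
  have fU: "finite (U x y z)" by (rule finite_subset[of _ "S x z"]) (use finite_S V in \<open>auto simp: U_def S_def\<close>)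
  have "pairs x y z = (SIGMA w:S x y. b w ` U x y z)"
  proof (intro equalityI subsetI)
    fix q assume "q \<in> pairs x y z"
    then obtain \<beta> where q: "\<beta> \<in> \<Gamma>" "\<beta> x = x" "q = (\<beta> y, \<beta> z)" by (auto simp: pairs_def)
    define w where "w = \<beta> y"
    have w: "w \<in> S x y" using q by (auto simp: S_def w_def)
    then have bw: "b w \<in> \<Gamma>" "b w x = x" "b w y = w" using b by auto
    obtain \<delta> where d: "\<delta> \<in> \<Gamma>" "\<forall>u\<in>V. \<delta> (b w u) = u \<and> b w (\<delta> u) = u" using inverse[OF bw(1)] by blast
    obtain \<epsilon> where e: "\<epsilon> \<in> \<Gamma>" "\<forall>u\<in>V. \<epsilon> u = \<delta> (\<beta> u)" using comp[OF d(1) q(1)] by blast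
    have "\<epsilon> x = x" "\<epsilon> y = y" "b w (\<epsilon> z) = \<beta> z" using e(2) d(2) bw q(2) V aut_V[OF q(1)] unfolding w_def by metis+
    then have "\<epsilon> z \<in> U x y z" "\<beta> z = b w (\<epsilon> z)" using e(1) by (auto simp: U_def)
    then show "q \<in> (SIGMA w:S x y. b w ` U x y z)" using w q(3) by (auto simp: w_def)
  next
    fix q assume "q \<in> (SIGMA w:S x y. b w ` U x y z)"
    then obtain w \<beta> where q: "w \<in> S x y" "q = (w, b w (\<beta> z))" "\<beta> \<in> \<Gamma>" "\<beta> x = x" "\<beta> y = y" by (auto simp: U_def)
    then have bw: "b w \<in> \<Gamma>" "b w x = x" "b w y = w" using b by auto
    obtain \<epsilon> where e: "\<epsilon> \<in> \<Gamma>" "\<forall>u\<in>V. \<epsilon> u = b w (\<beta> u)" using comp[OF bw(1) q(3)] by blast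
    have "\<epsilon> x = x" "\<epsilon> y = w" "\<epsilon> z = b w (\<beta> z)" using e(2) V q bw by auto
    then show "q \<in> pairs x y z" unfolding pairs_def q(2) using e(1) by (auto intro!: exI[of _ \<epsilon>])
  qed
  then have "card (pairs x y z) = (\<Sum>w\<in>S x y. card (b w ` U x y z))" using finite_S V fU by (simp add: card_SigmaI)
  also have "\<dots> = (\<Sum>w\<in>S x y. card (U x y z))"
    using b UV aut_inj by (intro sum.cong refl card_image inj_on_subset[OF _ UV]) auto
  finally show ?thesis by simp
qed

text \<open>Both orbits of pairs contain the same factor \<open>card (U x y z)\<close>, the orbit of
  \<open>z\<close> under the joint stabilizer of \<open>x\<close> and \<open>y\<close>, and it
  cancels in the quotient.\<close>

lemma ell_pairs:
  assumes V: "x \<in> V" "y \<in> V" "z \<in> V"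
  shows "ell x y = ln (card (pairs x y z)) - ln (card (pairs y x z))"
proof -
  have UU: "U y x z = U x y z" by (auto simp: U_def)
  have "finite (U x y z)" by (rule finite_subset[of _ "S x z"]) (use finite_S V in \<open>auto simp: U_def S_def\<close>)
  moreover have "z \<in> U x y z"
  proof -
    obtain \<delta> where "\<delta> \<in> \<Gamma>" "\<delta> x = x" "\<delta> y = y" "\<delta> z = z" using ident V by blast
    then show ?thesis by (auto simp: U_def intro!: exI[of _ \<delta>])
  qed
  ultimately have u: "0 < card (U x y z)" by (auto simp: card_gt_0_iff)
  show ?thesis using u card_S_pos[OF V(1,2)] card_S_pos[OF V(2,1)] by (simp add: ell_def card_pairs V UU ln_mult ln_div)
qed

lemma pairs_swap: "card (pairs x y z) = card (pairs x z y)"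
proof -
  have "pairs x z y = prod.swap ` pairs x y z" by (force simp: pairs_def image_iff)
  moreover have "inj_on prod.swap (pairs x y z)" by (auto simp: inj_on_def)
  ultimately show ?thesis by (simp add: card_image)
qed

text \<open>Written through \<open>ell_pairs\<close>, the terms telescope, because exchanging the
  last two arguments of \<open>pairs\<close> does not change its cardinality.\<close>

lemma ell_cocycle: "x \<in> V \<Longrightarrow> y \<in> V \<Longrightarrow> z \<in> V \<Longrightarrow> ell x z = ell x y + ell y z"
  using ell_pairs[of x y z] ell_pairs[of y z x] ell_pairs[of x z y] pairs_swap[of x y z] pairs_swap[of y x z] pairs_swap[of z x y]
  by simp

lemma ell_anti: "x \<in> V \<Longrightarrow> y \<in> V \<Longrightarrow> ell y x = - ell x y" using ell_cocycle[of x y x] ell_cocycle[of x x x] by simp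

lemma exp_ell: "x \<in> V \<Longrightarrow> y \<in> V \<Longrightarrow> exp (ell x y) = card (S x y) / card (S y x)"
  using card_S_pos[of x y] card_S_pos[of y x] by (simp add: ell_def)

text \<open>A double count. \<open>Y x\<close> collects the images of \<open>rt\<close> under the
  automorphisms that take \<open>x\<close> to \<open>rt\<close>; it has \<open>card (S x rt)\<close>
  elements, and a given \<open>y\<close> lies in \<open>Y x\<close> for at most
  \<open>card (S rt x)\<close> of the \<open>x\<close>. The quotient of these numbers is the
  weight.\<close>

lemma mass_transport:
  fixes f :: "'v set set \<Rightarrow> 'v \<Rightarrow> 'v \<Rightarrow> real"
  assumes rt: "rt \<in> V"
    and inv: "\<And>\<beta> F x y. \<beta> \<in> \<Gamma> \<Longrightarrow> finite F \<Longrightarrow> F \<subseteq> E \<Longrightarrow> rel rt x \<Longrightarrow> rel rt y \<Longrightarrow> f ((`) \<beta> ` F) (\<beta> x) (\<beta> y) = f F x y"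
    and mono: "\<And>F F' x y. finite F' \<Longrightarrow> F' \<subseteq> E \<Longrightarrow> F \<subseteq> F' \<Longrightarrow> rel rt x \<Longrightarrow> rel rt y \<Longrightarrow> f F x y \<le> f F' x y"
    and nonneg: "\<And>F x y. 0 \<le> f F x y"
    and K: "\<And>F B. finite F \<Longrightarrow> F \<subseteq> E \<Longrightarrow> finite B \<Longrightarrow> B \<subseteq> {y. rel rt y} \<Longrightarrow> (\<Sum>y\<in>B. f F rt y) \<le> K"
    and F: "finite F" "F \<subseteq> E" and A: "finite A" "A \<subseteq> {y. rel rt y}"
  shows "(\<Sum>x\<in>A. f F x rt * exp (ell x rt)) \<le> K"
proof -
  define Y where "Y = (\<lambda>x. {\<eta> rt |\<eta>. \<eta> \<in> \<Gamma> \<and> \<eta> x = rt})"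
  have AV: "x \<in> V" if "x \<in> A" for x using that A(2) rel_V[OF rt] by auto
  have Y: "Y x = \<gamma> ` S x rt" if x: "x \<in> A" and g: "\<gamma> \<in> \<Gamma>" "\<gamma> x = rt" for x \<gamma>
  proof (intro equalityI subsetI)
    fix y assume "y \<in> Y x"
    then obtain \<eta> where h: "\<eta> \<in> \<Gamma>" "\<eta> x = rt" "y = \<eta> rt" by (auto simp: Y_def)
    obtain \<delta> where d: "\<delta> \<in> \<Gamma>" "\<forall>u\<in>V. \<delta> (\<gamma> u) = u \<and> \<gamma> (\<delta> u) = u" using inverse[OF g(1)] by blast
    obtain \<epsilon> where e: "\<epsilon> \<in> \<Gamma>" "\<forall>u\<in>V. \<epsilon> u = \<delta> (\<eta> u)" using comp[OF d(1) h(1)] by blast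
    have "\<epsilon> x = x" "\<gamma> (\<epsilon> rt) = y" using e(2) d(2) h g AV[OF x] rt aut_V[OF h(1)] by metis+
    then show "y \<in> \<gamma> ` S x rt" using e(1) unfolding S_def by blast
  next
    fix y assume "y \<in> \<gamma> ` S x rt"
    then obtain \<beta> where b: "\<beta> \<in> \<Gamma>" "\<beta> x = x" "y = \<gamma> (\<beta> rt)" by (auto simp: S_def)
    obtain \<epsilon> where e: "\<epsilon> \<in> \<Gamma>" "\<forall>u\<in>V. \<epsilon> u = \<gamma> (\<beta> u)" using comp[OF g(1) b(1)] by blast
    have "\<epsilon> x = rt" "\<epsilon> rt = y" using e b g AV[OF x] rt by auto
    then show "y \<in> Y x" unfolding Y_def using e(1) by blast
  qed
  have Yc: "card (Y x) = card (S x rt)" "finite (Y x)" if x: "x \<in> A" for x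
  proof -
    have "rel x rt" using x A(2) rel_sym[OF rt] by auto
    then obtain \<gamma> where g: "\<gamma> \<in> \<Gamma>" "\<gamma> x = rt" by (auto simp: rel_def)
    have SV: "S x rt \<subseteq> V" "finite (S x rt)" using finite_S[OF AV[OF x] rt] by auto
    show "card (Y x) = card (S x rt)" "finite (Y x)"
      unfolding Y[OF x g] using card_image[OF inj_on_subset[OF aut_inj[OF g(1)] SV(1)]] SV(2) by auto
  qed
  have "\<forall>q\<in>Sigma A Y. \<exists>\<eta>. \<eta> \<in> \<Gamma> \<and> \<eta> (fst q) = rt \<and> \<eta> rt = snd q" by (auto simp: Y_def)
  from bchoice[OF this] obtain \<eta> where \<eta>: "\<forall>q\<in>Sigma A Y. \<eta> q \<in> \<Gamma> \<and> \<eta> q (fst q) = rt \<and> \<eta> q rt = snd q" ..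
  have fSig: "finite (Sigma A Y)" using A(1) Yc by auto
  \<comment> \<open>The automorphism, and with it the image of \<open>F\<close>, varies with the
    pair; the union of all images is still finite, and \<open>f\<close> is monotone in the edge
    set.\<close>
  define F' where "F' = (\<Union>q\<in>Sigma A Y. (`) (\<eta> q) ` F)"
  have F': "finite F'" "F' \<subseteq> E" using fSig F \<eta> aut_edge by (auto simp: F'_def)
  define B where "B = (\<Union>x\<in>A. Y x)"
  have B: "finite B" "B \<subseteq> {y. rel rt y}" using A(1) Yc by (auto simp: B_def Y_def rel_def)
  have le: "f F x rt \<le> f F' rt y" if "x \<in> A" "y \<in> Y x" for x y
  proof -
    have q: "(x, y) \<in> Sigma A Y" using that by simp
    then have e: "\<eta> (x, y) \<in> \<Gamma>" "\<eta> (x, y) x = rt" "\<eta> (x, y) rt = y" using \<eta> by force+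
    have "f F x rt = f ((`) (\<eta> (x, y)) ` F) rt y" using inv[OF e(1) F, of x rt] e that(1) A(2) rel_refl[OF rt] by auto
    also have "\<dots> \<le> f F' rt y"
    proof (rule mono[OF F'])
      show "(`) (\<eta> (x, y)) ` F \<subseteq> F'" using q unfolding F'_def by blast
      show "rel rt y" using e by (auto simp: rel_def)
    qed (rule rel_refl[OF rt])
    finally show ?thesis .
  qed
  have "(\<Sum>x\<in>A. f F x rt * exp (ell x rt)) = (\<Sum>x\<in>A. \<Sum>y\<in>Y x. f F x rt / card (S rt x))"
    using Yc(1) AV rt by (intro sum.cong refl) (simp add: exp_ell)
  also have "\<dots> \<le> (\<Sum>x\<in>A. \<Sum>y\<in>Y x. f F' rt y / card (S rt x))" using le by (intro sum_mono divide_right_mono) auto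
  also have "\<dots> = (\<Sum>x\<in>A. \<Sum>y\<in>B. if y \<in> Y x then f F' rt y / card (S rt x) else 0)"
  proof (rule sum.cong[OF refl])
    fix x assume x: "x \<in> A"
    have "Y x \<subseteq> B" using x by (auto simp: B_def)
    then show "(\<Sum>y\<in>Y x. f F' rt y / card (S rt x)) = (\<Sum>y\<in>B. if y \<in> Y x then f F' rt y / card (S rt x) else 0)"
      using B(1) by (intro sum.mono_neutral_cong_left) auto
  qed
  also have "\<dots> = (\<Sum>y\<in>B. \<Sum>x\<in>A. if y \<in> Y x then f F' rt y / card (S rt x) else 0)" by (rule sum.swap)
  also have "\<dots> \<le> (\<Sum>y\<in>B. f F' rt y)"
  proof (rule sum_mono)
    fix y assume "y \<in> B"
    define X where "X = {x \<in> A. y \<in> Y x}"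
    obtain x0 where x0: "x0 \<in> X" using \<open>y \<in> B\<close> by (auto simp: B_def X_def)
    have fwd: "x' \<in> S rt x" if X: "x \<in> X" "x' \<in> X" for x x'
    proof -
      obtain \<eta> \<eta>' where e: "\<eta> \<in> \<Gamma>" "\<eta> x = rt" "\<eta> rt = y" "\<eta>' \<in> \<Gamma>" "\<eta>' x' = rt" "\<eta>' rt = y"
        using X by (auto simp: X_def Y_def)
      obtain \<delta> where d: "\<delta> \<in> \<Gamma>" "\<forall>u\<in>V. \<delta> (\<eta>' u) = u \<and> \<eta>' (\<delta> u) = u" using inverse[OF e(4)] by blast
      obtain \<epsilon> where k: "\<epsilon> \<in> \<Gamma>" "\<forall>u\<in>V. \<epsilon> u = \<delta> (\<eta> u)" using comp[OF d(1) e(1)] by blast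
      have xV: "x \<in> V" "x' \<in> V" using X AV by (auto simp: X_def)
      have "\<epsilon> rt = rt" "\<epsilon> x = x'" using k(2) d(2) e xV rt by metis+
      then show ?thesis unfolding S_def using k(1) by blast
    qed
    have Seq: "card (S rt x) = card (S rt x0)" if x: "x \<in> X" for x
    proof -
      obtain \<beta> where b: "\<beta> \<in> \<Gamma>" "\<beta> rt = rt" "x = \<beta> x0" using fwd[OF x0 x] by (auto simp: S_def)
      have "x0 \<in> V" using x0 AV by (auto simp: X_def)
      then show ?thesis using card_S_aut[OF b(1) rt, of x0] b by simp
    qed
    have x0V: "x0 \<in> V" using x0 AV by (auto simp: X_def)
    have "(\<Sum>x\<in>A. if y \<in> Y x then f F' rt y / card (S rt x) else 0) = (\<Sum>x\<in>X. f F' rt y / card (S rt x0))"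
      unfolding X_def using A(1) Seq by (intro sum.mono_neutral_cong_right) (auto simp: X_def)
    also have "\<dots> = card X / card (S rt x0) * f F' rt y" by simp
    also have "\<dots> \<le> 1 * f F' rt y"
    proof (rule mult_right_mono[OF _ nonneg])
      have "card X \<le> card (S rt x0)" using finite_S[OF rt x0V] fwd[OF x0] by (intro card_mono) auto
      then show "card X / card (S rt x0) \<le> 1" using card_S_pos[OF rt x0V] by simp
    qed
    finally show "(\<Sum>x\<in>A. if y \<in> Y x then f F' rt y / card (S rt x) else 0) \<le> f F' rt y" by simp
  qed
  also have "\<dots> \<le> K" by (rule K[OF F' B])
  finally show ?thesis .
qed

text \<open>Take a shortest walk with equivalent ends and nonzero \<open>ell\<close>. If two of its
  earlier vertices were equivalent, minimality would make \<open>ell\<close> vanish between them; an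
  automorphism could then cut out the part between them without changing \<open>ell\<close> of the
  ends, giving a shorter walk.\<close>

lemma minimal_walk:
  assumes nonuni: "u0 \<in> V" "rel u0 v0" "ell u0 v0 \<noteq> 0"
  shows "\<exists>p k. 0 < k \<and> (\<forall>i\<le>k. p i \<in> V) \<and> (\<forall>i<k. {p i, p (Suc i)} \<in> E) \<and> rel (p 0) (p k) \<and> 0 < ell (p k) (p 0) \<and>
    (\<forall>i j. i < j \<longrightarrow> j < k \<longrightarrow> \<not> rel (p i) (p j))"
proof -
  define bad where "bad = (\<lambda>k. \<exists>p. p 0 \<in> V \<and> (\<forall>i<k. {p i, p (Suc i)} \<in> E) \<and> rel (p 0) (p k) \<and> ell (p k) (p 0) \<noteq> 0)"
  have badI: "bad k" if "p 0 \<in> V" "\<And>i. i < k \<Longrightarrow> {p i, p (Suc i)} \<in> E" "rel (p 0) (p k)" "ell (p k) (p 0) \<noteq> 0" for p k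
    unfolding bad_def using that by (intro exI[of _ p]) simp
  have v0: "v0 \<in> V" using rel_V nonuni by blast
  obtain xs where xs: "spath E u0 v0 xs" using connected[OF nonuni(1) v0] by (meson conn_spath)
  have "bad (length xs - 1)"
  proof (rule badI[where p = "\<lambda>i. xs ! i"])
    have e: "xs ! 0 = u0" "xs ! (length xs - 1) = v0" using xs by (auto simp: spath_def hd_conv_nth last_conv_nth)
    show "xs ! 0 \<in> V" "rel (xs ! 0) (xs ! (length xs - 1))" "ell (xs ! (length xs - 1)) (xs ! 0) \<noteq> 0"
      unfolding e using nonuni ell_anti[OF nonuni(1) v0] by auto
    fix i assume "i < length xs - 1"
    then have "{xs ! i, xs ! Suc i} \<in> path_edges xs" by (auto simp: path_edges_def)
    then show "{xs ! i, xs ! Suc i} \<in> E" using xs by (auto simp: spath_def)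
  qed
  define k where "k = (LEAST k. bad k)"
  have "bad k" unfolding k_def by (rule LeastI) fact
  have min: "\<not> bad j" if "j < k" for j using not_less_Least[of j bad] that by (simp add: k_def)
  obtain p0 where p0: "p0 0 \<in> V" "\<forall>i<k. {p0 i, p0 (Suc i)} \<in> E" "rel (p0 0) (p0 k)" "ell (p0 k) (p0 0) \<noteq> 0"
    using \<open>bad k\<close> unfolding bad_def by blast
  have "\<exists>p. p 0 \<in> V \<and> (\<forall>i<k. {p i, p (Suc i)} \<in> E) \<and> rel (p 0) (p k) \<and> 0 < ell (p k) (p 0)"
  proof (cases "0 < ell (p0 k) (p0 0)")
    case True
    then show ?thesis using p0 by blast
  next
    \<comment> \<open>With the wrong sign the walk is traversed backwards.\<close>
    case False
    have kV: "p0 k \<in> V" using p0 rel_V by blast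
    have "0 < ell (p0 0) (p0 k)" using False p0 ell_anti[OF kV p0(1)] by simp
    moreover have "{p0 (k - i), p0 (k - Suc i)} \<in> E" if "i < k" for i
    proof -
      have "k - i = Suc (k - Suc i)" using that by simp
      then show ?thesis using p0(2)[rule_format, of "k - Suc i"] that by (simp add: insert_commute)
    qed
    ultimately show ?thesis using p0 kV rel_sym by (intro exI[of _ "\<lambda>i. p0 (k - i)"]) auto
  qed
  then obtain p where p: "p 0 \<in> V" "\<And>i. i < k \<Longrightarrow> {p i, p (Suc i)} \<in> E" "rel (p 0) (p k)" "0 < ell (p k) (p 0)" by blast
  have k0: "0 < k"
  proof (rule ccontr)
    assume "\<not> 0 < k"
    then show False using p(4) ell_cocycle[of "p 0" "p 0" "p 0"] p(1) by simp
  qed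
  have pV: "p i \<in> V" if "i \<le> k" for i
  proof (cases "i = k")
    case True
    then show ?thesis using p rel_V by blast
  next
    case False
    then show ?thesis using p(2)[of i] edge_V[of "{p i, p (Suc i)}"] that by auto
  qed
  have "\<not> rel (p i) (p j)" if ij: "i < j" "j < k" for i j
  proof
    assume r: "rel (p i) (p j)"
    have V: "p i \<in> V" "p j \<in> V" "p k \<in> V" "p 0 \<in> V" using pV ij by auto
    have z: "ell (p j) (p i) = 0"
    proof (rule ccontr)
      assume "ell (p j) (p i) \<noteq> 0"
      then have "bad (j - i)" using r V p(2) ij by (intro badI[where p = "\<lambda>t. p (i + t)"]) auto
      then show False using min[of "j - i"] ij by simp
    qed
    obtain \<gamma> where g: "\<gamma> \<in> \<Gamma>" "\<gamma> (p j) = p i" using rel_sym[OF V(1) r] by (auto simp: rel_def)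
    \<comment> \<open>The tail after \<open>p j\<close> is moved by \<gamma> so that it continues at
      \<open>p i\<close>.\<close>
    define p' where "p' = (\<lambda>t. if t \<le> i then p t else \<gamma> (p (t + (j - i))))"
    define k' where "k' = k - (j - i)"
    have k': "k' < k" "i < k'" "k' + (j - i) = k" using ij by (auto simp: k'_def)
    have p'k: "p' k' = \<gamma> (p k)" "p' 0 = p 0" using k' by (auto simp: p'_def)
    have "bad k'"
    proof (rule badI[where p = p'])
      show "p' 0 \<in> V" using V p'k by simp
      have "rel (p k) (\<gamma> (p k))" using g(1) by (auto simp: rel_def)
      then show "rel (p' 0) (p' k')" unfolding p'k using rel_trans[OF V(4) p(3)] by blast
      have gV: "\<gamma> (p k) \<in> V" using aut_V[OF g(1) V(3)] .
      have "ell (\<gamma> (p k)) (p i) = ell (p k) (p j)" using ell_aut[OF g(1) V(3,2)] g(2) by simp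
      then have "ell (\<gamma> (p k)) (p 0) = ell (p k) (p 0)"
        using ell_cocycle[OF gV V(1,4)] ell_cocycle[OF V(3,2,1)] ell_cocycle[OF V(3,1,4)] z by simp
      then show "ell (p' k') (p' 0) \<noteq> 0" unfolding p'k using p(4) by simp
      fix t assume t: "t < k'"
      consider "Suc t \<le> i" | "t = i" | "i < t" by linarith
      then show "{p' t, p' (Suc t)} \<in> E"
      proof cases
        case 1
        then show ?thesis using p(2)[of t] ij by (simp add: p'_def)
      next
        case 2
        have "\<gamma> ` {p j, p (Suc j)} \<in> E" by (rule aut_edge[OF g(1) p(2)[OF ij(2)]])
        then show ?thesis using 2 ij g(2) by (simp add: p'_def)
      next
        case 3
        have "t + (j - i) < k" using t k'(3) by linarith
        then have "\<gamma> ` {p (t + (j - i)), p (Suc (t + (j - i)))} \<in> E" by (intro aut_edge[OF g(1)] p(2))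
        then show ?thesis using 3 by (simp add: p'_def)
      qed
    qed
    then show False using min k'(1) by blast
  qed
  then show ?thesis using p k0 pV by (intro exI[of _ p] exI[of _ k]) auto
qed

text \<open>Adding a constant to the modular function on each orbit makes a minimal walk flat up to its last vertex.\<close>

lemma tilted_exists:
  assumes R: "finite Reps" "Reps \<subseteq> V" "\<And>x. x \<in> V \<Longrightarrow> \<exists>v\<in>Reps. rel v x"
    and nonuni: "u0 \<in> V" "rel u0 v0" "ell u0 v0 \<noteq> 0"
  shows "\<exists>h Orb rt t0 g dg D L. tilted V E \<Gamma> h Orb rt Reps t0 g dg D L"
proof -
  from minimal_walk[OF nonuni] obtain p k where p: "0 < k" "\<forall>i\<le>k. p i \<in> V" "\<forall>i<k. {p i, p (Suc i)} \<in> E"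
    "rel (p 0) (p k)" "0 < ell (p k) (p 0)" "\<forall>i j. i < j \<longrightarrow> j < k \<longrightarrow> \<not> rel (p i) (p j)" by (elim exE conjE)
  define u where "u = p 0"
  have uV: "u \<in> V" using p by (simp add: u_def)
  \<comment> \<open>On the orbit of \<open>p i\<close> the correction is
    \<open>- ell (p i) u\<close>. These orbits are distinct for \<open>i < k\<close>, so
    \<open>h\<close> vanishes on the whole walk except at its last vertex.\<close>
  define s where "s = (\<lambda>x. \<Sum>i<k. of_bool (rel (p i) x) * (- ell (p i) u))"
  define h where "h = (\<lambda>x. ell x u + s x)"
  define g where "g = ell (p k) u"
  have g: "0 < g" using p(5) by (simp add: g_def u_def)
  have uu: "ell u u = 0" using ell_cocycle[of u u u] uV by simp
  have s_inv: "s (\<beta> x) = s x" if b: "\<beta> \<in> \<Gamma>" "x \<in> V" for \<beta> x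
  proof -
    have "rel (p i) (\<beta> x) = rel (p i) x" if "i < k" for i
    proof -
      have pi: "p i \<in> V" using p(2) that by simp
      have "rel x (\<beta> x)" using b(1) by (auto simp: rel_def)
      then show ?thesis using rel_trans[OF pi] rel_sym[OF b(2)] by blast
    qed
    then show ?thesis unfolding s_def by (intro sum.cong) auto
  qed
  have s_p: "s (p i) = - ell (p i) u" if i: "i < k" for i
  proof -
    have n: "\<not> rel (p j) (p i)" if j: "j < k" "j \<noteq> i" for j
    proof (cases "j < i")
      case True
      then show ?thesis using p(6) i by blast
    next
      case False
      then have "\<not> rel (p i) (p j)" using p(6) j by auto
      then show ?thesis using rel_sym[of "p j" "p i"] p(2) j by auto
    qed
    have "s (p i) = (\<Sum>j\<in>{i}. of_bool (rel (p j) (p i)) * (- ell (p j) u))"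
      unfolding s_def using n i by (intro sum.mono_neutral_right) auto
    also have "\<dots> = - ell (p i) u" using rel_refl[of "p i"] p(2) i by simp
    finally show ?thesis .
  qed
  have h_p: "h (p i) = 0" if "i < k" for i using s_p[OF that] by (simp add: h_def)
  have hu: "h u = 0" using h_p[OF p(1)] by (simp add: u_def)
  have su: "s u = 0" using hu uu by (simp add: h_def)
  have h_orb: "h x = ell x u" if ux: "rel u x" for x
  proof -
    obtain \<beta> where "\<beta> \<in> \<Gamma>" "x = \<beta> u" using ux by (auto simp: rel_def)
    then show ?thesis using s_inv[OF _ uV] su by (simp add: h_def)
  qed
  have hk: "h (p k) = g" using h_orb p(4) by (simp add: g_def u_def)
  have h_shift: "h (\<beta> x) - h (\<beta> y) = h x - h y" if b: "\<beta> \<in> \<Gamma>" "x \<in> V" "y \<in> V" for \<beta> x y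
  proof -
    have V: "\<beta> x \<in> V" "\<beta> y \<in> V" using aut_V b by auto
    have "ell (\<beta> x) u - ell (\<beta> y) u = ell x u - ell y u"
      using ell_cocycle[OF V uV] ell_cocycle[OF b(2,3) uV] ell_aut[OF b] by simp
    then show ?thesis using s_inv b by (simp add: h_def)
  qed
  \<comment> \<open>By invariance, sums over the finitely many representatives bound degrees, height
    differences along edges and distances to the orbit; the summand \<open>g\<close> in
    \<open>t0\<close> secures \<open>g \<le> t0\<close>.\<close>
  define dg where "dg = (\<Sum>v\<in>Reps. card {e \<in> E. v \<in> e})"
  define t0 where "t0 = g + (\<Sum>v\<in>Reps. \<Sum>e\<in>{e \<in> E. v \<in> e}. \<Sum>w\<in>e. \<bar>h v - h w\<bar>)"
  have "\<forall>v\<in>Reps. \<exists>C. finite C \<and> C \<subseteq> E \<and> conn C v u"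
  proof
    fix v assume "v \<in> Reps"
    then have "conn E v u" using connected uV R(2) by blast
    then obtain xs where xs: "spath E v u xs" by (meson conn_spath)
    then show "\<exists>C. finite C \<and> C \<subseteq> E \<and> conn C v u"
      using spath_conn[OF spath_sub[OF xs]] by (intro exI[of _ "path_edges xs"]) (auto simp: spath_def)
  qed
  from bchoice[OF this] obtain C where C: "\<forall>v\<in>Reps. finite (C v) \<and> C v \<subseteq> E \<and> conn (C v) v u" ..
  define D where "D = (\<Sum>v\<in>Reps. card (C v))"
  have "tilted V E \<Gamma> h {x. rel u x} u Reps t0 g dg D k"
  proof (rule tilted.intro)
    show "\<exists>x\<in>V. \<exists>y\<in>V. x \<noteq> y \<and> e = {x, y}" if "e \<in> E" for e using edge[OF that] .
    show "finite {e \<in> E. v \<in> e}" if "v \<in> V" for v using fin_deg[OF that] .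
    show "card {e \<in> E. v \<in> e} \<le> dg" if vV: "v \<in> V" for v
    proof -
      obtain w \<beta> where w: "w \<in> Reps" "\<beta> \<in> \<Gamma>" "\<beta> w = v" using R(3)[OF vV] by (auto simp: rel_def)
      have wV: "w \<in> V" using w R(2) by blast
      obtain \<delta> where d: "\<delta> \<in> \<Gamma>" "\<forall>u\<in>V. \<delta> (\<beta> u) = u \<and> \<beta> (\<delta> u) = u" using inverse[OF w(2)] by blast
      have "{e \<in> E. v \<in> e} \<subseteq> (`) \<beta> ` {e \<in> E. w \<in> e}"
      proof
        fix e assume e: "e \<in> {e \<in> E. v \<in> e}"
        have "\<beta> ` \<delta> ` e = e" using d(2) edge_V[of e] e by (force simp: image_image)
        moreover have "\<delta> ` e \<in> E" using aut_edge[OF d(1)] e by simp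
        moreover have "w \<in> \<delta> ` e"
        proof -
          have "w = \<delta> v" using d(2) w(3) wV by auto
          then show ?thesis using e by blast
        qed
        ultimately show "e \<in> (`) \<beta> ` {e \<in> E. w \<in> e}" by blast
      qed
      then have "card {e \<in> E. v \<in> e} \<le> card {e \<in> E. w \<in> e}" using fin_deg[OF wV] by (rule surj_card_le[rotated])
      also have "\<dots> \<le> dg" unfolding dg_def using w(1) R(1) by (intro member_le_sum) auto
      finally show ?thesis .
    qed
    show "conn E x y" if "x \<in> V" "y \<in> V" for x y using connected[OF that] .
    show "\<bar>h x - h y\<bar> \<le> t0" if xy: "{x, y} \<in> E" for x y
    proof -
      have V: "x \<in> V" "y \<in> V" using edge_V[OF xy] by auto
      obtain v \<beta> where w: "v \<in> Reps" "\<beta> \<in> \<Gamma>" "\<beta> v = x" using R(3)[OF V(1)] by (auto simp: rel_def)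
      have vV: "v \<in> V" using w R(2) by blast
      obtain \<delta> where d: "\<delta> \<in> \<Gamma>" "\<forall>u\<in>V. \<delta> (\<beta> u) = u \<and> \<beta> (\<delta> u) = u" using inverse[OF w(2)] by blast
      define y' where "y' = \<delta> y"
      have v: "\<delta> x = v" using d(2) w(3) vV by auto
      have e: "{v, y'} \<in> E" using aut_edge[OF d(1) xy] v by (simp add: y'_def)
      have "\<bar>h x - h y\<bar> = \<bar>h v - h y'\<bar>" using h_shift[OF d(1) V] v by (simp add: y'_def)
      also have "\<dots> \<le> (\<Sum>w\<in>{v, y'}. \<bar>h v - h w\<bar>)" by (rule member_le_sum) auto
      also have "\<dots> \<le> (\<Sum>e\<in>{e \<in> E. v \<in> e}. \<Sum>w\<in>e. \<bar>h v - h w\<bar>)"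
        using e fin_deg[OF vV] by (intro member_le_sum sum_nonneg) auto
      also have "\<dots> \<le> (\<Sum>v\<in>Reps. \<Sum>e\<in>{e \<in> E. v \<in> e}. \<Sum>w\<in>e. \<bar>h v - h w\<bar>)"
        using w(1) R(1) by (intro member_le_sum[where f = "\<lambda>v. \<Sum>e\<in>{e \<in> E. v \<in> e}. \<Sum>w\<in>e. \<bar>h v - h w\<bar>"] sum_nonneg) auto
      finally show ?thesis using g by (simp add: t0_def)
    qed
    show "bij_betw \<beta> V V" if "\<beta> \<in> \<Gamma>" for \<beta> using aut(1)[OF that] .
    show "\<beta> ` e \<in> E \<longleftrightarrow> e \<in> E" if "\<beta> \<in> \<Gamma>" "e \<subseteq> V" for \<beta> e using aut(2)[OF that] .
    show "h (\<beta> x) - h (\<beta> y) = h x - h y" if "\<beta> \<in> \<Gamma>" "x \<in> V" "y \<in> V" for \<beta> x y using h_shift[OF that] .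
    show "{x. rel u x} \<subseteq> V" using rel_V[OF uV] by blast
    show "u \<in> {x. rel u x}" using rel_refl[OF uV] by simp
    show "\<exists>\<beta>\<in>\<Gamma>. \<beta> x = y" if "x \<in> {x. rel u x}" "y \<in> {x. rel u x}" for x y
    proof -
      have "x \<in> V" using that rel_V[OF uV] by blast
      then have "rel x y" using rel_trans[of x u y] rel_sym[OF uV] that by blast
      then show ?thesis by (simp add: rel_def)
    qed
    show "\<beta> x \<in> {x. rel u x} \<longleftrightarrow> x \<in> {x. rel u x}" if "\<beta> \<in> \<Gamma>" "x \<in> V" for \<beta> x
    proof -
      have "rel x (\<beta> x)" using that by (auto simp: rel_def)
      then show ?thesis using rel_trans[OF uV] rel_sym[OF that(2)] by blast
    qed
    show "finite Reps" "Reps \<subseteq> V" by (rule R)+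
    show "\<exists>v\<in>Reps. \<exists>\<beta>\<in>\<Gamma>. \<beta> v = x" if "x \<in> V" for x using R(3)[OF that] by (simp add: rel_def)
    show "\<exists>a\<in>{x. rel u x}. a \<in> nb E D x" if xV: "x \<in> V" for x
    proof -
      obtain v \<beta> where w: "v \<in> Reps" "\<beta> \<in> \<Gamma>" "\<beta> v = x" using R(3)[OF xV] by (auto simp: rel_def)
      have Cv: "finite (C v)" "C v \<subseteq> E" "conn (C v) v u" using C w(1) by auto
      have "card (C v) \<le> D" unfolding D_def using w(1) R(1) by (intro member_le_sum) auto
      then have "card ((`) \<beta> ` C v) \<le> D" using card_image_le[OF Cv(1), of "(`) \<beta>"] by linarith
      moreover have "conn ((`) \<beta> ` C v) x (\<beta> u)" using conn_image[OF Cv(3), of \<beta>] w(3) by simp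
      moreover have "(`) \<beta> ` C v \<subseteq> E" using aut_edge[OF w(2)] Cv(2) by auto
      ultimately have "\<beta> u \<in> nb E D x" unfolding nb_def using Cv(1) by (auto intro!: exI[of _ "(`) \<beta> ` C v"])
      moreover have "rel u (\<beta> u)" using w(2) by (auto simp: rel_def)
      ultimately show ?thesis by blast
    qed
    show "0 < g" by (rule g)
    show "g \<le> t0" unfolding t0_def by (auto intro!: sum_nonneg)
    show "\<exists>C\<subseteq>E. \<exists>z\<in>{x. rel u x}. finite C \<and> card C \<le> k \<and> conn C u z \<and> h z = h u + g \<and>
      (\<forall>e\<in>C. (\<forall>ua\<in>e. h u \<le> h ua \<and> h ua \<le> h u + g) \<and> (\<exists>ua\<in>e. h ua = h u))"
    proof (rule exI[of _ "(\<lambda>i. {p i, p (Suc i)}) ` {..<k}"], intro conjI bexI[of _ "p k"])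
      let ?C = "(\<lambda>i. {p i, p (Suc i)}) ` {..<k}"
      show "?C \<subseteq> E" using p(3) by auto
      show "card ?C \<le> k" using card_image_le[of "{..<k}" "\<lambda>i. {p i, p (Suc i)}"] by simp
      have "conn ?C u (p i)" if "i \<le> k" for i using that
      proof (induction i)
        case (Suc i)
        then have "{p i, p (Suc i)} \<in> ?C" by auto
        then show ?case using conn_trans[OF Suc.IH conn_edge] Suc.prems by simp
      qed (simp add: u_def)
      then show "conn ?C u (p k)" by simp
      show "h (p k) = h u + g" using hk hu by simp
      have hs: "0 \<le> h (p (Suc i)) \<and> h (p (Suc i)) \<le> g" if "i < k" for i
        using h_p[of "Suc i"] hk g that by (cases "Suc i = k") auto
      show "\<forall>e\<in>?C. (\<forall>ua\<in>e. h u \<le> h ua \<and> h ua \<le> h u + g) \<and> (\<exists>ua\<in>e. h ua = h u)"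
      proof
        fix e assume "e \<in> ?C"
        then obtain i where i: "i < k" "e = {p i, p (Suc i)}" by auto
        show "(\<forall>ua\<in>e. h u \<le> h ua \<and> h ua \<le> h u + g) \<and> (\<exists>ua\<in>e. h ua = h u)"
          using h_p[OF i(1)] hs[OF i(1)] hu g by (simp add: i(2))
      qed
      show "p k \<in> {x. rel u x}" using p(4) by (simp add: u_def)
    qed simp
  next
    fix f :: "'v set set \<Rightarrow> 'v \<Rightarrow> 'v \<Rightarrow> real" and K F A
    assume a: "\<And>\<beta> F x y. \<beta> \<in> \<Gamma> \<Longrightarrow> finite F \<Longrightarrow> F \<subseteq> E \<Longrightarrow> x \<in> {x. rel u x} \<Longrightarrow> y \<in> {x. rel u x} \<Longrightarrow> f ((`) \<beta> ` F) (\<beta> x) (\<beta> y) = f F x y"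
      "\<And>F F' x y. finite F' \<Longrightarrow> F' \<subseteq> E \<Longrightarrow> F \<subseteq> F' \<Longrightarrow> x \<in> {x. rel u x} \<Longrightarrow> y \<in> {x. rel u x} \<Longrightarrow> f F x y \<le> f F' x y"
      "\<And>F x y. 0 \<le> f F x y"
      "\<And>F B. finite F \<Longrightarrow> F \<subseteq> E \<Longrightarrow> finite B \<Longrightarrow> B \<subseteq> {x. rel u x} \<Longrightarrow> (\<Sum>y\<in>B. f F u y) \<le> K"
      "finite F" "F \<subseteq> E" "finite A" "A \<subseteq> {x. rel u x}"
    have "(\<Sum>x\<in>A. f F x u * exp (h x - h u)) = (\<Sum>x\<in>A. f F x u * exp (ell x u))"
      using a(8) h_orb hu by (intro sum.cong refl) (auto simp: subset_iff)
    also have "\<dots> \<le> K" by (rule mass_transport[OF uV]) (use a in auto)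
    finally show "(\<Sum>x\<in>A. f F x u * exp (h x - h u)) \<le> K" .
  qed
  then show ?thesis by blast
qed

end

section \<open>Infinite clusters and spanning forests\<close>

definition infcl :: "'v set set \<Rightarrow> 'v \<Rightarrow> bool" where
  "infcl \<xi> x \<longleftrightarrow> infinite {u. conn \<xi> x u}"

lemma infcl_mono: "infcl \<xi> x \<Longrightarrow> \<xi> \<subseteq> \<xi>' \<Longrightarrow> infcl \<xi>' x"
  unfolding infcl_def by (erule contrapos_nn, erule finite_subset[rotated]) (auto intro: conn_mono)

lemma infcl_conn:
  assumes "infcl \<xi> x" "conn \<xi> x y"
  shows "infcl \<xi> y"
proof -
  have "{u. conn \<xi> x u} \<subseteq> {u. conn \<xi> y u}" using conn_trans[OF conn_sym[OF assms(2)]] by blast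
  then show ?thesis using assms(1) finite_subset unfolding infcl_def by blast
qed

text \<open>After its last use of the new edge the path starts from \<open>x\<close> or
  \<open>x'\<close> and stays in \<open>H\<close>.\<close>

lemma conn_insert:
  assumes "conn (insert {x, x'} H) x' y"
  shows "conn H x' y \<or> conn H x y" using assms
proof (induction rule: conn_induct)
  case (step y z)
  show ?case
  proof (cases "{y, z} \<in> H")
    case True
    then have "conn H y z" by (rule conn_edge)
    from step(3) show ?thesis by (elim disjE) (use conn_trans[OF _ \<open>conn H y z\<close>] in blast)+
  next
    case False
    then have "z = x \<or> z = x'" using step(2) by (auto simp: doubleton_eq_iff)
    then show ?thesis by auto
  qed
qed simp

section \<open>Rays in infinite clusters and comparison of the two forests\<close>

context conn_graph
begin

lemma finite_nb: "x \<in> V \<Longrightarrow> finite (nb E n x)" using finite_bl nb_sub_bl finite_subset by metis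

lemma conn_nb:
  assumes "conn E x u"
  shows "\<exists>n. u \<in> nb E n x"
proof -
  obtain xs where xs: "spath E x u xs" using assms by (rule conn_spath)
  have "conn (path_edges xs) x u" by (rule spath_conn[OF spath_sub[OF xs]])
  then have "u \<in> nb E (card (path_edges xs)) x" using xs by (intro conn_in_nb) (auto simp: spath_def)
  then show ?thesis ..
qed

lemma infcl_iff:
  assumes om: "\<xi> \<subseteq> E" and x: "x \<in> V"
  shows "infcl \<xi> x \<longleftrightarrow> (\<forall>n. out (nb E n x) \<xi> x)"
proof
  assume i: "infcl \<xi> x"
  show "\<forall>n. out (nb E n x) \<xi> x"
  proof (rule allI, rule ccontr)
    fix n assume "\<not> out (nb E n x) \<xi> x"
    then have "{u. conn \<xi> x u} \<subseteq> nb E n x" by (auto simp: out_def)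
    then show False using i finite_nb[OF x] finite_subset unfolding infcl_def by blast
  qed
next
  assume o: "\<forall>n. out (nb E n x) \<xi> x"
  show "infcl \<xi> x" unfolding infcl_def
  proof
    let ?U = "{u. conn \<xi> x u}"
    assume f: "finite ?U"
    have "\<forall>u\<in>?U. \<exists>n. u \<in> nb E n x"
    proof
      fix u assume "u \<in> ?U"
      then have "conn E x u" using conn_mono[OF _ om] by blast
      then show "\<exists>n. u \<in> nb E n x" by (rule conn_nb)
    qed
    from bchoice[OF this] obtain n where n: "\<forall>u\<in>?U. u \<in> nb E (n u) x" ..
    define N where "N = (\<Sum>u\<in>?U. n u)"
    have "u \<in> nb E N x" if u: "u \<in> ?U" for u
    proof -
      have "n u \<le> N" unfolding N_def using f u by (intro member_le_sum) auto
      from nb_mono[OF this, of E x] show ?thesis using n u by blast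
    qed
    then show False using o by (auto simp: out_def)
  qed
qed

text \<open>\<open>P\<close> is the set of vertices visited before \<open>v\<close>. If all of the
  finitely many neighbours of \<open>v\<close> had finite clusters off \<open>insert v P\<close>,
  the cluster of \<open>v\<close> off \<open>P\<close> would be finite.\<close>

lemma ray_step:
  assumes om: "\<xi> \<subseteq> E" and v: "v \<in> V" "infinite {u. conn {e \<in> \<xi>. e \<inter> P = {}} v u}"
  shows "\<exists>v'. {v, v'} \<in> \<xi> \<and> v' \<in> V \<and> v' \<notin> insert v P \<and> infinite {u. conn {e \<in> \<xi>. e \<inter> insert v P = {}} v' u}"
proof (rule ccontr)
  assume n: "\<not> ?thesis"
  let ?A = "{e \<in> \<xi>. e \<inter> P = {}}" and ?B = "{e \<in> \<xi>. e \<inter> insert v P = {}}"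
  define N where "N = {v'. {v, v'} \<in> ?A}"
  have "N \<subseteq> bl E 1 v" using om by (auto simp: N_def)
  then have fN: "finite N" using finite_bl[OF v(1), of 1] finite_subset by blast
  have fin: "finite {u. conn ?B v' u}" if v': "v' \<in> N" for v'
  proof (rule ccontr)
    assume i: "infinite {u. conn ?B v' u}"
    have e: "{v, v'} \<in> \<xi>" "{v, v'} \<inter> P = {}" using v' by (auto simp: N_def)
    then have "{v, v'} \<in> E" using om by blast
    then have "v' \<in> V" "v' \<noteq> v" using edge[of "{v, v'}"] by (auto simp: doubleton_eq_iff)
    then show False using n i e by blast
  qed
  have "{u. conn ?A v u} \<subseteq> insert v (\<Union>v'\<in>N. {u. conn ?B v' u})"
  proof
    fix u assume "u \<in> {u. conn ?A v u}"
    then obtain xs where xs: "spath ?A v u xs" by (auto elim: conn_spath)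
    show "u \<in> insert v (\<Union>v'\<in>N. {u. conn ?B v' u})"
    proof (cases xs)
      case Nil
      then show ?thesis using xs by (simp add: spath_def)
    next
      case (Cons w ys)
      then have w: "w = v" using xs by (simp add: spath_def)
      show ?thesis
      proof (cases ys)
        case Nil
        then have "u = v" using xs \<open>xs = w # ys\<close> by (auto simp: spath_def)
        then show ?thesis by blast
      next
        case (Cons v' zs)
        have xe: "xs = v # v' # zs" using \<open>xs = w # ys\<close> w Cons by simp
        have s: "{v, v'} \<in> ?A" "path_edges (v' # zs) \<subseteq> ?A" "v \<notin> set (v' # zs)" "last (v' # zs) = u"
          using xs unfolding xe spath_def by auto
        have "path_edges (v' # zs) \<subseteq> ?B"
        proof
          fix f assume f: "f \<in> path_edges (v' # zs)"
          then have "f \<subseteq> set (v' # zs)" by (rule path_edges_subset_set)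
          then show "f \<in> ?B" using s(2,3) f by blast
        qed
        then have "conn ?B v' u" using conn_path[of "v' # zs" ?B] s(4) by simp
        then show ?thesis using s(1) by (auto simp: N_def)
      qed
    qed
  qed
  then have "finite {u. conn ?A v u}" using fN fin by (auto intro: finite_subset)
  then show False using v(2) by blast
qed

lemma koenig:
  assumes om: "\<xi> \<subseteq> E" and x: "x \<in> V" "infcl \<xi> x"
  shows "\<exists>r. infinite_simple_path V E x r \<and> ray_edges r \<subseteq> \<xi> \<and> (\<forall>i. conn \<xi> x (r i))"
proof -
  \<comment> \<open>The state is the current vertex with the set of visited ones; the clause for
    \<open>n = 0\<close> fixes the starting point.\<close>
  define I where "I = (\<lambda>(n::nat) (s :: 'v \<times> 'v set). fst s \<in> V \<and> fst s \<notin> snd s \<and>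
    infinite {u. conn {e \<in> \<xi>. e \<inter> snd s = {}} (fst s) u} \<and> (n = 0 \<longrightarrow> s = (x, {})))"
  define Q where "Q = (\<lambda>(n::nat) (s :: 'v \<times> 'v set) s'. {fst s, fst s'} \<in> \<xi> \<and> snd s' = insert (fst s) (snd s))"
  have "\<exists>f. \<forall>n. I n (f n) \<and> Q n (f n) (f (Suc n))"
  proof (rule dependent_nat_choice)
    show "\<exists>s. I 0 s" using x by (intro exI[of _ "(x, {})"]) (simp add: I_def infcl_def)
  next
    fix s n assume s: "I n s"
    have "fst s \<in> V" "infinite {u. conn {e \<in> \<xi>. e \<inter> snd s = {}} (fst s) u}" using s by (auto simp: I_def)
    from ray_step[OF om this] obtain v' where v': "{fst s, v'} \<in> \<xi>" "v' \<in> V" "v' \<notin> insert (fst s) (snd s)"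
      "infinite {u. conn {e \<in> \<xi>. e \<inter> insert (fst s) (snd s) = {}} v' u}" by (elim exE conjE)
    show "\<exists>s'. I (Suc n) s' \<and> Q n s s'"
      by (rule exI[of _ "(v', insert (fst s) (snd s))"]) (use v' in \<open>simp add: I_def Q_def\<close>)
  qed
  then obtain f where f: "\<And>n. I n (f n)" "\<And>n. Q n (f n) (f (Suc n))" by blast
  define r where "r = (\<lambda>n. fst (f n))"
  have r0: "r 0 = x" using f(1)[of 0] by (simp add: I_def r_def)
  have rV: "r n \<in> V" for n using f(1)[of n] by (simp add: I_def r_def)
  have re: "{r n, r (Suc n)} \<in> \<xi>" for n using f(2)[of n] by (simp add: Q_def r_def)
  have P: "r m \<in> snd (f (Suc (m + n)))" for m n
  proof (induction n)
    case 0
    then show ?case using f(2)[of m] by (simp add: Q_def r_def)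
  next
    case (Suc n)
    then show ?case using f(2)[of "Suc (m + n)"] by (simp add: Q_def)
  qed
  have ne: "r m \<noteq> r n" if mn: "m < n" for m n
  proof -
    obtain k where "n = Suc (m + k)" using less_imp_Suc_add[OF mn] by auto
    then show ?thesis using P[of m k] f(1)[of n] by (auto simp: I_def r_def)
  qed
  have inj: "inj r"
  proof (rule injI)
    fix m n assume "r m = r n"
    then show "m = n" using ne[of m n] ne[of n m] by (cases m n rule: linorder_cases) auto
  qed
  have c: "conn \<xi> x (r i)" for i
  proof (induction i)
    case (Suc i)
    show ?case by (rule conn_trans[OF Suc conn_edge[OF re]])
  qed (simp add: r0)
  show ?thesis using r0 rV inj re om c by (intro exI[of _ r]) (auto simp: infinite_simple_path_def ray_edges_def)
qed

lemma finite_path_edges_E: "finite_path V E x y p \<Longrightarrow> path_edges p \<subseteq> E"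
  by (auto simp: finite_path_def path_edges_def successively_conv_nth)

text \<open>A finite path joining the ends uses the edge itself or one with label at least
  \<open>b\<close>, so the edge is in the free forest. Rays in the two infinite clusters are
  disjoint, since the clusters are, and form an extended path with labels below \<open>a\<close>, so
  it is not in the wired one.\<close>

lemma forest_diff:
  fixes \<phi> :: "'v set \<Rightarrow> real"
  assumes e: "{x, y} \<in> E" "a \<le> \<phi> {x, y}" "\<phi> {x, y} < b"
    and inf: "infcl {f \<in> E - {{x, y}}. \<phi> f < a} x" "infcl {f \<in> E - {{x, y}}. \<phi> f < a} y"
    and nc: "\<not> conn {f \<in> E - {{x, y}}. \<phi> f < b} x y"
  shows "WMSF V E \<phi> \<noteq> FMSF V E \<phi>"
proof -
  let ?e = "{x, y}"
  let ?H = "\<lambda>c. {f \<in> E - {?e}. \<phi> f < c}"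
  have V: "x \<in> V" "y \<in> V" using edge_V[OF e(1)] by auto
  have "?e \<in> FMSF V E \<phi>" unfolding FMSF_def
  proof (intro CollectI conjI allI impI e(1))
    fix x' y' p assume xy: "?e = {x', y'}" "finite_path V E x' y' p"
    show "\<exists>e'\<in>path_edges p. \<phi> ?e \<le> \<phi> e'"
    proof (rule ccontr)
      assume n: "\<not> ?thesis"
      have "path_edges p \<subseteq> ?H b"
      proof
        fix f assume f: "f \<in> path_edges p"
        then have "\<phi> f < \<phi> ?e" using n by force
        then show "f \<in> ?H b" using f finite_path_edges_E[OF xy(2)] e(3) by auto
      qed
      then have c: "conn (?H b) x' y'" using conn_path[of p "?H b"] xy(2) by (auto simp: finite_path_def)
      have "(x' = x \<and> y' = y) \<or> (x' = y \<and> y' = x)" using xy(1) by (auto simp: doubleton_eq_iff)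
      then have "conn (?H b) x y" using c conn_sym[OF c] by (elim disjE conjE) (simp_all only:)
      then show False using nc by simp
    qed
  qed
  moreover have "?e \<notin> WMSF V E \<phi>"
  proof
    assume w: "?e \<in> WMSF V E \<phi>"
    have HE: "?H a \<subseteq> E" by auto
    from koenig[OF HE V(1) inf(1)] obtain r where r: "infinite_simple_path V E x r" "ray_edges r \<subseteq> ?H a" "\<forall>i. conn (?H a) x (r i)"
      by (elim exE conjE)
    from koenig[OF HE V(2) inf(2)] obtain s where s: "infinite_simple_path V E y s" "ray_edges s \<subseteq> ?H a" "\<forall>i. conn (?H a) y (s i)"
      by (elim exE conjE)
    have "range r \<inter> range s = {}"
    proof (rule ccontr)
      assume "range r \<inter> range s \<noteq> {}"
      then obtain i j where "r i = s j" by auto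
      then have "conn (?H a) x y" using conn_trans[OF spec[OF r(3), of i]] conn_sym[OF spec[OF s(3), of j]] by simp
      moreover have "?H a \<subseteq> ?H b" using e(2,3) by auto
      ultimately have "conn (?H b) x y" by (rule conn_mono)
      then show False using nc by simp
    qed
    then have "extended_path_edges V E x y (ray_edges r \<union> ray_edges s)"
      unfolding extended_path_edges_def using r(1) s(1) by blast
    then obtain e' where "e' \<in> ray_edges r \<union> ray_edges s" "\<phi> ?e \<le> \<phi> e'" using w unfolding WMSF_def by blast
    then show False using r(2) s(2) e(2) by fastforce
  qed
  ultimately show ?thesis by blast
qed

text \<open>If \<open>x\<close> and \<open>y\<close> are badly connected although opening \<open>{x, x'}\<close> would connect them, then this edge witnesses the failure.\<close>

lemma edge_modification:
  fixes \<phi> :: "'v set \<Rightarrow> real"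
  assumes e: "{x, x'} \<in> E" and ab: "a < b'" "b' < b"
    and R: "infcl {f \<in> E. \<phi> f < a} x" "infcl {f \<in> E. \<phi> f < a} y" "\<not> conn {f \<in> E. \<phi> f < b} x y"
    and Z: "conn (insert {x, x'} {f \<in> E - {{x, x'}}. \<phi> f < b'}) x' y"
  shows "infcl {f \<in> E - {{x, x'}}. \<phi> f < b'} x \<and> infcl {f \<in> E - {{x, x'}}. \<phi> f < b'} x' \<and>
    \<not> conn {f \<in> E - {{x, x'}}. \<phi> f < b} x x'"
proof -
  let ?H = "\<lambda>c. {f \<in> E - {{x, x'}}. \<phi> f < c}" and ?L = "\<lambda>c. {f \<in> E. \<phi> f < c}"
  have HL: "?H b' \<subseteq> ?L b" "?H b' \<subseteq> ?H b" "?H b \<subseteq> ?L b" using ab by auto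
  have "\<not> conn (?H b') x y" using R(3) conn_mono[OF _ HL(1)] by blast
  then have c: "conn (?H b') x' y" using conn_insert[OF Z] by blast
  have c': "conn (?L b) x' y" by (rule conn_mono[OF c HL(1)])
  have n: "\<not> conn (?L b) x x'" using R(3) conn_trans[OF _ c'] by blast
  then have "\<not> conn (?H b) x x'" using conn_mono[OF _ HL(3)] by blast
  moreover have "{x, x'} \<notin> ?L b" using n conn_edge[of x x' "?L b"] by blast
  then have aH: "?L a \<subseteq> ?H b'" using ab e by auto
  have "infcl (?H b') x" "infcl (?H b') y" by (rule infcl_mono[OF R(1) aH], rule infcl_mono[OF R(2) aH])
  moreover have "infcl (?H b') x'" by (rule infcl_conn[OF \<open>infcl (?H b') y\<close> conn_sym[OF c]])
  ultimately show ?thesis by blast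
qed

lemma countable_E: "countable E"
proof (cases "V = {}")
  case True
  then have "E = {}" using edge by blast
  then show ?thesis by simp
next
  case False
  then obtain x where x: "x \<in> V" by blast
  have "V \<subseteq> (\<Union>n. nb E n x)" using conn_nb connected[OF x] by blast
  moreover have "countable (\<Union>n. nb E n x)" using finite_nb[OF x] by (intro countable_UN) (auto intro: countable_finite)
  ultimately have "countable V" by (rule countable_subset)
  then have "countable ((\<lambda>(x, y). {x, y}) ` (V \<times> V))" by simp
  moreover have "E \<subseteq> (\<lambda>(x, y). {x, y}) ` (V \<times> V)" using edge by fastforce
  ultimately show ?thesis by (rule countable_subset[rotated])
qed

end

section \<open>Random labels\<close>

text \<open>Such events are measurable, because \<open>E\<close> is countable, and their
  probabilities are limits of those on finite edge sets. Infinite clusters enter only as countable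
  intersections of them.\<close>

definition finitary :: "('e set \<Rightarrow> bool) \<Rightarrow> bool" where
  "finitary A \<longleftrightarrow> incr A \<and> (\<forall>\<xi>. A \<xi> \<longrightarrow> (\<exists>C\<subseteq>\<xi>. finite C \<and> A C))"

lemma finitary_conn: "finitary (\<lambda>\<xi>. conn \<xi> x y)" unfolding finitary_def
proof (intro conjI allI impI incr_conn(2))
  fix \<xi> assume "conn \<xi> x y"
  then obtain xs where xs: "spath \<xi> x y xs" by (rule conn_spath)
  then show "\<exists>C\<subseteq>\<xi>. finite C \<and> conn C x y"
    using spath_conn[OF spath_sub[OF xs]] by (intro exI[of _ "path_edges xs"]) (auto simp: spath_def)
qed

lemma finitary_out: "finitary (\<lambda>\<xi>. out B \<xi> x)" unfolding finitary_def
proof (intro conjI allI impI incr_out)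
  fix \<xi> assume "out B \<xi> x"
  then obtain u where u: "u \<notin> B" "conn \<xi> x u" by (auto simp: out_def)
  obtain C where "C \<subseteq> \<xi>" "finite C" "conn C x u" using finitary_conn[of x u] u(2) unfolding finitary_def by blast
  then show "\<exists>C\<subseteq>\<xi>. finite C \<and> out B C x" using u(1) by (auto simp: out_def)
qed

lemma finitary_conj: "finitary A \<Longrightarrow> finitary B \<Longrightarrow> finitary (\<lambda>\<xi>. A \<xi> \<and> B \<xi>)" unfolding finitary_def
proof (elim conjE, intro conjI allI impI)
  assume A: "incr A" "\<forall>\<xi>. A \<xi> \<longrightarrow> (\<exists>C\<subseteq>\<xi>. finite C \<and> A C)"
    and B: "incr B" "\<forall>\<xi>. B \<xi> \<longrightarrow> (\<exists>C\<subseteq>\<xi>. finite C \<and> B C)"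
  show "incr (\<lambda>\<xi>. A \<xi> \<and> B \<xi>)" using A(1) B(1) by (auto simp: incr_def)
  fix \<xi> assume "A \<xi> \<and> B \<xi>"
  then obtain C D where C: "C \<subseteq> \<xi>" "finite C" "A C" and D: "D \<subseteq> \<xi>" "finite D" "B D" using A(2) B(2) by meson
  have "A (C \<union> D)" "B (C \<union> D)" using incrD[OF A(1) _ C(3)] incrD[OF B(1) _ D(3)] by auto
  then show "\<exists>C\<subseteq>\<xi>. finite C \<and> A C \<and> B C" using C D by (intro exI[of _ "C \<union> D"]) auto
qed

text \<open>A countable union over finite witnesses. The fixed set \<open>D\<close> lets an edge be
  declared open, and the family \<open>X\<close> may be the labels themselves or the coordinates of
  a product space.\<close>

lemma pred_finitary:
  fixes X :: "'e \<Rightarrow> 'w \<Rightarrow> real"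
  assumes A: "finitary A" and I: "countable I" and X: "\<And>f. f \<in> I \<Longrightarrow> X f \<in> borel_measurable N"
  shows "Measurable.pred N (\<lambda>w. A (D \<union> {f \<in> I. X f w < a}))"
proof -
  let ?C = "{C. finite C \<and> C \<subseteq> I \<and> A (D \<union> C)}"
  have eq: "A (D \<union> {f \<in> I. X f w < a}) \<longleftrightarrow> (\<exists>C\<in>?C. \<forall>f\<in>C. X f w < a)" for w
  proof
    assume "A (D \<union> {f \<in> I. X f w < a})"
    then obtain C where C: "C \<subseteq> D \<union> {f \<in> I. X f w < a}" "finite C" "A C" using A unfolding finitary_def by blast
    have "A (D \<union> (C - D))" by (rule incrD[of A C]) (use A C in \<open>auto simp: finitary_def\<close>)
    then show "\<exists>C\<in>?C. \<forall>f\<in>C. X f w < a" using C by (intro bexI[of _ "C - D"]) auto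
  next
    assume "\<exists>C\<in>?C. \<forall>f\<in>C. X f w < a"
    then obtain C where C: "C \<subseteq> I" "A (D \<union> C)" "\<forall>f\<in>C. X f w < a" by auto
    have "D \<union> C \<subseteq> D \<union> {f \<in> I. X f w < a}" using C by auto
    then show "A (D \<union> {f \<in> I. X f w < a})" using incrD[of A "D \<union> C"] A C(2) by (simp add: finitary_def)
  qed
  have "countable {C. finite C \<and> C \<subseteq> I}" using I by (rule countable_Collect_finite_subset)
  then have c: "countable ?C" by (rule countable_subset[rotated]) auto
  show ?thesis unfolding eq pred_def
  proof (rule sets.sets_Collect_countable_Ex'[OF _ c])
    fix C assume "C \<in> ?C"
    then have C: "finite C" "C \<subseteq> I" by auto
    have "Measurable.pred N (\<lambda>w. \<forall>f\<in>C. X f w < a)"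
    proof (rule pred_intros_finite(3)[OF C(1)])
      fix f assume "f \<in> C"
      then have [measurable]: "X f \<in> borel_measurable N" using X C by blast
      show "Measurable.pred N (\<lambda>w. X f w < a)" by measurable
    qed
    then show "{w \<in> space N. \<forall>f\<in>C. X f w < a} \<in> sets N" by (simp add: pred_def)
  qed
qed

locale labelled = conn_graph V E + prob_space M for V :: "'v set" and E :: "'v set set" and M :: "'w measure" +
  fixes l :: "'v set \<Rightarrow> 'w \<Rightarrow> real"
  assumes indep: "indep_vars (\<lambda>_. borel) l E"
    and unif: "e \<in> E \<Longrightarrow> distr M borel (l e) = uniform_measure lborel {0..1}"
begin

definition lev :: "real \<Rightarrow> 'w \<Rightarrow> 'v set set" where
  "lev a w = {f \<in> E. l f w < a}"

lemma lev_E: "lev a w \<subseteq> E" by (auto simp: lev_def)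

lemma meas_l [measurable]: "e \<in> E \<Longrightarrow> l e \<in> borel_measurable M" using indep by (auto simp: indep_vars_def)

lemma prob_l:
  assumes e: "e \<in> E" and B: "B \<in> sets borel"
  shows "prob (l e -` B \<inter> space M) = measure lborel ({0..1} \<inter> B)"
proof -
  have "prob (l e -` B \<inter> space M) = measure (distr M borel (l e)) B" using e B by (intro measure_distr[symmetric]) auto
  also have "\<dots> = measure lborel ({0..1} \<inter> B)" unfolding unif[OF e] using B by (subst measure_uniform_measure) auto
  finally show ?thesis .
qed

lemma prob_piece:
  assumes F: "finite F" "F \<subseteq> E" and T: "T \<subseteq> F" and a: "0 \<le> a" "a \<le> 1"
  shows "prob {w \<in> space M. {f \<in> F. l f w < a} = T} = a ^ card T * (1 - a) ^ card (F - T)"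
proof (cases "F = {}")
  case True
  then show ?thesis using T prob_space by simp
next
  case False
  let ?B = "\<lambda>f. if f \<in> T then {..<a} else {a..}"
  have "{w \<in> space M. {f \<in> F. l f w < a} = T} = (\<Inter>f\<in>F. l f -` ?B f \<inter> space M)" using T False by (auto split: if_splits)
  also have "prob \<dots> = (\<Prod>f\<in>F. prob (l f -` ?B f \<inter> space M))" by (rule indep_varsD[OF indep False F(1,2)]) auto
  also have "\<dots> = (\<Prod>f\<in>F. if f \<in> T then a else 1 - a)"
  proof (rule prod.cong[OF refl])
    fix f assume "f \<in> F"
    then have f: "f \<in> E" using F by auto
    have "{0..1} \<inter> {..<a} = {0..<a}" "{0..1} \<inter> {a..} = {a..1}" using a by auto
    then show "prob (l f -` ?B f \<inter> space M) = (if f \<in> T then a else 1 - a)"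
      using prob_l[OF f, of "{..<a}"] prob_l[OF f, of "{a..}"] a by simp
  qed
  also have "\<dots> = a ^ card (F \<inter> {f. f \<in> T}) * (1 - a) ^ card (F \<inter> - {f. f \<in> T})" using F(1) by (simp add: prod.If_cases)
  also have "F \<inter> {f. f \<in> T} = T" using T by auto
  also have "F \<inter> - {f. f \<in> T} = F - T" by auto
  finally show ?thesis .
qed

lemma meas_piece:
  assumes F: "finite F" "F \<subseteq> E"
  shows "{w \<in> space M. {f \<in> F. l f w < a} = T} \<in> sets M"
proof -
  have "{f \<in> F. l f w < a} = T \<longleftrightarrow> T \<subseteq> F \<and> (\<forall>f\<in>F. (l f w < a) = (f \<in> T))" for w by blast
  moreover have "Measurable.pred M (\<lambda>w. \<forall>f\<in>F. (l f w < a) = (f \<in> T))"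
  proof (rule pred_intros_finite(3)[OF F(1)])
    fix f assume "f \<in> F"
    then have [measurable]: "l f \<in> borel_measurable M" using F by auto
    show "Measurable.pred M (\<lambda>w. (l f w < a) = (f \<in> T))" by measurable
  qed
  ultimately show ?thesis by (cases "T \<subseteq> F") (simp_all add: pred_def)
qed

lemma prob_Pr:
  assumes F: "finite F" "F \<subseteq> E" and a: "0 \<le> a" "a \<le> 1"
  shows "prob {w \<in> space M. A {f \<in> F. l f w < a}} = Pr a F A"
proof -
  let ?T = "{T. T \<subseteq> F \<and> A T}"
  have fT: "finite ?T" using F(1) by simp
  have "{w \<in> space M. A {f \<in> F. l f w < a}} = (\<Union>T\<in>?T. {w \<in> space M. {f \<in> F. l f w < a} = T})" by auto
  also have "prob \<dots> = (\<Sum>T\<in>?T. prob {w \<in> space M. {f \<in> F. l f w < a} = T})"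
    using meas_piece[OF F] by (intro finite_measure_finite_Union fT) (auto simp: disjoint_family_on_def)
  also have "\<dots> = (\<Sum>T\<in>?T. a ^ card T * (1 - a) ^ card (F - T))" using prob_piece[OF F _ a] by (intro sum.cong) auto
  also have "\<dots> = Pr a F A" unfolding Ex_def using F(1) by (intro sum.mono_neutral_cong_left) auto
  finally show ?thesis .
qed

lemma pred_lev: "finitary A \<Longrightarrow> Measurable.pred M (\<lambda>w. A (lev a w))"
  using pred_finitary[of A E l M "{}" a] countable_E by (simp add: lev_def)

lemma Pr_le_prob:
  assumes F: "finite F" "F \<subseteq> E" and a: "0 \<le> a" "a \<le> 1" and A: "finitary A"
  shows "Pr a F A \<le> prob {w \<in> space M. A (lev a w)}" unfolding prob_Pr[OF F a, symmetric]
proof (rule finite_measure_mono)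
  show "{w \<in> space M. A (lev a w)} \<in> sets M" using pred_lev[OF A] by (simp add: pred_def)
  have sub: "{f \<in> F. l f w < a} \<subseteq> lev a w" for w using F by (auto simp: lev_def)
  have incA: "incr A" using A by (simp add: finitary_def)
  show "{w \<in> space M. A {f \<in> F. l f w < a}} \<subseteq> {w \<in> space M. A (lev a w)}" using incrD[OF incA sub] by auto
qed

lemma prob_le_Pr:
  assumes A: "finitary A" and a: "0 \<le> a" "a \<le> 1" and c: "\<And>F. finite F \<Longrightarrow> F \<subseteq> E \<Longrightarrow> Pr a F A \<le> c"
  shows "prob {w \<in> space M. A (lev a w)} \<le> c"
proof -
  \<comment> \<open>An exhaustion of \<open>E\<close> by finite sets along an enumeration.\<close>
  define F where "F = (\<lambda>n. {f \<in> E. to_nat_on E f < n})"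
  have inj: "inj_on (to_nat_on E) E" using countable_E by (rule inj_on_to_nat_on)
  have F: "finite (F n)" "F n \<subseteq> E" for n
  proof -
    show "finite (F n)"
      by (rule inj_on_finite[of "to_nat_on E" _ "{..<n}"]) (auto simp: F_def intro: inj_on_subset[OF inj])
  qed (auto simp: F_def)
  let ?S = "\<lambda>n. {w \<in> space M. A {f \<in> F n. l f w < a}}"
  have incA: "incr A" using A by (simp add: finitary_def)
  have "?S n \<in> sets M" for n
  proof -
    have "Measurable.pred M (\<lambda>w. A ({} \<union> {f \<in> F n. l f w < a}))"
      by (rule pred_finitary[OF A countable_finite[OF F(1)]], rule meas_l) (use F(2) in blast)
    then show ?thesis by (simp add: pred_def)
  qed
  moreover have "incseq ?S"
  proof (rule incseq_SucI)
    fix n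
    have "{f \<in> F n. l f w < a} \<subseteq> {f \<in> F (Suc n). l f w < a}" for w by (auto simp: F_def)
    from incrD[OF incA this] show "?S n \<subseteq> ?S (Suc n)" by auto
  qed
  ultimately have lim: "(\<lambda>n. prob (?S n)) \<longlonglongrightarrow> prob (\<Union>n. ?S n)" by (intro finite_Lim_measure_incseq) auto
  have "{w \<in> space M. A (lev a w)} \<subseteq> (\<Union>n. ?S n)"
  proof
    fix w assume w: "w \<in> {w \<in> space M. A (lev a w)}"
    then obtain C where C: "C \<subseteq> lev a w" "finite C" "A C" using A unfolding finitary_def by blast
    define n where "n = Suc (\<Sum>f\<in>C. to_nat_on E f)"
    have "C \<subseteq> {f \<in> F n. l f w < a}"
    proof
      fix f assume f: "f \<in> C"
      have "to_nat_on E f \<le> (\<Sum>f\<in>C. to_nat_on E f)" using f C(2) by (intro member_le_sum) auto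
      then show "f \<in> {f \<in> F n. l f w < a}" using f C(1) by (auto simp: F_def n_def lev_def)
    qed
    from incrD[OF incA this C(3)] have "A {f \<in> F n. l f w < a}" .
    then show "w \<in> (\<Union>n. ?S n)" using w by blast
  qed
  then have "prob {w \<in> space M. A (lev a w)} \<le> prob (\<Union>n. ?S n)"
    using \<open>\<And>n. ?S n \<in> sets M\<close> by (intro finite_measure_mono) auto
  also have "\<dots> \<le> c" using prob_Pr[OF F a] c[OF F] by (intro LIMSEQ_le_const2[OF lim]) auto
  finally show ?thesis .
qed

section \<open>Varying the label of one edge\<close>

lemma null_off_edge:
  assumes e: "e \<in> E" and Z: "Measurable.pred (PiM (E - {e}) (\<lambda>_. borel)) Z" and ab: "0 \<le> a" "a < b" "b \<le> 1"
    and null: "AE w in M. \<not> (Z (restrict (\<lambda>f. l f w) (E - {e})) \<and> a \<le> l e w \<and> l e w < b)"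
  shows "AE w in M. \<not> Z (restrict (\<lambda>f. l f w) (E - {e}))"
proof -
  let ?N = "PiM (E - {e}) (\<lambda>_. borel) :: ('v set \<Rightarrow> real) measure" and ?N' = "PiM {e} (\<lambda>_. borel) :: ('v set \<Rightarrow> real) measure"
  let ?X = "\<lambda>w. restrict (\<lambda>f. l f w) (E - {e})" and ?Y = "\<lambda>w. restrict (\<lambda>f. l f w) {e}"
  let ?A = "{\<phi> \<in> space ?N. Z \<phi>}" and ?B = "{\<phi> \<in> space ?N'. a \<le> \<phi> e \<and> \<phi> e < b}"
  \<comment> \<open>Independence factors the probability of the null event; the factor belonging to
    the label of \<open>e\<close> is \<open>b - a > 0\<close>, so the other one vanishes.\<close>
  have ind: "indep_var ?N ?X ?N' ?Y" by (rule indep_var_restrict[OF indep]) (use e in auto)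
  have A: "?A \<in> sets ?N" using Z by (simp add: pred_def)
  have B: "?B \<in> sets ?N'" by measurable
  have X [measurable]: "?X \<in> measurable M ?N" by (rule measurable_restrict) auto
  have Y [measurable]: "?Y \<in> measurable M ?N'" using e by (intro measurable_restrict) auto
  have "prob ((\<lambda>w. (?X w, ?Y w)) -` (?A \<times> ?B) \<inter> space M) = prob (?X -` ?A \<inter> space M) * prob (?Y -` ?B \<inter> space M)"
    by (rule indep_varD[OF ind A B])
  moreover have "prob ((\<lambda>w. (?X w, ?Y w)) -` (?A \<times> ?B) \<inter> space M) = 0"
  proof -
    have "(\<lambda>w. (?X w, ?Y w)) -` (?A \<times> ?B) \<inter> space M = (?X -` ?A \<inter> space M) \<inter> (?Y -` ?B \<inter> space M)" by auto
    also have "\<dots> \<in> sets M" using measurable_sets[OF X A] measurable_sets[OF Y B] by blast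
    finally have s: "(\<lambda>w. (?X w, ?Y w)) -` (?A \<times> ?B) \<inter> space M \<in> sets M" .
    have "AE w in M. w \<notin> (\<lambda>w. (?X w, ?Y w)) -` (?A \<times> ?B) \<inter> space M" using null by eventually_elim auto
    then show ?thesis unfolding prob_eq_0[OF s] .
  qed
  moreover have "prob (?Y -` ?B \<inter> space M) = b - a"
  proof -
    have "?Y -` ?B \<inter> space M = l e -` {a..<b} \<inter> space M" by (auto simp: space_PiM)
    moreover have "{0..1} \<inter> {a..<b} = {a..<b}" using ab by auto
    ultimately show ?thesis using prob_l[OF e, of "{a..<b}"] ab by simp
  qed
  ultimately have p0: "prob (?X -` ?A \<inter> space M) = 0" using ab by simp
  have sX: "?X -` ?A \<inter> space M \<in> sets M" by (rule measurable_sets[OF X A])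
  have "AE w in M. w \<notin> ?X -` ?A \<inter> space M" using p0 unfolding prob_eq_0[OF sX] .
  moreover have "AE w in M. w \<in> space M" by (rule AE_space)
  ultimately show ?thesis
  proof eventually_elim
    case (elim w)
    then show ?case using measurable_space[OF X, of w] by auto
  qed
qed

lemma pred_off_infcl:
  assumes "I \<subseteq> E" "D \<subseteq> E" "x \<in> V"
  shows "Measurable.pred (PiM I (\<lambda>_. borel)) (\<lambda>\<phi> :: 'v set \<Rightarrow> real. infcl (D \<union> {f \<in> I. \<phi> f < a}) x)"
proof -
  have "D \<union> {f \<in> I. \<phi> f < a} \<subseteq> E" for \<phi> :: "'v set \<Rightarrow> real" using assms by auto
  note iff = infcl_iff[OF this assms(3)]
  have "Measurable.pred (PiM I (\<lambda>_. borel)) (\<lambda>\<phi> :: 'v set \<Rightarrow> real. out (nb E n x) (D \<union> {f \<in> I. \<phi> f < a}) x)" for n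
    by (rule pred_finitary[OF finitary_out, where X = "\<lambda>f \<phi>. \<phi> f"])
      (use countable_subset[OF assms(1) countable_E] in auto)
  then show ?thesis unfolding iff by (rule pred_intros_countable)
qed

lemma pred_off_conn:
  assumes "I \<subseteq> E"
  shows "Measurable.pred (PiM I (\<lambda>_. borel)) (\<lambda>\<phi> :: 'v set \<Rightarrow> real. conn (D \<union> {f \<in> I. \<phi> f < a}) x y)"
  by (rule pred_finitary[OF finitary_conn, where X = "\<lambda>f \<phi>. \<phi> f"])
    (use countable_subset[OF assms countable_E] in auto)

definition lev' :: "'v set \<Rightarrow> real \<Rightarrow> 'w \<Rightarrow> 'v set set" where
  "lev' e a w = {f \<in> E - {e}. l f w < a}"

lemma lev'_restrict: "{f \<in> E - {e}. restrict (\<lambda>f. l f w) (E - {e}) f < a} = lev' e a w"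
  unfolding lev'_def by (intro Collect_cong conj_cong refl) simp

text \<open>Were the two forests equal, the label of \<open>e\<close>, being independent of the rest, could not fall in \<open>[a, b)\<close>.\<close>

lemma edge_null:
  assumes eq: "AE w in M. WMSF V E (\<lambda>e. l e w) = FMSF V E (\<lambda>e. l e w)"
    and e: "{x, y} \<in> E" and ab: "0 \<le> a" "a < b" "b \<le> 1"
  shows "AE w in M. \<not> (infcl (lev' {x, y} a w) x \<and> infcl (lev' {x, y} a w) y \<and> \<not> conn (lev' {x, y} b w) x y)"
proof -
  let ?I = "E - {{x, y}}"
  define Z where "Z = (\<lambda>\<phi> :: 'v set \<Rightarrow> real. infcl ({} \<union> {f \<in> ?I. \<phi> f < a}) x \<and> infcl ({} \<union> {f \<in> ?I. \<phi> f < a}) y \<and>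
    \<not> conn ({} \<union> {f \<in> ?I. \<phi> f < b}) x y)"
  have V: "x \<in> V" "y \<in> V" using edge_V[OF e] by auto
  have Zr: "Z (restrict (\<lambda>f. l f w) ?I) \<longleftrightarrow>
      infcl (lev' {x, y} a w) x \<and> infcl (lev' {x, y} a w) y \<and> \<not> conn (lev' {x, y} b w) x y" for w
    unfolding Z_def lev'_restrict by simp
  have "Measurable.pred (PiM ?I (\<lambda>_. borel)) Z"
    unfolding Z_def using V by (intro pred_intros_logic pred_off_infcl pred_off_conn) auto
  moreover have "AE w in M. \<not> (Z (restrict (\<lambda>f. l f w) ?I) \<and> a \<le> l {x, y} w \<and> l {x, y} w < b)" using eq
  proof eventually_elim
    case (elim w)
    then show ?case unfolding Zr lev'_def using forest_diff[OF e, of a "\<lambda>e. l e w" b] by blast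
  qed
  ultimately have "AE w in M. \<not> Z (restrict (\<lambda>f. l f w) ?I)" by (rule null_off_edge[OF e _ ab])
  then show ?thesis unfolding Zr .
qed

text \<open>Induction along a path from \<open>y\<close>. Declaring the new edge open, the induction
  hypothesis for \<open>a < b'\<close> joins \<open>x'\<close> to \<open>y\<close>; then
  \<open>edge_modification\<close>, together with \<open>edge_null\<close> for
  \<open>b' < b\<close>, excludes the exceptional event for the true label of that edge.\<close>

lemma merge:
  assumes eq: "AE w in M. WMSF V E (\<lambda>e. l e w) = FMSF V E (\<lambda>e. l e w)"
    and c: "conn E y x" and y: "y \<in> V"
  shows "\<forall>a b. 0 < a \<longrightarrow> a < b \<longrightarrow> b < 1 \<longrightarrow>
    (AE w in M. \<not> (infcl (lev a w) x \<and> infcl (lev a w) y \<and> \<not> conn (lev b w) x y))"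
  using c
proof (induction rule: conn_induct)
  case (step x' x)
  have e: "{x, x'} \<in> E" using step(2) by (simp add: insert_commute)
  let ?e = "{x, x'}" and ?I = "E - {{x, x'}}"
  have V: "x \<in> V" "x' \<in> V" using edge_V[OF e] by auto
  show ?case
  proof (intro allI impI)
    fix a b :: real assume ab: "0 < a" "a < b" "b < 1"
    define b' where "b' = (a + b) / 2"
    have b': "a < b'" "b' < b" using ab by (auto simp: b'_def)
    define Z where "Z = (\<lambda>\<phi> :: 'v set \<Rightarrow> real. infcl ({?e} \<union> {f \<in> ?I. \<phi> f < a}) x \<and> infcl ({?e} \<union> {f \<in> ?I. \<phi> f < a}) y \<and>
      \<not> conn ({?e} \<union> {f \<in> ?I. \<phi> f < b'}) x' y)"
    have Zr: "Z (restrict (\<lambda>f. l f w) ?I) \<longleftrightarrow> infcl (insert ?e (lev' ?e a w)) x \<and> infcl (insert ?e (lev' ?e a w)) y \<and>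
        \<not> conn (insert ?e (lev' ?e b' w)) x' y" for w
      unfolding Z_def lev'_restrict by simp
    have pZ: "Measurable.pred (PiM ?I (\<lambda>_. borel)) Z"
      unfolding Z_def using V y e by (intro pred_intros_logic pred_off_infcl pred_off_conn) auto
    \<comment> \<open>When the edge has a label below \<open>a\<close>, the sets in \<open>Z\<close>
      are the true level sets and \<open>x'\<close> belongs to the infinite cluster of
      \<open>x\<close>, so the induction hypothesis applies.\<close>
    have null: "AE w in M. \<not> (Z (restrict (\<lambda>f. l f w) ?I) \<and> 0 \<le> l ?e w \<and> l ?e w < a)"
    proof -
      have "AE w in M. \<not> (infcl (lev a w) x' \<and> infcl (lev a w) y \<and> \<not> conn (lev b' w) x' y)" using step(3) ab b' by simp
      then show ?thesis
      proof eventually_elim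
        case (elim w)
        have "\<not> (infcl (insert ?e (lev' ?e a w)) x \<and> infcl (insert ?e (lev' ?e a w)) y \<and> \<not> conn (insert ?e (lev' ?e b' w)) x' y)"
          if "l ?e w < a"
        proof -
          have L: "insert ?e (lev' ?e a w) = lev a w" "insert ?e (lev' ?e b' w) = lev b' w"
            using that e b' by (auto simp: lev_def lev'_def)
          have "conn (lev a w) x x'" using that e by (intro conn_edge) (simp add: lev_def)
          then show ?thesis unfolding L using elim infcl_conn[of "lev a w" x x'] by blast
        qed
        then show ?case unfolding Zr by blast
      qed
    qed
    have "AE w in M. \<not> Z (restrict (\<lambda>f. l f w) ?I)"
      by (rule null_off_edge[OF e pZ order_refl _ _ null]) (use ab in auto)
    moreover have "AE w in M. \<not> (infcl (lev' ?e b' w) x \<and> infcl (lev' ?e b' w) x' \<and> \<not> conn (lev' ?e b w) x x')"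
      by (rule edge_null[OF eq e]) (use ab b' in auto)
    ultimately show "AE w in M. \<not> (infcl (lev a w) x \<and> infcl (lev a w) y \<and> \<not> conn (lev b w) x y)"
    proof eventually_elim
      case (elim w)
      show ?case
      proof
        assume R: "infcl (lev a w) x \<and> infcl (lev a w) y \<and> \<not> conn (lev b w) x y"
        then have R': "infcl (lev a w) x" "infcl (lev a w) y" by auto
        have "lev a w \<subseteq> insert ?e (lev' ?e a w)" by (auto simp: lev_def lev'_def)
        from infcl_mono[OF R'(1) this] infcl_mono[OF R'(2) this]
        have "infcl (insert ?e (lev' ?e a w)) x" "infcl (insert ?e (lev' ?e a w)) y" .
        then have "conn (insert ?e (lev' ?e b' w)) x' y" using elim(1) unfolding Zr by blast
        then show False using edge_modification[OF e b', of "\<lambda>f. l f w" y] R elim(2) unfolding lev_def lev'_def by blast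
      qed
    qed
  qed
qed simp

lemma forests_differ:
  assumes T: "tilted V E \<Gamma> h Orb rt Reps t0 g dg D L"
  shows "\<not> (AE w in M. WMSF V E (\<lambda>e. l e w) = FMSF V E (\<lambda>e. l e w))"
proof
  assume eq: "AE w in M. WMSF V E (\<lambda>e. l e w) = FMSF V E (\<lambda>e. l e w)"
  interpret T: tilted V E \<Gamma> h Orb rt Reps t0 g dg D L by (rule T)
  from T.phase obtain a b c Y where ph: "0 < a" "a < b" "b < 1" "0 < c" "T.XX b Y"
    "\<forall>x\<in>Orb. \<forall>n. \<exists>F. finite F \<and> F \<subseteq> E \<and> c \<le> Pr a F (\<lambda>\<xi>. out (nb E n x) \<xi> x)" by (elim exE conjE)
  have rV: "rt \<in> V" by (rule T.rt_V)
  have lower: "c * c \<le> prob {w \<in> space M. conn (lev b w) rt y}" if y: "y \<in> Orb" for y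
  proof -
    have yV: "y \<in> V" using y T.Orb_sub by blast
    \<comment> \<open>Harris' inequality is applied on finite edge sets to the approximating events
      for balls of radius \<open>n\<close>; only then does \<open>n\<close> tend to
      infinity.\<close>
    let ?A = "\<lambda>n \<xi>. out (nb E n rt) \<xi> rt \<and> out (nb E n y) \<xi> y"
    let ?S = "\<lambda>n. {w \<in> space M. ?A n (lev a w)}"
    have fA: "finitary (?A n)" for n by (intro finitary_conj finitary_out)
    have S: "?S n \<in> sets M" for n using pred_lev[OF fA[of n]] by (simp add: pred_def)
    have "decseq ?S"
    proof (rule decseq_SucI)
      fix n
      have "out (nb E n z) \<xi> z" if "out (nb E (Suc n) z) \<xi> z" for \<xi> z
        using that nb_mono[of n "Suc n" E z] by (auto simp: out_def)
      then show "?S (Suc n) \<subseteq> ?S n" by blast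
    qed
    then have lim: "(\<lambda>n. prob (?S n)) \<longlonglongrightarrow> prob (\<Inter>n. ?S n)" using S by (intro finite_Lim_measure_decseq) auto
    have "c * c \<le> prob (?S n)" for n
    proof -
      obtain F1 where F1: "finite F1" "F1 \<subseteq> E" "c \<le> Pr a F1 (\<lambda>\<xi>. out (nb E n rt) \<xi> rt)" using ph(6) T.rt by blast
      obtain F2 where F2: "finite F2" "F2 \<subseteq> E" "c \<le> Pr a F2 (\<lambda>\<xi>. out (nb E n y) \<xi> y)" using ph(6) y by blast
      let ?F = "F1 \<union> F2"
      have F: "finite ?F" "?F \<subseteq> E" using F1 F2 by auto
      have a01: "0 \<le> a" "a \<le> 1" using ph by auto
      have "c \<le> Pr a ?F (\<lambda>\<xi>. out (nb E n rt) \<xi> rt)"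
        by (rule order_trans[OF F1(3) Pr_mono_set[OF a01 F(1) _ incr_out]]) auto
      moreover have "c \<le> Pr a ?F (\<lambda>\<xi>. out (nb E n y) \<xi> y)"
        by (rule order_trans[OF F2(3) Pr_mono_set[OF a01 F(1) _ incr_out]]) auto
      ultimately have "c * c \<le> Pr a ?F (\<lambda>\<xi>. out (nb E n rt) \<xi> rt) * Pr a ?F (\<lambda>\<xi>. out (nb E n y) \<xi> y)"
        using ph a01 by (intro mult_mono) auto
      also have "\<dots> \<le> Pr a ?F (?A n)" by (rule Harris_Pr[OF F(1) a01 incr_out incr_out])
      also have "\<dots> \<le> prob (?S n)" by (rule Pr_le_prob[OF F a01 fA])
      finally show ?thesis .
    qed
    then have "c * c \<le> prob (\<Inter>n. ?S n)" by (intro LIMSEQ_le_const[OF lim]) auto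
    also have "\<dots> \<le> prob {w \<in> space M. conn (lev b w) rt y}"
    proof (rule finite_measure_mono_AE)
      show "{w \<in> space M. conn (lev b w) rt y} \<in> sets M" using pred_lev[OF finitary_conn] by (simp add: pred_def)
      have "AE w in M. \<not> (infcl (lev a w) rt \<and> infcl (lev a w) y \<and> \<not> conn (lev b w) rt y)"
        using merge[OF eq connected[OF yV rV] yV] ph by blast
      then show "AE w in M. w \<in> (\<Inter>n. ?S n) \<longrightarrow> w \<in> {w \<in> space M. conn (lev b w) rt y}"
      proof eventually_elim
        case (elim w)
        show ?case
        proof
          assume w: "w \<in> (\<Inter>n. ?S n)"
          then have "infcl (lev a w) rt" "infcl (lev a w) y"
            unfolding infcl_iff[OF lev_E rV] infcl_iff[OF lev_E yV] by blast+
          then show "w \<in> {w \<in> space M. conn (lev b w) rt y}" using elim w by blast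
        qed
      qed
    qed
    finally show ?thesis .
  qed
  have cc: "0 < c * c" using ph(4) by simp
  \<comment> \<open>Half of the constant is given up because finite edge sets only approximate the
    probability from below.\<close>
  have "\<exists>F. finite F \<and> F \<subseteq> E \<and> c * c / 2 \<le> tau b F rt y" if y: "y \<in> Orb" for y
  proof (rule ccontr)
    assume n: "\<not> ?thesis"
    have "prob {w \<in> space M. conn (lev b w) rt y} \<le> c * c / 2"
    proof (rule prob_le_Pr[OF finitary_conn])
      fix F assume "finite F" "F \<subseteq> E"
      then show "tau b F rt y \<le> c * c / 2" using n by (meson linear)
    qed (use ph in auto)
    then show False using lower[OF y] cc by simp
  qed
  then have "\<forall>y\<in>Orb. \<exists>F. finite F \<and> F \<subseteq> E \<and> c * c / 2 \<le> tau b F rt y" by blast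
  from bchoice[OF this] obtain F0 where F0: "\<forall>y\<in>Orb. finite (F0 y) \<and> F0 y \<subseteq> E \<and> c * c / 2 \<le> tau b (F0 y) rt y" ..
  obtain n :: nat where n: "Y / (c * c / 2) < n" using reals_Archimedean2 by blast
  obtain A where A: "A \<subseteq> Orb" "finite A" "card A = n" "\<forall>y\<in>A. h rt \<le> h y" using T.many_up by blast
  define F where "F = (\<Union>y\<in>A. F0 y)"
  have F: "finite F" "F \<subseteq> E" using A F0 by (auto simp: F_def)
  have "real n * (c * c / 2) = (\<Sum>y\<in>A. c * c / 2)" using A(3) by simp
  also have "\<dots> \<le> (\<Sum>y\<in>A. tau b F rt y * exp ((h y - h rt) / 2))"
  proof (rule sum_mono)
    fix y assume y: "y \<in> A"
    have "c * c / 2 \<le> tau b (F0 y) rt y" using F0 y A by blast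
    also have "\<dots> \<le> tau b F rt y" using ph y F by (intro Pr_mono_set incr_conn) (auto simp: F_def)
    finally have 1: "c * c / 2 \<le> tau b F rt y" .
    have 2: "1 \<le> exp ((h y - h rt) / 2)" using A(4) y by simp
    have "c * c / 2 * 1 \<le> tau b F rt y * exp ((h y - h rt) / 2)" by (rule mult_mono[OF 1 2]) (use ph 1 cc in auto)
    then show "c * c / 2 \<le> tau b F rt y * exp ((h y - h rt) / 2)" by simp
  qed
  also have "\<dots> \<le> Y" using A T.Orb_sub by (intro T.XX_D[OF ph(5) F] rV) auto
  finally show False using n cc by (simp add: divide_less_eq)
qed

end

section \<open>From the definitions of the theorem to the locales\<close>

lemma conn_graphI:
  assumes "simple_graph V E" "connected_graph V E" "locally_finite_graph V E"
  shows "conn_graph V E"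
proof
  show "\<exists>x\<in>V. \<exists>y\<in>V. x \<noteq> y \<and> e = {x, y}" if "e \<in> E" for e using assms(1) that unfolding simple_graph_def by blast
  show "finite {e \<in> E. v \<in> e}" if "v \<in> V" for v using assms(3) that unfolding locally_finite_graph_def by blast
  show "conn E x y" if xy: "x \<in> V" "y \<in> V" for x y
  proof -
    obtain p where p: "finite_path V E x y p" using assms(2) xy unfolding connected_graph_def by blast
    then have "path_edges p \<subseteq> E" by (auto simp: finite_path_def path_edges_def successively_conv_nth)
    then show ?thesis using conn_path[of p E] p by (auto simp: finite_path_def)
  qed
qed

lemma autgroupI:
  assumes g: "conn_graph V E" and sub: "subgroup \<Gamma> (GraphAut V E)"
  shows "autgroup V E \<Gamma>"
proof -
  interpret conn_graph V E by (rule g)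
  interpret G: group "GraphAut V E" by (rule group_GraphAut)
  interpret S: subgroup \<Gamma> "GraphAut V E" by (rule sub)
  have car: "\<beta> \<in> graph_aut V E" if "\<beta> \<in> \<Gamma>" for \<beta> using S.subset that by (auto simp: GraphAut_def)
  have bij: "\<beta> \<in> Bij V" "bij_betw \<beta> V V" if "\<beta> \<in> \<Gamma>" for \<beta> using car[OF that] by (auto simp: graph_aut_def Bij_def)
  have mult: "(\<beta> \<otimes>\<^bsub>GraphAut V E\<^esub> \<gamma>) x = \<beta> (\<gamma> x)" if "\<beta> \<in> \<Gamma>" "\<gamma> \<in> \<Gamma>" "x \<in> V" for \<beta> \<gamma> x
    using that bij by (simp add: GraphAut_def BijGroup_def compose_eq)
  have one: "\<one>\<^bsub>GraphAut V E\<^esub> x = x" if "x \<in> V" for x using that by (simp add: GraphAut_def BijGroup_def)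
  show ?thesis
  proof
    show "bij_betw \<beta> V V" if "\<beta> \<in> \<Gamma>" for \<beta> using bij[OF that] by blast
    show "\<beta> ` e \<in> E \<longleftrightarrow> e \<in> E" if b: "\<beta> \<in> \<Gamma>" and e: "e \<subseteq> V" for \<beta> e
    proof
      assume "e \<in> E"
      then obtain x y where "x \<in> V" "y \<in> V" "e = {x, y}" using edge by blast
      then show "\<beta> ` e \<in> E" using car[OF b] \<open>e \<in> E\<close> by (auto simp: graph_aut_def)
    next
      \<comment> \<open>\<open>graph_aut\<close> speaks about pairs of vertices only; a set whose
        image is an edge is itself a pair by injectivity.\<close>
      assume E: "\<beta> ` e \<in> E"
      then obtain u v where uv: "\<beta> ` e = {u, v}" using edge by blast
      then obtain x y where xy: "x \<in> e" "y \<in> e" "\<beta> x = u" "\<beta> y = v" by (metis imageE insertI1 insertI2)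
      have inj: "inj_on \<beta> e" using bij(2)[OF b] e by (auto simp: bij_betw_def intro: inj_on_subset)
      have "\<beta> ` e = \<beta> ` {x, y}" using uv xy by simp
      then have "e = {x, y}" using inj_on_image_eq_iff[OF inj, of e "{x, y}"] xy by simp
      moreover have "{\<beta> x, \<beta> y} \<in> E" using E uv xy by simp
      ultimately show "e \<in> E" using car[OF b] e by (auto simp: graph_aut_def)
    qed
    show "\<exists>\<delta>\<in>\<Gamma>. \<forall>x\<in>V. \<delta> x = \<beta> (\<gamma> x)" if "\<beta> \<in> \<Gamma>" "\<gamma> \<in> \<Gamma>" for \<beta> \<gamma>
      using that mult S.m_closed by (intro bexI[of _ "\<beta> \<otimes>\<^bsub>GraphAut V E\<^esub> \<gamma>"]) auto
    show "\<exists>\<delta>\<in>\<Gamma>. \<forall>x\<in>V. \<delta> (\<beta> x) = x \<and> \<beta> (\<delta> x) = x" if b: "\<beta> \<in> \<Gamma>" for \<beta>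
    proof -
      let ?\<delta> = "inv\<^bsub>GraphAut V E\<^esub> \<beta>"
      have d: "?\<delta> \<in> \<Gamma>" using b by (rule S.m_inv_closed)
      have bc: "\<beta> \<in> carrier (GraphAut V E)" using b S.subset by blast
      have "?\<delta> (\<beta> x) = x \<and> \<beta> (?\<delta> x) = x" if x: "x \<in> V" for x
        using mult[OF d b x] mult[OF b d x] G.l_inv[OF bc] G.r_inv[OF bc] one[OF x] by simp
      then show ?thesis using d by blast
    qed
    show "\<exists>\<delta>\<in>\<Gamma>. \<forall>x\<in>V. \<delta> x = x" using S.one_closed one by blast
  qed
qed

theorem corollary1p4:
  fixes V :: "'v set" and E :: "'v set set"
    and M :: "'w measure" and l :: "'v set \<Rightarrow> 'w \<Rightarrow> real"
  assumes "simple_graph V E"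
    and "connected_graph V E"
    and "locally_finite_graph V E"
    and "\<exists>\<Gamma>. subgroup \<Gamma> (GraphAut V E) \<and> quasi_transitive V E \<Gamma> \<and> \<not> unimodular V E \<Gamma>"
    and "iid_uniform_labels M E l"
  shows "distinct_MSFs V E M l"
proof -
  obtain \<Gamma> where \<Gamma>: "subgroup \<Gamma> (GraphAut V E)" "quasi_transitive V E \<Gamma>" "\<not> unimodular V E \<Gamma>" using assms(4) by blast
  have g: "conn_graph V E" by (rule conn_graphI) fact+
  interpret autgroup V E \<Gamma> by (rule autgroupI[OF g \<Gamma>(1)])
  let ?G = "GraphAut V E \<lparr>carrier := \<Gamma>\<rparr>"
  have orb: "orbit ?G id x = {y. rel x y}" for x by (auto simp: orbit_def rel_def)
  have stab: "stab_orbit V E \<Gamma> x y = S x y" for x y by (auto simp: stab_orbit_def orbit_def stabilizer_def S_def)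
  obtain u v where uv: "u \<in> V" "v \<in> V" "rel v u" "card (S v u) \<noteq> card (S u v)"
    using \<Gamma>(3) unfolding unimodular_def stab orb by blast
  have nz: "ell v u \<noteq> 0" using uv(4) card_S_pos[OF uv(1,2)] card_S_pos[OF uv(2,1)] by (simp add: ell_def)
  \<comment> \<open>One representative per orbit; quasi-transitivity makes this set finite.\<close>
  define Reps where "Reps = (\<lambda>O'. SOME v. v \<in> V \<and> O' = orbit ?G id v) ` orbits ?G V id"
  have SV: "(SOME v. v \<in> V \<and> O' = orbit ?G id v) \<in> V \<and> O' = orbit ?G id (SOME v. v \<in> V \<and> O' = orbit ?G id v)"
    if "O' \<in> orbits ?G V id" for O' by (rule someI_ex) (use that in \<open>auto simp: orbits_def\<close>)
  have "\<exists>h Orb rt t0 g dg D L. tilted V E \<Gamma> h Orb rt Reps t0 g dg D L"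
  proof (rule tilted_exists[OF _ _ _ uv(2,3) nz])
    show "finite Reps" using \<Gamma>(2) by (simp add: Reps_def quasi_transitive_def)
    show "Reps \<subseteq> V" using SV by (auto simp: Reps_def)
    fix x assume x: "x \<in> V"
    let ?O = "orbit ?G id x"
    have O: "?O \<in> orbits ?G V id" using x by (auto simp: orbits_def)
    let ?v = "SOME v. v \<in> V \<and> ?O = orbit ?G id v"
    have "x \<in> orbit ?G id ?v" using SV[OF O] rel_refl[OF x] unfolding orb by blast
    then have "rel ?v x" by (simp add: orb)
    moreover have "?v \<in> Reps" unfolding Reps_def using O by (rule imageI)
    ultimately show "\<exists>v\<in>Reps. rel v x" by blast
  qed
  then obtain h Orb rt t0 g dg D L where T: "tilted V E \<Gamma> h Orb rt Reps t0 g dg D L" by (elim exE)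
  have l: "prob_space M" "prob_space.indep_vars M (\<lambda>_. borel) l E"
    "\<And>e. e \<in> E \<Longrightarrow> distr M borel (l e) = uniform_measure lborel {0..1}"
    using assms(5) by (auto simp: iid_uniform_labels_def)
  interpret P: prob_space M by (rule l(1))
  interpret labelled V E M l by unfold_locales (use l in auto)
  show ?thesis unfolding distinct_MSFs_def by (rule forests_differ[OF T])
qed

end
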